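(* Let $p$ be a prime, $G$ a finite $p$-group, $R$ a $p$-local commutative ring with unity, and $F$ an $R\mathcal{D}_G$-module. For each $k\ge0$ let $\mathcal{E}_k$ be a set of representatives of the conjugacy classes of elementary abelian $p$-subgroups $E$ of $G$ with $\mathrm{rk}(E)=k$ (so $\mathcal{E}_0$ consists of the trivial group). Then for every $i\ge-1$ the reduced cohomology group $\widetilde{H}^i(\mathcal{D}_G^*;F)$ is isomorphic to the $i$-th cohomology of the cochain complex $(C^*_{\mathrm{St}}(F),\delta)$, where $$C^i_{\mathrm{St}}(F)\cong\prod_{E\in\mathcal{E}_{i+1}}\mathrm{Hom}_{\mathrm{Aut}_G(E)}\bigl(\mathrm{St}_E,F(C_G(E)/E)\bigr).$$ In particular, $\widetilde{H}^i(\mathcal{D}_G^*;F)=0$ for $i\ge\mathrm{rk}(G)$.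
   Context: $R$ is $p$-local if multiplication by $q$ is an isomorphism $R\to R$ for every integer $q$ prime to $p$. $\mathrm{rk}(G)$ is the largest $s$ with $(\mathbb{Z}/p)^s\le G$. Sections. A section of $G$ is a pair $(U,V)$ with $V\trianglelefteq U\le G$; $(U,V)\preceq(M,L)$ means $L\le V\le U\le M$. $\mathcal{D}_G$ is the category with objects all sections, $\mathrm{Hom}((U,V),(M,L))=\{Mg:g\in G,\ {}^g(U,V)\preceq(M,L)\}$ and composition $Nh\circ Mg=Nhg$; $\mathcal{D}_G^*$ is its full subcategory on the sections with $V\ne1$. An $R\mathcal{D}_G$-module is a contravariant functor $F$ to $R$-modules; $F(U/V):=F((U,V))$, $F(G):=F((G,1))$; $\mathrm{Defres}^{M/L}_{U/V}$ is the map induced by $M\cdot1$ when $(U,V)\preceq(M,L)$. $\widetilde{H}^n(\mathcal{D}_G^*;F)=\mathrm{Ext}^n_{R\mathcal{D}_G^*}(\underline{R},F)$ for $n\ge1$ ($\underline{R}$ constant functor); $\widetilde{H}^{-1}$ and $\widetilde{H}^0$ are the kernel and cokernel of $F(G)\to\varprojlim_{\mathcal{D}_G^*}F$, $f\mapsto(\mathrm{Defres}^G_{U/V}f)$. The complex. $\mathrm{Aut}_G(E)=N_G(E)/C_G(E)$ acts on $F(C_G(E)/E)$ through the maps induced by conjugation. $\mathrm{St}_E$ is the Steinberg module: for $\mathrm{rk}(E)=k$, the reduced homology $\widetilde{H}_{k-2}$ (integral coefficients) of the poset of proper nontrivial subgroups of $E$, with $\mathrm{St}_E=\mathbb{Z}$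 for $k=0,1$. The map $R_E:\mathrm{St}_E\to\bigoplus_{A\le E,[E:A]=p}\mathrm{St}_A$ is defined by truncating chains: its $A$-component keeps the maximal chains $E_1<\dots<E_{k-1}$ with $E_{k-1}=A$ and sends them to $E_1<\dots<E_{k-2}$ (the identity $\mathbb{Z}\to\mathbb{Z}$ for $k=1$). The coboundary $\delta^{i-1}:C^{i-1}_{\mathrm{St}}(F)\to C^i_{\mathrm{St}}(F)$ sends $c$ to the element whose $E$-coordinate, $E\in\mathcal{E}_{i+1}$, is the composite $$\mathrm{St}_E\xrightarrow{R_E}\bigoplus_{A}\mathrm{St}_A\xrightarrow{\oplus c(A)}\bigoplus_{A}F(C_G(A)/A)\xrightarrow{\oplus\mathrm{Defres}}F(C_G(E)/E),$$ sums over $A\le E$ with $[E:A]=p$, where $c$ is extended from $\mathcal{E}_i$ to all elementary abelian subgroups of rank $i$ by $G$-conjugation equivariance. *)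

theory Defs
  imports
    "HOL-Computational_Algebra.Primes"
    "HOL-Algebra.Module"
    "HOL-Algebra.AbelCoset"
    "HOL-Algebra.Group_Action"
    "HOL-Algebra.Elementary_Groups"
    "HOL-Algebra.Product_Groups"
begin

section \<open>Modules\<close>

definition module_homs :: "('r, 's) ring_scheme \<Rightarrow> ('r, 'm) module \<Rightarrow> ('r, 'n) module \<Rightarrow> ('m \<Rightarrow> 'n) set"
  where "module_homs R M N =
    {h \<in> carrier M \<rightarrow> carrier N.
      (\<forall>x\<in>carrier M. \<forall>y\<in>carrier M. h (x \<oplus>\<^bsub>M\<^esub> y) = h x \<oplus>\<^bsub>N\<^esub> h y) \<and>
      (\<forall>r\<in>carrier R. \<forall>x\<in>carrier M. h (r \<odot>\<^bsub>M\<^esub> x) = r \<odot>\<^bsub>N\<^esub> h x)}"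

definition module_isomorphic :: "('r, 's) ring_scheme \<Rightarrow> ('r, 'm) module \<Rightarrow> ('r, 'n) module \<Rightarrow> bool"
  where "module_isomorphic R M N \<longleftrightarrow> (\<exists>h\<in>module_homs R M N. bij_betw h (carrier M) (carrier N))"

definition zero_module :: "('r, 'm) module \<Rightarrow> bool"
  where "zero_module M \<longleftrightarrow> carrier M = {\<zero>\<^bsub>M\<^esub>}"

text \<open>The library's module record extends the ring record; the multiplicative fields of a module
  play no role and are left \<^const>\<open>undefined\<close>.\<close>

definition prod_module :: "'i set \<Rightarrow> ('i \<Rightarrow> ('r, 'm) module) \<Rightarrow> ('r, 'i \<Rightarrow> 'm) module"
  where "prod_module I M =
    \<lparr>carrier = (\<Pi>\<^sub>E i\<in>I. carrier (M i)), monoid.mult = undefined, one = undefined,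
     ring.zero = (\<lambda>i\<in>I. \<zero>\<^bsub>M i\<^esub>), add = (\<lambda>f g. \<lambda>i\<in>I. f i \<oplus>\<^bsub>M i\<^esub> g i),
     smult = (\<lambda>r f. \<lambda>i\<in>I. r \<odot>\<^bsub>M i\<^esub> f i)\<rparr>"

definition quot_module :: "('r, 'm) module \<Rightarrow> 'm set \<Rightarrow> ('r, 'm set) module"
  where "quot_module M N =
    \<lparr>carrier = a_rcosets\<^bsub>M\<^esub> N, monoid.mult = undefined, one = undefined,
     ring.zero = N, add = set_add M,
     smult = (\<lambda>r X. \<Union>x\<in>X. N +>\<^bsub>M\<^esub> (r \<odot>\<^bsub>M\<^esub> x))\<rparr>"

definition kernel_module :: "('r, 'm) module \<Rightarrow> ('r, 'n) module \<Rightarrow> ('m \<Rightarrow> 'n) \<Rightarrow> ('r, 'm) module"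
  where "kernel_module M N h = M\<lparr>carrier := {x \<in> carrier M. h x = \<zero>\<^bsub>N\<^esub>}\<rparr>"

definition cochain_complex ::
    "('r, 's) ring_scheme \<Rightarrow> (nat \<Rightarrow> ('r, 'm) module) \<Rightarrow> (nat \<Rightarrow> 'm \<Rightarrow> 'm) \<Rightarrow> bool"
  where "cochain_complex R C \<delta> \<longleftrightarrow>
    (\<forall>k. module R (C k) \<and> \<delta> k \<in> module_homs R (C k) (C (Suc k)) \<and>
      (\<forall>c\<in>carrier (C k). \<delta> (Suc k) (\<delta> k c) = \<zero>\<^bsub>C (Suc (Suc k))\<^esub>))"

definition cohomology :: "(nat \<Rightarrow> ('r, 'm) module) \<Rightarrow> (nat \<Rightarrow> 'm \<Rightarrow> 'm) \<Rightarrow> nat \<Rightarrow> ('r, 'm set) module"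
  where "cohomology C \<delta> k =
    quot_module (kernel_module (C k) (C (Suc k)) (\<delta> k))
      (case k of 0 \<Rightarrow> {\<zero>\<^bsub>C 0\<^esub>} | Suc j \<Rightarrow> \<delta> j ` carrier (C j))"

definition p_local :: "nat \<Rightarrow> ('r, 's) ring_scheme \<Rightarrow> bool"
  where "p_local p R \<longleftrightarrow>
    (\<forall>q::int. coprime q (int p) \<longrightarrow> bij_betw (\<lambda>x. [q] \<cdot>\<^bsub>R\<^esub> x) (carrier R) (carrier R))"


section \<open>Modules over a small category, limits and Ext\<close>

record ('o, 'a) small_category =
  Ob :: "'o set"
  Hom :: "'o \<Rightarrow> 'o \<Rightarrow> 'a set"
  Idm :: "'o \<Rightarrow> 'a"
  Comp :: "'a \<Rightarrow> 'a \<Rightarrow> 'a"  \<comment> \<open>\<open>Comp C b a\<close> is \<open>b\<close> after \<open>a\<close>\<close>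

text \<open>A morphism may belong to several hom-sets, so the induced map is indexed by source and
  target as well: for \<open>a\<close> from \<open>X\<close> to \<open>Y\<close>, \<open>Fmap F X Y a\<close> maps \<open>Fob F Y\<close> to \<open>Fob F X\<close>.
  The values at the various objects have one common carrier type, which is no restriction, as
  any family of sets embeds into a single type.\<close>

record ('r, 'o, 'a, 'm) catmod =
  Fob :: "'o \<Rightarrow> ('r, 'm) module"
  Fmap :: "'o \<Rightarrow> 'o \<Rightarrow> 'a \<Rightarrow> 'm \<Rightarrow> 'm"

definition is_catmod ::
    "('o, 'a) small_category \<Rightarrow> ('r, 's) ring_scheme \<Rightarrow> ('r, 'o, 'a, 'm) catmod \<Rightarrow> bool"
  where "is_catmod C R F \<longleftrightarrow>
    (\<forall>X\<in>Ob C. module R (Fob F X)) \<and>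
    (\<forall>X\<in>Ob C. \<forall>Y\<in>Ob C. \<forall>a\<in>Hom C X Y. Fmap F X Y a \<in> module_homs R (Fob F Y) (Fob F X)) \<and>
    (\<forall>X\<in>Ob C. \<forall>x\<in>carrier (Fob F X). Fmap F X X (Idm C X) x = x) \<and>
    (\<forall>X\<in>Ob C. \<forall>Y\<in>Ob C. \<forall>Z\<in>Ob C. \<forall>a\<in>Hom C X Y. \<forall>b\<in>Hom C Y Z. \<forall>x\<in>carrier (Fob F Z).
        Fmap F X Z (Comp C b a) x = Fmap F X Y a (Fmap F Y Z b x))"

definition const_catmod :: "('r, 's) ring_scheme \<Rightarrow> ('r, 'o, 'a, 'r) catmod"
  where "const_catmod R =
    \<lparr>Fob = (\<lambda>X. \<lparr>carrier = carrier R, monoid.mult = monoid.mult R, one = \<one>\<^bsub>R\<^esub>, ring.zero = \<zero>\<^bsub>R\<^esub>,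
                  add = add R, smult = monoid.mult R\<rparr>),
     Fmap = (\<lambda>X Y a x. x)\<rparr>"

definition nat_homs ::
    "('o, 'a) small_category \<Rightarrow> ('r, 's) ring_scheme \<Rightarrow> ('r, 'o, 'a, 'm) catmod \<Rightarrow>
     ('r, 'o, 'a, 'n) catmod \<Rightarrow> ('o \<Rightarrow> 'm \<Rightarrow> 'n) set"
  where "nat_homs C R M N =
    {\<eta> \<in> (\<Pi>\<^sub>E X\<in>Ob C. module_homs R (Fob M X) (Fob N X) \<inter> extensional (carrier (Fob M X))).
      \<forall>X\<in>Ob C. \<forall>Y\<in>Ob C. \<forall>a\<in>Hom C X Y. \<forall>y\<in>carrier (Fob M Y).
        \<eta> X (Fmap M X Y a y) = Fmap N X Y a (\<eta> Y y)}"

definition nat_hom_module ::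
    "('o, 'a) small_category \<Rightarrow> ('r, 's) ring_scheme \<Rightarrow> ('r, 'o, 'a, 'm) catmod \<Rightarrow>
     ('r, 'o, 'a, 'n) catmod \<Rightarrow> ('r, 'o \<Rightarrow> 'm \<Rightarrow> 'n) module"
  where "nat_hom_module C R M N =
    (prod_module (Ob C) (\<lambda>X. prod_module (carrier (Fob M X)) (\<lambda>_. Fob N X)))
      \<lparr>carrier := nat_homs C R M N\<rparr>"

definition precomp ::
    "('o, 'a) small_category \<Rightarrow> ('r, 'o, 'a, 'm) catmod \<Rightarrow> ('o \<Rightarrow> 'm \<Rightarrow> 'k) \<Rightarrow>
     ('o \<Rightarrow> 'k \<Rightarrow> 'n) \<Rightarrow> 'o \<Rightarrow> 'm \<Rightarrow> 'n"
  where "precomp C M \<theta> \<eta> = (\<lambda>X\<in>Ob C. \<lambda>x\<in>carrier (Fob M X). \<eta> X (\<theta> X x))"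

definition limit_module ::
    "('o, 'a) small_category \<Rightarrow> ('r, 'o, 'a, 'm) catmod \<Rightarrow> ('r, 'o \<Rightarrow> 'm) module"
  where "limit_module C F =
    (prod_module (Ob C) (Fob F))
      \<lparr>carrier := {f \<in> (\<Pi>\<^sub>E X\<in>Ob C. carrier (Fob F X)).
        \<forall>X\<in>Ob C. \<forall>Y\<in>Ob C. \<forall>a\<in>Hom C X Y. Fmap F X Y a (f Y) = f X}\<rparr>"

text \<open>Projectivity is the lifting property against epimorphisms (that is, objectwise surjective
  natural transformations). HOL cannot quantify over carrier types inside a definition, so the
  carrier types of \<open>M\<close> and \<open>N\<close> are fixed; they are large enough for the definition to give lifts
  against epimorphisms of catmods over all carrier types. Indeed the free cover of \<open>P\<close>, whose
  value at \<open>X\<close> is the free \<open>R\<close>-module on the triples \<open>(Y, y, a)\<close> with \<open>y\<close> in \<open>P(Y)\<close> and \<open>a\<close> a morphism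
  from \<open>X\<close> to \<open>Y\<close>, lives on the type used for \<open>M\<close>. Lifting the identity of \<open>P\<close> (take \<open>N = P\<close>)
  through it exhibits \<open>P\<close> as a direct summand of a free catmod.\<close>

definition projective ::
    "('o, 'a) small_category \<Rightarrow> ('r, 's) ring_scheme \<Rightarrow> ('r, 'o, 'a, 'q) catmod \<Rightarrow> bool"
  where "projective C R P \<longleftrightarrow> is_catmod C R P \<and>
    (\<forall>(M :: ('r, 'o, 'a, 'o \<times> 'q \<times> 'a \<Rightarrow> 'r) catmod) (N :: ('r, 'o, 'a, 'q) catmod) f g.
      is_catmod C R M \<and> is_catmod C R N \<and>
      f \<in> nat_homs C R M N \<and> (\<forall>X\<in>Ob C. f X ` carrier (Fob M X) = carrier (Fob N X)) \<and>
      g \<in> nat_homs C R P N \<longrightarrow>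
      (\<exists>h\<in>nat_homs C R P M. \<forall>X\<in>Ob C. \<forall>x\<in>carrier (Fob P X). f X (h X x) = g X x))"

definition projective_resolution ::
    "('o, 'a) small_category \<Rightarrow> ('r, 's) ring_scheme \<Rightarrow> ('r, 'o, 'a, 'm) catmod \<Rightarrow>
     (nat \<Rightarrow> ('r, 'o, 'a, 'q) catmod) \<Rightarrow> (nat \<Rightarrow> 'o \<Rightarrow> 'q \<Rightarrow> 'q) \<Rightarrow> ('o \<Rightarrow> 'q \<Rightarrow> 'm) \<Rightarrow> bool"
  where "projective_resolution C R A P d \<epsilon> \<longleftrightarrow>
    (\<forall>n. projective C R (P n)) \<and>
    (\<forall>n. d n \<in> nat_homs C R (P (Suc n)) (P n)) \<and>
    \<epsilon> \<in> nat_homs C R (P 0) A \<and>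
    (\<forall>X\<in>Ob C.
      \<epsilon> X ` carrier (Fob (P 0) X) = carrier (Fob A X) \<and>
      d 0 X ` carrier (Fob (P 1) X) = {x \<in> carrier (Fob (P 0) X). \<epsilon> X x = \<zero>\<^bsub>Fob A X\<^esub>} \<and>
      (\<forall>n. d (Suc n) X ` carrier (Fob (P (Suc (Suc n))) X) =
           {x \<in> carrier (Fob (P (Suc n)) X). d n X x = \<zero>\<^bsub>Fob (P n) X\<^esub>}))"

text \<open>\<open>Ext\<^sup>n(A, F)\<close>, computed from a projective resolution \<open>(P, d)\<close> of \<open>A\<close>.\<close>

definition Ext ::
    "('o, 'a) small_category \<Rightarrow> ('r, 's) ring_scheme \<Rightarrow> (nat \<Rightarrow> ('r, 'o, 'a, 'q) catmod) \<Rightarrow>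
     (nat \<Rightarrow> 'o \<Rightarrow> 'q \<Rightarrow> 'q) \<Rightarrow> ('r, 'o, 'a, 'm) catmod \<Rightarrow> nat \<Rightarrow> ('r, ('o \<Rightarrow> 'q \<Rightarrow> 'm) set) module"
  where "Ext C R P d F n =
    cohomology (\<lambda>n. nat_hom_module C R (P n) F) (\<lambda>n. precomp C (P (Suc n)) (d n)) n"


section \<open>The section category of a group\<close>

abbreviation conj_set :: "('g, 'x) monoid_scheme \<Rightarrow> 'g \<Rightarrow> 'g set \<Rightarrow> 'g set"
  where "conj_set G g H \<equiv> g <#\<^bsub>G\<^esub> H #>\<^bsub>G\<^esub> (inv\<^bsub>G\<^esub> g)"

definition sections :: "('g, 'x) monoid_scheme \<Rightarrow> ('g set \<times> 'g set) set"
  where "sections G = {(U, V). subgroup U G \<and> V \<lhd> (G\<lparr>carrier := U\<rparr>)}"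

definition sec_le :: "'g set \<times> 'g set \<Rightarrow> 'g set \<times> 'g set \<Rightarrow> bool"
  where "sec_le X Y \<longleftrightarrow> snd Y \<subseteq> snd X \<and> snd X \<subseteq> fst X \<and> fst X \<subseteq> fst Y"

definition sec_conj :: "('g, 'x) monoid_scheme \<Rightarrow> 'g \<Rightarrow> 'g set \<times> 'g set \<Rightarrow> 'g set \<times> 'g set"
  where "sec_conj G g X = (conj_set G g (fst X), conj_set G g (snd X))"

text \<open>The composite \<open>Nh \<circ> Mg = Nhg\<close> is the setwise product of the cosets, since \<open>hMh\<^sup>-\<^sup>1 \<subseteq> N\<close>;
  see \<open>sec_comp\<close> below.\<close>

definition sec_cat :: "('g, 'x) monoid_scheme \<Rightarrow> ('g set \<times> 'g set, 'g set) small_category"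
  where "sec_cat G =
    \<lparr>Ob = sections G,
     Hom = (\<lambda>X Y. {fst Y #>\<^bsub>G\<^esub> g | g. g \<in> carrier G \<and> sec_le (sec_conj G g X) Y}),
     Idm = (\<lambda>X. fst X #>\<^bsub>G\<^esub> \<one>\<^bsub>G\<^esub>),
     Comp = (\<lambda>b a. b <#>\<^bsub>G\<^esub> a)\<rparr>"

definition sec_cat_star :: "('g, 'x) monoid_scheme \<Rightarrow> ('g set \<times> 'g set, 'g set) small_category"
  where "sec_cat_star G = (sec_cat G)\<lparr>Ob := {X \<in> sections G. snd X \<noteq> {\<one>\<^bsub>G\<^esub>}}\<rparr>"

lemma (in group) sec_comp:
  assumes "subgroup M G" "subgroup N G" "g \<in> carrier G" "h \<in> carrier G" "conj_set G h M \<subseteq> N"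
  shows "(N #> h) <#> (M #> g) = N #> (h \<otimes> g)"
proof -
  note sub = subgroup.mem_carrier[OF assms(1)] subgroup.mem_carrier[OF assms(2)]
  show ?thesis
  proof (intro equalityI subsetI)
    fix x assume "x \<in> (N #> h) <#> (M #> g)"
    then obtain n m where nm: "n \<in> N" "m \<in> M" "x = (n \<otimes> h) \<otimes> (m \<otimes> g)"
      by (auto simp: set_mult_def r_coset_def)
    have "h \<otimes> m \<otimes> inv h \<in> N"
      using assms(5) nm(2) by (auto simp: l_coset_def r_coset_def)
    hence "n \<otimes> (h \<otimes> m \<otimes> inv h) \<in> N"
      using nm(1) assms(2) by (simp add: subgroup.m_closed)
    moreover have "h \<otimes> (m \<otimes> g) = (h \<otimes> m \<otimes> inv h) \<otimes> (h \<otimes> g)"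
      using sub nm assms(3,4) by (simp add: m_assoc inv_solve_left' flip: m_assoc[of "inv h" h g])
    hence "x = n \<otimes> (h \<otimes> m \<otimes> inv h) \<otimes> (h \<otimes> g)"
      using sub nm assms(3,4) by (simp add: m_assoc)
    ultimately show "x \<in> N #> (h \<otimes> g)"
      by (auto simp: r_coset_def)
  next
    fix x assume "x \<in> N #> (h \<otimes> g)"
    then obtain n where n: "n \<in> N" "x = n \<otimes> (h \<otimes> g)"
      by (auto simp: r_coset_def)
    hence "x = (n \<otimes> h) \<otimes> (\<one> \<otimes> g)"
      using sub assms(3,4) by (simp add: m_assoc)
    thus "x \<in> (N #> h) <#> (M #> g)"
      using n(1) subgroup.one_closed[OF assms(1)] by (auto simp: set_mult_def r_coset_def)
  qed
qed

definition Defres ::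
    "('g, 'x) monoid_scheme \<Rightarrow> ('r, 'g set \<times> 'g set, 'g set, 'm) catmod \<Rightarrow>
     'g set \<times> 'g set \<Rightarrow> 'g set \<times> 'g set \<Rightarrow> 'm \<Rightarrow> 'm"
  where "Defres G F Y X = Fmap F X Y (fst Y #>\<^bsub>G\<^esub> \<one>\<^bsub>G\<^esub>)"

text \<open>Conjugation \<open>F(X) \<rightarrow> F(\<^sup>gX)\<close>: as \<open>F\<close> is contravariant, it is induced by the morphism
  \<open>Ug\<^sup>-\<^sup>1 : \<^sup>gX \<rightarrow> X\<close>, where \<open>X = (U, V)\<close>. This makes it a left action.\<close>

definition conj_map ::
    "('g, 'x) monoid_scheme \<Rightarrow> ('r, 'g set \<times> 'g set, 'g set, 'm) catmod \<Rightarrow>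
     'g \<Rightarrow> 'g set \<times> 'g set \<Rightarrow> 'm \<Rightarrow> 'm"
  where "conj_map G F g X = Fmap F (sec_conj G g X) X (fst X #>\<^bsub>G\<^esub> (inv\<^bsub>G\<^esub> g))"


section \<open>Reduced cohomology of the section category\<close>

definition to_limit ::
    "('g, 'x) monoid_scheme \<Rightarrow> ('r, 'g set \<times> 'g set, 'g set, 'm) catmod \<Rightarrow>
     'm \<Rightarrow> ('g set \<times> 'g set) \<Rightarrow> 'm"
  where "to_limit G F f = (\<lambda>X\<in>Ob (sec_cat_star G). Defres G F (carrier G, {\<one>\<^bsub>G\<^esub>}) X f)"

definition reduced_cohomology_m1 ::
    "('g, 'x) monoid_scheme \<Rightarrow> ('r, 'g set \<times> 'g set, 'g set, 'm) catmod \<Rightarrow> ('r, 'm) module"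
  where "reduced_cohomology_m1 G F =
    kernel_module (Fob F (carrier G, {\<one>\<^bsub>G\<^esub>})) (limit_module (sec_cat_star G) F) (to_limit G F)"

definition reduced_cohomology_0 ::
    "('g, 'x) monoid_scheme \<Rightarrow> ('r, 'g set \<times> 'g set, 'g set, 'm) catmod \<Rightarrow>
     ('r, ('g set \<times> 'g set \<Rightarrow> 'm) set) module"
  where "reduced_cohomology_0 G F =
    quot_module (limit_module (sec_cat_star G) F)
      (to_limit G F ` carrier (Fob F (carrier G, {\<one>\<^bsub>G\<^esub>})))"


section \<open>Elementary abelian subgroups and Steinberg modules\<close>

definition elem_ab :: "('g, 'x) monoid_scheme \<Rightarrow> nat \<Rightarrow> nat \<Rightarrow> 'g set set"
  where "elem_ab G p k =
    {E. subgroup E G \<and> (G\<lparr>carrier := E\<rparr>) \<cong> product_group {..<k} (\<lambda>_. integer_mod_group p)}"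

definition rk :: "('g, 'x) monoid_scheme \<Rightarrow> nat \<Rightarrow> nat"
  where "rk G p = Max {s. elem_ab G p s \<noteq> {}}"

definition conj_representatives ::
    "('g, 'x) monoid_scheme \<Rightarrow> nat \<Rightarrow> nat \<Rightarrow> 'g set set \<Rightarrow> bool"
  where "conj_representatives G p k \<E> \<longleftrightarrow>
    \<E> \<subseteq> elem_ab G p k \<and>
    (\<forall>A\<in>elem_ab G p k. \<exists>!E. E \<in> \<E> \<and> (\<exists>g\<in>carrier G. A = conj_set G g E))"

definition centralizer :: "('g, 'x) monoid_scheme \<Rightarrow> 'g set \<Rightarrow> 'g set"
  where "centralizer G E = {g \<in> carrier G. \<forall>x\<in>E. g \<otimes>\<^bsub>G\<^esub> x = x \<otimes>\<^bsub>G\<^esub> g}"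

definition csec :: "('g, 'x) monoid_scheme \<Rightarrow> 'g set \<Rightarrow> 'g set \<times> 'g set"
  where "csec G E = (centralizer G E, E)"

text \<open>The augmented chain complex of the poset of proper nontrivial subgroups of \<open>E\<close>:
  \<open>subgroup_chains G E n\<close> is the set of chains with \<open>n\<close> members, i.e. of dimension \<open>n - 1\<close>, and
  for \<open>n = 1\<close> the boundary is the augmentation onto the multiples of the empty chain.
  A simplicial chain is an integer-valued function that vanishes off \<open>subgroup_chains G E n\<close>.\<close>

definition subgroup_chains :: "('g, 'x) monoid_scheme \<Rightarrow> 'g set \<Rightarrow> nat \<Rightarrow> 'g set list set"
  where "subgroup_chains G E n =
    {\<sigma>. length \<sigma> = n \<and> sorted_wrt (\<subset>) \<sigma> \<and> (\<forall>H\<in>set \<sigma>. subgroup H G \<and> H \<noteq> {\<one>\<^bsub>G\<^esub>} \<and> H \<subset> E)}"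

definition boundary ::
    "('g, 'x) monoid_scheme \<Rightarrow> 'g set \<Rightarrow> nat \<Rightarrow> ('g set list \<Rightarrow> int) \<Rightarrow> 'g set list \<Rightarrow> int"
  where "boundary G E n z \<tau> =
    (\<Sum>\<sigma>\<in>subgroup_chains G E n. \<Sum>j<n.
      if take j \<sigma> @ drop (Suc j) \<sigma> = \<tau> then (- 1) ^ j * z \<sigma> else 0)"

text \<open>For \<open>E\<close> of rank \<open>k\<close> there are no chains with \<open>k\<close> members (\<open>no_long_subgroup_chains\<close> below),
  so the reduced homology group in degree \<open>k - 2\<close> is the group of cycles on chains with \<open>k - 1\<close>
  members. For \<open>k = 1\<close>, and by truncated subtraction also for \<open>k = 0\<close>, only the empty chain
  occurs, and the group is a copy of the integers.\<close>

definition steinberg ::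
    "('g, 'x) monoid_scheme \<Rightarrow> nat \<Rightarrow> 'g set \<Rightarrow> ('g set list \<Rightarrow> int) set"
  where "steinberg G k E =
    {z. (\<forall>\<sigma>. \<sigma> \<notin> subgroup_chains G E (k - 1) \<longrightarrow> z \<sigma> = 0) \<and> (\<forall>\<tau>. boundary G E (k - 1) z \<tau> = 0)}"

lemma (in group) no_long_subgroup_chains:
  assumes p: "Factorial_Ring.prime p" and E: "subgroup E G" "card E = p ^ k" and n: "n \<ge> 1" "n \<ge> k"
  shows "subgroup_chains G E n = {}"
proof -
  have finE: "finite E"
    using E(2) p by (metis card.infinite power_not_zero not_prime_0)
  have step: "p * card H \<le> card K"
    if "subgroup H G" "subgroup K G" "H \<subset> K" "K \<subseteq> E" for H K
  proof -
    interpret K: group "G\<lparr>carrier := K\<rparr>"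
      using that(2) by (rule subgroup.subgroup_is_group) (rule is_group)
    have fin: "finite K" "finite H"
      using that(3,4) finE by (auto dest: finite_subset)
    have H: "subgroup H (G\<lparr>carrier := K\<rparr>)"
      using that by (intro subgroup_incl) auto
    from E(1) interpret E: group "G\<lparr>carrier := E\<rparr>"
      by (rule subgroup.subgroup_is_group) (rule is_group)
    have "subgroup K (G\<lparr>carrier := E\<rparr>)"
      using that E(1) by (intro subgroup_incl) auto
    hence "card K dvd p ^ k"
      using E.lagrange[of K] E(2) by (simp add: order_def) (metis dvd_triv_right)
    moreover obtain m where m: "card K = m * card H"
      using K.lagrange[OF H] by (simp add: order_def) metis
    ultimately have "m dvd p ^ k"
      using dvd_trans dvd_triv_left by metis
    then obtain i where i: "m = p ^ i"
      using p by (auto simp: divides_primepow_nat)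
    have "card H < card K"
      using that(3) fin by (simp add: psubset_card_mono)
    hence "i \<noteq> 0"
      using m i by (cases i) auto
    hence "p \<le> m"
      using i self_le_power[of p i] prime_ge_1_nat[OF p] by simp
    thus ?thesis
      using m by simp
  qed
  have triv: "subgroup {\<one>} G"
    by (rule triv_subgroup)
  have chain: "p ^ Suc i \<le> card (\<sigma> ! i)" if "\<sigma> \<in> subgroup_chains G E n" "i < n" for \<sigma> i
    using that(2)
  proof (induction i)
    case 0
    have "\<sigma> ! 0 \<in> set \<sigma>"
      using that(1) 0 by (auto simp: subgroup_chains_def)
    hence "subgroup (\<sigma> ! 0) G" "\<sigma> ! 0 \<noteq> {\<one>}" "\<sigma> ! 0 \<subset> E"
      using that(1) by (auto simp: subgroup_chains_def)
    thus ?case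
      using step[OF triv, of "\<sigma> ! 0"] subgroup.one_closed by fastforce
  next
    case (Suc i)
    have "\<sigma> ! i \<in> set \<sigma>" "\<sigma> ! Suc i \<in> set \<sigma>" "\<sigma> ! i \<subset> \<sigma> ! Suc i"
      using that(1) Suc.prems by (auto simp: subgroup_chains_def sorted_wrt_iff_nth_less)
    hence "p * card (\<sigma> ! i) \<le> card (\<sigma> ! Suc i)"
      using that(1) by (intro step) (auto simp: subgroup_chains_def)
    moreover have "p * p ^ Suc i \<le> p * card (\<sigma> ! i)"
      using Suc by (intro mult_le_mono2) simp
    ultimately show ?case
      by (metis le_trans power_Suc)
  qed
  show ?thesis
  proof (rule equals0I)
    fix \<sigma> assume \<sigma>: "\<sigma> \<in> subgroup_chains G E n"
    have "\<sigma> ! (n - 1) \<in> set \<sigma>"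
      using \<sigma> n by (auto simp: subgroup_chains_def)
    hence "\<sigma> ! (n - 1) \<subset> E"
      using \<sigma> by (auto simp: subgroup_chains_def)
    hence "card (\<sigma> ! (n - 1)) < p ^ k"
      using finE E(2) psubset_card_mono by metis
    moreover have "p ^ n \<le> card (\<sigma> ! (n - 1))"
      using chain[OF \<sigma>, of "n - 1"] n by simp
    moreover have "p ^ k \<le> p ^ n"
      using n prime_ge_1_nat[OF p] by (intro power_increasing) auto
    ultimately show False
      by simp
  qed
qed

text \<open>Conjugation \<open>St\<^sub>E \<rightarrow> St\<^sub>A\<close> for \<open>A = \<^sup>gE\<close>; the guard keeps the result zero off the chains of \<open>G\<close>.\<close>

definition conj_chain ::
    "('g, 'x) monoid_scheme \<Rightarrow> 'g \<Rightarrow> ('g set list \<Rightarrow> int) \<Rightarrow> 'g set list \<Rightarrow> int"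
  where "conj_chain G g z \<sigma> =
    (if \<forall>H\<in>set \<sigma>. H \<subseteq> carrier G then z (map (conj_set G (inv\<^bsub>G\<^esub> g)) \<sigma>) else 0)"

definition index_p_subgroups :: "('g, 'x) monoid_scheme \<Rightarrow> nat \<Rightarrow> 'g set \<Rightarrow> 'g set set"
  where "index_p_subgroups G p E =
    {A. subgroup A (G\<lparr>carrier := E\<rparr>) \<and> card (rcosets\<^bsub>G\<lparr>carrier := E\<rparr>\<^esub> A) = p}"

text \<open>The \<open>A\<close>-component of \<open>R\<^sub>E\<close>, for \<open>E\<close> of rank \<open>k\<close>: the coefficient of a chain \<open>\<tau>\<close> is
  that of \<open>\<tau>\<close> extended by \<open>A\<close> on top.\<close>

definition truncation ::
    "nat \<Rightarrow> 'g set \<Rightarrow> ('g set list \<Rightarrow> int) \<Rightarrow> 'g set list \<Rightarrow> int"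
  where "truncation k A z \<tau> = (if k = 1 then z \<tau> else z (\<tau> @ [A]))"


section \<open>The Steinberg complex\<close>

text \<open>\<open>N\<^sub>G(E)\<close> acts on both sides through \<open>Aut\<^sub>G(E) = N\<^sub>G(E)/C\<^sub>G(E)\<close>, so
  \<open>Aut\<^sub>G(E)\<close>-equivariance is tested on representatives in \<open>N\<^sub>G(E)\<close>.\<close>

definition steinberg_hom ::
    "('g, 'x) monoid_scheme \<Rightarrow> ('r, 'g set \<times> 'g set, 'g set, 'm) catmod \<Rightarrow> nat \<Rightarrow> 'g set \<Rightarrow>
     ('r, ('g set list \<Rightarrow> int) \<Rightarrow> 'm) module"
  where "steinberg_hom G F k E =
    (prod_module (steinberg G k E) (\<lambda>_. Fob F (csec G E)))
      \<lparr>carrier := {f \<in> steinberg G k E \<rightarrow>\<^sub>E carrier (Fob F (csec G E)).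
        (\<forall>z\<in>steinberg G k E. \<forall>w\<in>steinberg G k E.
          f (\<lambda>\<sigma>. z \<sigma> + w \<sigma>) = f z \<oplus>\<^bsub>Fob F (csec G E)\<^esub> f w) \<and>
        (\<forall>g\<in>normalizer G E. \<forall>z\<in>steinberg G k E.
          f (conj_chain G g z) = conj_map G F g (csec G E) (f z))}\<rparr>"

text \<open>Below, the index \<open>k\<close> of a cochain module is the rank of the elementary abelian subgroups
  involved, i.e. the cochain degree plus one; \<open>\<E> k\<close> is the set of representatives in rank \<open>k\<close>.\<close>

definition steinberg_cochains ::
    "('g, 'x) monoid_scheme \<Rightarrow> (nat \<Rightarrow> 'g set set) \<Rightarrow> ('r, 'g set \<times> 'g set, 'g set, 'm) catmod \<Rightarrow>
     nat \<Rightarrow> ('r, 'g set \<Rightarrow> ('g set list \<Rightarrow> int) \<Rightarrow> 'm) module"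
  where "steinberg_cochains G \<E> F k = prod_module (\<E> k) (steinberg_hom G F k)"

text \<open>The extension of a cochain by conjugation equivariance: \<open>c(\<^sup>gE)(z) = \<^sup>g(c(E)(g\<^sup>-\<^sup>1z))\<close>. By
  \<open>Aut\<^sub>G(E)\<close>-equivariance it does not depend on the choice of \<open>g\<close>.\<close>

definition extend_cochain ::
    "('g, 'x) monoid_scheme \<Rightarrow> (nat \<Rightarrow> 'g set set) \<Rightarrow> ('r, 'g set \<times> 'g set, 'g set, 'm) catmod \<Rightarrow>
     nat \<Rightarrow> ('g set \<Rightarrow> ('g set list \<Rightarrow> int) \<Rightarrow> 'm) \<Rightarrow> 'g set \<Rightarrow> ('g set list \<Rightarrow> int) \<Rightarrow> 'm"
  where "extend_cochain G \<E> F k c A z =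
    (let (g, E) = (SOME (g, E). g \<in> carrier G \<and> E \<in> \<E> k \<and> A = conj_set G g E)
     in conj_map G F g (csec G E) (c E (conj_chain G (inv\<^bsub>G\<^esub> g) z)))"

definition steinberg_coboundary ::
    "('g, 'x) monoid_scheme \<Rightarrow> nat \<Rightarrow> (nat \<Rightarrow> 'g set set) \<Rightarrow>
     ('r, 'g set \<times> 'g set, 'g set, 'm) catmod \<Rightarrow> nat \<Rightarrow>
     ('g set \<Rightarrow> ('g set list \<Rightarrow> int) \<Rightarrow> 'm) \<Rightarrow> 'g set \<Rightarrow> ('g set list \<Rightarrow> int) \<Rightarrow> 'm"
  where "steinberg_coboundary G p \<E> F k c =
    (\<lambda>E\<in>\<E> (Suc k). \<lambda>z\<in>steinberg G (Suc k) E.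
      \<Oplus>\<^bsub>Fob F (csec G E)\<^esub>A\<in>index_p_subgroups G p E.
        Defres G F (csec G A) (csec G E) (extend_cochain G \<E> F k c A (truncation (Suc k) A z)))"

text \<open>Cohomology in cochain degree \<open>i \<ge> -1\<close>.\<close>

definition steinberg_cohomology ::
    "('g, 'x) monoid_scheme \<Rightarrow> nat \<Rightarrow> (nat \<Rightarrow> 'g set set) \<Rightarrow>
     ('r, 'g set \<times> 'g set, 'g set, 'm) catmod \<Rightarrow> int \<Rightarrow>
     ('r, ('g set \<Rightarrow> ('g set list \<Rightarrow> int) \<Rightarrow> 'm) set) module"
  where "steinberg_cohomology G p \<E> F i =
    cohomology (steinberg_cochains G \<E> F) (steinberg_coboundary G p \<E> F) (nat (i + 1))"

end

theory Submission
  imports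
    "HOL-Algebra.Multiplicative_Group"
    "HOL-Algebra.Zassenhaus"
    Defs
begin

text \<open>
For a section \<open>X = (U, V)\<close> consider the elementary abelian \<open>E\<close> of rank \<open>k\<close> with \<open>E \<subseteq> V\<close> and
\<open>U \<subseteq> C(E)\<close>; these are the \<open>E\<close> for which \<open>X\<close> lies below the section \<open>(C(E), E)\<close>. Let \<open>Q k X\<close> be
\<open>R\<close> tensored with the sum of the Steinberg modules of these \<open>E\<close>. Conjugation makes \<open>Q k\<close> a functor, and
truncation of chains gives maps \<open>Q (k + 1) \<rightarrow> Q k\<close> with square zero; \<open>Q 0\<close> is the constant functor.
The theorem follows from two properties of this complex.

It is exact at the sections with \<open>V \<noteq> {1}\<close>. There \<open>V\<close>, being normal in the \<open>p\<close>-group \<open>U\<close>,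
contains a subgroup \<open>L\<close> of order \<open>p\<close> that \<open>U\<close> centralizes, so \<open>E\<close> may be replaced by \<open>EL\<close>. The cone
with vertex \<open>L\<close> lifts to the Steinberg modules and contracts the complex
(\<open>steinberg_line_lift\<close>, \<open>homotopy_Suc\<close>).

For \<open>k \<ge> 1\<close> the functor \<open>Q k\<close> is projective on these sections. A natural transformation
\<open>Q k \<rightarrow> N\<close> is the same as an equivariant family of additive maps from the Steinberg module of \<open>E\<close> to
\<open>N (C(E), E)\<close>, so everything reduces to the claim that the Steinberg module is free over the group
ring of \<open>N(E)/C(E)\<close>. The \<open>p\<close>-group \<open>N(E)\<close> leaves some full flag of \<open>E\<close> invariant. The flags opposite
to it index a basis of the Steinberg module that \<open>N(E)\<close> permutes. An element that fixes one of
these flags normalizes lines that span \<open>E\<close>, and a \<open>p\<close>-element that normalizes a subgroup of order \<open>p\<close>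
centralizes it, so the stabilizers are \<open>C(E)\<close> (\<open>steinberg_dual_exists\<close>, \<open>opp_free\<close>, \<open>cochain_lift\<close>).

Hence \<open>Q 1, Q 2, \<dots>\<close> resolve the constant functor and compute \<open>Ext\<close> (\<open>Ext_independent\<close>), and the
natural transformations from \<open>Q k\<close> to \<open>F\<close> are the Steinberg cochains (\<open>Ext_Q_Steinberg\<close>). In the two
lowest degrees one looks at \<open>Q 0\<close>: its natural transformations to \<open>F\<close> are the elements of
\<open>F(G)\<close> on all sections, and the elements of the limit on those with \<open>V \<noteq> {1}\<close>.
The cohomology vanishes above the rank because there are no cochains.
\<close>

section \<open>Linear maps, free modules and additive maps\<close>

lemma module_homsI:
 assumes "!!x. x \<in> carrier M ==> h x \<in> carrier N"
  and "!!x y. x \<in> carrier M ==> y \<in> carrier M ==> h (x \<oplus>\<^bsub>M\<^esub> y) = h x \<oplus>\<^bsub>N\<^esub> h y"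
  and "!!r x. r \<in> carrier R ==> x \<in> carrier M ==> h (r \<odot>\<^bsub>M\<^esub> x) = r \<odot>\<^bsub>N\<^esub> h x"
 shows "h \<in> module_homs R M N" using assms by (auto simp: module_homs_def)

lemma homs_closed: "h \<in> module_homs R M N ==> x \<in> carrier M ==> h x \<in> carrier N"
 and homs_add: "h \<in> module_homs R M N ==> x \<in> carrier M ==> y \<in> carrier M ==>
  h (x \<oplus>\<^bsub>M\<^esub> y) = h x \<oplus>\<^bsub>N\<^esub> h y"
 and homs_smult: "h \<in> module_homs R M N ==> r \<in> carrier R ==> x \<in> carrier M ==>
  h (r \<odot>\<^bsub>M\<^esub> x) = r \<odot>\<^bsub>N\<^esub> h x" by (auto simp: module_homs_def)

lemma homs_comp:
 assumes "h \<in> module_homs R M N" "k \<in> module_homs R N L"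
 shows "(%x. k (h x)) \<in> module_homs R M L" using assms by (auto simp: module_homs_def Pi_iff)

lemma module_homs_cong:
 assumes "h \<in> module_homs R M N" "!!x. x \<in> carrier M ==> h x = k x" "module R M"
 shows "k \<in> module_homs R M N"
proof -
 interpret M: module R M by fact
 show ?thesis using assms(1) by (intro module_homsI)
   (simp_all flip: assms(2) add: homs_closed homs_add homs_smult)
qed

lemma homs_zero:
 assumes "h \<in> module_homs R M N" "module R M" "module R N"
 shows "h \<zero>\<^bsub>M\<^esub> = \<zero>\<^bsub>N\<^esub>"
proof -
 interpret M: module R M by fact
 interpret N: module R N by fact
 have "h (\<zero>\<^bsub>R\<^esub> \<odot>\<^bsub>M\<^esub> \<zero>\<^bsub>M\<^esub>) = \<zero>\<^bsub>R\<^esub> \<odot>\<^bsub>N\<^esub> h \<zero>\<^bsub>M\<^esub>"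
  using assms(1) by (intro homs_smult) auto
 thus ?thesis using homs_closed[OF assms(1), of "\<zero>\<^bsub>M\<^esub>"] by simp
qed

lemma module_homs_neg:
 assumes "h \<in> module_homs R M N" "module R M" "module R N" "x \<in> carrier M"
 shows "h (\<ominus>\<^bsub>M\<^esub> x) = \<ominus>\<^bsub>N\<^esub> h x"
proof -
 interpret M: module R M by fact
 interpret N: module R N by fact
 have hx: "h x \<in> carrier N" "h (\<ominus>\<^bsub>M\<^esub> x) \<in> carrier N"
  using assms by (auto intro: homs_closed)
 have "h (\<ominus>\<^bsub>M\<^esub> x) \<oplus>\<^bsub>N\<^esub> h x = h (\<ominus>\<^bsub>M\<^esub> x \<oplus>\<^bsub>M\<^esub> x)"
  using assms by (intro homs_add[symmetric]) auto
 also have "... = \<zero>\<^bsub>N\<^esub>" using assms by (simp add: M.l_neg homs_zero)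
 finally show ?thesis using hx by (metis N.minus_equality)
qed

lemma homs_minus:
 assumes "h \<in> module_homs R M N" "module R M" "module R N" "x \<in> carrier M" "y \<in> carrier M"
 shows "h (x \<ominus>\<^bsub>M\<^esub> y) = h x \<ominus>\<^bsub>N\<^esub> h y"
proof -
 interpret M: module R M by fact
 show ?thesis using assms by (simp add: a_minus_def homs_add module_homs_neg)
qed

lemma homs_finsum:
 assumes "h \<in> module_homs R M N" "module R M" "module R N" "f \<in> A \<rightarrow> carrier M"
 shows "h (finsum M f A) = finsum N (%i. h (f i)) A"
proof -
 interpret M: module R M by fact
 interpret N: module R N by fact
 show ?thesis using assms(4)
 proof (induction A rule: infinite_finite_induct)
  case (insert i A)
  have "(%i. h (f i)) \<in> A \<rightarrow> carrier N" "h (f i) \<in> carrier N"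
   using insert(4) by (auto intro: homs_closed[OF assms(1)])
  thus ?case using insert assms(1) by (simp add: homs_add Pi_iff)
 qed (simp_all add: homs_zero[OF assms(1-3)])
qed

lemma homs_sum:
 assumes "h \<in> module_homs R M N" "k \<in> module_homs R M N" "module R M" "module R N"
 shows "(%x. h x \<oplus>\<^bsub>N\<^esub> k x) \<in> module_homs R M N"
proof -
 interpret M: module R M by fact
 interpret N: module R N by fact
 show ?thesis using assms(1,2) by (intro module_homsI)
   (auto simp: homs_add homs_smult homs_closed N.smult_r_distr N.a_ac)
qed

lemma module_homs_uminus:
 assumes "h \<in> module_homs R M N" "module R M" "module R N"
 shows "(%x. \<ominus>\<^bsub>N\<^esub> h x) \<in> module_homs R M N"
proof -
 interpret M: module R M by fact
 interpret N: module R N by fact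
 show ?thesis using assms(1) by (intro module_homsI)
   (auto simp: homs_add homs_smult homs_closed N.minus_add N.smult_r_minus)
qed

lemma homs_diff:
 assumes "h \<in> module_homs R M N" "k \<in> module_homs R M N" "module R M" "module R N"
 shows "(%x. h x \<ominus>\<^bsub>N\<^esub> k x) \<in> module_homs R M N"
 using homs_sum[OF assms(1) module_homs_uminus[OF assms(2-4)] assms(3,4)] by (simp add: a_minus_def)

lemma module_homs_scale:
 assumes "module R M" "x \<in> carrier M" "r \<in> carrier R"
 shows "(%x. r \<odot>\<^bsub>M\<^esub> x) \<in> module_homs R M M"
proof -
 interpret M: module R M by fact
 show ?thesis using assms
  by (intro module_homsI) (auto simp: M.smult_r_distr M.smult_assoc1[symmetric] M.m_comm)
qed

subsection \<open>Free modules\<close>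

definition free_module :: "('r, 's) ring_scheme => 'i set => ('r, 'i => 'r) module"
 where "free_module R I =
  \<lparr>carrier = {ph. (ALL i. ph i \<in> carrier R) & (ALL i. i \<notin> I --> ph i = \<zero>\<^bsub>R\<^esub>) & finite {i. ph i ~= \<zero>\<^bsub>R\<^esub>}},
  monoid.mult = undefined, one = undefined, ring.zero = (%i. \<zero>\<^bsub>R\<^esub>),
  add = (%ph ps i. ph i \<oplus>\<^bsub>R\<^esub> ps i), smult = (%r ph i. r \<otimes>\<^bsub>R\<^esub> ph i)\<rparr>"

definition unit_vec :: "('r, 's) ring_scheme => 'i => 'i => 'r"
 where "unit_vec R i = (%j. if j = i then \<one>\<^bsub>R\<^esub> else \<zero>\<^bsub>R\<^esub>)"

definition lin_ext :: "('r, 's) ring_scheme => ('r, 'm) module => ('i => 'm) => ('i => 'r) => 'm"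
 where "lin_ext R M v ph = (\<Oplus>\<^bsub>M\<^esub>i\<in>{i. ph i ~= \<zero>\<^bsub>R\<^esub>}. ph i \<odot>\<^bsub>M\<^esub> v i)"

context cring
begin

lemma free_module_simps:
 "\<zero>\<^bsub>free_module R I\<^esub> = (%i. \<zero>)" "ph \<oplus>\<^bsub>free_module R I\<^esub> ps = (%i. ph i \<oplus> ps i)"
 "r \<odot>\<^bsub>free_module R I\<^esub> ph = (%i. r \<otimes> ph i)" by (simp_all add: free_module_def)

lemma free_module_carrier:
 "ph \<in> carrier (free_module R I) \<longleftrightarrow>
  (ALL i. ph i \<in> carrier R) & (ALL i. i \<notin> I --> ph i = \<zero>) & finite {i. ph i ~= \<zero>}"
 by (simp add: free_module_def)

lemma free_module_module: "module R (free_module R I)"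
proof (rule moduleI)
 show "abelian_group (free_module R I)"
 proof (rule abelian_groupI)
  fix ph ps assume ph: "ph \<in> carrier (free_module R I)" and ps: "ps \<in> carrier (free_module R I)"
  have "{i. ph i \<oplus> ps i ~= \<zero>} \<subseteq> {i. ph i ~= \<zero>} \<union> {i. ps i ~= \<zero>}"
   by auto
  hence "finite {i. ph i \<oplus> ps i ~= \<zero>}"
   using ph ps by (auto simp: free_module_carrier intro: finite_subset)
  thus "ph \<oplus>\<^bsub>free_module R I\<^esub> ps \<in> carrier (free_module R I)"
   using ph ps by (auto simp: free_module_simps free_module_carrier)
 next
  fix ph assume ph: "ph \<in> carrier (free_module R I)"
  have "{i. \<ominus> ph i ~= \<zero>} \<subseteq> {i. ph i ~= \<zero>}" by auto
  hence "(%i. \<ominus> ph i) \<in> carrier (free_module R I)"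
   using ph by (auto simp: free_module_carrier intro: finite_subset)
  moreover have "(%i. \<ominus> ph i) \<oplus>\<^bsub>free_module R I\<^esub> ph = \<zero>\<^bsub>free_module R I\<^esub>"
   using ph by (auto simp: free_module_simps free_module_carrier l_neg)
  ultimately show "EX ps:carrier (free_module R I). ps \<oplus>\<^bsub>free_module R I\<^esub> ph = \<zero>\<^bsub>free_module R I\<^esub>"
   by blast
 qed (auto simp: free_module_simps free_module_carrier a_assoc intro: a_comm)
 fix r ph assume r: "r \<in> carrier R" and ph: "ph \<in> carrier (free_module R I)"
 have "{i. r \<otimes> ph i ~= \<zero>} \<subseteq> {i. ph i ~= \<zero>}" using r by auto
 thus "r \<odot>\<^bsub>free_module R I\<^esub> ph \<in> carrier (free_module R I)"
  using r ph by (auto simp: free_module_simps free_module_carrier intro: finite_subset)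
qed (auto simp: free_module_simps free_module_carrier l_distr r_distr m_assoc is_cring)

lemma unit_vec_closed: "i \<in> I ==> unit_vec R i \<in> carrier (free_module R I)"
 by (auto simp: unit_vec_def free_module_carrier)

lemma lin_ext_superset:
 assumes "module R M" "ph \<in> carrier (free_module R I)" "v \<in> I \<rightarrow> carrier M"
  "finite S" "{i. ph i ~= \<zero>} \<subseteq> S" "S \<subseteq> I"
 shows "lin_ext R M v ph = (\<Oplus>\<^bsub>M\<^esub>i\<in>S. ph i \<odot>\<^bsub>M\<^esub> v i)"
proof -
 interpret M: module R M by fact
 show ?thesis unfolding lin_ext_def using assms(2-6) by (intro M.add.finprod_mono_neutral_cong_left)
   (auto simp: free_module_carrier Pi_iff)
qed

lemma lin_ext_hom:
 assumes M: "module R M" and v: "v \<in> I \<rightarrow> carrier M"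
 shows "lin_ext R M v \<in> module_homs R (free_module R I) M"
proof -
 interpret M: module R M by fact
 show ?thesis
 proof (rule module_homsI)
  fix ph assume ph: "ph \<in> carrier (free_module R I)"
  show "lin_ext R M v ph \<in> carrier M" unfolding lin_ext_def using ph v
   by (intro M.finsum_closed) (auto simp: free_module_carrier Pi_iff)
 next
  fix ph ps assume ph: "ph \<in> carrier (free_module R I)" and ps: "ps \<in> carrier (free_module R I)"
  let ?S = "{i. ph i ~= \<zero>} \<union> {i. ps i ~= \<zero>}"
  have S: "finite ?S" "?S \<subseteq> I" using ph ps by (auto simp: free_module_carrier)
  interpret L: module R "free_module R I" by (rule free_module_module)
  have "ph \<oplus>\<^bsub>free_module R I\<^esub> ps \<in> carrier (free_module R I)"
   using ph ps by (rule L.add.m_closed)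
  moreover have "{i. (ph \<oplus>\<^bsub>free_module R I\<^esub> ps) i ~= \<zero>} \<subseteq> ?S"
   by (auto simp: free_module_simps)
  ultimately have "lin_ext R M v (ph \<oplus>\<^bsub>free_module R I\<^esub> ps) =
    (\<Oplus>\<^bsub>M\<^esub>i\<in>?S. (ph \<oplus>\<^bsub>free_module R I\<^esub> ps) i \<odot>\<^bsub>M\<^esub> v i)"
   using S by (intro lin_ext_superset[OF M _ v])
  also have "... = (\<Oplus>\<^bsub>M\<^esub>i\<in>?S. ph i \<odot>\<^bsub>M\<^esub> v i \<oplus>\<^bsub>M\<^esub> ps i \<odot>\<^bsub>M\<^esub> v i)"
   using ph ps S(2) v by (intro M.finsum_cong')
    (auto simp: free_module_simps free_module_carrier Pi_iff subset_iff M.smult_l_distr)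
  also have "... = (\<Oplus>\<^bsub>M\<^esub>i\<in>?S. ph i \<odot>\<^bsub>M\<^esub> v i) \<oplus>\<^bsub>M\<^esub> (\<Oplus>\<^bsub>M\<^esub>i\<in>?S. ps i \<odot>\<^bsub>M\<^esub> v i)"
   using ph ps S(2) v by (intro M.finsum_addf)
    (auto simp: free_module_carrier Pi_iff subset_iff)
  also have "(\<Oplus>\<^bsub>M\<^esub>i\<in>?S. ph i \<odot>\<^bsub>M\<^esub> v i) = lin_ext R M v ph"
   using S by (intro lin_ext_superset[OF M ph v, symmetric]) auto
  also have "(\<Oplus>\<^bsub>M\<^esub>i\<in>?S. ps i \<odot>\<^bsub>M\<^esub> v i) = lin_ext R M v ps"
   using S by (intro lin_ext_superset[OF M ps v, symmetric]) auto
  finally show "lin_ext R M v (ph \<oplus>\<^bsub>free_module R I\<^esub> ps) = lin_ext R M v ph \<oplus>\<^bsub>M\<^esub> lin_ext R M v ps" .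
 next
  fix r ph assume r: "r \<in> carrier R" and ph: "ph \<in> carrier (free_module R I)"
  let ?S = "{i. ph i ~= \<zero>}"
  interpret L: module R "free_module R I" by (rule free_module_module)
  have S: "finite ?S" "?S \<subseteq> I" using ph by (auto simp: free_module_carrier)
  have "lin_ext R M v (r \<odot>\<^bsub>free_module R I\<^esub> ph) = (\<Oplus>\<^bsub>M\<^esub>i\<in>?S. (r \<odot>\<^bsub>free_module R I\<^esub> ph) i \<odot>\<^bsub>M\<^esub> v i)"
   using S r L.smult_closed[OF r ph] by (intro lin_ext_superset[OF M _ v]) (auto simp: free_module_simps)
  also have "... = (\<Oplus>\<^bsub>M\<^esub>i\<in>?S. r \<odot>\<^bsub>M\<^esub> (ph i \<odot>\<^bsub>M\<^esub> v i))"
   using r ph S(2) v by (intro M.finsum_cong')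
    (auto simp: free_module_simps free_module_carrier Pi_iff subset_iff M.smult_assoc1)
  also have "... = r \<odot>\<^bsub>M\<^esub> lin_ext R M v ph" unfolding lin_ext_def
   using r ph S v by (intro M.finsum_smult_ldistr[symmetric])
    (auto simp: free_module_carrier Pi_iff subset_iff)
  finally show "lin_ext R M v (r \<odot>\<^bsub>free_module R I\<^esub> ph) = r \<odot>\<^bsub>M\<^esub> lin_ext R M v ph" .
 qed
qed

lemma lin_ext_unit_vec:
 assumes M: "module R M" and v: "v \<in> I \<rightarrow> carrier M" and i: "i \<in> I"
 shows "lin_ext R M v (unit_vec R i) = v i"
proof -
 interpret M: module R M by fact
 have "lin_ext R M v (unit_vec R i) = (\<Oplus>\<^bsub>M\<^esub>j\<in>{i}. unit_vec R i j \<odot>\<^bsub>M\<^esub> v j)"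
  using i by (intro lin_ext_superset[OF M unit_vec_closed v]) (auto simp: unit_vec_def)
 also have "... = v i" using v i by (simp add: unit_vec_def Pi_iff)
 finally show ?thesis .
qed

lemma free_module_expand:
 assumes ph: "ph \<in> carrier (free_module R I)"
 shows "lin_ext R (free_module R I) (unit_vec R) ph = ph"
proof
 fix j
 interpret L: module R "free_module R I" by (rule free_module_module)
 let ?S = "{i. ph i ~= \<zero>}"
 have S: "finite ?S" "?S \<subseteq> I" and phR: "!!i. ph i \<in> carrier R"
  using ph by (auto simp: free_module_carrier)
 have ev: "(\<Oplus>\<^bsub>free_module R I\<^esub>i\<in>A. f i) j = (\<Oplus>i\<in>A. f i j)"
  if "finite A" "f \<in> A \<rightarrow> carrier (free_module R I)" for A f using that
 proof (induction rule: finite_induct)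
  case (insert a A)
  have "(%i. f i j) \<in> A \<rightarrow> carrier R" "f a j \<in> carrier R"
   using insert(4) by (auto simp: free_module_carrier Pi_iff)
  thus ?case using insert by (simp add: free_module_simps Pi_iff)
 qed (simp add: free_module_simps)
 have "lin_ext R (free_module R I) (unit_vec R) ph j
   = (\<Oplus>i\<in>?S. (ph i \<odot>\<^bsub>free_module R I\<^esub> unit_vec R i) j)"
  unfolding lin_ext_def using S phR by (intro ev) (auto intro!: L.smult_closed unit_vec_closed)
 also have "... = (\<Oplus>i\<in>?S. if j = i then ph i else \<zero>)"
  using phR by (intro finsum_cong') (auto simp: free_module_simps unit_vec_def)
 also have "... = ph j"
 proof (cases "j \<in> ?S")
  case True
  thus ?thesis using finsum_singleton[of j ?S ph] S phR by auto
 next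
  case False
  hence "(\<Oplus>i\<in>?S. if j = i then ph i else \<zero>) = (\<Oplus>i\<in>?S. \<zero>)"
   by (intro finsum_cong') auto
  thus ?thesis using False by simp
 qed
 finally show "lin_ext R (free_module R I) (unit_vec R) ph j = ph j" .
qed

lemma free_module_hom_eqI:
 assumes h: "h \<in> module_homs R (free_module R I) M" and k: "k \<in> module_homs R (free_module R I) M"
  and M: "module R M" and eq: "!!i. i \<in> I ==> h (unit_vec R i) = k (unit_vec R i)"
  and ph: "ph \<in> carrier (free_module R I)"
 shows "h ph = k ph"
proof -
 interpret L: module R "free_module R I" by (rule free_module_module)
 interpret M: module R M by fact
 let ?S = "{i. ph i ~= \<zero>}"
 have S: "finite ?S" "?S \<subseteq> I" and phR: "!!i. ph i \<in> carrier R"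
  using ph by (auto simp: free_module_carrier)
 have expand: "f ph = (\<Oplus>\<^bsub>M\<^esub>i\<in>?S. ph i \<odot>\<^bsub>M\<^esub> f (unit_vec R i))"
  if f: "f \<in> module_homs R (free_module R I) M" for f
 proof -
  have "f ph = f (\<Oplus>\<^bsub>free_module R I\<^esub>i\<in>?S. ph i \<odot>\<^bsub>free_module R I\<^esub> unit_vec R i)"
   using free_module_expand[OF ph] by (simp add: lin_ext_def)
  also have "... = (\<Oplus>\<^bsub>M\<^esub>i\<in>?S. f (ph i \<odot>\<^bsub>free_module R I\<^esub> unit_vec R i))"
   using S phR by (intro homs_finsum[OF f free_module_module M])
    (auto intro!: L.smult_closed unit_vec_closed)
  also have "... = (\<Oplus>\<^bsub>M\<^esub>i\<in>?S. ph i \<odot>\<^bsub>M\<^esub> f (unit_vec R i))"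
   using S phR homs_closed[OF f]
   by (intro M.finsum_cong') (auto simp: homs_smult[OF f] unit_vec_closed subset_iff)
  finally show ?thesis .
 qed
 show ?thesis unfolding expand[OF h] expand[OF k]
  using S phR eq homs_closed[OF k] by (intro M.finsum_cong') (auto intro!: M.smult_closed simp: unit_vec_closed subset_iff)
qed

end

subsection \<open>Additive maps on groups of integer-valued functions\<close>

definition int_fun_group :: "('x => int) set => bool"
 where "int_fun_group T \<longleftrightarrow> (%x. 0) \<in> T & (ALL z:T. ALL w:T. (%x. z x + w x) \<in> T) & (ALL z:T. (%x. - z x) \<in> T)"

text \<open>Additive maps on the Steinberg group, which is given as a set of integer-valued functions
closed under pointwise addition.\<close>

definition additive_on :: "('x => int) set => ('m, 's) ring_scheme => (('x => int) => 'm) => bool"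
 where "additive_on T M ps \<longleftrightarrow> (ALL z:T. ps z \<in> carrier M) &
  (ALL z:T. ALL w:T. ps (%x. z x + w x) = ps z \<oplus>\<^bsub>M\<^esub> ps w)"

lemma int_groupD:
 assumes "int_fun_group T"
 shows "(%x. 0) \<in> T" "z \<in> T ==> w \<in> T ==> (%x. z x + w x) \<in> T" "z \<in> T ==> (%x. - z x) \<in> T"
 using assms by (auto simp: int_fun_group_def)

lemma int_fun_group_sum:
 assumes "int_fun_group T" "!!i. i \<in> I ==> f i \<in> T"
 shows "(%x. \<Sum>i\<in>I. f i x) \<in> T" using assms(2)
 by (induction I rule: infinite_finite_induct) (auto intro: int_groupD[OF assms(1)])

lemma int_fun_group_mult:
 assumes T: "int_fun_group T" and z: "z \<in> T"
 shows "(%x. n * z x) \<in> T"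
proof (induction n rule: int_induct[where k = 0])
 case (step1 n)
 thus ?case using int_groupD(2)[OF T step1(2) z] by (simp add: algebra_simps)
next
 case (step2 n)
 thus ?case using int_groupD(2)[OF T step2(2) int_groupD(3)[OF T z]] by (simp add: algebra_simps)
qed (use int_groupD(1)[OF T] in simp)

lemma additive_onD:
 assumes "additive_on T M ps"
 shows "z \<in> T ==> ps z \<in> carrier M" "z \<in> T ==> w \<in> T ==> ps (%x. z x + w x) = ps z \<oplus>\<^bsub>M\<^esub> ps w"
 using assms by (auto simp: additive_on_def)

lemma additive_on_zero:
 assumes T: "int_fun_group T" and M: "abelian_group M" and ps: "additive_on T M ps"
 shows "ps (%x. 0) = \<zero>\<^bsub>M\<^esub>"
proof -
 interpret M: abelian_group M by fact
 have "ps (%x. 0) = ps (%x. 0) \<oplus>\<^bsub>M\<^esub> ps (%x. 0)"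
  using additive_onD(2)[OF ps int_groupD(1)[OF T] int_groupD(1)[OF T]] by simp
 thus ?thesis using additive_onD(1)[OF ps int_groupD(1)[OF T]] by (metis M.add.r_cancel_one')
qed

lemma additive_on_neg:
 assumes T: "int_fun_group T" and M: "abelian_group M" and ps: "additive_on T M ps" and z: "z \<in> T"
 shows "ps (%x. - z x) = \<ominus>\<^bsub>M\<^esub> ps z"
proof -
 interpret M: abelian_group M by fact
 have "ps (%x. - z x) \<oplus>\<^bsub>M\<^esub> ps z = \<zero>\<^bsub>M\<^esub>"
  using additive_onD(2)[OF ps int_groupD(3)[OF T z] z] additive_on_zero[OF T M ps] by simp
 thus ?thesis using additive_onD(1)[OF ps z] additive_onD(1)[OF ps int_groupD(3)[OF T z]]
  by (metis M.minus_equality)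
qed

lemma additive_on_sum:
 assumes T: "int_fun_group T" and M: "abelian_group M" and ps: "additive_on T M ps"
  and f: "!!i. i \<in> I ==> f i \<in> T"
 shows "ps (%x. \<Sum>i\<in>I. f i x) = (\<Oplus>\<^bsub>M\<^esub>i\<in>I. ps (f i))"
proof -
 interpret M: abelian_group M by fact
 show ?thesis using f
 proof (induction I rule: infinite_finite_induct)
  case (insert i I)
  have "(%x. \<Sum>i\<in>I. f i x) \<in> T" using insert by (intro int_fun_group_sum[OF T]) auto
  thus ?case using insert additive_onD[OF ps] by (simp add: Pi_iff)
 qed (simp_all add: additive_on_zero[OF T M ps])
qed

lemma additive_on_mult:
 assumes T: "int_fun_group T" and M: "abelian_group M" and ps: "additive_on T M ps" and z: "z \<in> T"
 shows "ps (%x. n * z x) = [n] \<cdot>\<^bsub>M\<^esub> ps z"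
proof -
 interpret M: abelian_group M by fact
 note psz = additive_onD(1)[OF ps z]
 show ?thesis
 proof (induction n rule: int_induct[where k = 0])
  case base
  thus ?case by (simp add: additive_on_zero[OF T M ps] add_pow_def)
 next
  case (step1 n)
  have "ps (%x. (n + 1) * z x) = ps (%x. n * z x + z x)" by (simp add: algebra_simps)
  also have "... = [n] \<cdot>\<^bsub>M\<^esub> ps z \<oplus>\<^bsub>M\<^esub> ps z"
   using step1 additive_onD(2)[OF ps int_fun_group_mult[OF T z] z] by simp
  also have "... = [(n + 1)] \<cdot>\<^bsub>M\<^esub> ps z"
   using M.add.int_pow_mult[OF psz, of n 1] M.add.int_pow_1[OF psz] by simp
  finally show ?case .
 next
  case (step2 n)
  have "ps (%x. (n - 1) * z x) = ps (%x. n * z x + - z x)" by (simp add: algebra_simps)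
  also have "... = [n] \<cdot>\<^bsub>M\<^esub> ps z \<oplus>\<^bsub>M\<^esub> \<ominus>\<^bsub>M\<^esub> ps z"
   using step2 additive_onD(2)[OF ps int_fun_group_mult[OF T z] int_groupD(3)[OF T z]]
    additive_on_neg[OF T M ps z] by simp
  also have "... = [(n - 1)] \<cdot>\<^bsub>M\<^esub> ps z"
   using M.add.int_pow_mult[OF psz, of n "-1"] M.add.int_pow_neg[OF psz, of 1] M.add.int_pow_1[OF psz]
   by simp
  finally show ?case .
 qed
qed

lemma additive_on_comp:
 assumes "additive_on T M ps" "h \<in> module_homs R M N"
 shows "additive_on T N (%z. h (ps z))" using assms by (auto simp: additive_on_def homs_closed homs_add)

lemma (in module) int_smult:
 fixes n :: int
 assumes "x \<in> carrier M"
 shows "([n] \<cdot>\<^bsub>R\<^esub> \<one>) \<odot>\<^bsub>M\<^esub> x = [n] \<cdot>\<^bsub>M\<^esub> x"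
proof -
 have one: "[(1::int)] \<cdot>\<^bsub>R\<^esub> \<one> = \<one>" "[(-1::int)] \<cdot>\<^bsub>R\<^esub> \<one> = \<ominus> \<one>"
  using R.add.int_pow_1[of \<one>] R.add.int_pow_neg[of \<one> 1] by simp_all
 have M1: "[(1::int)] \<cdot>\<^bsub>M\<^esub> x = x" "[(-1::int)] \<cdot>\<^bsub>M\<^esub> x = \<ominus>\<^bsub>M\<^esub> x"
  using assms M.add.int_pow_1[of x] M.add.int_pow_neg[of x 1] by simp_all
 show ?thesis
 proof (induction n rule: int_induct[where k = 0])
  case (step1 n)
  have "([(n + 1)] \<cdot>\<^bsub>R\<^esub> \<one>) \<odot>\<^bsub>M\<^esub> x = ([n] \<cdot>\<^bsub>R\<^esub> \<one> \<oplus> \<one>) \<odot>\<^bsub>M\<^esub> x"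
   using R.add.int_pow_mult[of \<one> n 1] one by simp
  thus ?case using step1 assms M.add.int_pow_mult[of x n 1] M1 by (simp add: smult_l_distr)
 next
  case (step2 n)
  have "([(n - 1)] \<cdot>\<^bsub>R\<^esub> \<one>) \<odot>\<^bsub>M\<^esub> x = ([n] \<cdot>\<^bsub>R\<^esub> \<one> \<oplus> \<ominus> \<one>) \<odot>\<^bsub>M\<^esub> x"
   using R.add.int_pow_mult[of \<one> n "-1"] one by simp
  thus ?case using step2 assms M.add.int_pow_mult[of x n "-1"] M1 by (simp add: smult_l_distr smult_l_minus)
 qed (use assms in \<open>simp add: add_pow_def\<close>)
qed

section \<open>Projective functors lift through arbitrary carrier types\<close>

abbreviation elts :: "('r, 'o, 'a, 'm) catmod => 'o => 'm set"
 where "elts M X \<equiv> carrier (Fob M X)"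

definition catmap ::
  "('o, 'a) small_category => ('r, 's) ring_scheme => ('r, 'o, 'a, 'm) catmod =>
  ('r, 'o, 'a, 'n) catmod => ('o => 'm => 'n) => bool"
 where "catmap C R M N etg \<longleftrightarrow>
  (ALL X:Ob C. etg X \<in> module_homs R (Fob M X) (Fob N X)) &
  (ALL X:Ob C. ALL Y:Ob C. ALL a:Hom C X Y. ALL y:elts M Y.
    etg X (Fmap M X Y a y) = Fmap N X Y a (etg Y y))"

lemma catmapD:
 assumes "catmap C R M N etg"
 shows "X \<in> Ob C ==> etg X \<in> module_homs R (Fob M X) (Fob N X)"
  and "X \<in> Ob C ==> Y \<in> Ob C ==> a \<in> Hom C X Y ==> y \<in> elts M Y ==>
   etg X (Fmap M X Y a y) = Fmap N X Y a (etg Y y)"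
  and "X \<in> Ob C ==> x \<in> elts M X ==> etg X x \<in> elts N X"
 using assms by (auto simp: catmap_def homs_closed)

lemma is_catmodD:
 assumes "is_catmod C R F"
 shows "X \<in> Ob C ==> module R (Fob F X)"
  and "X \<in> Ob C ==> Y \<in> Ob C ==> a \<in> Hom C X Y ==> Fmap F X Y a \<in> module_homs R (Fob F Y) (Fob F X)"
  and "X \<in> Ob C ==> x \<in> elts F X ==> Fmap F X X (Idm C X) x = x"
  and "X \<in> Ob C ==> Y \<in> Ob C ==> Z \<in> Ob C ==> a \<in> Hom C X Y ==> b \<in> Hom C Y Z ==>
   x \<in> elts F Z ==> Fmap F X Z (Comp C b a) x = Fmap F X Y a (Fmap F Y Z b x)"
 using assms unfolding is_catmod_def by blast+

lemma is_catmod_closed: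
 assumes "is_catmod C R F" "X \<in> Ob C" "Y \<in> Ob C" "a \<in> Hom C X Y" "y \<in> elts F Y"
 shows "Fmap F X Y a y \<in> elts F X" using assms by (blast intro: homs_closed is_catmodD)

lemma catmap_comp:
 assumes "catmap C R M N f" "catmap C R N L g"
 shows "catmap C R M L (%X x. g X (f X x))" unfolding catmap_def
proof (intro conjI ballI)
 fix X assume "X \<in> Ob C"
 thus "(%x. g X (f X x)) \<in> module_homs R (Fob M X) (Fob L X)"
  by (intro homs_comp[OF catmapD(1)[OF assms(1)] catmapD(1)[OF assms(2)]])
qed (simp add: catmapD[OF assms(1)] catmapD[OF assms(2)])

lemma nat_homs_catmap: "etg \<in> nat_homs C R M N ==> catmap C R M N etg"
 by (auto simp: nat_homs_def catmap_def PiE_iff)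

lemma catmap_restrict:
 assumes "catmap C R M N etg" "is_catmod C R M"
 shows "(\<lambda>X\<in>Ob C. \<lambda>x\<in>elts M X. etg X x) \<in> nat_homs C R M N"
proof -
 have "restrict (etg X) (elts M X) \<in> module_homs R (Fob M X) (Fob N X)"
  if "X \<in> Ob C" for X
  by (rule module_homs_cong[OF catmapD(1)[OF assms(1) that] _ is_catmodD(1)[OF assms(2) that]]) auto
 thus ?thesis using assms unfolding nat_homs_def
  by (auto simp: catmapD(2)[OF assms(1)] is_catmod_closed[OF assms(2)])
qed

lemma catmap_diff:
 assumes f: "catmap C R M N f" and g: "catmap C R M N g" and M: "is_catmod C R M" and N: "is_catmod C R N"
 shows "catmap C R M N (%X x. f X x \<ominus>\<^bsub>Fob N X\<^esub> g X x)" unfolding catmap_def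
proof (intro conjI ballI)
 fix X assume X: "X \<in> Ob C"
 show "(%x. f X x \<ominus>\<^bsub>Fob N X\<^esub> g X x) \<in> module_homs R (Fob M X) (Fob N X)"
  using X by (intro homs_diff catmapD[OF f] catmapD[OF g] is_catmodD[OF M] is_catmodD[OF N])
next
 fix X Y a y assume *: "X \<in> Ob C" "Y \<in> Ob C" "a \<in> Hom C X Y" "y \<in> elts M Y"
 show "f X (Fmap M X Y a y) \<ominus>\<^bsub>Fob N X\<^esub> g X (Fmap M X Y a y) =
   Fmap N X Y a (f Y y \<ominus>\<^bsub>Fob N Y\<^esub> g Y y)"
  using * catmapD(2,3)[OF f] catmapD(2,3)[OF g]
  by (simp add: homs_minus[OF is_catmodD(2)[OF N] is_catmodD(1)[OF N] is_catmodD(1)[OF N]])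
qed

locale small_cat =
 fixes C :: "('o, 'a) small_category"
 assumes Idm_Hom: "X \<in> Ob C ==> Idm C X \<in> Hom C X X"
  and Comp_Hom: "X \<in> Ob C ==> Y \<in> Ob C ==> Z \<in> Ob C ==> a \<in> Hom C X Y ==> b \<in> Hom C Y Z ==>
   Comp C b a \<in> Hom C X Z"
  and Comp_Idm: "X \<in> Ob C ==> Y \<in> Ob C ==> a \<in> Hom C X Y ==> Comp C a (Idm C X) = a"
  and Comp_assoc: "W \<in> Ob C ==> X \<in> Ob C ==> Y \<in> Ob C ==> Z \<in> Ob C ==>
   a \<in> Hom C W X ==> b \<in> Hom C X Y ==> c \<in> Hom C Y Z ==>
   Comp C c (Comp C b a) = Comp C (Comp C c b) a"

definition cover_index :: "('o, 'a) small_category => ('r, 'o, 'a, 'q) catmod => 'o => ('o \<times> 'q \<times> 'a) set"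
 where "cover_index C P X = {(Y, y, a). Y \<in> Ob C & y \<in> elts P Y & a \<in> Hom C X Y}"

text \<open>The sum of representable functors, one for each element of each \<open>P Y\<close>; a triple \<open>(Y, y, a)\<close>
stands for the element \<open>y\<close> pulled back along \<open>a\<close>.\<close>

definition free_cover ::
  "('o, 'a) small_category => ('r, 's) ring_scheme => ('r, 'o, 'a, 'q) catmod =>
  ('r, 'o, 'a, 'o \<times> 'q \<times> 'a => 'r) catmod"
 where "free_cover C R P =
  \<lparr>Fob = (%X. free_module R (cover_index C P X)),
  Fmap = (%X X' b. lin_ext R (free_module R (cover_index C P X))
   (%(Y, y, a). unit_vec R (Y, y, Comp C a b)))\<rparr>"

definition cover_map ::
  "('r, 's) ring_scheme => ('r, 'o, 'a, 'm) catmod => ('o => 'q => 'm) => 'o =>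
  ('o \<times> 'q \<times> 'a => 'r) => 'm"
 where "cover_map R M m X = lin_ext R (Fob M X) (%(Y, y, a). Fmap M X Y a (m Y y))"

context
 fixes C :: "('o, 'a) small_category" and R :: "('r, 's) ring_scheme"
 assumes C: "small_cat C" and R: "cring R"
begin

interpretation small_cat C by (rule C)
interpretation cring R by (rule R)

lemma free_cover_Fmap_hom:
 assumes "X \<in> Ob C" "X' \<in> Ob C" "b \<in> Hom C X X'"
 shows "Fmap (free_cover C R P) X X' b \<in>
  module_homs R (free_module R (cover_index C P X')) (free_module R (cover_index C P X))"
 unfolding free_cover_def using assms
 by (auto intro!: lin_ext_hom free_module_module unit_vec_closed simp: cover_index_def intro: Comp_Hom)

lemma free_cover_Fmap_unit:
 assumes "X \<in> Ob C" "X' \<in> Ob C" "b \<in> Hom C X X'" "(Y, y, a) \<in> cover_index C P X'"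
 shows "Fmap (free_cover C R P) X X' b (unit_vec R (Y, y, a)) = unit_vec R (Y, y, Comp C a b)"
proof -
 have "(%(Y, y, a). unit_vec R (Y, y, Comp C a b)) \<in> cover_index C P X' \<rightarrow>
   carrier (free_module R (cover_index C P X))"
  using assms by (auto intro!: unit_vec_closed simp: cover_index_def intro: Comp_Hom)
 from lin_ext_unit_vec[OF free_module_module this assms(4)] show ?thesis by (simp add: free_cover_def)
qed

lemma free_cover_catmod: "is_catmod C R (free_cover C R P)" unfolding is_catmod_def
proof (intro conjI ballI)
 fix X assume X: "X \<in> Ob C"
 show "module R (Fob (free_cover C R P) X)" by (simp add: free_cover_def free_module_module)
 fix x assume x: "x \<in> elts (free_cover C R P) X"
 have "Fmap (free_cover C R P) X X (Idm C X) x = id x"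
 proof (rule free_module_hom_eqI[OF free_cover_Fmap_hom[OF X X Idm_Hom[OF X]] _ free_module_module])
  show "id \<in> module_homs R (free_module R (cover_index C P X)) (free_module R (cover_index C P X))"
   by (simp add: module_homs_def)
  show "x \<in> carrier (free_module R (cover_index C P X))" using x by (simp add: free_cover_def)
  fix i assume i: "i \<in> cover_index C P X"
  obtain Y y a where "i = (Y, y, a)" by (cases i)
  thus "Fmap (free_cover C R P) X X (Idm C X) (unit_vec R i) = id (unit_vec R i)"
   using i free_cover_Fmap_unit[OF X X Idm_Hom[OF X], of Y y a P] X by (auto simp: cover_index_def Comp_Idm)
 qed
 thus "Fmap (free_cover C R P) X X (Idm C X) x = x" by simp
next
 fix X Y a assume *: "X \<in> Ob C" "Y \<in> Ob C" "a \<in> Hom C X Y"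
 show "Fmap (free_cover C R P) X Y a \<in> module_homs R (Fob (free_cover C R P) Y) (Fob (free_cover C R P) X)"
  using free_cover_Fmap_hom[OF *, of P] by (simp add: free_cover_def)
next
 fix X Y Z a b x assume *: "X \<in> Ob C" "Y \<in> Ob C" "Z \<in> Ob C" "a \<in> Hom C X Y" "b \<in> Hom C Y Z"
  and x: "x \<in> elts (free_cover C R P) Z"
 note c = Comp_Hom[OF *]
 show "Fmap (free_cover C R P) X Z (Comp C b a) x =
   Fmap (free_cover C R P) X Y a (Fmap (free_cover C R P) Y Z b x)"
 proof (rule free_module_hom_eqI[OF free_cover_Fmap_hom[OF *(1,3) c] _ free_module_module])
  show "(%x. Fmap (free_cover C R P) X Y a (Fmap (free_cover C R P) Y Z b x)) \<in>
    module_homs R (free_module R (cover_index C P Z)) (free_module R (cover_index C P X))"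
   using * by (intro homs_comp[OF free_cover_Fmap_hom free_cover_Fmap_hom])
  show "x \<in> carrier (free_module R (cover_index C P Z))" using x by (simp add: free_cover_def)
  fix i assume i: "i \<in> cover_index C P Z"
  obtain W w e where e: "i = (W, w, e)" by (cases i)
  have "(W, w, Comp C e b) \<in> cover_index C P Y"
   using i e * by (auto simp: cover_index_def intro: Comp_Hom)
  thus "Fmap (free_cover C R P) X Z (Comp C b a) (unit_vec R i) =
    Fmap (free_cover C R P) X Y a (Fmap (free_cover C R P) Y Z b (unit_vec R i))"
   using i e * c by (simp add: free_cover_Fmap_unit)
    (auto simp: cover_index_def Comp_assoc[of X Y Z W])
 qed
qed

lemma cover_map_values:
 assumes "is_catmod C R M" "!!Y y. Y \<in> Ob C ==> y \<in> elts P Y ==> m Y y \<in> elts M Y"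
  "X \<in> Ob C"
 shows "(%(Y, y, a). Fmap M X Y a (m Y y)) \<in> cover_index C P X \<rightarrow> elts M X"
 using assms by (auto simp: cover_index_def is_catmod_closed)

lemma cover_map_unit:
 assumes "is_catmod C R M" "!!Y y. Y \<in> Ob C ==> y \<in> elts P Y ==> m Y y \<in> elts M Y"
  "X \<in> Ob C" "(Y, y, a) \<in> cover_index C P X"
 shows "cover_map R M m X (unit_vec R (Y, y, a)) = Fmap M X Y a (m Y y)"
 using lin_ext_unit_vec[OF is_catmodD(1)[OF assms(1,3)] cover_map_values[OF assms(1-3)] assms(4)]
 by (simp add: cover_map_def)

lemma cover_map_catmap:
 assumes M: "is_catmod C R M"
  and m: "!!Y y. Y \<in> Ob C ==> y \<in> elts P Y ==> m Y y \<in> elts M Y"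
 shows "catmap C R (free_cover C R P) M (cover_map R M m)" unfolding catmap_def
proof (intro conjI ballI)
 have hom: "cover_map R M m X \<in> module_homs R (free_module R (cover_index C P X)) (Fob M X)"
  if "X \<in> Ob C" for X unfolding cover_map_def
  by (intro lin_ext_hom is_catmodD(1)[OF M that] cover_map_values[OF M m that])
 fix X assume X: "X \<in> Ob C"
 show "cover_map R M m X \<in> module_homs R (Fob (free_cover C R P) X) (Fob M X)"
  using hom[OF X] by (simp add: free_cover_def)
 fix X' b ph assume X': "X' \<in> Ob C" and b: "b \<in> Hom C X X'"
  and ph: "ph \<in> elts (free_cover C R P) X'"
 show "cover_map R M m X (Fmap (free_cover C R P) X X' b ph) = Fmap M X X' b (cover_map R M m X' ph)"
 proof (rule free_module_hom_eqI[where M = "Fob M X" and I = "cover_index C P X'"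
    and h = "%ph. cover_map R M m X (Fmap (free_cover C R P) X X' b ph)"
    and k = "%ph. Fmap M X X' b (cover_map R M m X' ph)"])
  show "(%ph. cover_map R M m X (Fmap (free_cover C R P) X X' b ph)) \<in>
    module_homs R (free_module R (cover_index C P X')) (Fob M X)"
   by (rule homs_comp[OF free_cover_Fmap_hom[OF X X' b] hom[OF X]])
  show "(%ph. Fmap M X X' b (cover_map R M m X' ph)) \<in>
    module_homs R (free_module R (cover_index C P X')) (Fob M X)"
   by (rule homs_comp[OF hom[OF X'] is_catmodD(2)[OF M X X' b]])
  show "module R (Fob M X)" by (rule is_catmodD(1)[OF M X])
  show "ph \<in> carrier (free_module R (cover_index C P X'))" using ph by (simp add: free_cover_def)
  fix i assume i: "i \<in> cover_index C P X'"
  obtain Y y a where Y: "i = (Y, y, a)" by (cases i)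
  have *: "Y \<in> Ob C" "y \<in> elts P Y" "a \<in> Hom C X' Y" using i Y by (auto simp: cover_index_def)
  have "(Y, y, Comp C a b) \<in> cover_index C P X"
   using * X X' b by (auto simp: cover_index_def intro: Comp_Hom)
  thus "cover_map R M m X (Fmap (free_cover C R P) X X' b (unit_vec R i)) =
    Fmap M X X' b (cover_map R M m X' (unit_vec R i))"
   using i X X' b * by (simp add: Y free_cover_Fmap_unit cover_map_unit[OF M m] is_catmodD(4)[OF M] m)
 qed
qed

lemma projective_section:
 assumes P: "projective C R P"
 obtains s where "catmap C R P (free_cover C R P) s"
  "!!X x. X \<in> Ob C ==> x \<in> elts P X ==> cover_map R P (%Y y. y) X (s X x) = x"
proof -
 let ?M = "free_cover C R P" and ?\<pi> = "cover_map R P (%Y y. y)"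
 have Pc: "is_catmod C R P" using P by (simp add: projective_def)
 have \<pi>: "catmap C R ?M P ?\<pi>" by (rule cover_map_catmap[OF Pc])
 have id: "catmap C R P P (%X x. x)" by (simp add: catmap_def module_homs_def)
 define f where "f = (\<lambda>X\<in>Ob C. \<lambda>x\<in>carrier (Fob ?M X). ?\<pi> X x)"
 define g where "g = (\<lambda>X\<in>Ob C. \<lambda>x\<in>elts P X. x)"
 have f: "f \<in> nat_homs C R ?M P" unfolding f_def by (rule catmap_restrict[OF \<pi> free_cover_catmod])
 have g: "g \<in> nat_homs C R P P" unfolding g_def by (rule catmap_restrict[OF id Pc])
 have surj: "f X ` carrier (Fob ?M X) = elts P X" if X: "X \<in> Ob C" for X
 proof
  show "f X ` carrier (Fob ?M X) \<subseteq> elts P X" using catmapD(3)[OF nat_homs_catmap[OF f] X] by auto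
  show "elts P X \<subseteq> f X ` carrier (Fob ?M X)"
  proof
   fix x assume x: "x \<in> elts P X"
   have i: "(X, x, Idm C X) \<in> cover_index C P X" using X x by (simp add: cover_index_def Idm_Hom)
   have u: "unit_vec R (X, x, Idm C X) \<in> carrier (Fob ?M X)"
    using unit_vec_closed[OF i] by (simp add: free_cover_def)
   have "f X (unit_vec R (X, x, Idm C X)) = x"
    using X x u by (simp add: f_def cover_map_unit[OF Pc _ X i] is_catmodD(3)[OF Pc])
   thus "x \<in> f X ` carrier (Fob ?M X)" using u by (metis image_eqI)
  qed
 qed
 obtain h where h: "h \<in> nat_homs C R P ?M"
  and eq: "ALL X:Ob C. ALL x:elts P X. f X (h X x) = g X x"
  using P f g surj Pc free_cover_catmod[of P] unfolding projective_def by blast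
 show thesis
 proof (rule that[OF nat_homs_catmap[OF h]])
  fix X x assume *: "X \<in> Ob C" "x \<in> elts P X"
  have "h X x \<in> carrier (Fob ?M X)" using * by (rule catmapD(3)[OF nat_homs_catmap[OF h]])
  thus "?\<pi> X (h X x) = x" using bspec[OF bspec[OF eq *(1)] *(2)] * by (simp add: f_def g_def)
 qed
qed

text \<open>The definition of projectivity gives lifts for one carrier type only. A section of the free
cover transports them to all carrier types, and it allows to lift a single map whose values lie in the image
of \<open>f\<close> instead of asking \<open>f\<close> to be surjective.\<close>

theorem projective_lift:
 assumes P: "projective C R P" and M: "is_catmod C R M" and N: "is_catmod C R N"
  and f: "catmap C R M N f" and g: "catmap C R P N g"
  and im: "!!X x. X \<in> Ob C ==> x \<in> elts P X ==> g X x \<in> f X ` elts M X"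
 shows "EX h. catmap C R P M h & (ALL X:Ob C. ALL x:elts P X. f X (h X x) = g X x)"
proof -
 have Pc: "is_catmod C R P" using P by (simp add: projective_def)
 obtain s where s: "catmap C R P (free_cover C R P) s"
  and \<pi>s: "!!X x. X \<in> Ob C ==> x \<in> elts P X ==> cover_map R P (%Y y. y) X (s X x) = x"
  using projective_section[OF P] by blast
 obtain m where m: "!!Y y. Y \<in> Ob C ==> y \<in> elts P Y ==>
   m Y y \<in> elts M Y & f Y (m Y y) = g Y y"
 proof -
  have "EX z. z \<in> elts M Y & f Y z = g Y y" if "Y \<in> Ob C" "y \<in> elts P Y" for Y y
   using im[OF that] by (metis imageE)
  thus thesis
   using that[of "%Y y. SOME z. z \<in> elts M Y & f Y z = g Y y"] by (metis (mono_tags, lifting) someI_ex)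
 qed
 have \<mu>: "catmap C R (free_cover C R P) M (cover_map R M m)" using m by (intro cover_map_catmap M) auto
 have \<pi>: "catmap C R (free_cover C R P) P (cover_map R P (%Y y. y))" by (rule cover_map_catmap[OF Pc])
 have eq: "f X (cover_map R M m X ph) = g X (cover_map R P (%Y y. y) X ph)"
  if X: "X \<in> Ob C" and ph: "ph \<in> elts (free_cover C R P) X" for X ph
 proof (rule free_module_hom_eqI[where M = "Fob N X" and I = "cover_index C P X"
    and h = "%ph. f X (cover_map R M m X ph)"
    and k = "%ph. g X (cover_map R P (%Y y. y) X ph)"])
  show "(%ph. f X (cover_map R M m X ph)) \<in> module_homs R (free_module R (cover_index C P X)) (Fob N X)"
   using catmapD(1)[OF catmap_comp[OF \<mu> f] X] by (simp add: free_cover_def)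
  show "(%ph. g X (cover_map R P (%Y y. y) X ph)) \<in>
    module_homs R (free_module R (cover_index C P X)) (Fob N X)"
   using catmapD(1)[OF catmap_comp[OF \<pi> g] X] by (simp add: free_cover_def)
  show "module R (Fob N X)" by (rule is_catmodD(1)[OF N X])
  show "ph \<in> carrier (free_module R (cover_index C P X))" using ph by (simp add: free_cover_def)
  fix i assume i: "i \<in> cover_index C P X"
  obtain Y y a where Y: "i = (Y, y, a)" by (cases i)
  have *: "Y \<in> Ob C" "y \<in> elts P Y" "a \<in> Hom C X Y" using i Y by (auto simp: cover_index_def)
  have "f X (cover_map R M m X (unit_vec R i)) = f X (Fmap M X Y a (m Y y))"
   using i m by (subst Y, subst cover_map_unit[OF M _ X]) (auto simp: Y)
  also have "... = Fmap N X Y a (g Y y)" using * X m by (simp add: catmapD(2)[OF f])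
  also have "... = g X (Fmap P X Y a y)" using * X by (simp add: catmapD(2)[OF g])
  also have "... = g X (cover_map R P (%Y y. y) X (unit_vec R i))"
   using i by (subst Y, subst cover_map_unit[OF Pc _ X]) (auto simp: Y)
  finally show "f X (cover_map R M m X (unit_vec R i)) = g X (cover_map R P (%Y y. y) X (unit_vec R i))" .
 qed
 show ?thesis
 proof (intro exI conjI ballI)
  show "catmap C R P M (%X x. cover_map R M m X (s X x))" by (rule catmap_comp[OF s \<mu>])
  fix X x assume "X \<in> Ob C" "x \<in> elts P X"
  thus "f X (cover_map R M m X (s X x)) = g X x" using catmapD(3)[OF s] by (simp add: eq \<pi>s)
 qed
qed

end

section \<open>Elementary abelian subgroups of a finite p-group\<close>

text \<open>The intrinsic form of being elementary abelian; the rank is then read off from the order.\<close>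

definition exp_abelian :: "('g, 'x) monoid_scheme => nat => 'g set => bool"
 where "exp_abelian G p E \<longleftrightarrow> subgroup E G &
  (ALL x:E. ALL y:E. x \<otimes>\<^bsub>G\<^esub> y = y \<otimes>\<^bsub>G\<^esub> x) & (ALL x:E. x [^]\<^bsub>G\<^esub> p = \<one>\<^bsub>G\<^esub>)"

lemma dvd_pow_prime: "Factorial_Ring.prime (p::nat) ==> m dvd p ^ n ==> \<exists>i\<le>n. m = p ^ i"
 by (simp add: divides_primepow_nat)

context group
begin

subsection \<open>Products of subgroups\<close>

lemma set_multI: "x \<in> A ==> y \<in> B ==> x \<otimes> y \<in> A <#> B" by (auto simp: set_mult_def)

lemma set_mult_commuting_subgroup:
 assumes E: "subgroup E G" "ALL x:E. ALL y:E. x \<otimes> y = y \<otimes> x"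
  and A: "subgroup A G" "A \<subseteq> E" and B: "subgroup B G" "B \<subseteq> E"
 shows "subgroup (A <#> B) G" "A \<subseteq> A <#> B" "B \<subseteq> A <#> B"
  and "!!K. subgroup K G ==> A \<subseteq> K ==> B \<subseteq> K ==> A <#> B \<subseteq> K"
proof -
 note car = subgroup.mem_carrier[OF E(1)]
 show "subgroup (A <#> B) G"
 proof (rule subgroupI)
  show "A <#> B \<subseteq> carrier G" using A(2) B(2) car by (intro set_mult_closed) auto
  show "A <#> B ~= {}"
   using subgroup.one_closed[OF A(1)] subgroup.one_closed[OF B(1)] by (auto simp: set_mult_def)
 next
  fix x assume "x \<in> A <#> B"
  then obtain a b where ab: "a \<in> A" "b \<in> B" "x = a \<otimes> b" by (auto simp: set_mult_def)
  have "inv x = inv b \<otimes> inv a" using ab A B car by (simp add: inv_mult_group subset_iff)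
  also have "... = inv a \<otimes> inv b"
   using ab A B by (intro E(2)[rule_format]) (auto dest: subgroup.m_inv_closed)
  finally show "inv x \<in> A <#> B"
   using subgroup.m_inv_closed[OF A(1) ab(1)] subgroup.m_inv_closed[OF B(1) ab(2)]
   by (auto simp: set_mult_def)
 next
  fix x y assume "x \<in> A <#> B" "y \<in> A <#> B"
  then obtain a b c d where ab: "a \<in> A" "b \<in> B" "x = a \<otimes> b" "c \<in> A" "d \<in> B" "y = c \<otimes> d"
   by (auto simp: set_mult_def)
  have e: "a \<in> carrier G" "b \<in> carrier G" "c \<in> carrier G" "d \<in> carrier G"
   using ab A B car by auto
  have "x \<otimes> y = a \<otimes> (b \<otimes> c) \<otimes> d" using e ab by (simp add: m_assoc)
  also have "b \<otimes> c = c \<otimes> b" using ab A B by (intro E(2)[rule_format]) auto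
  finally have "x \<otimes> y = (a \<otimes> c) \<otimes> (b \<otimes> d)" using e by (simp add: m_assoc)
  thus "x \<otimes> y \<in> A <#> B"
   using subgroup.m_closed[OF A(1) ab(1) ab(4)] subgroup.m_closed[OF B(1) ab(2) ab(5)]
   by (auto simp: set_mult_def)
 qed
 show "A \<subseteq> A <#> B"
 proof
  fix x assume x: "x \<in> A"
  hence "x = x \<otimes> \<one>" using A car by auto
  thus "x \<in> A <#> B" using x subgroup.one_closed[OF B(1)] unfolding set_mult_def by blast
 qed
 show "B \<subseteq> A <#> B"
 proof
  fix x assume x: "x \<in> B"
  hence "x = \<one> \<otimes> x" using B car by auto
  thus "x \<in> A <#> B" using x subgroup.one_closed[OF A(1)] unfolding set_mult_def by blast
 qed
 show "A <#> B \<subseteq> K" if "subgroup K G" "A \<subseteq> K" "B \<subseteq> K" for K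
  using that by (auto simp: set_mult_def intro: subgroup.m_closed)
qed

lemma card_set_mult_disjoint:
 assumes A: "subgroup A G" and B: "subgroup B G" and AB: "A Int B = {\<one>}"
 shows "card (A <#> B) = card A * card B"
proof -
 have "inj_on (%(a, b). a \<otimes> b) (A \<times> B)"
 proof (intro inj_onI, clarify)
  fix a b c d assume *: "a \<in> A" "b \<in> B" "c \<in> A" "d \<in> B" "a \<otimes> b = c \<otimes> d"
  have e: "a \<in> carrier G" "b \<in> carrier G" "c \<in> carrier G" "d \<in> carrier G"
   using * subgroup.mem_carrier[OF A] subgroup.mem_carrier[OF B] by auto
  have eq: "inv c \<otimes> a = d \<otimes> inv b"
   using *(5) e by (metis inv_closed inv_solve_right m_assoc l_inv l_one m_closed inv_solve_left)
  moreover have "inv c \<otimes> a \<in> A" "d \<otimes> inv b \<in> B"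
   using * A B by (auto intro: subgroup.m_closed subgroup.m_inv_closed)
  ultimately have "inv c \<otimes> a = \<one>" "d \<otimes> inv b = \<one>" using AB by auto
  thus "a = c & b = d" using e by (metis inv_equality inv_inv inv_closed r_one inv_solve_right l_one)
 qed
 moreover have "A <#> B = (%(a, b). a \<otimes> b) ` (A \<times> B)" by (auto simp: set_mult_def)
 ultimately show ?thesis by (simp add: card_image card_cartesian_product)
qed

subsection \<open>Conjugation of subsets\<close>

lemma conj_image: "conj_set G g H = (%x. g \<otimes> x \<otimes> inv g) ` H"
 by (auto simp: l_coset_def r_coset_def)

lemma conj_set_one: "H \<subseteq> carrier G ==> conj_set G \<one> H = H"
 unfolding conj_image by (force simp: subset_iff image_iff)

lemma conj_set_mult:
 assumes "g \<in> carrier G" "h \<in> carrier G" "H \<subseteq> carrier G"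
 shows "conj_set G (g \<otimes> h) H = conj_set G g (conj_set G h H)" unfolding conj_image image_image
 using assms by (intro image_cong) (auto simp: inv_mult_group m_assoc subset_iff)

lemma conj_set_closed: "g \<in> carrier G ==> H \<subseteq> carrier G ==> conj_set G g H \<subseteq> carrier G"
 unfolding conj_image by auto

lemma conj_inv_left: "g \<in> carrier G ==> H \<subseteq> carrier G ==> conj_set G (inv g) (conj_set G g H) = H"
 by (subst conj_set_mult[symmetric]) (simp_all del: inv_inv add: conj_set_one[simplified])

lemma conj_set_inv_right: "g \<in> carrier G ==> H \<subseteq> carrier G ==> conj_set G g (conj_set G (inv g) H) = H"
 by (subst conj_set_mult[symmetric]) (simp_all del: inv_inv add: conj_set_one[simplified])

lemma conj_set_mono: "H \<subseteq> K ==> conj_set G g H \<subseteq> conj_set G g K"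
 unfolding conj_image by auto

lemma conj_set_subset_iff:
 assumes "g \<in> carrier G" "H \<subseteq> carrier G" "K \<subseteq> carrier G"
 shows "conj_set G g H \<subseteq> conj_set G g K \<longleftrightarrow> H \<subseteq> K"
 using conj_set_mono[of "conj_set G g H" "conj_set G g K" "inv g"] conj_set_mono[of H K g]
  conj_inv_left[OF assms(1,2)] conj_inv_left[OF assms(1,3)] by (simp del: inv_inv) blast

lemma conj_set_eq_iff:
 assumes "g \<in> carrier G" "H \<subseteq> carrier G" "K \<subseteq> carrier G"
 shows "conj_set G g H = conj_set G g K \<longleftrightarrow> H = K" using assms by (metis conj_inv_left)

lemma conj_inj: "g \<in> carrier G ==> H \<subseteq> carrier G ==> inj_on (%x. g \<otimes> x \<otimes> inv g) H"
 by (auto intro!: inj_onI simp: subset_iff)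

lemma card_conj_set: "g \<in> carrier G ==> H \<subseteq> carrier G ==> card (conj_set G g H) = card H"
 unfolding conj_image by (intro card_image conj_inj)

lemma conj_mult:
 "g \<in> carrier G ==> x \<in> carrier G ==> y \<in> carrier G ==>
  (g \<otimes> x \<otimes> inv g) \<otimes> (g \<otimes> y \<otimes> inv g) = g \<otimes> (x \<otimes> y) \<otimes> inv g"
 by (simp add: m_assoc inv_solve_left' flip: m_assoc[of "inv g" g])

lemma conj_pow:
 assumes "g \<in> carrier G" "x \<in> carrier G"
 shows "(g \<otimes> x \<otimes> inv g) [^] (n::nat) = g \<otimes> (x [^] n) \<otimes> inv g"
proof (induction n)
 case (Suc n)
 thus ?case using assms by (simp add: conj_mult)
qed (use assms in simp)

lemma conj_set_subgroup:
 assumes g: "g \<in> carrier G" and H: "subgroup H G"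
 shows "subgroup (conj_set G g H) G"
proof (rule subgroupI)
 note sub = subgroup.subset[OF H]
 show "conj_set G g H \<subseteq> carrier G" by (rule conj_set_closed[OF g sub])
 show "conj_set G g H ~= {}" using subgroup.one_closed[OF H] by (auto simp: conj_image)
 fix x assume x: "x \<in> conj_set G g H"
 then obtain u where u: "u \<in> H" "x = g \<otimes> u \<otimes> inv g" by (auto simp: conj_image)
 hence "inv x = g \<otimes> inv u \<otimes> inv g"
  using g sub by (simp add: inv_mult_group m_assoc subset_iff)
 thus "inv x \<in> conj_set G g H" using u subgroup.m_inv_closed[OF H] by (auto simp: conj_image)
 fix y assume "y \<in> conj_set G g H"
 then obtain v where v: "v \<in> H" "y = g \<otimes> v \<otimes> inv g" by (auto simp: conj_image)
 have "x \<otimes> y = g \<otimes> (u \<otimes> v) \<otimes> inv g"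
  unfolding u v using subsetD[OF sub u(1)] subsetD[OF sub v(1)] by (rule conj_mult[OF g])
 thus "x \<otimes> y \<in> conj_set G g H" using u v subgroup.m_closed[OF H] by (auto simp: conj_image)
qed

lemma normalizer_iff: "E \<subseteq> carrier G ==> g \<in> normalizer G E \<longleftrightarrow> g \<in> carrier G & conj_set G g E = E"
 by (simp add: normalizer_def stabilizer_def)

lemma centralizer_subgroup:
 assumes "E \<subseteq> carrier G"
 shows "subgroup (centralizer G E) G"
proof (rule subgroupI)
 fix g h assume g: "g \<in> centralizer G E" and h: "h \<in> centralizer G E"
 show "inv g \<in> centralizer G E" unfolding centralizer_def
 proof (clarsimp, intro conjI ballI)
  show "inv g \<in> carrier G" using g by (simp add: centralizer_def)
  fix x assume x: "x \<in> E"
  hence "g \<otimes> x = x \<otimes> g" "g \<in> carrier G" "x \<in> carrier G"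
   using g assms by (auto simp: centralizer_def)
  thus "inv g \<otimes> x = x \<otimes> inv g"
   by (metis inv_closed inv_solve_left inv_solve_right m_assoc m_closed)
 qed
 show "g \<otimes> h \<in> centralizer G E" unfolding centralizer_def
 proof (clarsimp, intro conjI ballI)
  show "g \<otimes> h \<in> carrier G" using g h by (simp add: centralizer_def)
  fix x assume x: "x \<in> E"
  hence "g \<otimes> x = x \<otimes> g" "h \<otimes> x = x \<otimes> h" "g \<in> carrier G" "h \<in> carrier G" "x \<in> carrier G"
   using g h assms by (auto simp: centralizer_def)
  thus "g \<otimes> h \<otimes> x = x \<otimes> (g \<otimes> h)" by (metis m_assoc)
 qed
qed (use assms in \<open>auto simp: centralizer_def intro!: exI[of _ \<one>]\<close>)

lemma conj_set_central:
 assumes "E \<subseteq> carrier G" "g \<in> centralizer G E" "H \<subseteq> E"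
 shows "conj_set G g H = H"
proof -
 have "g \<otimes> x \<otimes> inv g = x" if "x \<in> H" for x
 proof -
  have "g \<otimes> x = x \<otimes> g" "g \<in> carrier G" "x \<in> carrier G"
   using that assms by (auto simp: centralizer_def)
  thus ?thesis by (simp add: m_assoc)
 qed
 thus ?thesis by (force simp: conj_image image_iff)
qed

lemma centralizer_conj:
 assumes g: "g \<in> carrier G" and E: "E \<subseteq> carrier G"
 shows "centralizer G (conj_set G g E) = conj_set G g (centralizer G E)"
proof -
 have *: "conj_set G g (centralizer G E) \<subseteq> centralizer G (conj_set G g E)"
  if g: "g \<in> carrier G" and E: "E \<subseteq> carrier G" for g E
 proof
  fix x assume "x \<in> conj_set G g (centralizer G E)"
  then obtain c where c: "c \<in> centralizer G E" "x = g \<otimes> c \<otimes> inv g" by (auto simp: conj_image)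
  have cC: "c \<in> carrier G" using c by (simp add: centralizer_def)
  show "x \<in> centralizer G (conj_set G g E)" unfolding centralizer_def
  proof (clarsimp, intro conjI ballI)
   show "x \<in> carrier G" using c cC g by simp
   fix y assume "y \<in> conj_set G g E"
   then obtain e where e: "e \<in> E" "y = g \<otimes> e \<otimes> inv g" by (auto simp: conj_image)
   have "c \<otimes> e = e \<otimes> c" using c e by (simp add: centralizer_def)
   thus "x \<otimes> y = y \<otimes> x" using c e g cC E by (simp add: conj_mult subset_iff)
  qed
 qed
 show ?thesis
 proof
  show "conj_set G g (centralizer G E) \<subseteq> centralizer G (conj_set G g E)" by (rule *[OF g E])
  have cc: "centralizer G (conj_set G g E) \<subseteq> carrier G" by (auto simp: centralizer_def)
  have "conj_set G (inv g) (centralizer G (conj_set G g E)) \<subseteq> centralizer G E"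
   using *[of "inv g" "conj_set G g E"] inv_closed[OF g] conj_set_closed[OF g E]
   unfolding conj_inv_left[OF g E] by blast
  hence "conj_set G g (conj_set G (inv g) (centralizer G (conj_set G g E))) \<subseteq> conj_set G g (centralizer G E)"
   by (rule conj_set_mono)
  thus "centralizer G (conj_set G g E) \<subseteq> conj_set G g (centralizer G E)"
   by (simp only: conj_set_inv_right[OF g cc])
 qed
qed

end

subsection \<open>Fixed points of p-groups\<close>

text \<open>Orbits have \<open>p\<close>-power length, so the number of fixed points is divisible by \<open>p\<close>.\<close>

lemma (in group) p_group_second_fixed_point:
 assumes p: "Factorial_Ring.prime p" and ord: "order G = p ^ n"
  and act: "!!g x. g \<in> carrier G ==> x \<in> S ==> act g x \<in> S"
   "!!x. x \<in> S ==> act \<one> x = x"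
   "!!g h x. g \<in> carrier G ==> h \<in> carrier G ==> x \<in> S ==> act (g \<otimes> h) x = act g (act h x)"
  and S: "finite S" "p dvd card S" and x0: "x0 \<in> S" "!!g. g \<in> carrier G ==> act g x0 = x0"
 shows "EX x:S. x ~= x0 & (ALL g:carrier G. act g x = x)"
proof (rule ccontr)
 assume neg: "~ ?thesis"
 define ph where "ph = (%g. \<lambda>x\<in>S. act g x)"
 have bij: "ph g \<in> carrier (BijGroup S)" if g: "g \<in> carrier G" for g
 proof -
  have "bij_betw (act g) S S"
  proof (rule bij_betwI[of _ _ _ "act (inv g)"])
   fix x assume x: "x \<in> S"
   show "act (inv g) (act g x) = x" "act g (act (inv g) x) = x"
    using act(2)[OF x] act(3)[of "inv g" g x] act(3)[of g "inv g" x] x g by simp_all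
  qed (use act(1) g in auto)
  hence "bij_betw (ph g) S S" by (subst bij_betw_cong[of S _ "act g"]) (simp_all add: ph_def)
  thus ?thesis by (simp add: BijGroup_def Bij_def ph_def)
 qed
 have "group_hom G (BijGroup S) ph"
 proof (intro group_hom.intro group_hom_axioms.intro group_BijGroup homI bij)
  fix g h assume g: "g \<in> carrier G" and h: "h \<in> carrier G"
  show "ph (g \<otimes> h) = ph g \<otimes>\<^bsub>BijGroup S\<^esub> ph h"
   using bij[OF g] bij[OF h] act(1)[OF h] act(3)[OF g h]
   by (auto simp: BijGroup_def ph_def compose_def restrict_def fun_eq_iff)
 qed (rule is_group)
 then interpret group_action G S ph by (rule group_action.intro)
 have orb: "p dvd card X" if X: "X \<in> orbits G S ph - {{x0}}" for X
 proof -
  obtain x where x: "x \<in> S" "X = orbit G ph x" using X unfolding orbits_def by blast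
  have "card X dvd p ^ n" using orbit_stabilizer_theorem[OF x(1)] ord x(2) by (metis dvd_triv_left)
  then obtain i where i: "card X = p ^ i" using dvd_pow_prime[OF p] by blast
  have "X ~= {x0}" using X by simp
  have "i ~= 0"
  proof
   assume "i = 0"
   then obtain y where "X = {y}" using i by (auto simp: card_1_singleton_iff)
   hence "ph g x = x" if "g \<in> carrier G" for g
   proof -
    have "ph g x \<in> X" "x \<in> X" using that x(2) orbit_refl[OF x(1)] by (auto simp: orbit_def)
    thus ?thesis using \<open>X = {y}\<close> by simp
   qed
   hence "act g x = x" if "g \<in> carrier G" for g using that x(1) by (auto simp: ph_def)
   hence "x = x0" using neg x(1) by blast
   hence "X = {x0}" using \<open>X = {y}\<close> orbit_refl[OF x(1)] x(2) by auto
   thus False using \<open>X ~= {x0}\<close> by simp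
  qed
  thus ?thesis using i by (simp add: dvd_power)
 qed
 have x0orb: "orbit G ph x0 = {x0}" using x0 one_closed by (force simp: orbit_def ph_def)
 hence x0o: "{x0} \<in> orbits G S ph" using x0(1) by (auto simp: orbits_def)
 have part: "\<Union>(orbits G S ph) = S" and
  disj: "!!X Y. X \<in> orbits G S ph ==> Y \<in> orbits G S ph ==> X = Y | X Int Y = {}"
  using orbits_coverture disjoint_union by auto
 have "\<Union>(orbits G S ph - {{x0}}) = S - {x0}" using part disj x0o by blast
 moreover have "p dvd card (\<Union>(orbits G S ph - {{x0}}))"
 proof (rule dvd_partition)
  show "finite (\<Union>(orbits G S ph - {{x0}}))" by (rule finite_subset[OF _ S(1)]) (use part in auto)
  show "ALL c1:orbits G S ph - {{x0}}. ALL c2:orbits G S ph - {{x0}}. c1 ~= c2 --> c1 Int c2 = {}"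
   using disj by blast
 qed (use orb in blast)
 ultimately have "p dvd card S - 1" using x0(1) S(1) by simp
 moreover have "card S \<ge> 1"
  using x0(1) S(1) by (metis card_gt_0_iff empty_iff less_eq_Suc_le One_nat_def)
 ultimately have "p dvd 1" using S(2) by (metis dvd_diffD1)
 thus False using p by simp
qed

subsection \<open>The ranks of elementary abelian subgroups\<close>

locale finite_p_group = group +
 fixes p n_G :: nat
 assumes prime_p: "Factorial_Ring.prime p" and order_G: "order G = p ^ n_G"
begin

text \<open>Short forms for the fixed group.\<close>

abbreviation "EA \<equiv> elem_ab G p"
abbreviation "St \<equiv> steinberg G"
abbreviation "cs \<equiv> csec G"
abbreviation "cjc \<equiv> conj_chain G"
abbreviation "chs \<equiv> subgroup_chains G"
abbreviation "cj g H \<equiv> conj_set G g H"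

lemma p_gt_1: "p > 1" using prime_gt_1_nat[OF prime_p] .

lemma finite_G: "finite (carrier G)"
 using order_G p_gt_1 by (metis card.infinite order_def power_not_zero not_prime_0 prime_p)

lemma finite_subgroup: "subgroup H G ==> finite H" using finite_G finite_subset subgroup.subset by blast

lemma card_subgroup_dvd:
 assumes H: "subgroup H G" and K: "subgroup K G" and HK: "H \<subseteq> K"
 shows "card H dvd card K"
proof -
 interpret K: group "G\<lparr>carrier := K\<rparr>"
  using K by (rule subgroup.subgroup_is_group) (rule is_group)
 have "subgroup H (G\<lparr>carrier := K\<rparr>)" using H K HK by (intro subgroup_incl)
 thus ?thesis using K.lagrange[of H] by (simp add: order_def) (metis dvd_triv_right)
qed

lemma card_subgroup_pow: "subgroup H G ==> \<exists>n\<le>n_G. card H = p ^ n"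
 using card_subgroup_dvd[of H "carrier G"] subgroup_self order_G dvd_pow_prime[OF prime_p]
 by (metis order_def subgroup.subset)

lemma generate_exp_p:
 assumes x: "x \<in> carrier G" "x [^] p = \<one>" "x ~= \<one>"
 shows "card (generate G {x}) = p" "generate G {x} = {x [^] (i::nat) | i. True}"
proof -
 have "ord x dvd p" using x pow_eq_id by auto
 moreover have "ord x ~= 1" using ord_eq_1[OF x(1)] x(3) by simp
 ultimately have "ord x = p" using prime_p by (metis prime_nat_iff)
 thus "card (generate G {x}) = p" using generate_pow_card[OF x(1)] by simp
 show "generate G {x} = {x [^] (i::nat) | i. True}"
  using generate_pow_on_finite_carrier[OF finite_G x(1)] by auto
qed

lemma exp_abelianD:
 assumes "exp_abelian G p E"
 shows "subgroup E G" "x \<in> E ==> y \<in> E ==> x \<otimes> y = y \<otimes> x" "x \<in> E ==> x [^] p = \<one>"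
 using assms by (auto simp: exp_abelian_def)

lemma exp_abelian_comm: "exp_abelian G p E ==> ALL x:E. ALL y:E. x \<otimes> y = y \<otimes> x"
 by (simp add: exp_abelian_def)

lemma exp_abelian_subgroup: "exp_abelian G p E ==> subgroup A G ==> A \<subseteq> E ==> exp_abelian G p A"
 by (auto simp: exp_abelian_def subset_iff)

lemma elem_ab_imp_exp_abelian:
 assumes "E \<in> EA k"
 shows "exp_abelian G p E" "card E = p ^ k"
proof -
 let ?P = "product_group {..<k} (%_. integer_mod_group p)"
 have E: "subgroup E G" and iso: "G\<lparr>carrier := E\<rparr> \<cong> ?P"
  using assms by (auto simp: elem_ab_def)
 obtain h where h: "h \<in> iso (G\<lparr>carrier := E\<rparr>) ?P" using iso unfolding is_iso_def by blast
 have hom: "h (x \<otimes> y) = h x \<otimes>\<^bsub>?P\<^esub> h y" if "x \<in> E" "y \<in> E" for x y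
  using h that by (auto simp: iso_def hom_def)
 have inj: "inj_on h E" and hcar: "!!x. x \<in> E ==> h x \<in> carrier ?P"
  using h by (auto simp: iso_def bij_betw_def)
 have carP: "carrier ?P = (\<Pi>\<^sub>E i\<in>{..<k}. {0..<int p})"
  using p_gt_1 by (simp add: carrier_integer_mod_group)
 interpret P: group ?P by simp
 interpret E: group "G\<lparr>carrier := E\<rparr>"
  using E by (rule subgroup.subgroup_is_group) (rule is_group)
 have hgh: "group_hom (G\<lparr>carrier := E\<rparr>) ?P h"
  using h by (intro group_hom.intro group_hom_axioms.intro E.is_group P.is_group) (simp add: iso_def)
 show "card E = p ^ k"
 proof -
  have "card E = card (carrier ?P)" using h by (auto simp: iso_def intro: bij_betw_same_card)
  thus ?thesis unfolding carP by (simp add: card_PiE)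
 qed
 show "exp_abelian G p E" unfolding exp_abelian_def
 proof (intro conjI ballI E)
  fix x y assume x: "x \<in> E" and y: "y \<in> E"
  have "h (x \<otimes> y) = h (y \<otimes> x)" using x y by (simp add: hom add.commute)
  thus "x \<otimes> y = y \<otimes> x" using inj x y E by (auto dest: inj_onD intro: subgroup.m_closed)
 next
  fix x assume x: "x \<in> E"
  have pw: "u [^]\<^bsub>?P\<^esub> n = (\<lambda>i\<in>{..<k}. (int n * u i) mod int p)" if u: "u \<in> carrier ?P" for u and n :: nat
  proof (induction n)
   case (Suc n)
   thus ?case using u by (auto simp: carP fun_eq_iff mod_simps algebra_simps)
  qed simp
  have xp: "x [^] n = x [^]\<^bsub>G\<lparr>carrier := E\<rparr>\<^esub> n" for n :: nat
   by (simp add: nat_pow_consistent)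
  have one: "h \<one> = \<one>\<^bsub>?P\<^esub>" using group_hom.hom_one[OF hgh] by simp
  have "h (x [^] p) = h x [^]\<^bsub>?P\<^esub> p"
   unfolding xp using x by (intro group_hom.hom_nat_pow[OF hgh]) auto
  also have "... = h \<one>" by (simp add: pw[OF hcar[OF x]] one restrict_def)
  finally show "x [^] p = \<one>"
   using inj x E.nat_pow_closed[of x p] subgroup.one_closed[OF E] unfolding xp by (auto dest: inj_onD)
 qed
qed

lemma exp_abelian_extend:
 assumes E: "exp_abelian G p E" and A: "A \<in> EA k" "A \<subseteq> E" and x: "x \<in> E" "x \<notin> A"
 shows "A <#> generate G {x} \<in> EA (Suc k)" "A <#> generate G {x} \<subseteq> E"
  "card (A <#> generate G {x}) = card A * p"
proof -
 let ?L = "generate G {x}" and ?P = "product_group {..<k} (%_. integer_mod_group p)"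
  and ?Q = "product_group {..<Suc k} (%_. integer_mod_group p)"
 note sE = exp_abelianD(1)[OF E]
 note sA = exp_abelianD(1)[OF elem_ab_imp_exp_abelian(1)[OF A(1)]]
 note car = subgroup.mem_carrier[OF sE]
 have xG: "x \<in> carrier G" "x [^] p = \<one>" "x ~= \<one>"
  using x E sA subgroup.one_closed[OF sA] car by (auto simp: exp_abelian_def)
 note L = generate_exp_p[OF xG]
 have sL: "subgroup ?L G" using xG by (intro generate_is_subgroup) auto
 have LE: "?L \<subseteq> E" using x(1) sE by (intro generate_subgroup_incl) auto
 have xL: "x \<in> ?L" by (intro generate.incl) simp
 have int: "A Int ?L = {\<one>}"
 proof -
  have "subgroup (A Int ?L) G" using sA sL by (rule subgroups_Inter_pair)
  hence "card (A Int ?L) dvd p" using card_subgroup_dvd[OF _ sL, of "A Int ?L"] L(1) by auto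
  moreover have "card (A Int ?L) ~= p"
  proof
   assume "card (A Int ?L) = p"
   hence "A Int ?L = ?L" using L(1) finite_subgroup[OF sL] by (intro card_subset_eq) auto
   thus False using xL x by auto
  qed
  ultimately have "card (A Int ?L) = 1" using prime_p by (metis prime_nat_iff)
  moreover have "\<one> \<in> A Int ?L" using sA sL by (auto intro: subgroup.one_closed)
  ultimately show ?thesis by (metis card_1_singletonE singletonD)
 qed
 note AL = set_mult_commuting_subgroup[OF sE exp_abelian_comm[OF E] sA A(2) sL LE]
 show sub: "A <#> ?L \<subseteq> E" using AL(4)[OF sE A(2) LE] .
 show card: "card (A <#> ?L) = card A * p" using card_set_mult_disjoint[OF sA sL int] L(1) by simp
 obtain h0 where h0: "h0 \<in> iso (G\<lparr>carrier := A\<rparr>) ?P"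
  using A(1) by (auto simp: elem_ab_def is_iso_def)
 interpret GA: group "G\<lparr>carrier := A\<rparr>"
  using sA by (rule subgroup.subgroup_is_group) (rule is_group)
 obtain h where h: "h \<in> iso ?P (G\<lparr>carrier := A\<rparr>)" using GA.iso_set_sym[OF h0] by blast
 have hA: "!!u. u \<in> carrier ?P ==> h u \<in> A" and hom: "!!u v. u \<in> carrier ?P ==> v \<in> carrier ?P ==>
   h (u \<otimes>\<^bsub>?P\<^esub> v) = h u \<otimes> h v" and surj: "h ` carrier ?P = A"
  using h by (auto simp: iso_def hom_def bij_betw_def)
 define f where "f = (%u::nat => int. h (restrict u {..<k}) \<otimes> x [^] (u k))"
 have carP: "carrier ?P = (\<Pi>\<^sub>E i\<in>{..<k}. {0..<int p})" and carQ: "carrier ?Q = (\<Pi>\<^sub>E i\<in>{..<Suc k}. {0..<int p})"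
  using p_gt_1 by (simp_all add: carrier_integer_mod_group)
 have res: "restrict u {..<k} \<in> carrier ?P" if "u \<in> carrier ?Q" for u
  using that unfolding carP carQ restrict_PiE_iff by (simp add: PiE_iff)
 have xmod: "x [^] (n mod int p) = x [^] n" for n :: int
 proof -
  have "x [^] n = x [^] (int p * (n div int p) + n mod int p)" by simp
  also have "... = x [^] (int p * (n div int p)) \<otimes> x [^] (n mod int p)"
   using xG by (intro int_pow_mult)
  also have "x [^] (int p * (n div int p)) = (x [^] int p) [^] (n div int p)"
   using xG by (simp add: int_pow_pow)
  also have "x [^] int p = \<one>" using xG by (simp add: int_pow_int)
  finally show ?thesis using xG by simp
 qed
 have xn: "x [^] (n::int) \<in> ?L" for n using generate_pow[OF xG(1)] by auto
 have "f \<in> hom ?Q (G\<lparr>carrier := A <#> ?L\<rparr>)"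
 proof (rule homI)
  fix u assume "u \<in> carrier ?Q"
  thus "f u \<in> carrier (G\<lparr>carrier := A <#> ?L\<rparr>)"
   using set_multI[OF hA[OF res] xn] by (simp add: f_def)
 next
  fix u v assume u: "u \<in> carrier ?Q" and v: "v \<in> carrier ?Q"
  have "restrict (u \<otimes>\<^bsub>?Q\<^esub> v) {..<k} = restrict u {..<k} \<otimes>\<^bsub>?P\<^esub> restrict v {..<k}"
   by (auto simp: fun_eq_iff)
  hence "f (u \<otimes>\<^bsub>?Q\<^esub> v) = (h (restrict u {..<k}) \<otimes> h (restrict v {..<k})) \<otimes> x [^] (u k + v k)"
   by (simp add: f_def hom[OF res[OF u] res[OF v]] xmod del: mult_product_group)
    (simp add: xmod)
  also have "... = h (restrict u {..<k}) \<otimes> (h (restrict v {..<k}) \<otimes> x [^] (u k)) \<otimes> x [^] (v k)"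
   using hA[OF res[OF u]] hA[OF res[OF v]] A(2) car xG by (simp add: int_pow_mult m_assoc subset_iff)
  also have "h (restrict v {..<k}) \<otimes> x [^] (u k) = x [^] (u k) \<otimes> h (restrict v {..<k})"
   using hA[OF res[OF v]] A(2) xn LE by (intro exp_abelianD(2)[OF E]) auto
  also have "h (restrict u {..<k}) \<otimes> (x [^] (u k) \<otimes> h (restrict v {..<k})) \<otimes> x [^] (v k) = f u \<otimes> f v"
   using hA[OF res[OF u]] hA[OF res[OF v]] A(2) car xG by (simp add: f_def m_assoc subset_iff)
  finally show "f (u \<otimes>\<^bsub>?Q\<^esub> v) = f u \<otimes>\<^bsub>G\<lparr>carrier := A <#> ?L\<rparr>\<^esub> f v"
   by (simp del: mult_product_group)
 qed
 moreover have img: "f ` carrier ?Q = A <#> ?L"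
 proof
  show "f ` carrier ?Q \<subseteq> A <#> ?L"
   using set_multI[OF hA[OF res] xn] by (auto simp: f_def simp del: carrier_product_group)
  show "A <#> ?L \<subseteq> f ` carrier ?Q"
  proof
   fix y assume "y \<in> A <#> ?L"
   then obtain c n where c: "c \<in> A" "y = c \<otimes> x [^] (n::int)"
    using generate_pow[OF xG(1)] by (auto simp: set_mult_def)
   obtain u where u: "u \<in> carrier ?P" "c = h u" using c(1) surj by blast
   define w where "w = (\<lambda>i\<in>{..<Suc k}. if i = k then n mod int p else u i)"
   have "w \<in> carrier ?Q" using u(1) p_gt_1 unfolding carP carQ w_def restrict_PiE_iff
    by (auto simp: PiE_iff less_Suc_eq)
   moreover have "restrict w {..<k} = u"
    using u(1) unfolding carP w_def by (intro ext) (auto simp: PiE_iff extensional_def)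
   hence "f w = y" using c u by (simp add: f_def w_def xmod)
   ultimately show "y \<in> f ` carrier ?Q" by auto
  qed
 qed
 moreover have "inj_on f (carrier ?Q)"
 proof (rule eq_card_imp_inj_on)
  show "finite (carrier ?Q)" unfolding carQ by (intro finite_PiE) auto
  have "card (carrier ?Q) = p ^ Suc k" unfolding carQ by (simp only: card_PiE finite_lessThan) simp
  thus "card (f ` carrier ?Q) = card (carrier ?Q)"
   unfolding img card elem_ab_imp_exp_abelian(2)[OF A(1)] by simp
 qed
 ultimately have "f \<in> iso ?Q (G\<lparr>carrier := A <#> ?L\<rparr>)"
  by (auto simp: iso_def bij_betw_def)
 moreover have "group ?Q" by simp
 ultimately have "G\<lparr>carrier := A <#> ?L\<rparr> \<cong> ?Q" using group.iso_sym is_iso_def by blast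
 thus "A <#> ?L \<in> EA (Suc k)" using AL(1) by (simp add: elem_ab_def)
qed

lemma trivial_elem_ab: "{\<one>} \<in> EA 0"
proof -
 have "(%x. (\<lambda>i\<in>{..<0::nat}. 0::int)) \<in> iso (G\<lparr>carrier := {\<one>}\<rparr>) (product_group {..<0} (%_. integer_mod_group p))"
  by (auto simp: iso_def hom_def bij_betw_def)
 thus ?thesis using triv_subgroup by (auto simp: elem_ab_def is_iso_def)
qed

lemma exp_abelian_elem_ab:
 assumes E: "exp_abelian G p E"
 shows "EX k. E \<in> EA k"
proof -
 let ?S = "{A. A \<subseteq> E & (EX k. A \<in> EA k)}"
 note sE = exp_abelianD(1)[OF E]
 have "finite ?S"
  using finite_subgroup[OF sE] by (rule finite_subset[rotated, OF finite_Pow_iff[THEN iffD2]]) auto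
 moreover have "{\<one>} \<in> ?S" using trivial_elem_ab subgroup.one_closed[OF sE] by auto
 ultimately have S: "finite (card ` ?S)" "card ` ?S ~= {}" by blast+
 obtain A where A: "A \<in> ?S" "card A = Max (card ` ?S)"
  using Max_in[OF S] by (metis (no_types, lifting) imageE)
 have Amax: "card B \<le> card A" if "B \<in> ?S" for B
  unfolding A(2) by (rule Max_ge[OF S(1) imageI[OF that]])
 from A(1) obtain k where k: "A \<in> EA k" "A \<subseteq> E" by blast
 have "A = E"
 proof (rule ccontr)
  assume "A ~= E"
  then obtain x where x: "x \<in> E" "x \<notin> A" using k by auto
  note B = exp_abelian_extend[OF E k x]
  have "card A * p \<le> card A" using Amax[of "A <#> generate G {x}"] B by auto
  moreover have "card A > 0" using elem_ab_imp_exp_abelian(2)[OF k(1)] p_gt_1 by simp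
  ultimately show False using p_gt_1 by simp
 qed
 thus ?thesis using k by auto
qed

lemma elem_ab_iff: "E \<in> EA k \<longleftrightarrow> exp_abelian G p E & card E = p ^ k"
proof
 assume E: "exp_abelian G p E & card E = p ^ k"
 then obtain j where j: "E \<in> EA j" using exp_abelian_elem_ab by blast
 hence "p ^ j = p ^ k" using E elem_ab_imp_exp_abelian(2) by metis
 hence "j = k" using p_gt_1 by (simp add: power_inject_exp)
 thus "E \<in> EA k" using j by simp
qed (use elem_ab_imp_exp_abelian in auto)

end

context finite_p_group
begin

subsection \<open>Lines and hyperplanes\<close>

lemma subgroup_nat_pow_closed: "subgroup H G ==> x \<in> H ==> x [^] (n::nat) \<in> H"
 by (induction n) (auto intro: subgroup.one_closed subgroup.m_closed)

lemma elem_abD: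
 assumes "E \<in> EA k"
 shows "exp_abelian G p E" "subgroup E G" "card E = p ^ k" "E \<subseteq> carrier G" "finite E" "\<one> \<in> E"
 using assms exp_abelianD(1)[of E] subgroup.subset finite_subgroup subgroup.one_closed
 by (auto simp: elem_ab_iff)

lemma elem_ab_subgroup:
 assumes E: "E \<in> EA k" and H: "subgroup H G" "H \<subseteq> E"
 obtains j where "j \<le> k" "H \<in> EA j"
proof -
 have "card H dvd p ^ k" using card_subgroup_dvd[OF H(1) elem_abD(2)[OF E] H(2)] elem_abD(3)[OF E] by simp
 then obtain j where "j \<le> k" "card H = p ^ j" using dvd_pow_prime[OF prime_p] by blast
 thus thesis using that exp_abelian_subgroup[OF elem_abD(1)[OF E] H] by (auto simp: elem_ab_iff)
qed

lemma elem_ab_rank_unique: "E \<in> EA k ==> E \<in> EA j ==> j = k"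
 using p_gt_1 by (auto simp: elem_ab_iff)

lemma elem_ab_subset_eq: "A \<in> EA k ==> B \<in> EA k ==> A \<subseteq> B ==> A = B"
 using card_subset_eq[of B A] elem_abD by metis

lemma elem_ab_0: "E \<in> EA 0 \<longleftrightarrow> E = {\<one>}"
proof
 assume E: "E \<in> EA 0"
 show "E = {\<one>}" using elem_ab_subset_eq[OF trivial_elem_ab E] elem_abD(6)[OF E] by auto
qed (simp add: trivial_elem_ab)

lemma conj_elem_ab:
 assumes g: "g \<in> carrier G" and E: "E \<in> EA k"
 shows "cj g E \<in> EA k"
proof -
 note EG = elem_abD(4)[OF E] and EE = elem_abD(1)[OF E]
 have "exp_abelian G p (cj g E)" unfolding exp_abelian_def
 proof (intro conjI ballI conj_set_subgroup[OF g elem_abD(2)[OF E]])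
  fix x y assume "x \<in> cj g E" "y \<in> cj g E"
  then obtain u v where u: "u \<in> E" "x = g \<otimes> u \<otimes> inv g" and v: "v \<in> E" "y = g \<otimes> v \<otimes> inv g"
   by (auto simp: conj_image)
  show "x \<otimes> y = y \<otimes> x" using conj_mult[OF g subsetD[OF EG u(1)] subsetD[OF EG v(1)]]
    conj_mult[OF g subsetD[OF EG v(1)] subsetD[OF EG u(1)]] exp_abelianD(2)[OF EE u(1) v(1)]
   by (simp add: u v)
 next
  fix x assume "x \<in> cj g E"
  then obtain u where u: "u \<in> E" "x = g \<otimes> u \<otimes> inv g" by (auto simp: conj_image)
  show "x [^] p = \<one>"
   unfolding u(2) conj_pow[OF g subsetD[OF EG u(1)]] exp_abelianD(3)[OF EE u(1)] using g by simp
 qed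
 thus ?thesis using card_conj_set[OF g EG] elem_abD(3)[OF E] by (simp add: elem_ab_iff)
qed

lemma line_meet:
 assumes L: "L \<in> EA 1" and B: "subgroup B G" "~ L \<subseteq> B"
 shows "B Int L = {\<one>}"
proof -
 have sub: "subgroup (B Int L) G" using B(1) elem_abD(2)[OF L] by (rule subgroups_Inter_pair)
 then obtain j where j: "j \<le> 1" "B Int L \<in> EA j" using elem_ab_subgroup[OF L sub] by blast
 have "j ~= 1" using elem_ab_subset_eq[OF _ L, of "B Int L"] j(2) B(2) by auto
 thus ?thesis using j elem_ab_0 by (auto simp: le_Suc_eq)
qed

lemma line_join:
 assumes E: "E \<in> EA n" and B: "B \<in> EA m" "B \<subseteq> E"
  and L: "L \<in> EA 1" "L \<subseteq> E" "~ L \<subseteq> B"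
 shows "B <#> L \<in> EA (Suc m)" "B \<subseteq> B <#> L" "L \<subseteq> B <#> L" "B <#> L \<subseteq> E"
proof -
 note * = set_mult_commuting_subgroup[OF elem_abD(2)[OF E] exp_abelian_comm[OF elem_abD(1)[OF E]]
   elem_abD(2)[OF B(1)] B(2) elem_abD(2)[OF L(1)] L(2)]
 show "B \<subseteq> B <#> L" "L \<subseteq> B <#> L" by (rule *(2) *(3))+
 show sub: "B <#> L \<subseteq> E" by (rule *(4)[OF elem_abD(2)[OF E] B(2) L(2)])
 have "card (B <#> L) = p ^ Suc m"
  using card_set_mult_disjoint[OF elem_abD(2)[OF B(1)] elem_abD(2)[OF L(1)] line_meet[OF L(1) elem_abD(2)[OF B(1)] L(3)]]
   elem_abD(3)[OF B(1)] elem_abD(3)[OF L(1)] by simp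
 thus "B <#> L \<in> EA (Suc m)"
  using exp_abelian_subgroup[OF elem_abD(1)[OF E] *(1) sub] by (simp add: elem_ab_iff)
qed

lemma line_join_unique:
 assumes E: "E \<in> EA n" and B: "B \<in> EA m" "B \<subseteq> A"
  and L: "L \<in> EA 1" "L \<subseteq> A" "~ L \<subseteq> B" and A: "A \<in> EA (Suc m)"
 shows "B <#> L = A" using line_join[OF A B L] by (intro elem_ab_subset_eq[OF _ A]) auto

lemma hyperplane_meet:
 assumes E: "E \<in> EA (Suc n)" and A: "A \<in> EA n" "A \<subseteq> E"
  and L: "L \<in> EA 1" "~ L \<subseteq> A" and K: "K \<in> EA (Suc i)" "K \<subseteq> E" "L \<subseteq> K"
 shows "A Int K \<in> EA i" "(A Int K) <#> L = K" "~ L \<subseteq> A Int K"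
proof -
 have AL: "A <#> L = E" by (rule line_join_unique[OF E A L(1) _ L(2) E]) (use K in auto)
 show nL: "~ L \<subseteq> A Int K" using L by auto
 have sub: "subgroup (A Int K) G"
  using elem_abD(2)[OF A(1)] elem_abD(2)[OF K(1)] by (rule subgroups_Inter_pair)
 obtain j where j: "A Int K \<in> EA j" using elem_ab_subgroup[OF A(1) sub] by auto
 note J = line_join[OF K(1) j _ L(1) K(3) nL]
 have "K \<subseteq> (A Int K) <#> L"
 proof
  fix x assume x: "x \<in> K"
  then obtain y l where y: "y \<in> A" "l \<in> L" "x = y \<otimes> l"
   using AL K(2) by (auto simp: set_mult_def)
  have car: "y \<in> carrier G" "l \<in> carrier G"
   using y elem_abD(4)[OF A(1)] elem_abD(4)[OF L(1)] by auto
  have "y = x \<otimes> inv l" using car y(3) by (simp add: m_assoc)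
  moreover have "x \<otimes> inv l \<in> K"
   using x y(2) K(3) elem_abD(2)[OF K(1)] by (auto intro: subgroup.m_closed subgroup.m_inv_closed)
  ultimately show "x \<in> (A Int K) <#> L" using y by (auto intro: set_multI)
 qed
 thus eq: "(A Int K) <#> L = K" using J(4) by auto
 hence "Suc j = Suc i" using J(1) elem_ab_rank_unique[OF K(1)] by auto
 thus "A Int K \<in> EA i" using j by simp
qed

lemma hyps_iff:
 assumes E: "E \<in> EA (Suc k)"
 shows "A \<in> index_p_subgroups G p E \<longleftrightarrow> A \<in> EA k & A \<subseteq> E"
proof -
 interpret E: group "G\<lparr>carrier := E\<rparr>"
  using elem_abD(2)[OF E] by (rule subgroup.subgroup_is_group) (rule is_group)
 have lag: "card (rcosets\<^bsub>G\<lparr>carrier := E\<rparr>\<^esub> A) * card A = p ^ Suc k" if "subgroup A (G\<lparr>carrier := E\<rparr>)"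
  using E.lagrange[OF that] elem_abD(3)[OF E] by (simp add: order_def)
 show ?thesis
 proof
  assume A: "A \<in> index_p_subgroups G p E"
  hence sA: "subgroup A (G\<lparr>carrier := E\<rparr>)" by (simp add: index_p_subgroups_def)
  hence "card A = p ^ k" using lag[OF sA] A p_gt_1 by (simp add: index_p_subgroups_def)
  moreover have "A \<subseteq> E" using subgroup.subset[OF sA] by simp
  moreover have "subgroup A G" using incl_subgroup[OF elem_abD(2)[OF E] sA] .
  ultimately show "A \<in> EA k & A \<subseteq> E"
   using exp_abelian_subgroup[OF elem_abD(1)[OF E]] by (auto simp: elem_ab_iff)
 next
  assume A: "A \<in> EA k & A \<subseteq> E"
  hence sA: "subgroup A (G\<lparr>carrier := E\<rparr>)"
   using elem_abD(2)[OF E] elem_abD(2)[of A k] by (intro subgroup_incl) auto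
  have "card (rcosets\<^bsub>G\<lparr>carrier := E\<rparr>\<^esub> A) * p ^ k = p * p ^ k"
   using lag[OF sA] A elem_abD(3)[of A k] by simp
  hence "card (rcosets\<^bsub>G\<lparr>carrier := E\<rparr>\<^esub> A) = p" using p_gt_1 by simp
  thus "A \<in> index_p_subgroups G p E" using sA by (simp add: index_p_subgroups_def)
 qed
qed

lemma hyps_trivial:
 assumes E: "E \<in> EA 0"
 shows "index_p_subgroups G p E = {}"
proof -
 interpret E: group "G\<lparr>carrier := E\<rparr>"
  using elem_abD(2)[OF E] by (rule subgroup.subgroup_is_group) (rule is_group)
 have "card (rcosets\<^bsub>G\<lparr>carrier := E\<rparr>\<^esub> A) * card A = 1" if "subgroup A (G\<lparr>carrier := E\<rparr>)" for A
  using E.lagrange[OF that] elem_abD(3)[OF E] by (simp add: order_def)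
 thus ?thesis using p_gt_1 by (auto simp: index_p_subgroups_def)
qed

lemma fin_hyps: "finite E ==> finite (index_p_subgroups G p E)"
 by (rule finite_subset[of _ "Pow E"]) (use subgroup.subset in \<open>fastforce simp: index_p_subgroups_def\<close>)+

lemma finite_elem_ab: "finite (EA k)"
 by (rule finite_subset[of _ "Pow (carrier G)"]) (use elem_abD(4) finite_G in auto)

subsection \<open>Central lines and invariant flags\<close>

text \<open>A fixed point other than 1 of \<open>U\<close> acting by conjugation on \<open>V\<close> spans a central subgroup; a power of
it has order \<open>p\<close>.\<close>

lemma central_line:
 assumes U: "subgroup U G" and V: "V \<lhd> (G\<lparr>carrier := U\<rparr>)" "V ~= {\<one>}"
 obtains L where "L \<in> EA 1" "L \<subseteq> V" "U \<subseteq> centralizer G L"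
proof -
 interpret U: group "G\<lparr>carrier := U\<rparr>"
  using U by (rule subgroup.subgroup_is_group) (rule is_group)
 have sV: "subgroup V (G\<lparr>carrier := U\<rparr>)" using V(1) by (rule normal_imp_subgroup)
 have VU: "V \<subseteq> U" using subgroup.subset[OF sV] by simp
 have sVG: "subgroup V G" using incl_subgroup[OF U sV] .
 note UG = subgroup.subset[OF U]
 have invU: "inv\<^bsub>G\<lparr>carrier := U\<rparr>\<^esub> g = inv g" if "g \<in> U" for g
  using that U by (intro m_inv_consistent)
 obtain n where n: "card U = p ^ n" using card_subgroup_pow[OF U] by auto
 obtain v where v: "card V = p ^ v" using card_subgroup_pow[OF sVG] by auto
 have "v ~= 0"
 proof
  assume "v = 0"
  then obtain y where "V = {y}" using v by (auto simp: card_1_singleton_iff)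
  thus False using subgroup.one_closed[OF sVG] V(2) by auto
 qed
 have "EX x:V. x ~= \<one> & (ALL g:carrier (G\<lparr>carrier := U\<rparr>). g \<otimes> x \<otimes> inv g = x)"
 proof (rule U.p_group_second_fixed_point[OF prime_p, of n])
  show "order (G\<lparr>carrier := U\<rparr>) = p ^ n" using n by (simp add: order_def)
  fix g x assume g: "g \<in> carrier (G\<lparr>carrier := U\<rparr>)" and x: "x \<in> V"
  show "g \<otimes> x \<otimes> inv g \<in> V" using U.normal_inv_iff V(1) g x invU by auto
 next
  fix g h x assume "g \<in> carrier (G\<lparr>carrier := U\<rparr>)" "h \<in> carrier (G\<lparr>carrier := U\<rparr>)" "x \<in> V"
  hence "g \<in> carrier G" "h \<in> carrier G" "x \<in> carrier G" using UG VU by auto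
  thus "(g \<otimes>\<^bsub>G\<lparr>carrier := U\<rparr>\<^esub> h) \<otimes> x \<otimes> inv (g \<otimes>\<^bsub>G\<lparr>carrier := U\<rparr>\<^esub> h) = g \<otimes> (h \<otimes> x \<otimes> inv h) \<otimes> inv g"
   by (simp add: inv_mult_group m_assoc)
 next
  fix x assume "x \<in> V"
  thus "\<one>\<^bsub>G\<lparr>carrier := U\<rparr>\<^esub> \<otimes> x \<otimes> inv \<one>\<^bsub>G\<lparr>carrier := U\<rparr>\<^esub> = x" using VU UG by auto
 next
  show "finite V" by (rule finite_subgroup[OF sVG])
  show "p dvd card V" using v \<open>v ~= 0\<close> by (simp add: dvd_power)
  show "\<one> \<in> V" by (rule subgroup.one_closed[OF sVG])
  fix g assume "g \<in> carrier (G\<lparr>carrier := U\<rparr>)"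
  thus "g \<otimes> \<one> \<otimes> inv g = \<one>" using UG by auto
 qed
 then obtain z where z: "z \<in> V" "z ~= \<one>" "!!g. g \<in> U ==> g \<otimes> z \<otimes> inv g = z" by auto
 have zG: "z \<in> carrier G" using z(1) VU UG by auto
 have zC: "z \<in> centralizer G U" unfolding centralizer_def
 proof (clarsimp simp: zG)
  fix g assume g: "g \<in> U"
  hence "g \<in> carrier G" using UG by auto
  hence "g \<otimes> z = z \<otimes> g" using z(3)[OF g] zG by (metis inv_solve_right' m_closed)
  thus "z \<otimes> g = g \<otimes> z" by simp
 qed
 obtain j where j: "ord z = p ^ j"
  using dvd_pow_prime[OF prime_p, of "ord z" n_G] ord_dvd_group_order[OF zG] order_G by auto
 have "j ~= 0" using j z(2) ord_eq_1[OF zG] by (intro notI) simp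
 then obtain i where i: "j = Suc i" by (cases j) auto
 define x where "x = z [^] (p ^ i)"
 have xG: "x \<in> carrier G" using zG by (simp add: x_def)
 have "x [^] p = z [^] (p ^ j)" using zG by (simp add: x_def nat_pow_pow i mult.commute)
 hence xp: "x [^] p = \<one>" using zG j by (metis pow_ord_eq_1)
 have x1: "x ~= \<one>"
 proof
  assume "x = \<one>"
  hence "p ^ j dvd p ^ i" using pow_eq_id[OF zG] j by (simp add: x_def)
  hence "p ^ Suc i \<le> p ^ i" using p_gt_1 by (intro dvd_imp_le) (auto simp: i)
  thus False using p_gt_1 by simp
 qed
 note L = generate_exp_p[OF xG xp x1]
 have sL: "subgroup (generate G {x}) G" using xG by (intro generate_is_subgroup) auto
 have xV: "x \<in> V" using subgroup_nat_pow_closed[OF sVG z(1)] by (simp add: x_def)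
 have xC: "x \<in> centralizer G U"
  unfolding x_def by (rule subgroup_nat_pow_closed[OF centralizer_subgroup[OF UG] zC])
 have LV: "generate G {x} \<subseteq> V" using xV sVG by (intro generate_subgroup_incl) auto
 have LC: "generate G {x} \<subseteq> centralizer G U"
  using xC centralizer_subgroup[OF UG] by (intro generate_subgroup_incl) auto
 have pw: "x [^] i \<otimes> x [^] j = x [^] j \<otimes> x [^] (i::nat)" for i j :: nat
  using xG by (simp add: nat_pow_mult add.commute)
 have "(x [^] i) [^] p = \<one>" for i :: nat using xG xp by (metis nat_pow_pow mult.commute nat_pow_one)
 hence "exp_abelian G p (generate G {x})" unfolding exp_abelian_def using sL L(2) pw by auto
 hence "generate G {x} \<in> EA 1" using L(1) by (simp add: elem_ab_iff)
 moreover have "U \<subseteq> centralizer G (generate G {x})"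
  using LC UG unfolding centralizer_def by (auto simp: subset_iff)
 ultimately show thesis using that LV by blast
qed

text \<open>The automorphism group of a group of order \<open>p\<close> has order \<open>p - 1\<close>, so a \<open>p\<close>-element acts
trivially. In terms of fixed points: besides 1, conjugation fixes a second element, which generates \<open>L\<close>.\<close>

lemma line_normalizer_centralizes:
 assumes L: "L \<in> EA 1" and g: "g \<in> carrier G" "cj g L = L"
 shows "g \<in> centralizer G L"
proof -
 note LG = elem_abD(4)[OF L]
 have N: "subgroup (normalizer G L) G" by (rule normalizer_imp_subgroup[OF LG])
 have "L ~= {\<one>}" using elem_abD(3)[OF L] p_gt_1 by auto
 then obtain L' where L': "L' \<in> EA 1" "L' \<subseteq> L" "normalizer G L \<subseteq> centralizer G L'"
  using central_line[OF N subgroup_in_normalizer[OF elem_abD(2)[OF L]]] by blast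
 have "L' = L" by (rule elem_ab_subset_eq[OF L'(1) L L'(2)])
 moreover have "g \<in> normalizer G L" using g by (simp add: normalizer_iff[OF LG])
 ultimately show ?thesis using L'(3) by auto
qed

text \<open>The subgroups between \<open>D\<close> and \<open>E\<close> that are one step larger than \<open>D\<close> correspond to cosets in \<open>E/D\<close>,
on which the \<open>p\<close>-group acts with a second fixed point.\<close>

lemma invariant_subgroup_step:
 assumes E: "E \<in> EA k" and D: "D \<in> EA i" "D \<subseteq> E" and ik: "i < k"
  and H: "subgroup H G" "!!g. g \<in> H ==> cj g D = D" "!!g. g \<in> H ==> cj g E = E"
 shows "EX D':EA (Suc i). D \<subseteq> D' & D' \<subseteq> E & (ALL g:H. cj g D' = D')"
proof -
 note EG = elem_abD(4)[OF E] and DG = elem_abD(4)[OF D(1)] and HG = subgroup.subset[OF H(1)]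
 interpret E: group "G\<lparr>carrier := E\<rparr>"
  using elem_abD(2)[OF E] by (rule subgroup.subgroup_is_group) (rule is_group)
 interpret H: group "G\<lparr>carrier := H\<rparr>"
  using H(1) by (rule subgroup.subgroup_is_group) (rule is_group)
 define S where "S = (%x. D #> x) ` E"
 have "rcosets\<^bsub>G\<lparr>carrier := E\<rparr>\<^esub> D = S"
  by (auto simp: RCOSETS_def S_def r_coset_def)
 moreover have "subgroup D (G\<lparr>carrier := E\<rparr>)"
  using elem_abD(2)[OF D(1)] elem_abD(2)[OF E] D(2) by (rule subgroup_incl)
 ultimately have "card S * p ^ i = p ^ (k - i) * p ^ i"
  using E.lagrange[of D] elem_abD(3)[OF E] elem_abD(3)[OF D(1)] ik by (simp add: order_def flip: power_add)
 hence cS: "card S = p ^ (k - i)" using p_gt_1 by simp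
 have cosc: "cj g (D #> x) = D #> (g \<otimes> x \<otimes> inv g)" if g: "g \<in> H" and x: "x \<in> E" for g x
 proof -
  have gx: "g \<in> carrier G" "x \<in> carrier G" using g x HG EG by auto
  have "cj g (D #> x) = (%d. g \<otimes> (d \<otimes> x) \<otimes> inv g) ` D"
   unfolding conj_image by (auto simp: r_coset_def)
  also have "... = (%d. (g \<otimes> d \<otimes> inv g) \<otimes> (g \<otimes> x \<otimes> inv g)) ` D"
   using gx DG by (intro image_cong) (auto simp: conj_mult subset_iff)
  also have "... = cj g D #> (g \<otimes> x \<otimes> inv g)"
   unfolding conj_image by (auto simp: r_coset_def)
  finally show ?thesis using H(2)[OF g] by simp
 qed
 have conjE: "g \<otimes> x \<otimes> inv g \<in> E" if "g \<in> H" "x \<in> E" for g x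
  using H(3)[OF that(1)] that(2) unfolding conj_image by blast
 have SG: "X \<subseteq> carrier G" if "X \<in> S" for X
  using that DG EG unfolding S_def r_coset_def by auto
 obtain n where n: "card H = p ^ n" using card_subgroup_pow[OF H(1)] by auto
 have "EX X:S. X ~= D & (ALL g:carrier (G\<lparr>carrier := H\<rparr>). cj g X = X)"
 proof (rule H.p_group_second_fixed_point[OF prime_p, of n])
  show "order (G\<lparr>carrier := H\<rparr>) = p ^ n" using n by (simp add: order_def)
  fix g X assume g: "g \<in> carrier (G\<lparr>carrier := H\<rparr>)" and X: "X \<in> S"
  thus "cj g X \<in> S" using cosc conjE by (auto simp: S_def)
 next
  fix X assume "X \<in> S"
  thus "cj \<one>\<^bsub>G\<lparr>carrier := H\<rparr>\<^esub> X = X" using SG conj_set_one by (simp del: inv_one)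
 next
  fix g h X assume "g \<in> carrier (G\<lparr>carrier := H\<rparr>)" "h \<in> carrier (G\<lparr>carrier := H\<rparr>)" "X \<in> S"
  thus "cj (g \<otimes>\<^bsub>G\<lparr>carrier := H\<rparr>\<^esub> h) X = cj g (cj h X)"
   using conj_set_mult[of g h X] SG HG by auto
 next
  show "finite S" using elem_abD(5)[OF E] by (simp add: S_def)
  show "p dvd card S" using cS ik by (simp add: dvd_power)
  show "D \<in> S" unfolding S_def using coset_mult_one[OF DG] elem_abD(6)[OF E] by (metis image_eqI)
  fix g assume "g \<in> carrier (G\<lparr>carrier := H\<rparr>)"
  thus "cj g D = D" using H(2) by simp
 qed
 then obtain x where x: "x \<in> E" "D #> x ~= D" and fixX: "!!g. g \<in> H ==> cj g (D #> x) = D #> x"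
  by (auto simp: S_def)
 have xD: "x \<notin> D" using x(2) coset_join2[of x D] elem_abD(2)[OF D(1)] x(1) EG by auto
 let ?D = "D <#> generate G {x}"
 note D' = exp_abelian_extend[OF elem_abD(1)[OF E] D x(1) xD]
 have sL: "subgroup (generate G {x}) G" and LE: "generate G {x} \<subseteq> E"
  using x(1) EG elem_abD(2)[OF E] generate_is_subgroup[of "{x}"] generate_subgroup_incl[of "{x}" E] by auto
 note J = set_mult_commuting_subgroup[OF elem_abD(2)[OF E] exp_abelian_comm[OF elem_abD(1)[OF E]]
   elem_abD(2)[OF D(1)] D(2) sL LE]
 have xL: "x \<in> generate G {x}" by (intro generate.incl) simp
 have "cj g ?D = ?D" if g: "g \<in> H" for g
 proof (rule card_subset_eq)
  have gG: "g \<in> carrier G" and xG: "x \<in> carrier G" using g HG x(1) EG by auto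
  show "finite ?D" by (rule elem_abD(5)[OF D'(1)])
  show "card (cj g ?D) = card ?D" by (rule card_conj_set[OF gG elem_abD(4)[OF D'(1)]])
  have "g \<otimes> x \<otimes> inv g \<in> cj g (D #> x)"
   unfolding conj_image using elem_abD(6)[OF D(1)] xG by (force simp: r_coset_def)
  hence "g \<otimes> x \<otimes> inv g \<in> D #> x" using fixX[OF g] by simp
  hence gx: "g \<otimes> x \<otimes> inv g \<in> ?D" using xL by (auto simp: r_coset_def set_mult_def)
  show "cj g ?D \<subseteq> ?D"
  proof
   fix y assume "y \<in> cj g ?D"
   then obtain d l where d: "d \<in> D" "l \<in> generate G {x}" "y = g \<otimes> (d \<otimes> l) \<otimes> inv g"
    by (auto simp: conj_image set_mult_def)
   obtain m :: nat where m: "l = x [^] m" using d(2) generate_pow_on_finite_carrier[OF finite_G xG] by auto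
   have dG: "d \<in> carrier G" using d(1) DG by auto
   have "y = (g \<otimes> d \<otimes> inv g) \<otimes> (g \<otimes> x \<otimes> inv g) [^] m"
    using gG xG dG by (simp add: d(3) m conj_pow conj_mult)
   moreover have "g \<otimes> d \<otimes> inv g \<in> ?D"
    using H(2)[OF g] d(1) J(2) unfolding conj_image by blast
   moreover have "(g \<otimes> x \<otimes> inv g) [^] m \<in> ?D"
    by (rule subgroup_nat_pow_closed[OF J(1) gx])
   ultimately show "y \<in> ?D" using subgroup.m_closed[OF J(1)] by simp
  qed
 qed
 thus ?thesis using D'(1,2) J(2) by blast
qed

definition full_flag :: "nat => (nat => 'a set) => bool"
 where "full_flag k La \<longleftrightarrow> (\<forall>i\<le>k. La i \<in> EA i & (\<forall>j\<le>i. La j \<subseteq> La i))"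

lemma invariant_full_flag:
 assumes E: "E \<in> EA k"
 shows "EX La. full_flag k La & La k = E & (\<forall>i\<le>k. ALL g:normalizer G E. cj g (La i) = La i)"
proof -
 let ?N = "normalizer G E"
 note EG = elem_abD(4)[OF E]
 have N: "subgroup ?N G" by (rule normalizer_imp_subgroup[OF EG])
 have NE: "cj g E = E" if "g \<in> ?N" for g using that normalizer_iff[OF EG] by simp
 let ?P = "%i D. i \<le> k --> D \<in> EA i & D \<subseteq> E & (ALL g:?N. cj g D = D)"
 have "EX La. ALL n. ?P n (La n) & (n < k --> La n \<subseteq> La (Suc n))"
 proof (rule dependent_nat_choice)
  have "cj g {\<one>} = {\<one>}" if "g \<in> ?N" for g
   using subgroup.mem_carrier[OF N that] by (simp add: conj_image)
  thus "EX x. ?P 0 x" using trivial_elem_ab elem_abD(6)[OF E] by (intro exI[of _ "{\<one>}"]) auto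
  fix D n assume D: "?P n D"
  show "EX y. ?P (Suc n) y & (n < k --> D \<subseteq> y)"
  proof (cases "n < k")
   case True
   thus ?thesis using invariant_subgroup_step[OF E _ _ True N _ NE, of D] D by auto
  qed auto
 qed
 then obtain La where La: "!!n. ?P n (La n)" "!!n. n < k ==> La n \<subseteq> La (Suc n)" by blast
 have mono: "La j \<subseteq> La i" if "i \<le> k" "j \<le> i" for i j using that(2,1)
 proof (induction rule: dec_induct)
  case (step n)
  thus ?case using La(2)[of n] by auto
 qed simp
 have "La k = E" using La(1)[of k] by (intro elem_ab_subset_eq[OF _ E]) auto
 thus ?thesis using La(1) mono by (intro exI[of _ La]) (auto simp: full_flag_def)
qed

end

section \<open>The Steinberg module\<close>

context finite_p_group
begin

abbreviation hyps :: "'a set => 'a set set"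
 where "hyps E \<equiv> index_p_subgroups G p E"

subsection \<open>Removing the top member of a chain\<close>

lemma subgroup_chains_0: "chs E 0 = {[]}" by (auto simp: subgroup_chains_def)

lemma finite_subgroup_chains: "finite E ==> finite (chs E n)"
proof -
 assume "finite E"
 hence "finite {si. set si \<subseteq> Pow E & length si = n}" by (intro finite_lists_length_eq) auto
 thus ?thesis by (rule finite_subset[rotated]) (auto simp: subgroup_chains_def)
qed

lemma subgroup_chains_snoc:
 assumes E: "E \<in> EA (Suc (Suc k))"
 shows "ta @ [A] \<in> chs E (Suc k) \<longleftrightarrow> A \<in> hyps E & ta \<in> chs A k"
proof
 assume si: "ta @ [A] \<in> chs E (Suc k)"
 hence A: "subgroup A G" "A ~= {\<one>}" "A \<subset> E" and ta: "ta \<in> chs A k"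
  by (auto simp: subgroup_chains_def sorted_wrt_append)
 obtain j where j: "j \<le> Suc (Suc k)" "A \<in> EA j" using elem_ab_subgroup[OF E A(1)] A(3) by blast
 have "j ~= Suc (Suc k)" using A(3) j(2) elem_ab_subset_eq[OF _ E, of A] by auto
 moreover have "j ~= 0" using A(2) j(2) elem_ab_0 by auto
 moreover have "~ (k \<ge> 1 & k \<ge> j)"
  using no_long_subgroup_chains[OF prime_p A(1) elem_abD(3)[OF j(2)], of k] ta by auto
 ultimately have "j = Suc k" using j(1) by auto
 thus "A \<in> hyps E & ta \<in> chs A k" using ta j(2) A(3) hyps_iff[OF E] by auto
next
 assume *: "A \<in> hyps E & ta \<in> chs A k"
 hence A: "A \<in> EA (Suc k)" "A \<subseteq> E" using hyps_iff[OF E] by auto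
 have "A ~= {\<one>}" using A(1) elem_ab_rank_unique[OF trivial_elem_ab, of "Suc k"] by auto
 moreover have "A ~= E" using elem_ab_rank_unique[OF E, of "Suc k"] A(1) by auto
 ultimately show "ta @ [A] \<in> chs E (Suc k)"
  using * A elem_abD(2)[OF A(1)] by (auto simp: subgroup_chains_def sorted_wrt_append)
qed

lemma subgroup_chains_Suc:
 assumes E: "E \<in> EA (Suc (Suc k))"
 shows "chs E (Suc k) = (\<Union>A\<in>hyps E. (%ta. ta @ [A]) ` chs A k)"
proof (intro equalityI subsetI)
 fix si assume si: "si \<in> chs E (Suc k)"
 then obtain ta A where "si = ta @ [A]" by (cases si rule: rev_cases) (auto simp: subgroup_chains_def)
 thus "si \<in> (\<Union>A\<in>hyps E. (%ta. ta @ [A]) ` chs A k)"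
  using si subgroup_chains_snoc[OF E] by auto
qed (auto simp: subgroup_chains_snoc[OF E])

lemma boundary_snoc:
 assumes E: "E \<in> EA (Suc (Suc k))"
 shows "boundary G E (Suc k) z ta =
  (\<Sum>A\<in>hyps E. (if ta ~= [] & last ta = A then boundary G A k (%rh. z (rh @ [A])) (butlast ta) else 0)) +
  (\<Sum>A\<in>hyps E. if ta \<in> chs A k then (- 1) ^ k * z (ta @ [A]) else 0)"
proof -
 have fin: "finite (hyps E)" "!!A. A \<in> hyps E ==> finite (chs A k)"
  using fin_hyps[OF elem_abD(5)[OF E]] hyps_iff[OF E]
   elem_abD(5) finite_subgroup_chains by auto
 let ?f = "%si. \<Sum>j<Suc k. if take j si @ drop (Suc j) si = ta then (- 1) ^ j * z si else 0"
 have f: "?f (rh @ [A]) =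
   (if ta ~= [] & last ta = A then
    (\<Sum>j<k. if take j rh @ drop (Suc j) rh = butlast ta then (- 1) ^ j * z (rh @ [A]) else 0) else 0) +
   (if rh = ta then (- 1) ^ k * z (rh @ [A]) else 0)"
  if "rh \<in> chs A k" for rh A
 proof -
  have len: "length rh = k" using that by (simp add: subgroup_chains_def)
  have iff: "take j (rh @ [A]) @ drop (Suc j) (rh @ [A]) = ta \<longleftrightarrow>
    ta ~= [] & last ta = A & take j rh @ drop (Suc j) rh = butlast ta" if "j < k" for j
   using that len by (cases ta rule: rev_cases) auto
  have "(\<Sum>j<k. if take j (rh @ [A]) @ drop (Suc j) (rh @ [A]) = ta then (- 1) ^ j * z (rh @ [A]) else 0) =
    (\<Sum>j<k. if ta ~= [] & last ta = A & take j rh @ drop (Suc j) rh = butlast ta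
     then (- 1) ^ j * z (rh @ [A]) else 0)" using iff by (intro sum.cong) auto
  also have "... = (if ta ~= [] & last ta = A then
    (\<Sum>j<k. if take j rh @ drop (Suc j) rh = butlast ta then (- 1) ^ j * z (rh @ [A]) else 0) else 0)"
   by auto
  finally have body: "(\<Sum>j<k. if take j (rh @ [A]) @ drop (Suc j) (rh @ [A]) = ta
    then (- 1) ^ j * z (rh @ [A]) else 0) = ..." .
  have "take k (rh @ [A]) @ drop (Suc k) (rh @ [A]) = rh" using len by simp
  thus ?thesis unfolding sum.lessThan_Suc body by (intro arg_cong2[where f = "(+)"] refl) (simp only:)
 qed
 have "boundary G E (Suc k) z ta = (\<Sum>A\<in>hyps E. \<Sum>si\<in>(%rh. rh @ [A]) ` chs A k. ?f si)"
  unfolding boundary_def subgroup_chains_Suc[OF E] using fin by (intro sum.UNION_disjoint) auto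
 also have "... = (\<Sum>A\<in>hyps E. \<Sum>rh\<in>chs A k. ?f (rh @ [A]))"
  by (rule sum.cong[OF refl], subst sum.reindex) (auto simp: inj_on_def o_def)
 also have "... = (\<Sum>A\<in>hyps E. \<Sum>rh\<in>chs A k.
   (if ta ~= [] & last ta = A then
    (\<Sum>j<k. if take j rh @ drop (Suc j) rh = butlast ta then (- 1) ^ j * z (rh @ [A]) else 0) else 0) +
   (if rh = ta then (- 1) ^ k * z (rh @ [A]) else 0))" by (intro sum.cong refl f)
 also have "... = (\<Sum>A\<in>hyps E.
   (if ta ~= [] & last ta = A then boundary G A k (%rh. z (rh @ [A])) (butlast ta) else 0) +
   (if ta \<in> chs A k then (- 1) ^ k * z (ta @ [A]) else 0))"
  using fin by (intro sum.cong refl) (simp add: sum.distrib boundary_def sum.delta')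
 finally show ?thesis by (simp add: sum.distrib)
qed

lemma steinberg_low:
 assumes "k \<le> 1"
 shows "St k E = {z. ALL si. si ~= [] --> z si = 0}"
 using assms by (auto simp: steinberg_def boundary_def subgroup_chains_0)

lemma steinberg_snoc:
 assumes E: "E \<in> EA (Suc (Suc k))"
 shows "z \<in> St (Suc (Suc k)) E \<longleftrightarrow>
  (ALL si. si \<notin> chs E (Suc k) --> z si = 0) &
  (ALL A:hyps E. (%ta. z (ta @ [A])) \<in> St (Suc k) A) &
  (ALL ta. (\<Sum>A\<in>hyps E. z (ta @ [A])) = 0)"
proof -
 have fin: "finite (hyps E)" using fin_hyps[OF elem_abD(5)[OF E]] .
 have key: "(ALL ta. boundary G E (Suc k) z ta = 0) \<longleftrightarrow>
   (ALL A:hyps E. ALL ta. boundary G A k (%ta. z (ta @ [A])) ta = 0) & (ALL ta. (\<Sum>A\<in>hyps E. z (ta @ [A])) = 0)"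
  if supp: "ALL si. si \<notin> chs E (Suc k) --> z si = 0"
 proof -
  have top: "(\<Sum>A\<in>hyps E. if ta \<in> chs A k then (- 1) ^ k * z (ta @ [A]) else 0) =
    (- 1) ^ k * (\<Sum>A\<in>hyps E. z (ta @ [A]))" for ta unfolding sum_distrib_left
   using supp subgroup_chains_snoc[OF E] by (intro sum.cong) auto
  have hyp_end: "z (ta @ [B, A]) = 0" if "A \<in> hyps E" "B \<in> hyps E" for ta A B
  proof (rule ccontr)
   assume "z (ta @ [B, A]) ~= 0"
   hence "(ta @ [B]) @ [A] \<in> chs E (Suc k)" using supp by auto
   hence "B \<subset> A" by (auto simp: subgroup_chains_def sorted_wrt_append)
   thus False using that hyps_iff[OF E] elem_ab_subset_eq[of B "Suc k" A] by auto
  qed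
  have at_hyp: "boundary G E (Suc k) z (ta @ [B]) = boundary G B k (%ta. z (ta @ [B])) ta"
   if "B \<in> hyps E" for ta B
   unfolding boundary_snoc[OF E] top using fin that by (simp add: hyp_end sum.delta')
  have off_hyp: "boundary G E (Suc k) z ta = (- 1) ^ k * (\<Sum>A\<in>hyps E. z (ta @ [A]))"
   if "ta = [] | last ta \<notin> hyps E" for ta
   unfolding boundary_snoc[OF E] top using that by (auto intro!: sum.neutral)
  show ?thesis
  proof (intro iffI conjI ballI allI; (elim conjE)?)
   fix A ta assume "ALL ta. boundary G E (Suc k) z ta = 0" "A \<in> hyps E"
   thus "boundary G A k (%ta. z (ta @ [A])) ta = 0" using at_hyp by metis
  next
   fix ta assume *: "ALL ta. boundary G E (Suc k) z ta = 0"
   show "(\<Sum>A\<in>hyps E. z (ta @ [A])) = 0"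
   proof (cases "ta = [] | last ta \<notin> hyps E")
    case True
    thus ?thesis using off_hyp[OF True] * by simp
   next
    case False
    then obtain rh B where "ta = rh @ [B]" "B \<in> hyps E" by (cases ta rule: rev_cases) auto
    thus ?thesis by (simp add: hyp_end)
   qed
  next
   fix ta assume *: "ALL A:hyps E. ALL ta. boundary G A k (%ta. z (ta @ [A])) ta = 0"
    "ALL ta. (\<Sum>A\<in>hyps E. z (ta @ [A])) = 0"
   show "boundary G E (Suc k) z ta = 0"
   proof (cases "ta = [] | last ta \<notin> hyps E")
    case False
    then obtain rh B where "ta = rh @ [B]" "B \<in> hyps E" by (cases ta rule: rev_cases) auto
    thus ?thesis using at_hyp * by simp
   qed (use off_hyp * in simp)
  qed
 qed
 have supp: "(ALL ta. ta \<notin> chs A k --> z (ta @ [A]) = 0)"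
  if "ALL si. si \<notin> chs E (Suc k) --> z si = 0" for A using that subgroup_chains_snoc[OF E] by auto
 show ?thesis unfolding steinberg_def using key supp by auto
qed

lemma boundary_lin:
 "boundary G E n (%si. z si + w si) ta = boundary G E n z ta + boundary G E n w ta"
 "boundary G E n (%si. - z si) ta = - boundary G E n z ta"
 "boundary G E n (%si. 0) ta = 0"
proof -
 have 1: "(\<Sum>j<n. if P j then (- 1) ^ j * (z si + w si) else 0) =
   (\<Sum>j<n. if P j then (- 1) ^ j * z si else 0) + (\<Sum>j<n. if P j then (- 1) ^ j * w si else 0)" for P si
  unfolding sum.distrib[symmetric] by (intro sum.cong) (auto simp: algebra_simps)
 have 2: "(\<Sum>j<n. if P j then (- 1) ^ j * (- z si) else 0) = - (\<Sum>j<n. if P j then (- 1) ^ j * z si else 0)" for P si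
  unfolding sum_negf[symmetric] by (intro sum.cong) auto
 show "boundary G E n (%si. z si + w si) ta = boundary G E n z ta + boundary G E n w ta"
  unfolding boundary_def 1 sum.distrib ..
 show "boundary G E n (%si. - z si) ta = - boundary G E n z ta" unfolding boundary_def 2 sum_negf ..
 show "boundary G E n (%si. 0) ta = 0" unfolding boundary_def by (auto intro!: sum.neutral)
qed

lemma steinberg_group: "int_fun_group (St k E)" by (auto simp: int_fun_group_def steinberg_def boundary_lin)

subsection \<open>The Steinberg module of a group from those of its hyperplanes\<close>

lemma truncation_lin:
 "truncation k A (%si. 0) = (%ta. 0)"
 "truncation k A (%si. z si + w si) = (%ta. truncation k A z ta + truncation k A w ta)"
 "truncation k A (%si. - z si) = (%ta. - truncation k A z ta)"
 "truncation k A (%si. \<Sum>i\<in>I. f i si) = (%ta. \<Sum>i\<in>I. truncation k A (f i) ta)"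
 by (auto simp: truncation_def fun_eq_iff)

lemma hyps_rank_1: "E \<in> EA (Suc 0) ==> hyps E = {{\<one>}}"
 using hyps_iff[of E 0] elem_ab_0 elem_abD(6)[of E] by auto

text \<open>Chains of maximal length in \<open>E\<close> end in a hyperplane. Sorting them by that hyperplane turns a
cycle for \<open>E\<close> into a family of cycles for the hyperplanes; \<open>steinberg_sum\<close> records the face that drops the
hyperplane, and \<open>steinberg_glue\<close> says that there is no other condition.\<close>

lemma steinberg_truncation:
 assumes E: "E \<in> EA (Suc k)" and z: "z \<in> St (Suc k) E" and A: "A \<in> hyps E"
 shows "truncation (Suc k) A z \<in> St k A"
proof (cases k)
 case 0
 thus ?thesis using z by (simp add: steinberg_low truncation_def)
next
 case (Suc j)
 have "truncation (Suc (Suc j)) A z = (%ta. z (ta @ [A]))" by (simp add: truncation_def fun_eq_iff)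
 thus ?thesis using z A E steinberg_snoc[of E j z] Suc by simp
qed

lemma steinberg_sum:
 assumes E: "E \<in> EA (Suc (Suc k))" and z: "z \<in> St (Suc (Suc k)) E"
  and B: "B \<in> EA k" "B \<subseteq> E"
 shows "(\<Sum>A | A \<in> hyps E & B \<subseteq> A. truncation (Suc k) B (truncation (Suc (Suc k)) A z) ta) = 0"
proof -
 have fin: "finite (hyps E)" using fin_hyps[OF elem_abD(5)[OF E]] .
 have s: "(\<Sum>A\<in>hyps E. z (ta @ [A])) = 0" for ta using z steinberg_snoc[OF E] by auto
 show ?thesis
 proof (cases k)
  case 0
  hence "B = {\<one>}" using B elem_ab_0 by simp
  hence "{A. A \<in> hyps E & B \<subseteq> A} = hyps E" using hyps_iff[OF E] elem_abD(6) by auto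
  thus ?thesis using s 0 by (simp add: truncation_def)
 next
  case (Suc j)
  have "z (ta @ [B, A]) = 0" if "A \<in> hyps E" "~ B \<subseteq> A" for A
  proof (rule ccontr)
   assume "z (ta @ [B, A]) ~= 0"
   hence "(ta @ [B]) @ [A] \<in> chs E (Suc k)" using z by (auto simp: steinberg_def)
   hence "B \<subset> A" by (auto simp: subgroup_chains_def sorted_wrt_append)
   thus False using that by auto
  qed
  hence "(\<Sum>A | A \<in> hyps E & B \<subseteq> A. z (ta @ [B, A])) = (\<Sum>A\<in>hyps E. z (ta @ [B, A]))"
   using fin by (intro sum.mono_neutral_left) auto
  thus ?thesis using s[of "ta @ [B]"] Suc by (simp add: truncation_def)
 qed
qed

lemma steinberg_ext:
 assumes E: "E \<in> EA (Suc k)" and z: "z \<in> St (Suc k) E" and w: "w \<in> St (Suc k) E"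
  and eq: "!!A. A \<in> hyps E ==> truncation (Suc k) A z = truncation (Suc k) A w"
 shows "z = w"
proof (cases k)
 case 0
 thus ?thesis using eq[of "{\<one>}"] hyps_rank_1[of E] E by (simp add: truncation_def fun_eq_iff)
next
 case (Suc j)
 show ?thesis
 proof
  fix si
  show "z si = w si"
  proof (cases "si \<in> chs E (Suc j)")
   case True
   then obtain A ta where "A \<in> hyps E" "si = ta @ [A]" using subgroup_chains_Suc[of E j] E Suc by auto
   thus ?thesis using fun_cong[OF eq[of A], of ta] Suc by (simp add: truncation_def)
  next
   case False
   thus ?thesis using z w Suc by (simp add: steinberg_def)
  qed
 qed
qed

lemma steinberg_glue:
 assumes E: "E \<in> EA (Suc (Suc k))"
  and w: "!!A. A \<in> hyps E ==> w A \<in> St (Suc k) A"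
  and sum: "!!B ta. B \<in> EA k ==> B \<subseteq> E ==>
   (\<Sum>A | A \<in> hyps E & B \<subseteq> A. truncation (Suc k) B (w A) ta) = 0"
 shows "EX z:St (Suc (Suc k)) E. ALL A:hyps E. truncation (Suc (Suc k)) A z = w A"
proof -
 have fin: "finite (hyps E)" using fin_hyps[OF elem_abD(5)[OF E]] .
 define z where "z = (%si. if si ~= [] & last si \<in> hyps E then w (last si) (butlast si) else 0)"
 have zw: "z (ta @ [A]) = w A ta" if "A \<in> hyps E" for A ta using that by (simp add: z_def)
 have wsupp: "ta \<in> chs A k" if "A \<in> hyps E" "w A ta ~= 0" for A ta
  using w[OF that(1)] that(2) by (auto simp: steinberg_def)
 have "z \<in> St (Suc (Suc k)) E" unfolding steinberg_snoc[OF E]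
 proof (intro conjI allI ballI impI)
  fix si assume si: "si \<notin> chs E (Suc k)"
  show "z si = 0"
   using si wsupp[of "last si" "butlast si"] subgroup_chains_snoc[OF E, of "butlast si" "last si"]
   by (auto simp: z_def)
 next
  fix A assume "A \<in> hyps E"
  thus "(%ta. z (ta @ [A])) \<in> St (Suc k) A" using w zw by simp
 next
  fix ta
  have "(\<Sum>A\<in>hyps E. z (ta @ [A])) = (\<Sum>A\<in>hyps E. w A ta)"
   by (intro sum.cong) (simp_all add: zw)
  also have "... = 0"
  proof (cases k)
   case 0
   have "{A. A \<in> hyps E & {\<one>} \<subseteq> A} = hyps E" using hyps_iff[OF E] elem_abD(6) by auto
   thus ?thesis
    using sum[of "{\<one>}" ta] 0 trivial_elem_ab elem_abD(6)[OF E] by (simp add: truncation_def)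
  next
   case (Suc j)
   show ?thesis
   proof (rule ccontr)
    assume "(\<Sum>A\<in>hyps E. w A ta) ~= 0"
    then obtain A0 where A0: "A0 \<in> hyps E" "w A0 ta ~= 0"
     using sum.neutral[of "hyps E" "%A. w A ta"] by blast
    hence A0k: "A0 \<in> EA (Suc (Suc j))" "A0 \<subseteq> E" using hyps_iff[OF E] Suc by auto
    obtain B rh where B: "B \<in> hyps A0" "ta = rh @ [B]"
     using wsupp[OF A0] subgroup_chains_Suc[OF A0k(1)] Suc by auto
    have "w A ta = 0" if "A \<in> hyps E" "~ B \<subseteq> A" for A
     using wsupp[OF that(1), of ta] that(2) B(2) by (auto simp: subgroup_chains_def)
    hence "(\<Sum>A | A \<in> hyps E & B \<subseteq> A. w A ta) = (\<Sum>A\<in>hyps E. w A ta)"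
     using fin by (intro sum.mono_neutral_left) auto
    moreover have "(\<Sum>A | A \<in> hyps E & B \<subseteq> A. w A ta) = 0"
     using sum[of B rh] B hyps_iff[OF A0k(1)] A0k(2) Suc by (simp add: truncation_def) blast
    ultimately show False using \<open>(\<Sum>A\<in>hyps E. w A ta) ~= 0\<close> by simp
   qed
  qed
  finally show "(\<Sum>A\<in>hyps E. z (ta @ [A])) = 0" .
 qed
 moreover have "ALL A:hyps E. truncation (Suc (Suc k)) A z = w A" by (auto simp: truncation_def zw)
 ultimately show ?thesis by blast
qed

subsection \<open>Hyperplanes that avoid a line\<close>

text \<open>For a fixed line \<open>L\<close>, an element of the Steinberg module is determined by its components at the
hyperplanes that do not contain \<open>L\<close>, and by \<open>steinberg_line_lift\<close> these components are arbitrary. This is the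
combinatorial form of the cone with vertex \<open>L\<close>.\<close>

lemma steinberg_line_zero:
 assumes "E \<in> EA (Suc k)" "L \<in> EA 1" "L \<subseteq> E" "z \<in> St (Suc k) E"
  and "!!A. A \<in> hyps E ==> ~ L \<subseteq> A ==> truncation (Suc k) A z = (%_. 0)"
 shows "z = (%_. 0)" using assms
proof (induction k arbitrary: E z)
 case 0
 have "L ~= {\<one>}" using 0(2) elem_ab_rank_unique[OF trivial_elem_ab, of 1] by auto
 hence "~ L \<subseteq> {\<one>}" using elem_abD(6)[OF 0(2)] by auto
 thus ?case using 0(5)[of "{\<one>}"] hyps_rank_1[of E] 0(1) by (simp add: truncation_def fun_eq_iff)
next
 case (Suc k E z)
 note E = Suc.prems(1) and L = Suc.prems(2,3) and z = Suc.prems(4) and zero = Suc.prems(5)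
 show ?case
 proof (rule steinberg_ext[OF E z int_groupD(1)[OF steinberg_group]])
  fix A assume A: "A \<in> hyps E"
  hence A': "A \<in> EA (Suc k)" "A \<subseteq> E" using hyps_iff[OF E] by auto
  have "truncation (Suc (Suc k)) A z = (%_. 0)"
  proof (cases "L \<subseteq> A")
   case True
   show ?thesis
   proof (rule Suc.IH[OF A'(1) L(1) True steinberg_truncation[OF E z A]])
    fix B assume B: "B \<in> hyps A" and LB: "~ L \<subseteq> B"
    have B': "B \<in> EA k" "B \<subseteq> A" using B hyps_iff[OF A'(1)] by auto
    show "truncation (Suc k) B (truncation (Suc (Suc k)) A z) = (%_. 0)"
    proof
     fix ta
     have "(\<Sum>C | C \<in> hyps E & B \<subseteq> C. truncation (Suc k) B (truncation (Suc (Suc k)) C z) ta) =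
       (\<Sum>C\<in>{A}. truncation (Suc k) B (truncation (Suc (Suc k)) C z) ta)"
     proof (rule sum.mono_neutral_right)
      show "finite {C. C \<in> hyps E & B \<subseteq> C}" using fin_hyps[OF elem_abD(5)[OF E]] by auto
      show "{A} \<subseteq> {C. C \<in> hyps E & B \<subseteq> C}" using A B' by auto
      show "ALL C:{C. C \<in> hyps E & B \<subseteq> C} - {A}.
        truncation (Suc k) B (truncation (Suc (Suc k)) C z) ta = 0"
      proof
       fix C assume C: "C \<in> {C. C \<in> hyps E & B \<subseteq> C} - {A}"
       have C': "C \<in> EA (Suc k)" using C hyps_iff[OF E] by auto
       have "~ L \<subseteq> C"
        using C line_join_unique[OF C' B'(1) _ L(1) _ LB C'] line_join_unique[OF A'(1) B' L(1) True LB A'(1)]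
        by auto
       thus "truncation (Suc k) B (truncation (Suc (Suc k)) C z) ta = 0"
        using zero[of C] C by (simp add: truncation_lin)
      qed
     qed
     thus "truncation (Suc k) B (truncation (Suc (Suc k)) A z) ta = 0"
      using steinberg_sum[OF E z B'(1), of ta] B'(2) A'(2) by simp
    qed
   qed
  qed (use zero A in simp)
  thus "truncation (Suc (Suc k)) A z = truncation (Suc (Suc k)) A (%x. 0)" by (simp add: truncation_lin)
 qed
qed

text \<open>By induction on the rank: the component at a hyperplane containing \<open>L\<close> has to be the negative of a
lift, with respect to \<open>L\<close>, of the truncation of \<open>z\<close> to its intersection with \<open>A\<close>.\<close>

lemma steinberg_line_lift:
 assumes "E \<in> EA (Suc k)" "L \<in> EA 1" "L \<subseteq> E" "A \<in> hyps E" "~ L \<subseteq> A"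
  "z \<in> St k A"
 shows "EX w:St (Suc k) E. truncation (Suc k) A w = z &
  (ALL A':hyps E. ~ L \<subseteq> A' --> A' ~= A --> truncation (Suc k) A' w = (%_. 0))" using assms
proof (induction k arbitrary: E A z)
 case 0
 thus ?case using hyps_rank_1[of E] by (intro bexI[of _ z]) (auto simp: steinberg_low truncation_def)
next
 case (Suc k E A z)
 note E = Suc.prems(1) and L = Suc.prems(2,3) and AE = Suc.prems(4) and LA = Suc.prems(5) and z = Suc.prems(6)
 have fin: "finite (hyps E)" using fin_hyps[OF elem_abD(5)[OF E]] .
 have A: "A \<in> EA (Suc k)" "A \<subseteq> E" using AE hyps_iff[OF E] by auto
 have meet: "A Int A' \<in> hyps A" "A Int A' \<in> EA k" "A Int A' \<in> hyps A'" "(A Int A') <#> L = A'"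
  "A' \<in> EA (Suc k)" "~ L \<subseteq> A Int A'"
  if A': "A' \<in> hyps E" "L \<subseteq> A'" for A'
 proof -
  show A'k: "A' \<in> EA (Suc k)" using A' hyps_iff[OF E] by auto
  have "A' \<subseteq> E" using A' hyps_iff[OF E] by auto
  note * = hyperplane_meet[OF E A L(1) LA A'k this A'(2)]
  show "A Int A' \<in> EA k" "(A Int A') <#> L = A'" "~ L \<subseteq> A Int A'" by (rule *)+
  show "A Int A' \<in> hyps A" "A Int A' \<in> hyps A'"
   using *(1) hyps_iff[OF A(1)] hyps_iff[OF A'k] by auto
 qed
 have "EX u. ALL A':hyps E. L \<subseteq> A' --> u A' \<in> St (Suc k) A' &
   truncation (Suc k) (A Int A') (u A') = truncation (Suc k) (A Int A') z &
   (ALL B:hyps A'. ~ L \<subseteq> B --> B ~= A Int A' --> truncation (Suc k) B (u A') = (%_. 0))"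
 proof (intro bchoice ballI)
  fix A' assume A': "A' \<in> hyps E"
  show "EX u. L \<subseteq> A' --> u \<in> St (Suc k) A' &
    truncation (Suc k) (A Int A') u = truncation (Suc k) (A Int A') z &
    (ALL B:hyps A'. ~ L \<subseteq> B --> B ~= A Int A' --> truncation (Suc k) B u = (%_. 0))"
  proof (cases "L \<subseteq> A'")
   case True
   note m = meet[OF A' True]
   show ?thesis using Suc.IH[OF m(5) L(1) True m(3) m(6) steinberg_truncation[OF A(1) z m(1)]] by blast
  qed simp
 qed
 then obtain u where uu: "ALL A':hyps E. L \<subseteq> A' --> u A' \<in> St (Suc k) A' &
   truncation (Suc k) (A Int A') (u A') = truncation (Suc k) (A Int A') z &
   (ALL B:hyps A'. ~ L \<subseteq> B --> B ~= A Int A' --> truncation (Suc k) B (u A') = (%_. 0))" ..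
 have u: "!!A'. A' \<in> hyps E ==> L \<subseteq> A' ==> u A' \<in> St (Suc k) A'"
  "!!A'. A' \<in> hyps E ==> L \<subseteq> A' ==> truncation (Suc k) (A Int A') (u A') = truncation (Suc k) (A Int A') z"
  "!!A' B. A' \<in> hyps E ==> L \<subseteq> A' ==> B \<in> hyps A' ==> ~ L \<subseteq> B ==> B ~= A Int A' ==>
   truncation (Suc k) B (u A') = (%_. 0)" using uu by simp_all
 define w where "w = (%A'. if A' = A then z else if L \<subseteq> A' then (%si. - u A' si) else (%_. 0))"
 have wS: "w A' \<in> St (Suc k) A'" if "A' \<in> hyps E" for A'
  using that z u(1) int_groupD[OF steinberg_group] by (auto simp: w_def)
 have wL: "w A' = (%si. - u A' si)" if "L \<subseteq> A'" for A' using that LA by (auto simp: w_def)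
 have "EX v:St (Suc (Suc k)) E. ALL A':hyps E. truncation (Suc (Suc k)) A' v = w A'"
 proof (rule steinberg_glue[OF E wS])
  fix B ta assume B: "B \<in> EA k" "B \<subseteq> E"
  show "(\<Sum>A' | A' \<in> hyps E & B \<subseteq> A'. truncation (Suc k) B (w A') ta) = 0"
  proof (cases "L \<subseteq> B")
   case False
   note J = line_join[OF E B L(1,2) False]
   have J': "B <#> L \<in> hyps E" using J hyps_iff[OF E] by auto
   note m = meet[OF J' J(3)]
   have BJ: "B \<in> hyps (B <#> L)" using B J hyps_iff[OF J(1)] by auto
   have other: "w A' = (%_. 0)" if A': "A' \<in> hyps E" "B \<subseteq> A'" "A' ~= A" "A' ~= B <#> L" for A'
   proof -
    have "A' \<in> EA (Suc k)" using A'(1) hyps_iff[OF E] by auto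
    hence "~ L \<subseteq> A'" using line_join_unique[OF E B(1) A'(2) L(1) _ False] A'(4) by auto
    thus ?thesis using A'(3) by (simp add: w_def)
   qed
   have neq: "B <#> L ~= A" using J(3) LA by auto
   show ?thesis
   proof (cases "B \<subseteq> A")
    case True
    have eq: "B = A Int (B <#> L)" using True J(2) by (intro elem_ab_subset_eq[OF B(1) m(2)]) auto
    have "(\<Sum>A' | A' \<in> hyps E & B \<subseteq> A'. truncation (Suc k) B (w A') ta) =
      (\<Sum>A'\<in>{A, B <#> L}. truncation (Suc k) B (w A') ta)"
     using fin True AE J' J(2) other by (intro sum.mono_neutral_right) (auto simp: truncation_lin)
    also have "... = truncation (Suc k) B z ta - truncation (Suc k) B (u (B <#> L)) ta"
     using neq J(3) by (simp add: w_def truncation_lin)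
    also have "... = 0" using u(2)[OF J' J(3)] eq by simp
    finally show ?thesis .
   next
    case nBA: False
    hence neqB: "B ~= A Int (B <#> L)" by auto
    have "truncation (Suc k) B (w A') ta = 0" if A': "A' \<in> hyps E" "B \<subseteq> A'" for A'
    proof (cases "A' = B <#> L")
     case True
     thus ?thesis using u(3)[OF J' J(3) BJ False neqB] wL[OF J(3)] by (simp add: truncation_lin)
    next
     case neqJ: False
     have "A' ~= A" using A'(2) nBA by auto
     thus ?thesis using other[OF A' _ neqJ] by (simp add: truncation_lin)
    qed
    thus ?thesis by (intro sum.neutral) auto
   qed
  next
   case LB: True
   obtain k' where k: "k = Suc k'"
   proof (cases k)
    case 0
    hence "L \<subseteq> {\<one>}" using B elem_ab_0 LB by simp
    hence "L = {\<one>}" using elem_abD(6)[OF L(1)] by auto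
    thus ?thesis using L(1) elem_ab_rank_unique[OF trivial_elem_ab, of 1] by auto
   qed
   let ?I = "{A'. A' \<in> hyps E & B \<subseteq> A'}"
   have I: "A' \<in> hyps E" "L \<subseteq> A'" "B \<in> hyps A'" if "A' \<in> ?I" for A'
    using that LB B hyps_iff[of A' k] meet(5)[of A'] by auto
   define y where "y = (%ta. \<Sum>A'\<in>?I. truncation (Suc k) B (w A') ta)"
   have yS: "y \<in> St k B" unfolding y_def
   proof (rule int_fun_group_sum[OF steinberg_group])
    fix A' assume "A' \<in> ?I"
    note A' = I[OF this]
    show "truncation (Suc k) B (w A') \<in> St k B"
     by (rule steinberg_truncation[OF meet(5)[OF A'(1,2)] wS[OF A'(1)] A'(3)])
   qed
   have Bk: "B \<in> EA (Suc k')" using B k by simp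
   have "y = (%_. 0)"
   proof (rule steinberg_line_zero[OF Bk L(1) LB yS[unfolded k]])
    fix C assume C: "C \<in> hyps B" and LC: "~ L \<subseteq> C"
    have C': "C \<in> EA k'" "C \<subseteq> B" using C hyps_iff[OF Bk] by auto
    have CL: "C <#> L = B" by (rule line_join_unique[OF Bk C' L(1) LB LC Bk])
    have trm: "truncation k C (truncation (Suc k) B (w A')) ta =
      (if C \<subseteq> A then truncation k C (truncation (Suc k) (A Int A') z) ta else 0)"
     if A'I: "A' \<in> ?I" for A' ta
    proof -
     note A' = I[OF A'I]
     note m = meet[OF A'(1,2)]
     have A'k: "A' \<in> EA (Suc (Suc k'))" using m(5) k by simp
     have finA: "finite (hyps A')" using fin_hyps[OF elem_abD(5)[OF A'k]] .
     let ?t = "%D. truncation k C (truncation (Suc k) D (u A')) ta"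
     let ?J = "{D. D \<in> hyps A' & C \<subseteq> D}"
     have uS: "u A' \<in> St (Suc (Suc k')) A'" using u(1)[OF A'(1,2)] k by simp
     have "C \<subseteq> A'" using C' A'I by auto
     hence sum0: "(\<Sum>D\<in>?J. ?t D) = 0" using steinberg_sum[OF A'k uS C'(1), of ta] k by simp
     have other: "?t D = 0" if D: "D \<in> ?J" "D ~= B" "D ~= A Int A'" for D
     proof -
      have Dk: "D \<in> EA (Suc k')" using D hyps_iff[OF A'k] by auto
      have "~ L \<subseteq> D" using D line_join_unique[OF Dk C'(1) _ L(1) _ LC Dk] CL by auto
      thus ?thesis using u(3)[OF A'(1,2), of D] D by (simp add: truncation_lin)
     qed
     have BJ: "B \<in> ?J" using A'(3) C' by auto
     have neq: "A Int A' ~= B" using LB m(6) by auto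
     have "truncation k C (truncation (Suc k) B (w A')) ta = - ?t B"
      using wL[OF A'(2)] by (simp add: truncation_lin)
     also have "... = (if C \<subseteq> A then ?t (A Int A') else 0)"
     proof (cases "C \<subseteq> A")
      case True
      have "(\<Sum>D\<in>?J. ?t D) = (\<Sum>D\<in>{B, A Int A'}. ?t D)"
       using finA BJ m(3) True \<open>C \<subseteq> A'\<close> other by (intro sum.mono_neutral_right) auto
      thus ?thesis using True sum0 neq by simp
     next
      case False
      have "(\<Sum>D\<in>?J. ?t D) = (\<Sum>D\<in>{B}. ?t D)"
       using finA BJ False other by (intro sum.mono_neutral_right) auto
      thus ?thesis using False sum0 by simp
     qed
     finally show ?thesis using u(2)[OF A'(1,2)] by simp
    qed
    show "truncation (Suc k') C y = (%_. 0)"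
    proof
     fix ta
     have "truncation (Suc k') C y ta = (\<Sum>A'\<in>?I. truncation k C (truncation (Suc k) B (w A')) ta)"
      unfolding y_def by (simp add: truncation_lin k)
     also have "... = (\<Sum>A'\<in>?I. if C \<subseteq> A then truncation k C (truncation (Suc k) (A Int A') z) ta else 0)"
      by (intro sum.cong refl trm)
     also have "... = 0"
     proof (cases "C \<subseteq> A")
      case True
      let ?J = "{D. D \<in> hyps A & C \<subseteq> D}"
      have Ak: "A \<in> EA (Suc (Suc k'))" using A k by simp
      have "(\<Sum>A'\<in>?I. truncation k C (truncation (Suc k) (A Int A') z) ta) =
        (\<Sum>D\<in>?J. truncation k C (truncation (Suc k) D z) ta)"
      proof (rule sum.reindex_bij_witness[of _ "%D. D <#> L" "%A'. A Int A'"])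
       fix A' assume A'I: "A' \<in> ?I"
       note m = meet[OF I(1,2)[OF A'I]]
       show "(A Int A') <#> L = A'" by (rule m(4))
       show "A Int A' \<in> ?J" using m(1) True C'(2) A'I by auto
      next
       fix D assume D: "D \<in> ?J"
       have Dk: "D \<in> EA k" "D \<subseteq> A" using D hyps_iff[OF A(1)] by auto
       have LD: "~ L \<subseteq> D" using Dk LA by auto
       have DE: "D \<subseteq> E" using Dk A by auto
       note J = line_join[OF E Dk(1) DE L(1,2) LD]
       have J': "D <#> L \<in> hyps E" using J hyps_iff[OF E] by auto
       have "C <#> L \<subseteq> D <#> L" using D by (intro mono_set_mult) auto
       thus "D <#> L \<in> ?I" using J' CL by auto
       show "A Int (D <#> L) = D" using elem_ab_subset_eq[OF Dk(1) meet(2)[OF J' J(3)]] Dk(2) J(2) by auto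
      qed simp
      also have "... = 0" using steinberg_sum[OF Ak _ C'(1) True, of z ta] z k by simp
      finally show ?thesis using True by simp
     qed simp
     finally show "truncation (Suc k') C y ta = 0" .
    qed
   qed
   thus ?thesis by (simp add: y_def fun_eq_iff)
  qed
 qed
 then obtain v where v: "v \<in> St (Suc (Suc k)) E"
  "!!A'. A' \<in> hyps E ==> truncation (Suc (Suc k)) A' v = w A'" by blast
 show ?case using v AE by (intro bexI[OF _ v(1)]) (auto simp: w_def)
qed

end

context finite_p_group
begin

section \<open>A permuted basis of the Steinberg module\<close>

subsection \<open>Flags opposite to a given flag\<close>

text \<open>The flags in general position to the given full flag; their subgroups have ranks \<open>1, \<dots>, k - 1\<close>.\<close>

definition opposite_flags :: "(nat => 'a set) => nat => 'a set => 'a set list set"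
 where "opposite_flags La k E =
  {si \<in> chs E (k - 1). \<forall>i<k - 1. si ! i Int La (k - 1 - i) = {\<one>}}"

lemma opposite_flags_low: "k \<le> 1 ==> opposite_flags La k E = {[]}"
 by (auto simp: opposite_flags_def subgroup_chains_0)

lemma full_flag_hyperplane:
 assumes La: "full_flag (Suc k) La" "La (Suc k) = E" and A: "A \<in> EA k" "A \<subseteq> E" "~ La 1 \<subseteq> A"
 shows "full_flag k (%i. A Int La (Suc i))" "A Int La (Suc k) = A"
proof -
 have E: "E \<in> EA (Suc k)" using La by (auto simp: full_flag_def)
 have L: "La 1 \<in> EA 1" using La by (auto simp: full_flag_def)
 show "A Int La (Suc k) = A" using La(2) A(2) by auto
 show "full_flag k (%i. A Int La (Suc i))" unfolding full_flag_def
 proof (intro allI impI conjI)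
  fix i assume i: "i \<le> k"
  have "La (Suc i) \<in> EA (Suc i)" "La (Suc i) \<subseteq> E" "La 1 \<subseteq> La (Suc i)"
   using La i by (auto simp: full_flag_def)
  thus "A Int La (Suc i) \<in> EA i" using hyperplane_meet(1)[OF E A(1,2) L A(3)] by blast
  fix j assume "j \<le> i"
  thus "A Int La (Suc j) \<subseteq> A Int La (Suc i)" using La(1) i by (auto simp: full_flag_def)
 qed
qed

lemma opposite_flags_snoc:
 assumes La: "full_flag (Suc (Suc k)) La" "La (Suc (Suc k)) = E"
 shows "ta @ [A] \<in> opposite_flags La (Suc (Suc k)) E \<longleftrightarrow>
  A \<in> hyps E & ~ La 1 \<subseteq> A & ta \<in> opposite_flags (%i. A Int La (Suc i)) (Suc k) A"
proof -
 have E: "E \<in> EA (Suc (Suc k))" using La by (auto simp: full_flag_def)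
 have L: "La 1 \<in> EA 1" using La by (auto simp: full_flag_def)
 have Lne: "La 1 ~= {\<one>}" using L elem_ab_rank_unique[OF trivial_elem_ab, of 1] by auto
 show ?thesis
 proof (cases "A \<in> hyps E & ta \<in> chs A k")
  case False
  thus ?thesis using subgroup_chains_snoc[OF E, of ta A] by (auto simp: opposite_flags_def)
 next
  case True
  hence len: "length ta = k" and set: "ALL H:set ta. H \<subset> A" by (simp_all add: subgroup_chains_def)
  have sub: "ta ! i \<subseteq> A" if "i < k" for i using set nth_mem[of i ta] that len by blast
  have A: "A \<in> EA (Suc k)" using True hyps_iff[OF E] by auto
  have last: "A Int La 1 = {\<one>} \<longleftrightarrow> ~ La 1 \<subseteq> A"
  proof
   assume "A Int La 1 = {\<one>}" thus "~ La 1 \<subseteq> A" using Lne by auto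
  qed (rule line_meet[OF L elem_abD(2)[OF A]])
  have "(\<forall>i<Suc k. (ta @ [A]) ! i Int La (Suc k - i) = {\<one>}) \<longleftrightarrow>
    (\<forall>i<k. ta ! i Int La (Suc k - i) = {\<one>}) & A Int La 1 = {\<one>}"
   using len by (auto simp: less_Suc_eq nth_append)
  also have "(\<forall>i<k. ta ! i Int La (Suc k - i) = {\<one>}) \<longleftrightarrow>
    (\<forall>i<k. ta ! i Int (A Int La (Suc (k - i))) = {\<one>})"
  proof -
   have "ta ! i Int La (Suc k - i) = ta ! i Int (A Int La (Suc (k - i)))" if "i < k" for i
    using sub[OF that] that by (auto simp: Suc_diff_le)
   thus ?thesis by auto
  qed
  finally show ?thesis
   using True subgroup_chains_snoc[OF E, of ta A] last by (simp add: opposite_flags_def) blast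
 qed
qed

lemma opposite_flags_cases:
 assumes La: "full_flag (Suc (Suc k)) La" "La (Suc (Suc k)) = E"
  and si: "si \<in> opposite_flags La (Suc (Suc k)) E"
 obtains ta A where "si = ta @ [A]" "A \<in> hyps E" "~ La 1 \<subseteq> A"
  "ta \<in> opposite_flags (%i. A Int La (Suc i)) (Suc k) A"
proof -
 have "si \<in> chs E (Suc k)" using si unfolding opposite_flags_def by simp
 hence "length si = Suc k" by (simp add: subgroup_chains_def)
 hence "si ~= []" by auto
 then obtain ta A where eq: "si = ta @ [A]" by (cases si rule: rev_cases) auto
 have "A \<in> hyps E & ~ La 1 \<subseteq> A & ta \<in> opposite_flags (%i. A Int La (Suc i)) (Suc k) A"
  using si unfolding eq opposite_flags_snoc[OF La] .
 thus thesis using that[OF eq] by simp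
qed

lemma steinberg_low_zero:
 assumes "k \<le> 1" "z \<in> St k E" "z [] = 0"
 shows "z = (%_. 0)"
proof
 fix si
 show "z si = 0" using assms by (cases "si = []") (auto simp: steinberg_low)
qed

lemma steinberg_zero_on_opposite:
 assumes "full_flag k La" "La k = E" "z \<in> St k E"
  "!!si. si \<in> opposite_flags La k E ==> z si = 0"
 shows "z = (%_. 0)" using assms
proof (induction k arbitrary: E La z)
 case 0
 thus ?case by (intro steinberg_low_zero[of 0 z E]) (auto simp: opposite_flags_low)
next
 case (Suc k E La z)
 show ?case
 proof (cases k)
  case 0
  thus ?thesis using Suc.prems by (intro steinberg_low_zero[of "Suc k" z E]) (auto simp: opposite_flags_low)
 next
  case k: (Suc j)
  have E: "E \<in> EA (Suc k)" and L: "La 1 \<in> EA 1" "La 1 \<subseteq> E"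
   using Suc.prems by (auto simp: full_flag_def)
  show ?thesis
  proof (rule steinberg_line_zero[OF E L Suc.prems(3)])
   fix A assume A: "A \<in> hyps E" "~ La 1 \<subseteq> A"
   have A': "A \<in> EA k" "A \<subseteq> E" using A hyps_iff[OF E] by auto
   note La' = full_flag_hyperplane[OF Suc.prems(1,2) A' A(2)]
   show "truncation (Suc k) A z = (%_. 0)"
   proof (rule Suc.IH[OF La' steinberg_truncation[OF E Suc.prems(3) A(1)]])
    fix ta assume ta: "ta \<in> opposite_flags (%i. A Int La (Suc i)) k A"
    hence "ta @ [A] \<in> opposite_flags La (Suc k) E"
     using opposite_flags_snoc[of j La E] Suc.prems(1,2) A k by simp
    thus "truncation (Suc k) A z ta = 0" using Suc.prems(4) k by (simp add: truncation_def)
   qed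
  qed
 qed
qed

text \<open>The last hyperplane of an opposite flag does not contain the first line of the given flag, so the
dual basis element is obtained from one for that hyperplane by lifting with respect to this line.\<close>

lemma steinberg_dual_exists:
 assumes "full_flag k La" "La k = E" "si \<in> opposite_flags La k E"
 shows "EX z:St k E. ALL ta:opposite_flags La k E. z ta = (if ta = si then 1 else 0)" using assms
proof (induction k arbitrary: E La si)
 case 0
 thus ?case
  by (intro bexI[of _ "%ta. if ta = [] then 1 else 0"]) (auto simp: opposite_flags_low steinberg_low)
next
 case (Suc k E La si)
 show ?case
 proof (cases k)
  case 0
  thus ?thesis using Suc.prems
   by (intro bexI[of _ "%ta. if ta = [] then 1 else 0"]) (auto simp: opposite_flags_low steinberg_low)
 next
  case k: (Suc j)
  have E: "E \<in> EA (Suc k)" and L: "La 1 \<in> EA 1" "La 1 \<subseteq> E"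
   using Suc.prems by (auto simp: full_flag_def)
  obtain ta A where ta: "si = ta @ [A]" "A \<in> hyps E" "~ La 1 \<subseteq> A"
   "ta \<in> opposite_flags (%i. A Int La (Suc i)) k A"
   by (rule opposite_flags_cases[OF Suc.prems(1-3)[unfolded k], folded k])
  have A': "A \<in> EA k" "A \<subseteq> E" using ta hyps_iff[OF E] by auto
  note La' = full_flag_hyperplane[OF Suc.prems(1,2) A' ta(3)]
  obtain z where z: "z \<in> St k A"
   "!!rh. rh \<in> opposite_flags (%i. A Int La (Suc i)) k A ==> z rh = (if rh = ta then 1 else 0)"
   using Suc.IH[OF La' ta(4)] by blast
  obtain w where w: "w \<in> St (Suc k) E" "truncation (Suc k) A w = z"
   "!!A'. A' \<in> hyps E ==> ~ La 1 \<subseteq> A' ==> A' ~= A ==> truncation (Suc k) A' w = (%_. 0)"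
   using steinberg_line_lift[OF E L ta(2,3) z(1)] by blast
  have "w rh = (if rh = si then 1 else 0)" if rh: "rh \<in> opposite_flags La (Suc k) E" for rh
  proof -
   obtain rh' A' where rh': "rh = rh' @ [A']" "A' \<in> hyps E" "~ La 1 \<subseteq> A'"
    "rh' \<in> opposite_flags (%i. A' Int La (Suc i)) k A'"
    by (rule opposite_flags_cases[OF Suc.prems(1,2)[unfolded k] rh[unfolded k], folded k])
   have "w rh = truncation (Suc k) A' w rh'" using rh'(1) k by (simp add: truncation_def)
   thus ?thesis using w(2) w(3)[OF rh'(2,3)] z(2) rh'(1,4) ta(1) by (cases "A' = A") auto
  qed
  thus ?thesis using w(1) by blast
 qed
qed

text \<open>The first line of the invariant flag is normalized, hence centralized. It spans \<open>E\<close> together with the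
last hyperplane of the opposite flag, where the invariant flag induces one to which induction applies. In the
end, \<open>E\<close> is spanned by normalized lines.\<close>

lemma opposite_flag_stabilizer:
 assumes "full_flag k La" "La k = E" "si \<in> opposite_flags La k E" "g \<in> carrier G"
  "!!i. i \<le> k ==> cj g (La i) = La i" "map (cj g) si = si"
 shows "g \<in> centralizer G E" using assms
proof (induction k arbitrary: E La si)
 case 0
 hence "E = {\<one>}" using elem_ab_0 by (auto simp: full_flag_def)
 thus ?case using 0(4) by (simp add: centralizer_def)
next
 case (Suc k E La si)
 have E: "E \<in> EA (Suc k)" and L: "La 1 \<in> EA 1" "La 1 \<subseteq> E"
  using Suc.prems by (auto simp: full_flag_def)
 have gL: "g \<in> centralizer G (La 1)"
  by (rule line_normalizer_centralizes[OF L(1) Suc.prems(4) Suc.prems(5)]) simp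
 show ?case
 proof (cases k)
  case 0
  thus ?thesis using gL Suc.prems(2) by simp
 next
  case k: (Suc j)
  obtain ta A where ta: "si = ta @ [A]" "A \<in> hyps E" "~ La 1 \<subseteq> A"
   "ta \<in> opposite_flags (%i. A Int La (Suc i)) k A"
   by (rule opposite_flags_cases[OF Suc.prems(1-3)[unfolded k], folded k])
  have A': "A \<in> EA k" "A \<subseteq> E" using ta hyps_iff[OF E] by auto
  note La' = full_flag_hyperplane[OF Suc.prems(1,2) A' ta(3)]
  have fixed: "cj g A = A" "map (cj g) ta = ta" using Suc.prems(6) ta(1) by auto
  have "cj g (A Int La (Suc i)) = A Int La (Suc i)" if "i \<le> k" for i
  proof -
   have "La (Suc i) \<in> EA (Suc i)" using Suc.prems(1) that by (simp add: full_flag_def)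
   hence "La (Suc i) \<subseteq> carrier G" by (rule elem_abD(4))
   hence "cj g (A Int La (Suc i)) = cj g A Int cj g (La (Suc i))" unfolding conj_image
    using inj_on_image_Int[OF conj_inj[OF Suc.prems(4) subset_refl] elem_abD(4)[OF A'(1)]] by blast
   thus ?thesis using fixed(1) Suc.prems(5)[of "Suc i"] that by simp
  qed
  hence gA: "g \<in> centralizer G A" using Suc.IH[OF La' ta(4) Suc.prems(4) _ fixed(2)] by blast
  have sub: "subgroup (centralizer G {g}) G" using Suc.prems(4) by (intro centralizer_subgroup) auto
  have "A \<subseteq> centralizer G {g}" "La 1 \<subseteq> centralizer G {g}"
   using gA gL elem_abD(4)[OF A'(1)] elem_abD(4)[OF L(1)] by (auto simp: centralizer_def)
  hence "A <#> La 1 \<subseteq> centralizer G {g}"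
   by (rule set_mult_commuting_subgroup(4)[OF elem_abD(2)[OF E] exp_abelian_comm[OF elem_abD(1)[OF E]]
     elem_abD(2)[OF A'(1)] A'(2) elem_abD(2)[OF L(1)] L(2) sub])
  hence "E \<subseteq> centralizer G {g}" using line_join_unique[OF E A'(1,2) L(1,2) ta(3) E] by simp
  thus ?thesis using Suc.prems(4) by (auto simp: centralizer_def)
 qed
qed

subsection \<open>Conjugation of chains\<close>

lemma map_conj_set_mult:
 assumes "g \<in> carrier G" "h \<in> carrier G" "ALL H:set si. H \<subseteq> carrier G"
 shows "map (cj (g \<otimes> h)) si = map (cj g) (map (cj h) si)" using assms conj_set_mult[of g h] by auto

lemma map_conj_set_one: "ALL H:set si. H \<subseteq> carrier G ==> map (cj \<one>) si = si"
 using conj_set_one by (intro map_idI) auto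

lemma map_conj_set_inv:
 assumes "g \<in> carrier G" "ALL H:set si. H \<subseteq> carrier G"
 shows "map (cj (inv g)) (map (cj g) si) = si"
  "map (cj g) (map (cj (inv g)) si) = si"
proof -
 have "cj (inv g) (cj g H) = H" "cj g (cj (inv g) H) = H"
  if "H \<in> set si" for H
  using conj_inv_left[OF assms(1)] conj_set_inv_right[OF assms(1)] bspec[OF assms(2) that] by blast+
 thus "map (cj (inv g)) (map (cj g) si) = si"
  "map (cj g) (map (cj (inv g)) si) = si" unfolding map_map by (intro map_idI; simp only: o_apply)+
qed

lemma map_conj_set_closed:
 "g \<in> carrier G ==> ALL H:set si. H \<subseteq> carrier G ==> ALL H:set (map (cj g) si). H \<subseteq> carrier G"
 using conj_set_closed[of g] by auto

lemma subgroup_chainsD: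
 assumes "si \<in> chs E n"
 shows "length si = n" "sorted_wrt (\<subset>) si"
  "H \<in> set si ==> subgroup H G & H ~= {\<one>} & H \<subset> E"
 using assms unfolding subgroup_chains_def by simp_all

lemma chain_carrier:
 assumes "si \<in> chs E n"
 shows "ALL H:set si. H \<subseteq> carrier G" using subgroup_chainsD(3)[OF assms] subgroup.subset by metis

lemma conj_set_trivial: "g \<in> carrier G ==> H \<subseteq> carrier G ==> cj g H = {\<one>} \<longleftrightarrow> H = {\<one>}"
proof -
 assume g: "g \<in> carrier G" and H: "H \<subseteq> carrier G"
 have "cj g {\<one>} = {\<one>}" using g by (simp add: conj_image)
 thus ?thesis using conj_set_eq_iff[OF g H, of "{\<one>}"] by auto
qed

lemma conj_set_psubset_iff:
 "g \<in> carrier G ==> H \<subseteq> carrier G ==> K \<subseteq> carrier G ==> cj g H \<subset> cj g K \<longleftrightarrow> H \<subset> K"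
 using conj_set_subset_iff[of g H K] conj_set_eq_iff[of g H K] by (simp add: psubset_eq)

lemma map_conj_set_chain:
 assumes g: "g \<in> carrier G" and E: "E \<subseteq> carrier G" and si: "si \<in> chs E n"
 shows "map (cj g) si \<in> chs (cj g E) n"
proof -
 have car: "ALL H:set si. H \<subseteq> carrier G" by (rule chain_carrier[OF si])
 have "sorted_wrt (\<subset>) (map (cj g) si)" unfolding sorted_wrt_map
 proof (rule sorted_wrt_mono_rel[OF _ subgroup_chainsD(2)[OF si]])
  fix H K assume "H \<in> set si" "K \<in> set si" "H \<subset> K"
  thus "cj g H \<subset> cj g K" using car conj_set_psubset_iff[OF g, of H K] by blast
 qed
 moreover have "subgroup (cj g H) G & cj g H ~= {\<one>} & cj g H \<subset> cj g E"
  if "H \<in> set si" for H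
  using subgroup_chainsD(3)[OF si that] bspec[OF car that] conj_set_subgroup[OF g, of H]
   conj_set_trivial[OF g, of H] conj_set_psubset_iff[OF g _ E, of H] by blast
 ultimately show ?thesis using subgroup_chainsD(1)[OF si] unfolding subgroup_chains_def by simp
qed

lemma bij_map_conj_set_chains:
 assumes g: "g \<in> carrier G" and E: "E \<subseteq> carrier G"
 shows "bij_betw (map (cj g)) (chs E n) (chs (cj g E) n)"
proof (rule bij_betwI[where g = "map (cj (inv g))"])
 have gE: "cj g E \<subseteq> carrier G" by (rule conj_set_closed[OF g E])
 show "map (cj g) \<in> chs E n \<rightarrow> chs (cj g E) n" using map_conj_set_chain[OF g E] by blast
 show "map (cj (inv g)) \<in> chs (cj g E) n \<rightarrow> chs E n"
  using map_conj_set_chain[OF inv_closed[OF g] gE] unfolding conj_inv_left[OF g E] by blast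
 fix si assume "si \<in> chs E n"
 thus "map (cj (inv g)) (map (cj g) si) = si" by (intro map_conj_set_inv[OF g] chain_carrier)
next
 fix si assume "si \<in> chs (cj g E) n"
 thus "map (cj g) (map (cj (inv g)) si) = si" by (intro map_conj_set_inv[OF g] chain_carrier)
qed

lemma conj_chain_apply:
 assumes "g \<in> carrier G" "ALL H:set si. H \<subseteq> carrier G"
 shows "cjc g z (map (cj g) si) = z si"
 using map_conj_set_closed[OF assms] map_conj_set_inv(1)[OF assms] by (simp add: conj_chain_def)

lemma boundary_conj:
 assumes g: "g \<in> carrier G" and E: "E \<subseteq> carrier G" and ta: "ALL H:set ta. H \<subseteq> carrier G"
 shows "boundary G (cj g E) n (cjc g z) (map (cj g) ta) = boundary G E n z ta"
proof -
 let ?f = "map (cj g)"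
 have "boundary G (cj g E) n (cjc g z) (?f ta) =
   (\<Sum>si\<in>chs E n. \<Sum>j<n.
    if take j (?f si) @ drop (Suc j) (?f si) = ?f ta then (- 1) ^ j * cjc g z (?f si) else 0)"
  unfolding boundary_def by (rule sum.reindex_bij_betw[OF bij_map_conj_set_chains[OF g E], symmetric])
 also have "... = boundary G E n z ta" unfolding boundary_def
 proof (intro sum.cong refl)
  fix si j assume si: "si \<in> chs E n"
  note car = chain_carrier[OF si]
  have "take j (?f si) @ drop (Suc j) (?f si) = ?f (take j si @ drop (Suc j) si)"
   by (simp add: take_map drop_map)
  moreover have "ALL H:set (take j si @ drop (Suc j) si). H \<subseteq> carrier G"
   using car by (auto dest: in_set_takeD in_set_dropD)
  ultimately have "take j (?f si) @ drop (Suc j) (?f si) = ?f ta \<longleftrightarrow> take j si @ drop (Suc j) si = ta"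
   using map_conj_set_inv(1)[OF g] ta by metis
  thus "(if take j (?f si) @ drop (Suc j) (?f si) = ?f ta then (- 1) ^ j * cjc g z (?f si) else 0) =
    (if take j si @ drop (Suc j) si = ta then (- 1) ^ j * z si else 0)"
   using conj_chain_apply[OF g car] by simp
 qed
 finally show ?thesis .
qed

lemma conj_steinberg:
 assumes g: "g \<in> carrier G" and E: "E \<subseteq> carrier G" and z: "z \<in> St k E"
 shows "cjc g z \<in> St k (cj g E)" unfolding steinberg_def
proof (clarify, intro conjI allI impI)
 have gE: "cj g E \<subseteq> carrier G" by (rule conj_set_closed[OF g E])
 fix si assume si: "si \<notin> chs (cj g E) (k - 1)"
 show "cjc g z si = 0"
 proof (cases "ALL H:set si. H \<subseteq> carrier G")
  case True
  have "map (cj (inv g)) si \<notin> chs E (k - 1)"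
  proof
   assume "map (cj (inv g)) si \<in> chs E (k - 1)"
   from map_conj_set_chain[OF g E this] show False using si map_conj_set_inv(2)[OF g True] by metis
  qed
  hence "z (map (cj (inv g)) si) = 0" using z unfolding steinberg_def by blast
  thus ?thesis unfolding conj_chain_def by presburger
 qed (auto simp: conj_chain_def)
next
 fix ta
 show "boundary G (cj g E) (k - 1) (cjc g z) ta = 0"
 proof (cases "ALL H:set ta. H \<subseteq> carrier G")
  case True
  have "boundary G (cj g E) (k - 1) (cjc g z) (map (cj g) (map (cj (inv g)) ta)) = 0"
   using boundary_conj[OF g E map_conj_set_closed[OF inv_closed[OF g] True], of "k - 1" z] z
   by (simp only: steinberg_def mem_Collect_eq)
  thus ?thesis by (simp only: map_conj_set_inv(2)[OF g True])
 next
  case False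
  have "take j si @ drop (Suc j) si ~= ta" if "si \<in> chs (cj g E) (k - 1)" for si j
  proof -
   have "set (take j si @ drop (Suc j) si) \<subseteq> set si" by (auto dest: in_set_takeD in_set_dropD)
   thus ?thesis using False chain_carrier[OF that] by blast
  qed
  thus ?thesis unfolding boundary_def by (intro sum.neutral ballI) auto
 qed
qed

lemma conj_chain_mult:
 assumes "g \<in> carrier G" "h \<in> carrier G"
 shows "cjc (g \<otimes> h) z = cjc g (cjc h z)"
proof
 fix si
 show "cjc (g \<otimes> h) z si = cjc g (cjc h z) si"
 proof (cases "ALL H:set si. H \<subseteq> carrier G")
  case True
  have "map (cj (inv (g \<otimes> h))) si = map (cj (inv h)) (map (cj (inv g)) si)"
   unfolding inv_mult_group[OF assms] using assms True by (intro map_conj_set_mult) auto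
  thus ?thesis
   using True map_conj_set_closed[OF inv_closed[OF assms(1)] True] unfolding conj_chain_def by presburger
 qed (auto simp: conj_chain_def)
qed

lemma conj_chain_one:
 assumes z: "z \<in> St k E"
 shows "cjc \<one> z = z"
proof
 fix si
 show "cjc \<one> z si = z si"
 proof (cases "ALL H:set si. H \<subseteq> carrier G")
  case True
  thus ?thesis using map_conj_set_one[OF True] by (simp add: conj_chain_def)
 next
  case False
  hence "z si = 0" using z chain_carrier[of si E "k - 1"] by (auto simp: steinberg_def)
  thus ?thesis using False by (auto simp: conj_chain_def)
 qed
qed

lemma conj_chain_inv:
 assumes "g \<in> carrier G" "z \<in> St k E"
 shows "cjc (inv g) (cjc g z) = z" "cjc g (cjc (inv g) z) = z"
 using conj_chain_mult[of "inv g" g z] conj_chain_mult[of g "inv g" z] conj_chain_one[OF assms(2)] assms(1)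
 by (simp_all del: inv_inv)

lemma conj_chain_add: "cjc g (%si. z si + w si) = (%si. cjc g z si + cjc g w si)"
 by (auto simp: conj_chain_def fun_eq_iff)

lemma conj_chain_central:
 assumes E: "E \<subseteq> carrier G" and g: "g \<in> centralizer G E" and z: "z \<in> St k E"
 shows "cjc g z = z"
proof
 fix si
 have gG: "g \<in> carrier G" using g by (simp add: centralizer_def)
 have ginv: "inv g \<in> centralizer G E" by (rule subgroup.m_inv_closed[OF centralizer_subgroup[OF E] g])
 have "cj g E = E" by (rule conj_set_central[OF E g subset_refl])
 hence gz: "cjc g z \<in> St k E" using conj_steinberg[OF gG E z] by simp
 show "cjc g z si = z si"
 proof (cases "si \<in> chs E (k - 1)")
  case True
  have "map (cj (inv g)) si = si"
   using True by (intro map_idI conj_set_central[OF E ginv]) (auto simp: subgroup_chains_def)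
  thus ?thesis using chain_carrier[OF True] unfolding conj_chain_def by presburger
 next
  case False
  thus ?thesis using z gz by (simp add: steinberg_def)
 qed
qed

lemma truncation_conj:
 assumes g: "g \<in> carrier G" and A: "A \<subseteq> carrier G"
 shows "truncation k (cj g A) (cjc g z) = cjc g (truncation k A z)"
proof
 fix ta
 have "map (cj (inv g)) (ta @ [cj g A]) = map (cj (inv g)) ta @ [A]" using conj_inv_left[OF g A] by simp
 moreover have "(ALL H:set (ta @ [cj g A]). H \<subseteq> carrier G) \<longleftrightarrow> (ALL H:set ta. H \<subseteq> carrier G)"
  using conj_set_closed[OF g A] by auto
 ultimately show "truncation k (cj g A) (cjc g z) ta = cjc g (truncation k A z) ta"
  unfolding truncation_def conj_chain_def by presburger
qed

lemma hyps_conj: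
 assumes g: "g \<in> carrier G" and E: "E \<in> EA k"
 shows "hyps (cj g E) = cj g ` hyps E" "inj_on (cj g) (hyps E)"
proof -
 note EG = elem_abD(4)[OF E]
 have sub: "A \<subseteq> E" if "A \<in> hyps E" for A
  using that subgroup.subset by (fastforce simp: index_p_subgroups_def)
 show "inj_on (cj g) (hyps E)" using conj_set_eq_iff[OF g] sub EG by (intro inj_onI) (meson subset_trans)
 show "hyps (cj g E) = cj g ` hyps E"
 proof (cases k)
  case 0
  hence "cj g E \<in> EA 0" "E \<in> EA 0" using conj_elem_ab[OF g E] E by auto
  thus ?thesis by (simp add: hyps_trivial)
 next
  case (Suc j)
  have gE: "cj g E \<in> EA (Suc j)" using conj_elem_ab[OF g E] Suc by simp
  have E': "E \<in> EA (Suc j)" using E Suc by simp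
  show ?thesis
  proof (intro equalityI subsetI)
   fix A assume A: "A \<in> hyps (cj g E)"
   hence A': "A \<in> EA j" "A \<subseteq> cj g E" using hyps_iff[OF gE] by auto
   have "cj (inv g) A \<subseteq> E"
    using conj_set_mono[OF A'(2), of "inv g"] unfolding conj_inv_left[OF g EG] .
   hence "cj (inv g) A \<in> hyps E" using conj_elem_ab[OF inv_closed[OF g] A'(1)] hyps_iff[OF E'] by blast
   thus "A \<in> cj g ` hyps E" using conj_set_inv_right[OF g elem_abD(4)[OF A'(1)]] by (metis image_eqI)
  next
   fix B assume "B \<in> cj g ` hyps E"
   then obtain A where A: "A \<in> hyps E" "B = cj g A" by auto
   thus "B \<in> hyps (cj g E)" using hyps_iff[OF gE] hyps_iff[OF E'] conj_elem_ab[OF g, of A j]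
     conj_set_mono[of A E g] by auto
  qed
 qed
qed

subsection \<open>The chosen basis\<close>

definition chosen_flag :: "nat => 'a set => nat => 'a set"
 where "chosen_flag k E = (SOME La. full_flag k La & La k = E &
  (\<forall>i\<le>k. ALL g:normalizer G E. cj g (La i) = La i))"

definition opp :: "nat => 'a set => 'a set list set"
 where "opp k E = opposite_flags (chosen_flag k E) k E"

text \<open>The basis of the Steinberg module dual to evaluation at the opposite flags.\<close>

definition dual :: "nat => 'a set => 'a set list => 'a set list => int"
 where "dual k E si = (SOME z. z \<in> St k E & (ALL ta:opp k E. z ta = (if ta = si then 1 else 0)))"

lemma chosen_flag:
 assumes "E \<in> EA k"
 shows "full_flag k (chosen_flag k E)" "chosen_flag k E k = E"
  "i \<le> k ==> g \<in> normalizer G E ==> cj g (chosen_flag k E i) = chosen_flag k E i"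
 using someI_ex[OF invariant_full_flag[OF assms], folded chosen_flag_def] by auto

lemma opp_chain: "si \<in> opp k E ==> si \<in> chs E (k - 1)" by (auto simp: opp_def opposite_flags_def)

lemma finite_opp: "E \<in> EA k ==> finite (opp k E)"
 using finite_subgroup_chains[OF elem_abD(5)] by (auto simp: opp_def opposite_flags_def)

lemma dual:
 assumes "E \<in> EA k" "si \<in> opp k E"
 shows "dual k E si \<in> St k E" "ta \<in> opp k E ==> dual k E si ta = (if ta = si then 1 else 0)"
proof -
 have "EX z. z \<in> St k E & (ALL ta:opp k E. z ta = (if ta = si then 1 else 0))"
  using steinberg_dual_exists[OF chosen_flag(1,2)[OF assms(1)], of si] assms(2) by (auto simp: opp_def)
 from someI_ex[OF this, folded dual_def]
 show "dual k E si \<in> St k E" "ta \<in> opp k E ==> dual k E si ta = (if ta = si then 1 else 0)" by auto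
qed

lemma steinberg_expand:
 assumes E: "E \<in> EA k" and z: "z \<in> St k E"
 shows "z = (%x. \<Sum>si\<in>opp k E. z si * dual k E si x)"
proof -
 let ?s = "%x. \<Sum>si\<in>opp k E. z si * dual k E si x"
 note S = steinberg_group[of k E]
 have s: "?s \<in> St k E" using dual(1)[OF E] by (intro int_fun_group_sum[OF S] int_fun_group_mult[OF S])
 have eq: "(%x. z x + - ?s x) = (%_. 0)"
 proof (rule steinberg_zero_on_opposite[OF chosen_flag(1,2)[OF E]])
  show "(%x. z x + - ?s x) \<in> St k E" by (rule int_groupD(2)[OF S z int_groupD(3)[OF S s]])
  fix ta assume "ta \<in> opposite_flags (chosen_flag k E) k E"
  hence ta: "ta \<in> opp k E" by (simp add: opp_def)
  have "?s ta = (\<Sum>si\<in>opp k E. if ta = si then z si else 0)"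
   using dual(2)[OF E _ ta] by (intro sum.cong) auto
  thus "z ta + - ?s ta = 0" using finite_opp[OF E] ta by simp
 qed
 have "z x = ?s x" for x using fun_cong[OF eq, of x] by linarith
 thus ?thesis by (rule ext)
qed

lemma additive_on_expand:
 assumes E: "E \<in> EA k" and M: "abelian_group M" and ps: "additive_on (St k E) M ps"
  and z: "z \<in> St k E"
 shows "ps z = (\<Oplus>\<^bsub>M\<^esub>si\<in>opp k E. [z si] \<cdot>\<^bsub>M\<^esub> ps (dual k E si))"
proof -
 interpret M: abelian_group M by fact
 note S = steinberg_group[of k E]
 have "ps z = ps (%x. \<Sum>si\<in>opp k E. z si * dual k E si x)"
  by (rule arg_cong[OF steinberg_expand[OF E z]])
 also have "... = (\<Oplus>\<^bsub>M\<^esub>si\<in>opp k E. ps (%x. z si * dual k E si x))"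
  using dual(1)[OF E] by (intro additive_on_sum[OF S M ps] int_fun_group_mult[OF S])
 also have "... = (\<Oplus>\<^bsub>M\<^esub>si\<in>opp k E. [z si] \<cdot>\<^bsub>M\<^esub> ps (dual k E si))"
  using dual(1)[OF E] additive_onD(1)[OF ps] by (intro M.finsum_cong')
   (auto simp: additive_on_mult[OF S M ps] intro!: M.add.int_pow_closed)
 finally show ?thesis .
qed

lemma additive_on_eqI:
 assumes E: "E \<in> EA k" and M: "abelian_group M"
  and ps: "additive_on (St k E) M ps" and ph: "additive_on (St k E) M ph"
  and eq: "!!si. si \<in> opp k E ==> ps (dual k E si) = ph (dual k E si)" and z: "z \<in> St k E"
 shows "ps z = ph z"
proof -
 interpret M: abelian_group M by fact
 show ?thesis unfolding additive_on_expand[OF E M ps z] additive_on_expand[OF E M ph z]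
  using eq additive_onD(1)[OF ph dual(1)[OF E]]
  by (intro M.finsum_cong') (auto intro!: M.add.int_pow_closed)
qed

lemma opp_conj:
 assumes E: "E \<in> EA k" and g: "g \<in> normalizer G E" and si: "si \<in> opp k E"
 shows "map (cj g) si \<in> opp k E"
proof -
 have gG: "g \<in> carrier G" "cj g E = E" using g normalizer_iff[OF elem_abD(4)[OF E]] by auto
 let ?La = "chosen_flag k E"
 have ch: "si \<in> chs E (k - 1)" by (rule opp_chain[OF si])
 hence car: "ALL H:set si. H \<subseteq> carrier G" by (rule chain_carrier)
 have "map (cj g) si ! i Int ?La (k - 1 - i) = {\<one>}" if i: "i < k - 1" for i
 proof -
  have len: "i < length si" using ch i by (simp add: subgroup_chains_def)
  have LaG: "?La (k - 1 - i) \<subseteq> carrier G"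
   using chosen_flag(1)[OF E] elem_abD(4)[of "?La (k - 1 - i)" "k - 1 - i"] by (auto simp: full_flag_def)
  have "cj g (si ! i) Int ?La (k - 1 - i) = cj g (si ! i) Int cj g (?La (k - 1 - i))"
   using chosen_flag(3)[OF E _ g, of "k - 1 - i"] by simp
  also have "... = cj g (si ! i Int ?La (k - 1 - i))" unfolding conj_image
   using inj_on_image_Int[OF conj_inj[OF gG(1) subset_refl] _ LaG, of "si ! i"] car len by auto
  also have "... = cj g {\<one>}" using si i by (simp add: opp_def opposite_flags_def)
  also have "... = {\<one>}" using gG(1) by (simp add: conj_image)
  finally show ?thesis using len by simp
 qed
 thus ?thesis
  using map_conj_set_chain[OF gG(1) elem_abD(4)[OF E] ch] gG(2) by (simp add: opp_def opposite_flags_def)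
qed

lemma opp_free:
 assumes E: "E \<in> EA k" and g: "g \<in> normalizer G E" and si: "si \<in> opp k E"
  and eq: "map (cj g) si = si"
 shows "g \<in> centralizer G E"
proof (rule opposite_flag_stabilizer[OF chosen_flag(1,2)[OF E] _ _ _ eq])
 show "g \<in> carrier G" using g normalizer_iff[OF elem_abD(4)[OF E]] by simp
qed (use si chosen_flag(3)[OF E _ g] in \<open>auto simp: opp_def\<close>)

end

section \<open>The resolution of the constant functor\<close>

subsection \<open>Sums\<close>

context abelian_monoid
begin

lemma finsum_single:
 assumes "finite S" "i \<in> S" "!!j. j \<in> S ==> j ~= i ==> f j = \<zero>" "f i \<in> carrier G"
 shows "finsum G f S = f i"
proof -
 have "f \<in> S \<rightarrow> carrier G"
 proof
  fix j assume "j \<in> S"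
  thus "f j \<in> carrier G" using assms(3,4) by (cases "j = i") auto
 qed
 hence "finsum G f {i} = finsum G f S" using assms by (intro add.finprod_mono_neutral_cong_left) auto
 thus ?thesis using assms(4) by simp
qed

lemma finsum_restrict:
 assumes "finite S" "f \<in> {x\<in>S. P x} \<rightarrow> carrier G"
 shows "(\<Oplus>x\<in>{x\<in>S. P x}. f x) = (\<Oplus>x\<in>S. if P x then f x else \<zero>)"
 using assms by (intro add.finprod_mono_neutral_cong_left) auto

lemma finsum_swap:
 assumes "finite A" "finite B" "!!x y. x \<in> A ==> y \<in> B ==> f x y \<in> carrier G"
 shows "(\<Oplus>x\<in>A. \<Oplus>y\<in>B. f x y) = (\<Oplus>y\<in>B. \<Oplus>x\<in>A. f x y)"
 using assms(1,3)
proof (induction A rule: finite_induct)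
 case (insert a A)
 have c: "!!x y. x \<in> insert a A ==> y \<in> B ==> f x y \<in> carrier G" by (rule insert.prems)
 have "(\<Oplus>x\<in>insert a A. \<Oplus>y\<in>B. f x y) = (\<Oplus>y\<in>B. f a y) \<oplus> (\<Oplus>x\<in>A. \<Oplus>y\<in>B. f x y)"
  using insert.hyps c by (intro finsum_insert) (auto intro!: finsum_closed)
 also have "(\<Oplus>x\<in>A. \<Oplus>y\<in>B. f x y) = (\<Oplus>y\<in>B. \<Oplus>x\<in>A. f x y)"
  using c by (intro insert.IH) auto
 also have "(\<Oplus>y\<in>B. f a y) \<oplus> (\<Oplus>y\<in>B. \<Oplus>x\<in>A. f x y) = (\<Oplus>y\<in>B. f a y \<oplus> (\<Oplus>x\<in>A. f x y))"
  using c by (intro finsum_addf[symmetric]) (auto intro!: finsum_closed)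
 also have "... = (\<Oplus>y\<in>B. \<Oplus>x\<in>insert a A. f x y)"
  using insert.hyps c by (intro finsum_cong') (auto intro!: finsum_closed finsum_insert[symmetric])
 finally show ?case .
qed simp

end

lemma additive_on_finsum:
 assumes M: "abelian_group M" and "!!i. i \<in> I ==> additive_on T M (f i)"
 shows "additive_on T M (%z. \<Oplus>\<^bsub>M\<^esub>i\<in>I. f i z)"
proof -
 interpret M: abelian_group M by fact
 show ?thesis unfolding additive_on_def
 proof (intro conjI ballI)
  fix z assume z: "z \<in> T"
  show "(\<Oplus>\<^bsub>M\<^esub>i\<in>I. f i z) \<in> carrier M"
   using additive_onD(1)[OF assms(2) z] by (intro M.finsum_closed) auto
  fix w assume w: "w \<in> T"
  have "(\<Oplus>\<^bsub>M\<^esub>i\<in>I. f i (%x. z x + w x)) = (\<Oplus>\<^bsub>M\<^esub>i\<in>I. f i z \<oplus>\<^bsub>M\<^esub> f i w)"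
   using additive_onD[OF assms(2)] z w by (intro M.finsum_cong') auto
  also have "... = (\<Oplus>\<^bsub>M\<^esub>i\<in>I. f i z) \<oplus>\<^bsub>M\<^esub> (\<Oplus>\<^bsub>M\<^esub>i\<in>I. f i w)"
   using additive_onD(1)[OF assms(2)] z w by (intro M.finsum_addf) auto
  finally show "(\<Oplus>\<^bsub>M\<^esub>i\<in>I. f i (%x. z x + w x)) = (\<Oplus>\<^bsub>M\<^esub>i\<in>I. f i z) \<oplus>\<^bsub>M\<^esub> (\<Oplus>\<^bsub>M\<^esub>i\<in>I. f i w)" .
 qed
qed

context finite_p_group
begin

lemma hypsD:
 assumes "E \<in> EA (Suc k)" "A \<in> hyps E"
 shows "A \<in> EA k" "A \<subseteq> E" using assms hyps_iff by auto

lemma finite_hyps: "E \<in> EA k ==> finite (hyps E)" by (intro fin_hyps elem_abD(5))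

lemma additive_on_truncation:
 assumes "E \<in> EA (Suc k)" "A \<in> hyps E" "additive_on (St k A) M ps"
 shows "additive_on (St (Suc k) E) M (%z. ps (truncation (Suc k) A z))"
 unfolding additive_on_def truncation_lin
 using steinberg_truncation[OF assms(1) _ assms(2)] additive_onD[OF assms(3)] by simp

text \<open>Each subgroup \<open>B\<close> of corank two occurs once for every hyperplane above it, and the sum over these
hyperplanes is the vanishing boundary in \<open>steinberg_sum\<close>.\<close>

lemma double_truncation_zero:
 assumes E: "E \<in> EA (Suc (Suc k))" and M: "abelian_group M"
  and ps: "!!B. B \<in> EA k ==> B \<subseteq> E ==> additive_on (St k B) M (ps B)"
  and z: "z \<in> St (Suc (Suc k)) E"
 shows "(\<Oplus>\<^bsub>M\<^esub>A\<in>hyps E. \<Oplus>\<^bsub>M\<^esub>B\<in>hyps A. ps B (truncation (Suc k) B (truncation (Suc (Suc k)) A z))) = \<zero>\<^bsub>M\<^esub>"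
proof -
 interpret M: abelian_group M by fact
 let ?T = "{B \<in> EA k. B \<subseteq> E}"
 let ?f = "%A B. truncation (Suc k) B (truncation (Suc (Suc k)) A z)"
 have finT: "finite ?T" using finite_elem_ab by simp
 have hA: "hyps A = {B \<in> ?T. B \<subseteq> A}" if "A \<in> hyps E" for A
  using hypsD[OF E that] hyps_iff[of A k] by blast
 have fS: "?f A B \<in> St k B" if "A \<in> hyps E" "B \<in> hyps A" for A B
  by (rule steinberg_truncation[OF hypsD(1)[OF E that(1)] steinberg_truncation[OF E z that(1)] that(2)])
 have cl: "ps B (?f A B) \<in> carrier M" if "A \<in> hyps E" "B \<in> ?T" "B \<subseteq> A" for A B
  using additive_onD(1)[OF ps[of B] fS[of A B]] that hA[OF that(1)] by blast
 have "(\<Oplus>\<^bsub>M\<^esub>A\<in>hyps E. \<Oplus>\<^bsub>M\<^esub>B\<in>hyps A. ps B (?f A B)) =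
   (\<Oplus>\<^bsub>M\<^esub>A\<in>hyps E. \<Oplus>\<^bsub>M\<^esub>B\<in>?T. if B \<subseteq> A then ps B (?f A B) else \<zero>\<^bsub>M\<^esub>)"
 proof (rule M.finsum_cong'[OF refl])
  show "(%A. \<Oplus>\<^bsub>M\<^esub>B\<in>?T. if B \<subseteq> A then ps B (?f A B) else \<zero>\<^bsub>M\<^esub>) \<in> hyps E \<rightarrow> carrier M"
   using cl by (intro funcsetI M.finsum_closed) auto
  fix A assume A: "A \<in> hyps E"
  show "(\<Oplus>\<^bsub>M\<^esub>B\<in>hyps A. ps B (?f A B)) = (\<Oplus>\<^bsub>M\<^esub>B\<in>?T. if B \<subseteq> A then ps B (?f A B) else \<zero>\<^bsub>M\<^esub>)"
   unfolding hA[OF A] using cl[OF A] by (intro M.finsum_restrict finT) auto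
 qed
 also have "... = (\<Oplus>\<^bsub>M\<^esub>B\<in>?T. \<Oplus>\<^bsub>M\<^esub>A\<in>hyps E. if B \<subseteq> A then ps B (?f A B) else \<zero>\<^bsub>M\<^esub>)"
  using cl by (intro M.finsum_swap finT finite_hyps[OF E]) auto
 also have "... = (\<Oplus>\<^bsub>M\<^esub>B\<in>?T. \<zero>\<^bsub>M\<^esub>)"
 proof (rule M.finsum_cong'[OF refl])
  fix B assume B: "B \<in> ?T"
  let ?J = "{A \<in> hyps E. B \<subseteq> A}"
  have BA: "B \<in> hyps A" if "A \<in> ?J" for A using that B hA[of A] by blast
  have fS': "?f A B \<in> St k B" if "A \<in> ?J" for A using fS[OF _ BA[OF that]] that by blast
  have "(\<Oplus>\<^bsub>M\<^esub>A\<in>hyps E. if B \<subseteq> A then ps B (?f A B) else \<zero>\<^bsub>M\<^esub>) = (\<Oplus>\<^bsub>M\<^esub>A\<in>?J. ps B (?f A B))"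
   using cl B by (intro M.finsum_restrict[symmetric] finite_hyps[OF E]) auto
  also have "... = ps B (%ta. \<Sum>A\<in>?J. ?f A B ta)"
   using B fS' by (intro additive_on_sum[OF steinberg_group M ps, symmetric]) auto
  also have "(%ta. \<Sum>A\<in>?J. ?f A B ta) = (%ta. 0)" using steinberg_sum[OF E z, of B] B by auto
  also have "ps B (%ta. 0) = \<zero>\<^bsub>M\<^esub>"
   using B by (intro additive_on_zero[OF steinberg_group M ps]) auto
  finally show "(\<Oplus>\<^bsub>M\<^esub>A\<in>hyps E. if B \<subseteq> A then ps B (?f A B) else \<zero>\<^bsub>M\<^esub>) = \<zero>\<^bsub>M\<^esub>" .
 qed simp
 also have "... = \<zero>\<^bsub>M\<^esub>" by simp
 finally show ?thesis .
qed

subsection \<open>Extending cycles along a line\<close>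

text \<open>By \<open>steinberg_line_zero\<close> the lift is unique.\<close>

definition line_lift :: "'a set => nat => 'a set => ('a set list => int) => 'a set list => int"
 where "line_lift L k A z = (SOME w. w \<in> St (Suc k) (A <#> L) & truncation (Suc k) A w = z &
  (ALL A':hyps (A <#> L). ~ L \<subseteq> A' --> A' ~= A --> truncation (Suc k) A' w = (%_. 0)))"

context
 fixes \<Omega> L n
 assumes \<Omega>: "\<Omega> \<in> EA n" and L: "L \<in> EA 1" "L \<subseteq> \<Omega>"
begin

lemma join_facts:
 assumes "A \<in> EA k" "A \<subseteq> \<Omega>" "~ L \<subseteq> A"
 shows "A <#> L \<in> EA (Suc k)" "A \<subseteq> A <#> L" "L \<subseteq> A <#> L" "A <#> L \<subseteq> \<Omega>" "A \<in> hyps (A <#> L)"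
proof -
 note J = line_join[OF \<Omega> assms(1,2) L assms(3)]
 show "A <#> L \<in> EA (Suc k)" "A \<subseteq> A <#> L" "L \<subseteq> A <#> L" "A <#> L \<subseteq> \<Omega>" by (rule J)+
 show "A \<in> hyps (A <#> L)" using hyps_iff[OF J(1)] assms(1) J(2) by blast
qed

lemma line_lift:
 assumes "A \<in> EA k" "A \<subseteq> \<Omega>" "~ L \<subseteq> A" "z \<in> St k A"
 shows "line_lift L k A z \<in> St (Suc k) (A <#> L)" "truncation (Suc k) A (line_lift L k A z) = z"
  "A' \<in> hyps (A <#> L) ==> ~ L \<subseteq> A' ==> A' ~= A ==> truncation (Suc k) A' (line_lift L k A z) = (%_. 0)"
proof -
 note J = join_facts[OF assms(1-3)]
 have "EX w. w \<in> St (Suc k) (A <#> L) & truncation (Suc k) A w = z &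
  (ALL A':hyps (A <#> L). ~ L \<subseteq> A' --> A' ~= A --> truncation (Suc k) A' w = (%_. 0))"
  using steinberg_line_lift[OF J(1) L(1) J(3) J(5) assms(3,4)] by blast
 from someI_ex[OF this, folded line_lift_def]
 show "line_lift L k A z \<in> St (Suc k) (A <#> L)" "truncation (Suc k) A (line_lift L k A z) = z"
  "A' \<in> hyps (A <#> L) ==> ~ L \<subseteq> A' ==> A' ~= A ==> truncation (Suc k) A' (line_lift L k A z) = (%_. 0)"
  by blast+
qed

lemma steinberg_line_eqI:
 assumes E: "E \<in> EA (Suc k)" "L \<subseteq> E" and z: "z \<in> St (Suc k) E" and w: "w \<in> St (Suc k) E"
  and eq: "!!A. A \<in> hyps E ==> ~ L \<subseteq> A ==> truncation (Suc k) A z = truncation (Suc k) A w"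
 shows "z = w"
proof -
 have "(%si. z si + - w si) = (%_. 0)"
 proof (rule steinberg_line_zero[OF E(1) L(1) E(2)])
  show "(%si. z si + - w si) \<in> St (Suc k) E"
   by (rule int_groupD(2)[OF steinberg_group z int_groupD(3)[OF steinberg_group w]])
  fix A assume "A \<in> hyps E" "~ L \<subseteq> A"
  thus "truncation (Suc k) A (%si. z si + - w si) = (%_. 0)" unfolding truncation_lin using eq by simp
 qed
 hence "z si + - w si = 0" for si by (rule fun_cong)
 thus ?thesis by (intro ext) (metis add.right_inverse add_right_cancel)
qed

lemma line_lift_add:
 assumes A: "A \<in> EA k" "A \<subseteq> \<Omega>" "~ L \<subseteq> A" and z: "z \<in> St k A" and w: "w \<in> St k A"
 shows "line_lift L k A (%si. z si + w si) = (%si. line_lift L k A z si + line_lift L k A w si)"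
proof -
 have zw: "(%si. z si + w si) \<in> St k A" by (rule int_groupD(2)[OF steinberg_group z w])
 note J = join_facts[OF A]
 show ?thesis
 proof (rule steinberg_line_eqI[OF J(1,3) line_lift(1)[OF A zw]
    int_groupD(2)[OF steinberg_group line_lift(1)[OF A z] line_lift(1)[OF A w]]])
  fix A' assume A': "A' \<in> hyps (A <#> L)" "~ L \<subseteq> A'"
  show "truncation (Suc k) A' (line_lift L k A (%si. z si + w si)) =
    truncation (Suc k) A' (%si. line_lift L k A z si + line_lift L k A w si)" unfolding truncation_lin
   using line_lift(2,3)[OF A zw] line_lift(2,3)[OF A z] line_lift(2,3)[OF A w] A' by (cases "A' = A") auto
 qed
qed

lemma line_lift_side:
 assumes E: "E \<in> EA (Suc j)" "E \<subseteq> \<Omega>" "~ L \<subseteq> E" and z: "z \<in> St (Suc j) E" and B: "B \<in> hyps E"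
 shows "truncation (Suc (Suc j)) (B <#> L) (line_lift L (Suc j) E z) =
  (%ta. - line_lift L j B (truncation (Suc j) B z) ta)"
proof -
 have B': "B \<in> EA j" "B \<subseteq> E" using hypsD[OF E(1) B] .
 have B\<Omega>: "B \<subseteq> \<Omega>" "~ L \<subseteq> B" using B' E by auto
 note JE = join_facts[OF E] and JB = join_facts[OF B'(1) B\<Omega>]
 let ?A = "B <#> L" and ?w = "line_lift L (Suc j) E z" and ?u = "line_lift L j B (truncation (Suc j) B z)"
 have zB: "truncation (Suc j) B z \<in> St j B" by (rule steinberg_truncation[OF E(1) z B])
 note w = line_lift[OF E z] and u = line_lift[OF B'(1) B\<Omega> zB]
 have AE: "?A \<subseteq> E <#> L" using B'(2) by (intro mono_set_mult) auto
 have A: "?A \<in> hyps (E <#> L)" using hyps_iff[OF JE(1)] JB(1) AE by blast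
 show ?thesis
 proof (rule steinberg_line_eqI[OF JB(1,3) steinberg_truncation[OF JE(1) w(1) A] int_groupD(3)[OF steinberg_group u(1)]])
  fix C assume C: "C \<in> hyps ?A" and LC: "~ L \<subseteq> C"
  have C': "C \<in> EA j" "C \<subseteq> ?A" using hypsD[OF JB(1) C] .
  have CL: "C <#> L = ?A" by (rule line_join_unique[OF JB(1) C' L(1) JB(3) LC JB(1)])
  show "truncation (Suc j) C (truncation (Suc (Suc j)) ?A ?w) = truncation (Suc j) C (%ta. - ?u ta)"
  proof
   fix ta
   let ?t = "%D. truncation (Suc j) C (truncation (Suc (Suc j)) D ?w) ta"
   let ?J = "{D. D \<in> hyps (E <#> L) & C \<subseteq> D}"
   have finJ: "finite ?J" using finite_hyps[OF JE(1)] by simp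
   have CE: "C \<subseteq> E <#> L" using C'(2) AE by auto
   have sum0: "(\<Sum>D\<in>?J. ?t D) = 0" by (rule steinberg_sum[OF JE(1) w(1) C'(1) CE])
   have other: "?t D = 0" if D: "D \<in> ?J" "D ~= ?A" "D ~= E" for D
   proof -
    have Dk: "D \<in> EA (Suc j)" using D(1) hypsD[OF JE(1)] by blast
    have "~ L \<subseteq> D"
    proof
     assume "L \<subseteq> D"
     hence "C <#> L = D" using D(1) by (intro line_join_unique[OF Dk C'(1) _ L(1) _ LC Dk]) auto
     thus False using CL D(2) by simp
    qed
    thus ?thesis using w(3)[of D] D by (simp add: truncation_lin)
   qed
   have AJ: "?A \<in> ?J" using A C'(2) by simp
   have neq: "?A ~= E" using JB(3) E(3) by auto
   show "?t ?A = truncation (Suc j) C (%ta. - ?u ta) ta"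
   proof (cases "C = B")
    case True
    have "E \<in> ?J" using JE(5) B'(2) True by simp
    hence "(\<Sum>D\<in>?J. ?t D) = (\<Sum>D\<in>{?A, E}. ?t D)"
     using finJ AJ other by (intro sum.mono_neutral_right) auto
    hence "?t ?A = - ?t E" using sum0 neq by simp
    also have "... = - truncation (Suc j) B z ta" using w(2) True by simp
    finally show ?thesis using u(2) True by (simp add: truncation_lin)
   next
    case False
    have "~ C \<subseteq> E"
    proof
     assume "C \<subseteq> E"
     have "E Int ?A \<in> EA j" by (rule hyperplane_meet(1)[OF JE(1) E(1) JE(2) L(1) E(3) JB(1) AE JB(3)])
     moreover have "C \<subseteq> E Int ?A" "B \<subseteq> E Int ?A" using \<open>C \<subseteq> E\<close> C'(2) B'(2) JB(2) by auto
     ultimately have "C = E Int ?A" "B = E Int ?A"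
      using elem_ab_subset_eq[OF C'(1)] elem_ab_subset_eq[OF B'(1)] by blast+
     thus False using False by simp
    qed
    hence "(\<Sum>D\<in>?J. ?t D) = (\<Sum>D\<in>{?A}. ?t D)"
     using finJ AJ other by (intro sum.mono_neutral_right) auto
    hence "?t ?A = 0" using sum0 by simp
    thus ?thesis using u(3)[OF C LC False] by (simp add: truncation_lin)
   qed
  qed
 qed
qed

end

lemma line_lift_full:
 assumes \<Omega>: "\<Omega> \<in> EA n" and L: "L \<in> EA 1" "L \<subseteq> \<Omega>"
  and E: "E \<in> EA (Suc k)" "E \<subseteq> \<Omega>" "L \<subseteq> E" and z: "z \<in> St (Suc k) E"
 shows "(%si. \<Sum>A\<in>{A \<in> hyps E. ~ L \<subseteq> A}. line_lift L k A (truncation (Suc k) A z) si) = z"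
proof -
 let ?I = "{A \<in> hyps E. ~ L \<subseteq> A}" and ?u = "%A. line_lift L k A (truncation (Suc k) A z)"
 have A: "A \<in> EA k" "A \<subseteq> \<Omega>" "~ L \<subseteq> A" "A <#> L = E" "truncation (Suc k) A z \<in> St k A"
  if "A \<in> ?I" for A
 proof -
  have *: "A \<in> EA k" "A \<subseteq> E" using that hypsD[OF E(1)] by auto
  thus "A \<in> EA k" "A \<subseteq> \<Omega>" using E(2) by auto
  show "~ L \<subseteq> A" using that by simp
  show "A <#> L = E" using that by (intro line_join_unique[OF E(1) * L(1) E(3) _ E(1)]) simp
  show "truncation (Suc k) A z \<in> St k A" using that by (intro steinberg_truncation[OF E(1) z]) simp
 qed
 have u: "?u A \<in> St (Suc k) E" "truncation (Suc k) A (?u A) = truncation (Suc k) A z"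
  "!!A'. A' \<in> hyps E ==> ~ L \<subseteq> A' ==> A' ~= A ==> truncation (Suc k) A' (?u A) = (%_. 0)"
  if "A \<in> ?I" for A using line_lift[OF \<Omega> L A(1-3,5)[OF that]] unfolding A(4)[OF that] by blast+
 show ?thesis
 proof (rule steinberg_line_eqI[OF \<Omega> L E(1,3) int_fun_group_sum[OF steinberg_group u(1)] z], simp)
  fix A assume "A \<in> hyps E" "~ L \<subseteq> A"
  hence AI: "A \<in> ?I" by simp
  have "truncation (Suc k) A (%si. \<Sum>A'\<in>?I. ?u A' si) ta = truncation (Suc k) A z ta" for ta
  proof -
   have "truncation (Suc k) A (%si. \<Sum>A'\<in>?I. ?u A' si) ta = (\<Sum>A'\<in>?I. truncation (Suc k) A (?u A') ta)"
    by (simp add: truncation_lin)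
   also have "... = (\<Sum>A'\<in>{A}. truncation (Suc k) A (?u A') ta)"
   proof (rule sum.mono_neutral_right)
    show "finite ?I" using finite_hyps[OF E(1)] by simp
    show "ALL A':?I - {A}. truncation (Suc k) A (?u A') ta = 0"
    proof
     fix A' assume A': "A' \<in> ?I - {A}"
     hence "A' \<in> ?I" "A ~= A'" by auto
     from u(3)[OF this(1) _ _ this(2)] AI
     show "truncation (Suc k) A (?u A') ta = 0" by simp
    qed
   qed (use AI in simp)
   finally show ?thesis using u(2)[OF AI] by simp
  qed
  thus "truncation (Suc k) A (%si. \<Sum>A'\<in>?I. ?u A' si) = truncation (Suc k) A z" by (rule ext)
 qed
qed

end

subsection \<open>Morphisms between sections\<close>

lemma small_cat_restrict:
 assumes "small_cat C" "O' \<subseteq> Ob C"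
 shows "small_cat (C\<lparr>Ob := O'\<rparr>)"
proof -
 interpret small_cat C by fact
 show ?thesis
  by unfold_locales (use assms(2) in \<open>auto simp: subset_iff intro: Idm_Hom Comp_Hom Comp_Idm Comp_assoc\<close>)
qed

lemma is_catmod_restrict:
 assumes "is_catmod C R F" "O' \<subseteq> Ob C"
 shows "is_catmod (C\<lparr>Ob := O'\<rparr>) R F"
 using assms unfolding is_catmod_def by (simp add: subset_iff)

context finite_p_group
begin

definition arrow :: "'a set \<times> 'a set => 'a set \<times> 'a set => 'a => bool"
 where "arrow X Y g \<longleftrightarrow> g \<in> carrier G & sec_le (sec_conj G g X) Y"

lemma Hom_iff: "a \<in> Hom (sec_cat G) X Y \<longleftrightarrow> (EX g. arrow X Y g & a = fst Y #> g)"
 by (auto simp: sec_cat_def arrow_def)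

lemma sectionsD:
 assumes "X \<in> sections G"
 shows "subgroup (fst X) G" "snd X \<lhd> (G\<lparr>carrier := fst X\<rparr>)" "subgroup (snd X) G" "snd X \<subseteq> fst X"
  "fst X \<subseteq> carrier G" "snd X \<subseteq> carrier G"
proof -
 show U: "subgroup (fst X) G" and V: "snd X \<lhd> (G\<lparr>carrier := fst X\<rparr>)"
  using assms by (auto simp: sections_def)
 note sV = normal_imp_subgroup[OF V]
 show sub: "subgroup (snd X) G" by (rule incl_subgroup[OF U sV])
 show "snd X \<subseteq> fst X" using subgroup.subset[OF sV] by simp
 show "fst X \<subseteq> carrier G" by (rule subgroup.subset[OF U])
 show "snd X \<subseteq> carrier G" by (rule subgroup.subset[OF sub])
qed

lemma sec_le_refl: "X \<in> sections G ==> sec_le X X" using sectionsD(4) by (simp add: sec_le_def)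

lemma sec_le_trans: "sec_le X Y ==> sec_le Y Z ==> sec_le X Z" by (auto simp: sec_le_def)

lemma sec_conj_one: "X \<in> sections G ==> sec_conj G \<one> X = X"
 using conj_set_one[of "fst X"] conj_set_one[of "snd X"] sectionsD[of X] by (simp add: sec_conj_def)

lemma sec_conj_mult: "X \<in> sections G ==> g \<in> carrier G ==> h \<in> carrier G ==>
  sec_conj G (g \<otimes> h) X = sec_conj G g (sec_conj G h X)"
 unfolding sec_conj_def using conj_set_mult[of g h "fst X"] conj_set_mult[of g h "snd X"] sectionsD[of X]
 by (simp only: fst_conv snd_conv)

lemma sec_le_conj: "sec_le X Y ==> sec_le (sec_conj G g X) (sec_conj G g Y)"
 unfolding sec_le_def sec_conj_def fst_conv snd_conv by (intro conjI conj_set_mono) simp_all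

lemma sec_conj_inv: "X \<in> sections G ==> g \<in> carrier G ==> sec_conj G (inv g) (sec_conj G g X) = X"
 using sec_conj_mult[of X "inv g" g] sec_conj_one[of X] by (simp del: inv_inv)

lemma arrow_one: "X \<in> sections G ==> sec_le X Y ==> arrow X Y \<one>"
 using sec_conj_one[of X] by (simp add: arrow_def)

lemma arrow_carrier: "arrow X Y g ==> g \<in> carrier G" by (simp add: arrow_def)

lemma arrow_mult:
 assumes "X \<in> sections G" "arrow X Y g" "arrow Y Z h"
 shows "arrow X Z (h \<otimes> g)"
proof -
 have "sec_le (sec_conj G h (sec_conj G g X)) (sec_conj G h Y)"
  using assms(2) by (intro sec_le_conj) (simp add: arrow_def)
 thus ?thesis
  using assms sec_conj_mult[OF assms(1), of h g] unfolding arrow_def by (metis m_closed sec_le_trans)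
qed

lemma coset_Comp:
 assumes "Y \<in> sections G" "Z \<in> sections G" "g \<in> carrier G" "arrow Y Z h"
 shows "(fst Z #> h) <#> (fst Y #> g) = fst Z #> (h \<otimes> g)"
proof (rule sec_comp)
 show "cj h (fst Y) \<subseteq> fst Z" using assms(4) by (simp add: arrow_def sec_le_def sec_conj_def)
qed (use assms sectionsD(1) arrow_carrier in auto)

lemma coset_self: "Y \<in> sections G ==> g \<in> carrier G ==> g \<in> fst Y #> g"
 using subgroup.one_closed[OF sectionsD(1)[of Y]] by (force simp: r_coset_def)

lemma coset_shift:
 assumes "Y \<in> sections G" "m \<in> fst Y" "g \<in> carrier G"
 shows "fst Y #> (m \<otimes> g) = fst Y #> g"
 using coset_mult_assoc[of "fst Y" m g] sectionsD[OF assms(1)] assms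
  coset_join2[of m "fst Y"] by (auto simp: subset_iff)

lemma small_cat_sec_cat: "small_cat (sec_cat G)"
proof
 have Ob: "Ob (sec_cat G) = sections G" and Idm: "!!X. Idm (sec_cat G) X = fst X #> \<one>"
  and Comp: "!!a b. Comp (sec_cat G) b a = b <#> a" by (simp_all add: sec_cat_def)
 fix X assume X: "X \<in> Ob (sec_cat G)"
 show "Idm (sec_cat G) X \<in> Hom (sec_cat G) X X"
  using X arrow_one[of X X] sec_le_refl[of X] unfolding Hom_iff Idm Ob by blast
 fix Y a assume Y: "Y \<in> Ob (sec_cat G)" and a: "a \<in> Hom (sec_cat G) X Y"
 obtain g where g: "arrow X Y g" "a = fst Y #> g" using a Hom_iff by blast
 show "Comp (sec_cat G) a (Idm (sec_cat G) X) = a"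
  unfolding Comp Idm g(2) using coset_Comp[of X Y \<one> g] X Y g(1) arrow_carrier[OF g(1)] by (simp add: Ob)
 fix Z b assume Z: "Z \<in> Ob (sec_cat G)" and b: "b \<in> Hom (sec_cat G) Y Z"
 obtain h where h: "arrow Y Z h" "b = fst Z #> h" using b Hom_iff by blast
 show "Comp (sec_cat G) b a \<in> Hom (sec_cat G) X Z" unfolding Hom_iff Comp g(2) h(2)
  using coset_Comp[of Y Z g h] arrow_mult[OF _ g(1) h(1)] X Y Z h(1) arrow_carrier[OF g(1)]
  by (auto simp: Ob)
next
 have Ob: "Ob (sec_cat G) = sections G" and Comp: "!!a b. Comp (sec_cat G) b a = b <#> a"
  by (simp_all add: sec_cat_def)
 have car: "a \<subseteq> carrier G" if "Y \<in> Ob (sec_cat G)" "a \<in> Hom (sec_cat G) X Y" for X Y a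
  using that sectionsD(5)[of Y] unfolding Hom_iff Ob arrow_def by (auto simp: r_coset_def)
 fix W X Y Z a b c
 assume "W \<in> Ob (sec_cat G)" "X \<in> Ob (sec_cat G)" "Y \<in> Ob (sec_cat G)" "Z \<in> Ob (sec_cat G)"
  "a \<in> Hom (sec_cat G) W X" "b \<in> Hom (sec_cat G) X Y" "c \<in> Hom (sec_cat G) Y Z"
 thus "Comp (sec_cat G) c (Comp (sec_cat G) b a) = Comp (sec_cat G) (Comp (sec_cat G) c b) a"
  unfolding Comp using car set_mult_assoc[of c b a] by simp
qed

definition els :: "nat => 'a set \<times> 'a set => 'a set set"
 where "els k X = {E \<in> EA k. sec_le X (cs E)}"

lemma elsD:
 assumes "E \<in> els k X"
 shows "E \<in> EA k" "E \<subseteq> snd X" "snd X \<subseteq> fst X" "fst X \<subseteq> centralizer G E" "sec_le X (cs E)"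
 using assms by (auto simp: els_def sec_le_def csec_def)

lemma elsI: "X \<in> sections G ==> E \<in> EA k ==> E \<subseteq> snd X ==> fst X \<subseteq> centralizer G E ==> E \<in> els k X"
 using sectionsD(4)[of X] by (simp add: els_def sec_le_def csec_def)

lemma centralizer_antimono: "A \<subseteq> E ==> centralizer G E \<subseteq> centralizer G A"
 by (auto simp: centralizer_def)

lemma els_subset: "E \<in> els k X ==> A \<in> EA j ==> A \<subseteq> E ==> A \<in> els j X"
 using centralizer_antimono[of A E] by (auto simp: els_def sec_le_def csec_def)

lemma els_hyps: "E \<in> els (Suc k) X ==> A \<in> hyps E ==> A \<in> els k X"
 using els_subset hypsD elsD(1) by metis

lemma csec_section:
 assumes E: "E \<in> EA k"
 shows "cs E \<in> sections G"
proof -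
 have C: "subgroup (centralizer G E) G" by (rule centralizer_subgroup[OF elem_abD(4)[OF E]])
 have EC: "E \<subseteq> centralizer G E"
  using elem_abD(4)[OF E] exp_abelianD(2)[OF elem_abD(1)[OF E]] by (auto simp: centralizer_def)
 interpret C: group "G\<lparr>carrier := centralizer G E\<rparr>"
  using C by (rule subgroup.subgroup_is_group) (rule is_group)
 have "E \<lhd> (G\<lparr>carrier := centralizer G E\<rparr>)" unfolding C.normal_inv_iff
 proof (intro conjI ballI)
  show "subgroup E (G\<lparr>carrier := centralizer G E\<rparr>)"
   by (rule subgroup_incl[OF elem_abD(2)[OF E] C EC])
  fix g x assume g: "g \<in> carrier (G\<lparr>carrier := centralizer G E\<rparr>)" and x: "x \<in> E"
  hence "g \<otimes> x = x \<otimes> g" "g \<in> carrier G" "x \<in> carrier G"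
   using elem_abD(4)[OF E] by (auto simp: centralizer_def)
  hence "g \<otimes> x \<otimes> inv g = x" by (simp add: m_assoc)
  moreover have "inv\<^bsub>G\<lparr>carrier := centralizer G E\<rparr>\<^esub> g = inv g"
   using g C by (intro m_inv_consistent) auto
  ultimately show "g \<otimes>\<^bsub>G\<lparr>carrier := centralizer G E\<rparr>\<^esub> x \<otimes>\<^bsub>G\<lparr>carrier := centralizer G E\<rparr>\<^esub>
    inv\<^bsub>G\<lparr>carrier := centralizer G E\<rparr>\<^esub> g \<in> E" using x by simp
 qed
 thus ?thesis using C by (simp add: csec_def sections_def)
qed

lemma csec_els: "E \<in> EA k ==> E \<in> els k (cs E)"
 using sec_le_refl[OF csec_section] by (simp add: els_def)

lemma csec_conj: "g \<in> carrier G ==> E \<subseteq> carrier G ==> sec_conj G g (cs E) = cs (cj g E)"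
 using centralizer_conj[of g E] by (simp add: sec_conj_def csec_def)

lemma csec_star: "E \<in> EA (Suc k) ==> cs E \<in> Ob (sec_cat_star G)"
 using csec_section[of E "Suc k"] elem_ab_rank_unique[OF trivial_elem_ab, of "Suc k"]
 by (auto simp: sec_cat_star_def csec_def)

lemma arrow_els:
 assumes X: "X \<in> sections G" and g: "arrow X Y g" and E: "E \<in> els k Y"
 shows "cj (inv g) E \<in> els k X"
proof -
 have gG: "g \<in> carrier G" by (rule arrow_carrier[OF g])
 note EG = elem_abD(4)[OF elsD(1)[OF E]]
 have "sec_le (sec_conj G g X) (cs E)"
  using g unfolding arrow_def by (intro sec_le_trans[OF _ elsD(5)[OF E]]) simp
 hence "sec_le (sec_conj G (inv g) (sec_conj G g X)) (sec_conj G (inv g) (cs E))" by (rule sec_le_conj)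
 hence "sec_le X (cs (cj (inv g) E))" unfolding sec_conj_inv[OF X gG] csec_conj[OF inv_closed[OF gG] EG] .
 thus ?thesis using conj_elem_ab[OF inv_closed[OF gG] elsD(1)[OF E]] unfolding els_def by blast
qed

lemma arrow_coset_conj:
 assumes Y: "Y \<in> sections G" and g: "g \<in> carrier G" and h: "h \<in> fst Y #> g" and E: "E \<in> els k Y"
 shows "cj (inv h) E = cj (inv g) E"
  "z \<in> St k E ==> cjc (inv h) z = cjc (inv g) z"
proof -
 note EG = elem_abD(4)[OF elsD(1)[OF E]]
 obtain m where m: "m \<in> fst Y" "h = m \<otimes> g" using h by (auto simp: r_coset_def)
 have mG: "m \<in> carrier G" using m sectionsD(5)[OF Y] by auto
 have mC: "inv m \<in> centralizer G E"
  using m(1) elsD(4)[OF E] subgroup.m_inv_closed[OF centralizer_subgroup[OF EG]] by auto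
 have hi: "inv h = inv g \<otimes> inv m" unfolding m(2) by (rule inv_mult_group[OF mG g])
 have "cj (inv h) E = cj (inv g) (cj (inv m) E)"
  unfolding hi by (rule conj_set_mult[OF inv_closed[OF g] inv_closed[OF mG] EG])
 thus "cj (inv h) E = cj (inv g) E" unfolding conj_set_central[OF EG mC subset_refl] .
 assume z: "z \<in> St k E"
 have "cjc (inv h) z = cjc (inv g) (cjc (inv m) z)"
  unfolding hi by (rule conj_chain_mult[OF inv_closed[OF g] inv_closed[OF mG]])
 thus "cjc (inv h) z = cjc (inv g) z" unfolding conj_chain_central[OF EG mC z] .
qed

end

subsection \<open>The terms of the resolution\<close>

locale p_group_ring = finite_p_group +
 fixes R :: "('r, 's) ring_scheme"
 assumes cring_R: "cring R"
begin

interpretation R: cring R by (rule cring_R)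

definition qindex :: "nat => 'a set \<times> 'a set => ('a set \<times> 'a set list) set"
 where "qindex k X = Sigma (els k X) (opp k)"

text \<open>The free module on the bases dual to opposite flags is \<open>R\<close> tensored with the sum of the Steinberg modules;
\<open>can\<close> below is the canonical map, so that statements need no basis.\<close>

definition Qmod :: "nat => 'a set \<times> 'a set => ('r, 'a set \<times> 'a set list => 'r) module"
 where "Qmod k X = free_module R (qindex k X)"

definition can :: "nat => 'a set => ('a set list => int) => 'a set \<times> 'a set list => 'r"
 where "can k E z = (%(E', si). if E' = E & si \<in> opp k E then [z si] \<cdot>\<^bsub>R\<^esub> \<one>\<^bsub>R\<^esub> else \<zero>\<^bsub>R\<^esub>)"

definition Qext :: "nat => ('r, 'm) module => ('a set => ('a set list => int) => 'm) =>
  ('a set \<times> 'a set list => 'r) => 'm"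
 where "Qext k M ps = lin_ext R M (%(E, si). ps E (dual k E si))"

lemma Qmod_module: "module R (Qmod k X)" by (simp add: Qmod_def R.free_module_module)

lemma Qmod_group: "abelian_group (Qmod k X)" using Qmod_module module.axioms(2) by blast

lemma can_closed:
 assumes "E \<in> els k X"
 shows "can k E z \<in> carrier (Qmod k X)"
proof -
 have "{i. can k E z i ~= \<zero>\<^bsub>R\<^esub>} \<subseteq> {E} \<times> opp k E"
  by (auto simp: can_def split: if_splits)
 hence "finite {i. can k E z i ~= \<zero>\<^bsub>R\<^esub>}"
  by (rule finite_subset) (simp add: finite_opp[OF elsD(1)[OF assms]])
 thus ?thesis using assms by (auto simp: Qmod_def R.free_module_carrier can_def qindex_def)
qed

lemma can_additive:
 assumes "E \<in> els k X"
 shows "additive_on (St k E) (Qmod k X) (can k E)" unfolding additive_on_def using can_closed[OF assms]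
 by (auto simp: Qmod_def R.free_module_simps can_def fun_eq_iff R.add.int_pow_mult[symmetric])

lemma can_dual:
 assumes "E \<in> EA k" "si \<in> opp k E"
 shows "can k E (dual k E si) = unit_vec R (E, si)"
proof -
 have one: "[(1::int)] \<cdot>\<^bsub>R\<^esub> \<one>\<^bsub>R\<^esub> = \<one>\<^bsub>R\<^esub>" by (rule R.add.int_pow_1) simp
 have zero: "[(0::int)] \<cdot>\<^bsub>R\<^esub> \<one>\<^bsub>R\<^esub> = \<zero>\<^bsub>R\<^esub>" by (simp add: add_pow_def)
 show ?thesis using dual(2)[OF assms] assms(2) one zero by (auto simp: can_def unit_vec_def fun_eq_iff)
qed

lemma Qext_hom:
 assumes M: "module R M" and ps: "!!E. E \<in> els k X ==> additive_on (St k E) M (ps E)"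
 shows "Qext k M ps \<in> module_homs R (Qmod k X) M"
  and "E \<in> els k X ==> z \<in> St k E ==> Qext k M ps (can k E z) = ps E z"
proof -
 have v: "(%(E, si). ps E (dual k E si)) \<in> qindex k X \<rightarrow> carrier M"
 proof -
  have "ps E (dual k E si) \<in> carrier M" if "E \<in> els k X" "si \<in> opp k E" for E si
   by (rule additive_onD(1)[OF ps[OF that(1)] dual(1)[OF elsD(1)[OF that(1)] that(2)]])
  thus ?thesis by (auto simp: qindex_def)
 qed
 show hom: "Qext k M ps \<in> module_homs R (Qmod k X) M"
  unfolding Qext_def Qmod_def by (rule R.lin_ext_hom[OF M v])
 assume E: "E \<in> els k X" and z: "z \<in> St k E"
 show "Qext k M ps (can k E z) = ps E z"
 proof (rule additive_on_eqI[OF elsD(1)[OF E] _ additive_on_comp[OF can_additive[OF E] hom] ps[OF E] _ z])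
  show "abelian_group M" using M module.axioms(2) by blast
  fix si assume si: "si \<in> opp k E"
  have "(E, si) \<in> qindex k X" using E si by (simp add: qindex_def)
  from R.lin_ext_unit_vec[OF M v this]
  show "Qext k M ps (can k E (dual k E si)) = ps E (dual k E si)"
   unfolding can_dual[OF elsD(1)[OF E] si] Qext_def by simp
 qed
qed

lemma Qmod_hom_eqI:
 assumes h: "h \<in> module_homs R (Qmod k X) M" and l: "l \<in> module_homs R (Qmod k X) M" and M: "module R M"
  and eq: "!!E z. E \<in> els k X ==> z \<in> St k E ==> h (can k E z) = l (can k E z)"
  and x: "x \<in> carrier (Qmod k X)"
 shows "h x = l x"
proof (rule R.free_module_hom_eqI[OF h[unfolded Qmod_def] l[unfolded Qmod_def] M _ x[unfolded Qmod_def]])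
 fix i assume "i \<in> qindex k X"
 then obtain E si where i: "i = (E, si)" "E \<in> els k X" "si \<in> opp k E" by (auto simp: qindex_def)
 show "h (unit_vec R i) = l (unit_vec R i)"
  using eq[OF i(2) dual(1)[OF elsD(1)[OF i(2)] i(3)]] can_dual[OF elsD(1)[OF i(2)] i(3)] i(1) by simp
qed

subsection \<open>Functoriality\<close>

definition Qmap :: "nat => 'a set \<times> 'a set => 'a set \<times> 'a set => 'a set =>
  ('a set \<times> 'a set list => 'r) => 'a set \<times> 'a set list => 'r"
 where "Qmap k X Y c = (let g = SOME g. g \<in> c in
  Qext k (Qmod k X) (%E z. can k (cj (inv g) E) (cjc (inv g) z)))"

definition Q :: "nat => ('r, 'a set \<times> 'a set, 'a set, 'a set \<times> 'a set list => 'r) catmod"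
 where "Q k = \<lparr>Fob = Qmod k, Fmap = Qmap k\<rparr>"

lemma conj_can_additive:
 assumes g: "g \<in> carrier G" and E: "E \<subseteq> carrier G" and gE: "cj g E \<in> els k X"
 shows "additive_on (St k E) (Qmod k X) (%z. can k (cj g E) (cjc g z))"
 unfolding additive_on_def conj_chain_add
 using additive_onD[OF can_additive[OF gE]] conj_steinberg[OF g E] by blast

lemma Qmap_hom:
 assumes X: "X \<in> sections G" and Y: "Y \<in> sections G" and g: "arrow X Y g"
 shows "Qmap k X Y (fst Y #> g) \<in> module_homs R (Qmod k Y) (Qmod k X)"
  and "E \<in> els k Y ==> z \<in> St k E ==>
   Qmap k X Y (fst Y #> g) (can k E z) = can k (cj (inv g) E) (cjc (inv g) z)"
proof -
 have gG: "g \<in> carrier G" by (rule arrow_carrier[OF g])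
 define h where "h = (SOME h. h \<in> fst Y #> g)"
 have h: "h \<in> fst Y #> g" unfolding h_def by (rule someI[of "%h. h \<in> fst Y #> g" g]) (rule coset_self[OF Y gG])
 have hG: "h \<in> carrier G" using h r_coset_subset_G[OF sectionsD(5)[OF Y] gG] by auto
 have Qm: "Qmap k X Y (fst Y #> g) = Qext k (Qmod k X) (%E z. can k (cj (inv h) E) (cjc (inv h) z))"
  unfolding Qmap_def Let_def h_def ..
 have add: "additive_on (St k E) (Qmod k X) (%z. can k (cj (inv h) E) (cjc (inv h) z))"
  if E: "E \<in> els k Y" for E
 proof (rule conj_can_additive[OF inv_closed[OF hG] elem_abD(4)[OF elsD(1)[OF E]]])
  show "cj (inv h) E \<in> els k X" unfolding arrow_coset_conj(1)[OF Y gG h E] by (rule arrow_els[OF X g E])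
 qed
 show "Qmap k X Y (fst Y #> g) \<in> module_homs R (Qmod k Y) (Qmod k X)"
  unfolding Qm by (rule Qext_hom(1)[OF Qmod_module add])
 assume E: "E \<in> els k Y" and z: "z \<in> St k E"
 show "Qmap k X Y (fst Y #> g) (can k E z) = can k (cj (inv g) E) (cjc (inv g) z)"
 proof -
  have "Qmap k X Y (fst Y #> g) (can k E z) = can k (cj (inv h) E) (cjc (inv h) z)"
   unfolding Qm by (rule Qext_hom(2)[OF Qmod_module add E z])
  thus ?thesis by (simp only: arrow_coset_conj(1)[OF Y gG h E] arrow_coset_conj(2)[OF Y gG h E z])
 qed
qed

lemma conj_els_steinberg:
 assumes "arrow X Y g" "E \<in> els k Y" "z \<in> St k E"
 shows "cjc (inv g) z \<in> St k (cj (inv g) E)"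
 using assms by (intro conj_steinberg inv_closed arrow_carrier elem_abD(4)[OF elsD(1)])

lemma Q_catmod: "is_catmod (sec_cat G) R (Q k)" unfolding is_catmod_def
proof (intro conjI ballI)
 have Ob: "Ob (sec_cat G) = sections G" and Idm: "!!X. Idm (sec_cat G) X = fst X #> \<one>"
  and Comp: "!!a b. Comp (sec_cat G) b a = b <#> a" by (simp_all add: sec_cat_def)
 have Qs: "Fob (Q k) = Qmod k" "Fmap (Q k) = Qmap k" by (simp_all add: Q_def)
 fix X assume X: "X \<in> Ob (sec_cat G)"
 hence Xs: "X \<in> sections G" by (simp add: Ob)
 show "module R (Fob (Q k) X)" unfolding Qs by (rule Qmod_module)
 {
  fix x assume x: "x \<in> elts (Q k) X"
  note one = arrow_one[OF Xs sec_le_refl[OF Xs]]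
  have "Qmap k X X (fst X #> \<one>) x = id x"
  proof (rule Qmod_hom_eqI[OF Qmap_hom(1)[OF Xs Xs one] _ Qmod_module])
   show "id \<in> module_homs R (Qmod k X) (Qmod k X)" by (simp add: module_homs_def)
   show "x \<in> carrier (Qmod k X)" using x by (simp add: Qs)
   fix E z assume E: "E \<in> els k X" and z: "z \<in> St k E"
   show "Qmap k X X (fst X #> \<one>) (can k E z) = id (can k E z)"
   proof -
    have "cj (inv \<one>) E = E" "cjc (inv \<one>) z = z"
     using conj_set_one[OF elem_abD(4)[OF elsD(1)[OF E]]] conj_chain_one[OF z] inv_one by metis+
    thus ?thesis by (simp only: Qmap_hom(2)[OF Xs Xs one E z] id_apply)
   qed
  qed
  thus "Fmap (Q k) X X (Idm (sec_cat G) X) x = x" by (simp add: Qs Idm)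
 }
 fix Y c assume Y: "Y \<in> Ob (sec_cat G)" and c: "c \<in> Hom (sec_cat G) X Y"
 hence Ys: "Y \<in> sections G" by (simp add: Ob)
 obtain g where g: "arrow X Y g" "c = fst Y #> g" using c Hom_iff by blast
 show "Fmap (Q k) X Y c \<in> module_homs R (Fob (Q k) Y) (Fob (Q k) X)"
  unfolding Qs g(2) by (rule Qmap_hom(1)[OF Xs Ys g(1)])
 fix Z d x assume Z: "Z \<in> Ob (sec_cat G)" and d: "d \<in> Hom (sec_cat G) Y Z" and x: "x \<in> elts (Q k) Z"
 hence Zs: "Z \<in> sections G" by (simp add: Ob)
 obtain h where h: "arrow Y Z h" "d = fst Z #> h" using d Hom_iff by blast
 note gG = arrow_carrier[OF g(1)] and hG = arrow_carrier[OF h(1)]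
 note hg = arrow_mult[OF Xs g(1) h(1)]
 have "Qmap k X Z (fst Z #> (h \<otimes> g)) x = Qmap k X Y (fst Y #> g) (Qmap k Y Z (fst Z #> h) x)"
 proof (rule Qmod_hom_eqI[OF Qmap_hom(1)[OF Xs Zs hg]
    homs_comp[OF Qmap_hom(1)[OF Ys Zs h(1)] Qmap_hom(1)[OF Xs Ys g(1)]] Qmod_module])
  show "x \<in> carrier (Qmod k Z)" using x by (simp add: Qs)
  fix E z assume E: "E \<in> els k Z" and z: "z \<in> St k E"
  note EG = elem_abD(4)[OF elsD(1)[OF E]]
  show "Qmap k X Z (fst Z #> (h \<otimes> g)) (can k E z) = Qmap k X Y (fst Y #> g) (Qmap k Y Z (fst Z #> h) (can k E z))"
   unfolding Qmap_hom(2)[OF Xs Zs hg E z] Qmap_hom(2)[OF Ys Zs h(1) E z]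
    Qmap_hom(2)[OF Xs Ys g(1) arrow_els[OF Ys h(1) E] conj_els_steinberg[OF h(1) E z]]
    inv_mult_group[OF hG gG] conj_set_mult[OF inv_closed[OF gG] inv_closed[OF hG] EG]
    conj_chain_mult[OF inv_closed[OF gG] inv_closed[OF hG]] ..
 qed
 thus "Fmap (Q k) X Z (Comp (sec_cat G) d c) x = Fmap (Q k) X Y c (Fmap (Q k) Y Z d x)"
  unfolding Qs Comp g(2) h(2) coset_Comp[OF Ys Zs gG h(1)] .
qed

subsection \<open>The differential and its exactness\<close>

definition bd :: "nat => 'a set \<times> 'a set => ('a set \<times> 'a set list => 'r) => 'a set \<times> 'a set list => 'r"
 where "bd k X = Qext (Suc k) (Qmod k X)
  (%E z. \<Oplus>\<^bsub>Qmod k X\<^esub>A\<in>hyps E. can k A (truncation (Suc k) A z))"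

lemma bd_additive:
 assumes E: "E \<in> els (Suc k) X"
 shows "additive_on (St (Suc k) E) (Qmod k X)
  (%z. \<Oplus>\<^bsub>Qmod k X\<^esub>A\<in>hyps E. can k A (truncation (Suc k) A z))"
 by (intro additive_on_finsum Qmod_group additive_on_truncation[OF elsD(1)[OF E]] can_additive els_hyps[OF E])

lemma bd_hom: "bd k X \<in> module_homs R (Qmod (Suc k) X) (Qmod k X)"
 and bd_can: "E \<in> els (Suc k) X ==> z \<in> St (Suc k) E ==>
  bd k X (can (Suc k) E z) = (\<Oplus>\<^bsub>Qmod k X\<^esub>A\<in>hyps E. can k A (truncation (Suc k) A z))"
 unfolding bd_def by (rule Qext_hom[OF Qmod_module bd_additive]; assumption?)+

lemma Qmod_hom_can_sum:
 assumes h: "h \<in> module_homs R (Qmod k X) M" and M: "module R M" and E: "E \<in> els (Suc k) X"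
  and z: "z \<in> St (Suc k) E"
 shows "h (bd k X (can (Suc k) E z)) = (\<Oplus>\<^bsub>M\<^esub>A\<in>hyps E. h (can k A (truncation (Suc k) A z)))"
 unfolding bd_can[OF E z]
 using can_closed[OF els_hyps[OF E]] by (intro homs_finsum[OF h Qmod_module M]) auto

lemma bd_bd:
 assumes x: "x \<in> carrier (Qmod (Suc (Suc k)) X)"
 shows "bd k X (bd (Suc k) X x) = \<zero>\<^bsub>Qmod k X\<^esub>"
proof (rule Qmod_hom_eqI[OF homs_comp[OF bd_hom bd_hom] _ Qmod_module _ x])
 interpret M: module R "Qmod k X" by (rule Qmod_module)
 show "(%_. \<zero>\<^bsub>Qmod k X\<^esub>) \<in> module_homs R (Qmod (Suc (Suc k)) X) (Qmod k X)"
  by (rule module_homsI) auto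
 fix E z assume E: "E \<in> els (Suc (Suc k)) X" and z: "z \<in> St (Suc (Suc k)) E"
 have "bd k X (bd (Suc k) X (can (Suc (Suc k)) E z)) =
   (\<Oplus>\<^bsub>Qmod k X\<^esub>A\<in>hyps E. bd k X (can (Suc k) A (truncation (Suc (Suc k)) A z)))"
  by (rule Qmod_hom_can_sum[OF bd_hom Qmod_module E z])
 also have "... = (\<Oplus>\<^bsub>Qmod k X\<^esub>A\<in>hyps E. \<Oplus>\<^bsub>Qmod k X\<^esub>B\<in>hyps A.
   can k B (truncation (Suc k) B (truncation (Suc (Suc k)) A z)))"
  using E z can_closed[OF els_hyps[OF els_hyps[OF E]]]
  by (intro M.finsum_cong'[OF refl] funcsetI M.finsum_closed bd_can els_hyps[OF E]
    steinberg_truncation[OF elsD(1)[OF E]]) auto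
 also have "... = \<zero>\<^bsub>Qmod k X\<^esub>"
  using els_subset[OF E] by (intro double_truncation_zero[OF elsD(1)[OF E] Qmod_group _ z] can_additive) auto
 finally show "bd k X (bd (Suc k) X (can (Suc (Suc k)) E z)) = \<zero>\<^bsub>Qmod k X\<^esub>" .
qed

lemma bd_catmap: "catmap (sec_cat G) R (Q (Suc k)) (Q k) (bd k)" unfolding catmap_def
proof (intro conjI ballI)
 have Ob: "Ob (sec_cat G) = sections G" by (simp add: sec_cat_def)
 have Qs: "!!k. Fob (Q k) = Qmod k" "!!k. Fmap (Q k) = Qmap k" by (simp_all add: Q_def)
 fix X assume X: "X \<in> Ob (sec_cat G)"
 show "bd k X \<in> module_homs R (Fob (Q (Suc k)) X) (Fob (Q k) X)" unfolding Qs by (rule bd_hom)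
 fix Y c x assume Y: "Y \<in> Ob (sec_cat G)" and c: "c \<in> Hom (sec_cat G) X Y"
  and x: "x \<in> elts (Q (Suc k)) Y"
 have Xs: "X \<in> sections G" and Ys: "Y \<in> sections G" using X Y by (simp_all add: Ob)
 interpret M: module R "Qmod k X" by (rule Qmod_module)
 obtain g where g: "arrow X Y g" "c = fst Y #> g" using c Hom_iff by blast
 note gi = inv_closed[OF arrow_carrier[OF g(1)]]
 note q = Qmap_hom[OF Xs Ys g(1)]
 have "bd k X (Qmap (Suc k) X Y (fst Y #> g) x) = Qmap k X Y (fst Y #> g) (bd k Y x)"
 proof (rule Qmod_hom_eqI[OF homs_comp[OF q(1) bd_hom] homs_comp[OF bd_hom q(1)] Qmod_module])
  show "x \<in> carrier (Qmod (Suc k) Y)" using x by (simp add: Qs)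
  fix E z assume E: "E \<in> els (Suc k) Y" and z: "z \<in> St (Suc k) E"
  let ?gE = "cj (inv g) E"
  note gE = arrow_els[OF Xs g(1) E] and gz = conj_els_steinberg[OF g(1) E z]
  have A: "A \<in> els k Y" "A \<subseteq> carrier G" "truncation (Suc k) A z \<in> St k A"
   "truncation (Suc k) (cj (inv g) A) (cjc (inv g) z) = cjc (inv g) (truncation (Suc k) A z)"
   if "A \<in> hyps E" for A
  proof -
   show A: "A \<in> els k Y" by (rule els_hyps[OF E that])
   show AG: "A \<subseteq> carrier G" by (rule elem_abD(4)[OF elsD(1)[OF A]])
   show "truncation (Suc k) A z \<in> St k A" by (rule steinberg_truncation[OF elsD(1)[OF E] z that])
   show "truncation (Suc k) (cj (inv g) A) (cjc (inv g) z) = cjc (inv g) (truncation (Suc k) A z)"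
    by (rule truncation_conj[OF gi AG])
  qed
  have "bd k X (Qmap (Suc k) X Y (fst Y #> g) (can (Suc k) E z)) =
    (\<Oplus>\<^bsub>Qmod k X\<^esub>A\<in>cj (inv g) ` hyps E. can k A (truncation (Suc k) A (cjc (inv g) z)))"
   unfolding q(2)[OF E z] bd_can[OF gE gz] hyps_conj(1)[OF gi elsD(1)[OF E]] ..
  also have "... = (\<Oplus>\<^bsub>Qmod k X\<^esub>A\<in>hyps E. can k (cj (inv g) A)
    (truncation (Suc k) (cj (inv g) A) (cjc (inv g) z)))"
   using can_closed[OF els_hyps[OF gE]] unfolding hyps_conj(1)[OF gi elsD(1)[OF E]]
   by (intro M.finsum_reindex hyps_conj(2)[OF gi elsD(1)[OF E]]) blast
  also have "... = (\<Oplus>\<^bsub>Qmod k X\<^esub>A\<in>hyps E. Qmap k X Y (fst Y #> g) (can k A (truncation (Suc k) A z)))"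
  proof (rule M.finsum_cong'[OF refl])
   show "(%A. Qmap k X Y (fst Y #> g) (can k A (truncation (Suc k) A z))) \<in> hyps E \<rightarrow> carrier (Qmod k X)"
    using homs_closed[OF q(1)] can_closed A(1) by blast
   fix A' assume A': "A' \<in> hyps E"
   show "can k (cj (inv g) A') (truncation (Suc k) (cj (inv g) A') (cjc (inv g) z)) =
     Qmap k X Y (fst Y #> g) (can k A' (truncation (Suc k) A' z))"
    unfolding A(4)[OF A'] q(2)[OF A(1,3)[OF A']] ..
  qed
  also have "... = Qmap k X Y (fst Y #> g) (bd k Y (can (Suc k) E z))"
   by (rule Qmod_hom_can_sum[OF q(1) Qmod_module E z, symmetric])
  finally show "bd k X (Qmap (Suc k) X Y (fst Y #> g) (can (Suc k) E z)) =
    Qmap k X Y (fst Y #> g) (bd k Y (can (Suc k) E z))" .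
 qed
 thus "bd k X (Fmap (Q (Suc k)) X Y c x) = Fmap (Q k) X Y c (bd k Y x)" by (simp add: Qs g(2))
qed

end

context finite_p_group
begin

definition omega :: "'a set \<times> 'a set => 'a set"
 where "omega X = {x \<in> snd X. x \<in> centralizer G (fst X) & x [^] p = \<one>}"

lemma omega_exp_abelian:
 assumes X: "X \<in> sections G"
 shows "exp_abelian G p (omega X)"
proof -
 let ?Z = "snd X Int centralizer G (fst X)"
 note sX = sectionsD[OF X]
 have Z: "subgroup ?Z G" by (rule subgroups_Inter_pair[OF sX(3) centralizer_subgroup[OF sX(5)]])
 have comm: "x \<otimes> y = y \<otimes> x" if "x \<in> ?Z" "y \<in> ?Z" for x y
  using that sX(4) by (auto simp: centralizer_def)
 have car: "x \<in> carrier G" if "x \<in> ?Z" for x using that sX(6) by auto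
 have om: "x \<in> omega X \<longleftrightarrow> x \<in> ?Z & x [^] p = \<one>" for x by (auto simp: omega_def)
 have "subgroup (omega X) G"
 proof (rule subgroupI)
  show "omega X \<subseteq> carrier G" using om car by blast
  show "omega X ~= {}" using om[of \<one>] subgroup.one_closed[OF Z] by auto
  fix x assume x: "x \<in> omega X"
  hence xZ: "x \<in> ?Z" "x [^] p = \<one>" using om by auto
  have "(inv x) [^] p = \<one>" using nat_pow_inv[OF car[OF xZ(1)]] xZ(2) by simp
  thus "inv x \<in> omega X" using om[of "inv x"] subgroup.m_inv_closed[OF Z xZ(1)] by simp
  fix y assume y: "y \<in> omega X"
  hence yZ: "y \<in> ?Z" "y [^] p = \<one>" using om by auto
  have "(x \<otimes> y) [^] p = \<one>"
   using pow_mult_distrib[OF comm[OF xZ(1) yZ(1)] car[OF xZ(1)] car[OF yZ(1)]] xZ(2) yZ(2) by simp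
  thus "x \<otimes> y \<in> omega X" using om subgroup.m_closed[OF Z xZ(1) yZ(1)] by simp
 qed
 thus ?thesis unfolding exp_abelian_def using om comm by simp
qed

lemma els_omega:
 assumes X: "X \<in> sections G"
 shows "E \<in> els k X \<longleftrightarrow> E \<in> EA k & E \<subseteq> omega X"
proof
 assume E: "E \<in> els k X"
 note sX = sectionsD[OF X]
 have "x \<in> omega X" if x: "x \<in> E" for x
 proof -
  have "x \<in> snd X" using x elsD(2)[OF E] by auto
  moreover have "x \<in> centralizer G (fst X)"
   using elsD(4)[OF E] x sX(6) \<open>x \<in> snd X\<close> by (auto simp: centralizer_def)
  ultimately show ?thesis using exp_abelianD(3)[OF elem_abD(1)[OF elsD(1)[OF E]] x] by (simp add: omega_def)
 qed
 thus "E \<in> EA k & E \<subseteq> omega X" using elsD(1)[OF E] by auto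
next
 assume E: "E \<in> EA k & E \<subseteq> omega X"
 show "E \<in> els k X"
 proof (rule elsI[OF X])
  show "fst X \<subseteq> centralizer G E"
   using E sectionsD(5)[OF X] by (force simp: omega_def centralizer_def)
 qed (use E in \<open>auto simp: omega_def\<close>)
qed

lemma star_section: "X \<in> Ob (sec_cat_star G) \<longleftrightarrow> X \<in> sections G & snd X ~= {\<one>}"
 by (simp add: sec_cat_star_def)

lemma star_line:
 assumes "X \<in> Ob (sec_cat_star G)"
 obtains L where "L \<in> els 1 X"
proof -
 have X: "X \<in> sections G" "snd X ~= {\<one>}" using assms star_section by auto
 obtain L where "L \<in> EA 1" "L \<subseteq> snd X" "fst X \<subseteq> centralizer G L"
  using central_line[OF sectionsD(1,2)[OF X(1)] X(2)] by blast
 thus thesis using that elsI[OF X(1)] by blast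
qed

lemma els_0: "X \<in> sections G ==> els 0 X = {{\<one>}}"
 using els_omega[of X _ 0] elem_ab_0 exp_abelianD(1)[OF omega_exp_abelian[of X]] subgroup.one_closed
 by fastforce

lemma opp_0: "opp 0 E = {[]}" by (simp add: opp_def opposite_flags_low)

end

context p_group_ring
begin

interpretation R: cring R by (rule cring_R)

text \<open>The contracting homotopy: the cone with vertex \<open>L\<close>.\<close>

definition contraction :: "'a set => nat => 'a set \<times> 'a set => ('a set \<times> 'a set list => 'r) => 'a set \<times> 'a set list => 'r"
 where "contraction L k X = Qext k (Qmod (Suc k) X)
  (%E z. if L \<subseteq> E then \<zero>\<^bsub>Qmod (Suc k) X\<^esub> else can (Suc k) (E <#> L) (line_lift L k E z))"

context
 fixes X L n
 assumes X: "X \<in> sections G" and L: "L \<in> els 1 X" and om: "omega X \<in> EA n"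
begin

lemma L_line: "L \<in> EA 1" "L \<subseteq> omega X" using L els_omega[OF X] by auto

lemma join_els:
 assumes "E \<in> els k X" "~ L \<subseteq> E"
 shows "E <#> L \<in> els (Suc k) X" using join_facts[OF om L_line, of E k] assms els_omega[OF X] by blast

lemma contraction_additive:
 assumes E: "E \<in> els k X"
 shows "additive_on (St k E) (Qmod (Suc k) X)
  (%z. if L \<subseteq> E then \<zero>\<^bsub>Qmod (Suc k) X\<^esub> else can (Suc k) (E <#> L) (line_lift L k E z))"
proof (cases "L \<subseteq> E")
 case True
 interpret M: module R "Qmod (Suc k) X" by (rule Qmod_module)
 show ?thesis using True by (simp add: additive_on_def)
next
 case False
 have E': "E \<in> EA k" "E \<subseteq> omega X" using E els_omega[OF X] by auto
 note add = additive_onD[OF can_additive[OF join_els[OF E False]]]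
 show ?thesis
  unfolding additive_on_def using False add line_lift(1)[OF om L_line E' False] line_lift_add[OF om L_line E' False]
  by simp
qed

lemma contraction_hom: "contraction L k X \<in> module_homs R (Qmod k X) (Qmod (Suc k) X)"
 and contraction_can: "E \<in> els k X ==> z \<in> St k E ==> contraction L k X (can k E z) =
  (if L \<subseteq> E then \<zero>\<^bsub>Qmod (Suc k) X\<^esub> else can (Suc k) (E <#> L) (line_lift L k E z))"
 unfolding contraction_def by (rule Qext_hom[OF Qmod_module contraction_additive]; assumption?)+

lemma bd_contraction:
 assumes E: "E \<in> els k X" and LE: "~ L \<subseteq> E" and z: "z \<in> St k E"
 shows "bd k X (contraction L k X (can k E z)) = can k E z \<oplus>\<^bsub>Qmod k X\<^esub>
  (\<Oplus>\<^bsub>Qmod k X\<^esub>B\<in>hyps E. can k (B <#> L) (truncation (Suc k) (B <#> L) (line_lift L k E z)))"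
proof -
 interpret M: module R "Qmod k X" by (rule Qmod_module)
 have E': "E \<in> EA k" "E \<subseteq> omega X" using E els_omega[OF X] by auto
 note J = join_facts[OF om L_line E' LE] and w = line_lift[OF om L_line E' LE z]
 note EL = join_els[OF E LE]
 let ?f = "%A. can k A (truncation (Suc k) A (line_lift L k E z))"
 have f: "?f A \<in> carrier (Qmod k X)" if "A \<in> hyps (E <#> L)" for A
  by (rule can_closed[OF els_hyps[OF EL that]])
 have side: "(%B. B <#> L) ` hyps E = {A \<in> hyps (E <#> L). L \<subseteq> A} & inj_on (%B. B <#> L) (hyps E)"
 proof (cases k)
  case 0
  have "E = {\<one>}" using E'(1) 0 elem_ab_0 by simp
  hence "hyps (E <#> L) = {{\<one>}}" using hyps_rank_1[of "E <#> L"] J(1) 0 by simp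
  thus ?thesis using LE \<open>E = {\<one>}\<close> hyps_trivial[OF trivial_elem_ab] by auto
 next
  case (Suc j)
  have Ej: "E \<in> EA (Suc j)" using E'(1) Suc by simp
  have Jj: "E <#> L \<in> EA (Suc (Suc j))" using J(1) Suc by simp
  have B: "B <#> L \<in> hyps (E <#> L)" "L \<subseteq> B <#> L" "E Int (B <#> L) = B" if "B \<in> hyps E" for B
  proof -
   have B': "B \<in> EA j" "B \<subseteq> E" using hypsD[OF Ej that] .
   have "B \<subseteq> omega X" "~ L \<subseteq> B" using B' E' LE by auto
   note JB = join_facts[OF om L_line B'(1) this]
   have sub: "B <#> L \<subseteq> E <#> L" using B'(2) by (intro mono_set_mult) auto
   show "L \<subseteq> B <#> L" by (rule JB(3))
   show "B <#> L \<in> hyps (E <#> L)" using hyps_iff[OF Jj] JB(1) sub by blast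
   have "E Int (B <#> L) \<in> EA j"
    by (rule hyperplane_meet(1)[OF Jj Ej J(2) L_line(1) LE JB(1) sub JB(3)])
   moreover have "B \<subseteq> E Int (B <#> L)" using B'(2) JB(2) by auto
   ultimately show "E Int (B <#> L) = B" using elem_ab_subset_eq[OF B'(1)] by blast
  qed
  show ?thesis
  proof (intro conjI equalityI subsetI)
   fix A assume "A \<in> (%B. B <#> L) ` hyps E"
   thus "A \<in> {A \<in> hyps (E <#> L). L \<subseteq> A}" using B(1,2) by auto
  next
   fix A assume "A \<in> {A \<in> hyps (E <#> L). L \<subseteq> A}"
   hence A: "A \<in> EA (Suc j)" "A \<subseteq> E <#> L" "L \<subseteq> A" using hypsD[OF Jj] by auto
   note m = hyperplane_meet[OF Jj Ej J(2) L_line(1) LE A]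
   have "E Int A \<in> hyps E" using m(1) hyps_iff[OF Ej] by blast
   thus "A \<in> (%B. B <#> L) ` hyps E" using m(2) by (metis image_eqI)
  next
   show "inj_on (%B. B <#> L) (hyps E)" by (rule inj_on_inverseI[where g = "%A. E Int A"]) (rule B(3))
  qed
 qed
 have fin: "finite (hyps (E <#> L))" by (rule finite_hyps[OF J(1)])
 let ?H1 = "{A \<in> hyps (E <#> L). L \<subseteq> A}" and ?H2 = "{A \<in> hyps (E <#> L). ~ L \<subseteq> A}"
 have "bd k X (contraction L k X (can k E z)) = (\<Oplus>\<^bsub>Qmod k X\<^esub>A\<in>hyps (E <#> L). ?f A)"
  using contraction_can[OF E z] LE bd_can[OF EL w(1)] by simp
 also have "hyps (E <#> L) = ?H2 \<union> ?H1" by auto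
 also have "(\<Oplus>\<^bsub>Qmod k X\<^esub>A\<in>?H2 \<union> ?H1. ?f A) = (\<Oplus>\<^bsub>Qmod k X\<^esub>A\<in>?H2. ?f A) \<oplus>\<^bsub>Qmod k X\<^esub> (\<Oplus>\<^bsub>Qmod k X\<^esub>A\<in>?H1. ?f A)"
  using fin f by (intro M.finsum_Un_disjoint) auto
 also have "(\<Oplus>\<^bsub>Qmod k X\<^esub>A\<in>?H2. ?f A) = ?f E"
 proof (rule M.finsum_single)
  fix A assume A: "A \<in> ?H2" "A ~= E"
  have "truncation (Suc k) A (line_lift L k E z) = (%_. 0)" using w(3) A by auto
  moreover have "can k A (%_. 0) = \<zero>\<^bsub>Qmod k X\<^esub>"
   using A els_hyps[OF EL] by (intro additive_on_zero[OF steinberg_group Qmod_group can_additive]) auto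
  ultimately show "?f A = \<zero>\<^bsub>Qmod k X\<^esub>" by simp
 qed (use fin J(5) LE f in auto)
 also have "?f E = can k E z" using w(2) by simp
 also have "(\<Oplus>\<^bsub>Qmod k X\<^esub>A\<in>?H1. ?f A) = (\<Oplus>\<^bsub>Qmod k X\<^esub>B\<in>hyps E. ?f (B <#> L))"
  unfolding conjunct1[OF side, symmetric]
 proof (rule M.finsum_reindex)
  show "?f \<in> (%B. B <#> L) ` hyps E \<rightarrow> carrier (Qmod k X)"
   unfolding conjunct1[OF side] using f by auto
 qed (rule conjunct2[OF side])
 finally show ?thesis .
qed

lemma homotopy_0:
 assumes x: "x \<in> carrier (Qmod 0 X)"
 shows "bd 0 X (contraction L 0 X x) = x"
proof -
 interpret M: module R "Qmod 0 X" by (rule Qmod_module)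
 have "bd 0 X (contraction L 0 X x) = id x"
 proof (rule Qmod_hom_eqI[OF homs_comp[OF contraction_hom bd_hom] _ Qmod_module _ x])
  show "id \<in> module_homs R (Qmod 0 X) (Qmod 0 X)" by (simp add: module_homs_def)
  fix E z assume E: "E \<in> els 0 X" and z: "z \<in> St 0 E"
  have E1: "E = {\<one>}" using E els_0[OF X] by simp
  have LE: "~ L \<subseteq> E"
  proof
   assume "L \<subseteq> E"
   hence "L = {\<one>}" using E1 elem_abD(6)[OF L_line(1)] by auto
   thus False using L_line(1) elem_ab_rank_unique[OF trivial_elem_ab, of 1] by auto
  qed
  show "bd 0 X (contraction L 0 X (can 0 E z)) = id (can 0 E z)"
   using bd_contraction[OF E LE z] hyps_trivial[OF elsD(1)[OF E]] can_closed[OF E] by simp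
 qed
 thus ?thesis by simp
qed

lemma homotopy_Suc:
 assumes x: "x \<in> carrier (Qmod (Suc k) X)"
 shows "bd (Suc k) X (contraction L (Suc k) X x) \<oplus>\<^bsub>Qmod (Suc k) X\<^esub> contraction L k X (bd k X x) = x"
proof -
 let ?M = "Qmod (Suc k) X"
 interpret M: module R ?M by (rule Qmod_module)
 have "bd (Suc k) X (contraction L (Suc k) X x) \<oplus>\<^bsub>?M\<^esub> contraction L k X (bd k X x) = id x"
 proof (rule Qmod_hom_eqI[OF homs_sum[OF homs_comp[OF contraction_hom bd_hom]
    homs_comp[OF bd_hom contraction_hom] Qmod_module Qmod_module] _ Qmod_module _ x])
  show "id \<in> module_homs R ?M ?M" by (simp add: module_homs_def)
  fix E z assume E: "E \<in> els (Suc k) X" and z: "z \<in> St (Suc k) E"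
  have E': "E \<in> EA (Suc k)" "E \<subseteq> omega X" using E els_omega[OF X] by auto
  have A: "A \<in> els k X" "truncation (Suc k) A z \<in> St k A" "A \<in> EA k" "A \<subseteq> E" "A \<subseteq> omega X"
   if "A \<in> hyps E" for A
   using that els_hyps[OF E that] steinberg_truncation[OF E'(1) z that] hypsD[OF E'(1) that] E'(2) by auto
  have cE: "can (Suc k) E z \<in> carrier ?M" by (rule can_closed[OF E])
  define s where "s = (%A. if L \<subseteq> A then \<zero>\<^bsub>?M\<^esub> else can (Suc k) (A <#> L) (line_lift L k A (truncation (Suc k) A z)))"
  have s: "s A \<in> carrier ?M" if "A \<in> hyps E" for A
   using can_closed[OF join_els[OF A(1)[OF that]]] by (auto simp: s_def)
  have sbd: "contraction L k X (bd k X (can (Suc k) E z)) = (\<Oplus>\<^bsub>?M\<^esub>A\<in>hyps E. s A)"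
   unfolding Qmod_hom_can_sum[OF contraction_hom Qmod_module E z]
   using s by (intro M.finsum_cong'[OF refl]) (auto simp: s_def contraction_can A)
  show "bd (Suc k) X (contraction L (Suc k) X (can (Suc k) E z)) \<oplus>\<^bsub>?M\<^esub>
    contraction L k X (bd k X (can (Suc k) E z)) = id (can (Suc k) E z)"
  proof (cases "L \<subseteq> E")
   case True
   let ?I = "{A \<in> hyps E. ~ L \<subseteq> A}"
   have join: "A <#> L = E" if "A \<in> ?I" for A
   proof -
    have "A \<in> hyps E" "~ L \<subseteq> A" using that by auto
    thus ?thesis using line_join_unique[OF E'(1) A(3,4) L_line(1) True _ E'(1)] by blast
   qed
   have lS: "line_lift L k A (truncation (Suc k) A z) \<in> St (Suc k) E" if "A \<in> ?I" for A
   proof -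
    have "A \<in> hyps E" "~ L \<subseteq> A" using that by auto
    thus ?thesis using line_lift(1)[OF om L_line A(3,5) _ A(2)] join[OF that] by metis
   qed
   have "(\<Oplus>\<^bsub>?M\<^esub>A\<in>hyps E. s A) =
     (\<Oplus>\<^bsub>?M\<^esub>A\<in>?I. can (Suc k) E (line_lift L k A (truncation (Suc k) A z)))"
    using finite_hyps[OF E'(1)] join can_closed[OF E] s
    by (intro M.add.finprod_mono_neutral_cong_right) (auto simp: s_def)
   also have "... = can (Suc k) E (%si. \<Sum>A\<in>?I. line_lift L k A (truncation (Suc k) A z) si)"
    by (rule additive_on_sum[OF steinberg_group Qmod_group can_additive[OF E] lS, symmetric])
   also have "... = can (Suc k) E z" by (simp only: line_lift_full[OF om L_line E' True z])
   finally have "contraction L k X (bd k X (can (Suc k) E z)) = can (Suc k) E z" unfolding sbd .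
   moreover have "contraction L (Suc k) X (can (Suc k) E z) = \<zero>\<^bsub>Qmod (Suc (Suc k)) X\<^esub>"
    using contraction_can[OF E z] True by simp
   ultimately show ?thesis using homs_zero[OF bd_hom Qmod_module Qmod_module, of "Suc k" X] cE by simp
  next
   case False
   have neg: "can (Suc k) (A <#> L) (truncation (Suc (Suc k)) (A <#> L) (line_lift L (Suc k) E z)) \<in> carrier ?M"
    "can (Suc k) (A <#> L) (truncation (Suc (Suc k)) (A <#> L) (line_lift L (Suc k) E z)) \<oplus>\<^bsub>?M\<^esub> s A = \<zero>\<^bsub>?M\<^esub>"
    if A': "A \<in> hyps E" for A
   proof -
    have LA: "~ L \<subseteq> A" using A(4)[OF A'] False by auto
    note AL = join_els[OF A(1)[OF A'] LA]
    let ?l = "line_lift L k A (truncation (Suc k) A z)"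
    have lS: "?l \<in> St (Suc k) (A <#> L)" by (rule line_lift(1)[OF om L_line A(3,5)[OF A'] LA A(2)[OF A']])
    show c: "can (Suc k) (A <#> L) (truncation (Suc (Suc k)) (A <#> L) (line_lift L (Suc k) E z)) \<in> carrier ?M"
     by (rule can_closed[OF AL])
    have "can (Suc k) (A <#> L) (truncation (Suc (Suc k)) (A <#> L) (line_lift L (Suc k) E z)) =
      \<ominus>\<^bsub>?M\<^esub> can (Suc k) (A <#> L) ?l"
     unfolding line_lift_side[OF om L_line E' False z A']
     by (rule additive_on_neg[OF steinberg_group Qmod_group can_additive[OF AL] lS])
    thus "can (Suc k) (A <#> L) (truncation (Suc (Suc k)) (A <#> L) (line_lift L (Suc k) E z)) \<oplus>\<^bsub>?M\<^esub> s A = \<zero>\<^bsub>?M\<^esub>"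
     using LA can_closed[OF AL] by (simp add: s_def M.l_neg)
   qed
   let ?t = "%A. can (Suc k) (A <#> L) (truncation (Suc (Suc k)) (A <#> L) (line_lift L (Suc k) E z))"
   have t: "?t \<in> hyps E \<rightarrow> carrier ?M" "s \<in> hyps E \<rightarrow> carrier ?M" using neg(1) s by auto
   have "(\<Oplus>\<^bsub>?M\<^esub>A\<in>hyps E. ?t A) \<oplus>\<^bsub>?M\<^esub> (\<Oplus>\<^bsub>?M\<^esub>A\<in>hyps E. s A) = (\<Oplus>\<^bsub>?M\<^esub>A\<in>hyps E. ?t A \<oplus>\<^bsub>?M\<^esub> s A)"
    using t by (intro M.finsum_addf[symmetric])
   also have "... = \<zero>\<^bsub>?M\<^esub>" by (rule M.add.finprod_one_eqI) (rule neg(2))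
   finally have zero: "(\<Oplus>\<^bsub>?M\<^esub>A\<in>hyps E. ?t A) \<oplus>\<^bsub>?M\<^esub> (\<Oplus>\<^bsub>?M\<^esub>A\<in>hyps E. s A) = \<zero>\<^bsub>?M\<^esub>" .
   have c: "(\<Oplus>\<^bsub>?M\<^esub>A\<in>hyps E. ?t A) \<in> carrier ?M" "(\<Oplus>\<^bsub>?M\<^esub>A\<in>hyps E. s A) \<in> carrier ?M"
    using t by (auto intro: M.finsum_closed)
   show ?thesis unfolding sbd bd_contraction[OF E False z] M.add.m_assoc[OF cE c] zero using cE by simp
  qed
 qed
 thus ?thesis by simp
qed

end

lemma Q_exact_0:
 assumes X: "X \<in> Ob (sec_cat_star G)" and x: "x \<in> carrier (Qmod 0 X)"
 shows "EX y:carrier (Qmod 1 X). bd 0 X y = x"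
proof -
 obtain L where L: "L \<in> els 1 X" using star_line[OF X] .
 have Xs: "X \<in> sections G" using X star_section by simp
 obtain n where om: "omega X \<in> EA n" using exp_abelian_elem_ab[OF omega_exp_abelian[OF Xs]] by blast
 show ?thesis using homotopy_0[OF Xs L om x] homs_closed[OF contraction_hom[OF Xs L om] x] by auto
qed

lemma Q_exact_Suc:
 assumes X: "X \<in> Ob (sec_cat_star G)" and x: "x \<in> carrier (Qmod (Suc k) X)" and zero: "bd k X x = \<zero>\<^bsub>Qmod k X\<^esub>"
 shows "EX y:carrier (Qmod (Suc (Suc k)) X). bd (Suc k) X y = x"
proof -
 obtain L where L: "L \<in> els 1 X" using star_line[OF X] .
 have Xs: "X \<in> sections G" using X star_section by simp
 obtain n where om: "omega X \<in> EA n" using exp_abelian_elem_ab[OF omega_exp_abelian[OF Xs]] by blast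
 interpret M: module R "Qmod (Suc k) X" by (rule Qmod_module)
 note c = homs_closed[OF contraction_hom[OF Xs L om] x]
 have "contraction L k X (bd k X x) = \<zero>\<^bsub>Qmod (Suc k) X\<^esub>"
  unfolding zero by (rule homs_zero[OF contraction_hom[OF Xs L om] Qmod_module Qmod_module])
 hence "bd (Suc k) X (contraction L (Suc k) X x) = x"
  using homotopy_Suc[OF Xs L om x] homs_closed[OF bd_hom c] by simp
 thus ?thesis using c by blast
qed

subsection \<open>The augmentation\<close>

definition unit0 :: "'a set \<times> 'a set list => 'r"
 where "unit0 = unit_vec R ({\<one>}, [])"

lemma unit0_can: "unit0 = can 0 {\<one>} (dual 0 {\<one>} [])"
 unfolding unit0_def by (rule can_dual[OF trivial_elem_ab, symmetric]) (simp add: opp_0)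

lemma unit0_closed: "X \<in> sections G ==> unit0 \<in> carrier (Qmod 0 X)"
 unfolding unit0_can by (rule can_closed) (simp add: els_0)

lemma unit0_scale_inj:
 assumes "r \<in> carrier R" "r \<odot>\<^bsub>Qmod 0 X\<^esub> unit0 = \<zero>\<^bsub>Qmod 0 X\<^esub>"
 shows "r = \<zero>\<^bsub>R\<^esub>"
proof -
 have "r \<otimes>\<^bsub>R\<^esub> unit0 ({\<one>}, []) = \<zero>\<^bsub>R\<^esub>"
  using fun_cong[OF assms(2), of "({\<one>}, [])"] by (simp add: Qmod_def R.free_module_simps)
 thus ?thesis using assms(1) by (simp add: unit0_def unit_vec_def)
qed

lemma Qmod_0_scale:
 assumes X: "X \<in> sections G" and x: "x \<in> carrier (Qmod 0 X)"
 shows "x = x ({\<one>}, []) \<odot>\<^bsub>Qmod 0 X\<^esub> unit0" "x ({\<one>}, []) \<in> carrier R"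
proof -
 have q: "qindex 0 X = {({\<one>}, [])}" using els_0[OF X] by (auto simp: qindex_def opp_0)
 show "x ({\<one>}, []) \<in> carrier R" using x by (simp add: Qmod_def R.free_module_carrier)
 show "x = x ({\<one>}, []) \<odot>\<^bsub>Qmod 0 X\<^esub> unit0"
 proof
  fix i
  have "x i \<in> carrier R" "i ~= ({\<one>}, []) ==> x i = \<zero>\<^bsub>R\<^esub>"
   using x unfolding Qmod_def R.free_module_carrier q by (simp_all del: split_paired_All)
  thus "x i = (x ({\<one>}, []) \<odot>\<^bsub>Qmod 0 X\<^esub> unit0) i"
   using \<open>x ({\<one>}, []) \<in> carrier R\<close>
   by (cases "i = ({\<one>}, [])") (simp_all add: Qmod_def R.free_module_simps unit0_def unit_vec_def)
 qed
qed

lemma Qmap_unit0: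
 assumes X: "X \<in> sections G" and Y: "Y \<in> sections G" and g: "arrow X Y g"
 shows "Qmap 0 X Y (fst Y #> g) unit0 = unit0"
proof -
 have d: "dual 0 {\<one>} [] \<in> St 0 {\<one>}" using dual(1)[OF trivial_elem_ab] by (simp add: opp_0)
 have g1: "cj (inv g) {\<one>} = {\<one>}"
  using conj_set_trivial[OF inv_closed[OF arrow_carrier[OF g]], of "{\<one>}"] by blast
 have "cjc (inv g) (dual 0 {\<one>} []) = dual 0 {\<one>} []"
 proof
  fix si
  show "cjc (inv g) (dual 0 {\<one>} []) si = dual 0 {\<one>} [] si"
   using d by (cases si) (auto simp: conj_chain_def steinberg_low)
 qed
 moreover have "{\<one>} \<in> els 0 Y" using els_0[OF Y] by simp
 ultimately show ?thesis unfolding unit0_can using Qmap_hom(2)[OF X Y g _ d] g1 by simp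
qed

end

section \<open>Steinberg cochains\<close>

context p_group_ring
begin

interpretation R: cring R by (rule cring_R)

definition Fm :: "('r, 'a set \<times> 'a set, 'a set, 'm) catmod => 'a set \<times> 'a set => 'a set \<times> 'a set =>
  'a => 'm => 'm"
 where "Fm N X Y g = Fmap N X Y (fst Y #> g)"

abbreviation secs_cat :: "('a set \<times> 'a set) set => ('a set \<times> 'a set, 'a set) small_category"
 where "secs_cat Os \<equiv> (sec_cat G)\<lparr>Ob := Os\<rparr>"

definition secs_mod :: "('a set \<times> 'a set) set => ('r, 'a set \<times> 'a set, 'a set, 'm) catmod => bool"
 where "secs_mod Os N \<longleftrightarrow> Os \<subseteq> sections G & is_catmod (secs_cat Os) R N"

lemma arrow_Hom: "arrow X Y g ==> fst Y #> g \<in> Hom (secs_cat Os) X Y"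
 using Hom_iff[of "fst Y #> g" X Y] by auto

lemma secs_modD:
 assumes "secs_mod Os N"
 shows "X \<in> Os ==> X \<in> sections G" "X \<in> Os ==> module R (Fob N X)"
 using assms by (auto simp: secs_mod_def is_catmod_def)

lemma Fm_hom:
 assumes "secs_mod Os N" "X \<in> Os" "Y \<in> Os" "arrow X Y g"
 shows "Fm N X Y g \<in> module_homs R (Fob N Y) (Fob N X)"
 using is_catmodD(2)[of "secs_cat Os" R N X Y "fst Y #> g"] arrow_Hom[OF assms(4), of Os] assms(1-3)
 by (simp add: Fm_def secs_mod_def)

lemma Fm_comp:
 assumes "secs_mod Os N" "X \<in> Os" "Y \<in> Os" "Z \<in> Os" "arrow X Y g" "arrow Y Z h" "x \<in> elts N Z"
 shows "Fm N X Y g (Fm N Y Z h x) = Fm N X Z (h \<otimes> g) x"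
proof -
 have "Fmap N X Z (Comp (secs_cat Os) (fst Z #> h) (fst Y #> g)) x = Fmap N X Y (fst Y #> g) (Fmap N Y Z (fst Z #> h) x)"
  using assms arrow_Hom[OF assms(5), of Os] arrow_Hom[OF assms(6), of Os]
  by (intro is_catmodD(4)[of "secs_cat Os" R N]) (auto simp: secs_mod_def)
 moreover have "Comp (secs_cat Os) (fst Z #> h) (fst Y #> g) = fst Z #> (h \<otimes> g)"
  using coset_Comp[OF _ _ arrow_carrier[OF assms(5)] assms(6)] secs_modD(1)[OF assms(1)] assms(3,4)
  by (simp add: sec_cat_def)
 ultimately show ?thesis by (simp add: Fm_def)
qed

lemma Fm_one:
 assumes "secs_mod Os N" "X \<in> Os" "x \<in> elts N X"
 shows "Fm N X X \<one> x = x"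
 using is_catmodD(3)[of "secs_cat Os" R N X x] assms by (simp add: Fm_def secs_mod_def sec_cat_def)

lemma Fm_shift: "Y \<in> sections G ==> m \<in> fst Y ==> g \<in> carrier G ==> Fm N X Y (m \<otimes> g) = Fm N X Y g"
 by (simp add: Fm_def coset_shift)

lemma Fm_catmap:
 assumes "catmap (secs_cat Os) R N N' etg" "X \<in> Os" "Y \<in> Os" "arrow X Y g" "y \<in> elts N Y"
 shows "etg X (Fm N X Y g y) = Fm N' X Y g (etg Y y)"
 using catmapD(2)[OF assms(1), of X Y "fst Y #> g" y] arrow_Hom[OF assms(4), of Os] assms(2,3,5)
 by (simp add: Fm_def)

lemma catmap_secsI:
 assumes "Os \<subseteq> sections G" "!!X. X \<in> Os ==> etg X \<in> module_homs R (Fob N X) (Fob N' X)"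
  and "!!X Y g y. X \<in> Os ==> Y \<in> Os ==> arrow X Y g ==> y \<in> elts N Y ==>
   etg X (Fm N X Y g y) = Fm N' X Y g (etg Y y)"
 shows "catmap (secs_cat Os) R N N' etg" unfolding catmap_def
proof (intro conjI ballI)
 fix X Y c y assume *: "X \<in> Ob (secs_cat Os)" "Y \<in> Ob (secs_cat Os)" "c \<in> Hom (secs_cat Os) X Y" "y \<in> elts N Y"
 then obtain g where "arrow X Y g" "c = fst Y #> g" using Hom_iff[of c X Y] by auto
 thus "etg X (Fmap N X Y c y) = Fmap N' X Y c (etg Y y)" using assms(3)[of X Y g y] * by (simp add: Fm_def)
qed (use assms(2) in simp)

lemma catmap_subset: "catmap C R N N' etg ==> O' \<subseteq> Ob C ==> catmap (C\<lparr>Ob := O'\<rparr>) R N N' etg"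
 unfolding catmap_def by (simp add: subset_iff)

lemma Q_secs: "Os \<subseteq> sections G ==> secs_mod Os (Q k)"
 using is_catmod_restrict[OF Q_catmod, of Os] by (simp add: secs_mod_def sec_cat_def)

lemma Q_Fob: "Fob (Q k) = Qmod k" and Q_Fm: "Fm (Q k) X Y g = Qmap k X Y (fst Y #> g)"
 by (simp_all add: Q_def Fm_def)

lemma bd_secs: "Os \<subseteq> sections G ==> catmap (secs_cat Os) R (Q (Suc k)) (Q k) (bd k)"
 using catmap_subset[OF bd_catmap, of Os] by (simp add: sec_cat_def)

lemma Defres_Fm: "Defres G N Y X = Fm N X Y \<one>" by (simp add: Defres_def Fm_def)

lemma conj_map_Fm:
 assumes "g \<in> carrier G" "E \<in> EA k"
 shows "conj_map G N g (cs E) = Fm N (cs (cj g E)) (cs E) (inv g)"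
 unfolding conj_map_def Fm_def csec_conj[OF assms(1) elem_abD(4)[OF assms(2)]] ..

lemma arrow_csec_conj:
 assumes "g \<in> carrier G" "E \<in> EA k"
 shows "arrow (cs (cj g E)) (cs E) (inv g)"
proof -
 note EG = elem_abD(4)[OF assms(2)]
 have "sec_conj G (inv g) (cs (cj g E)) = cs E"
  unfolding csec_conj[OF inv_closed[OF assms(1)] conj_set_closed[OF assms(1) EG]]
   conj_inv_left[OF assms(1) EG] ..
 thus ?thesis
  using sec_le_refl[OF csec_section[OF assms(2)]] inv_closed[OF assms(1)] unfolding arrow_def by presburger
qed

lemma arrow_els_csec: "X \<in> sections G ==> E \<in> els k X ==> arrow X (cs E) \<one>"
 using arrow_one elsD(5) by blast

definition has_csec :: "('a set \<times> 'a set) set => nat => bool"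
 where "has_csec Os k \<longleftrightarrow> (ALL E:EA k. cs E \<in> Os)"

lemma has_csecD: "has_csec Os k ==> E \<in> EA k ==> cs E \<in> Os" by (simp add: has_csec_def)

lemma has_csec_star: "has_csec (Ob (sec_cat_star G)) (Suc k)" using csec_star by (simp add: has_csec_def)

lemma has_sections: "has_csec (sections G) k" using csec_section by (simp add: has_csec_def)

lemma conj_map_hom:
 assumes "secs_mod Os N" "has_csec Os k" "g \<in> carrier G" "E \<in> EA k"
 shows "conj_map G N g (cs E) \<in> module_homs R (Fob N (cs E)) (Fob N (cs (cj g E)))"
 unfolding conj_map_Fm[OF assms(3,4)] using has_csecD[OF assms(2)] assms(4) conj_elem_ab[OF assms(3,4)]
 by (intro Fm_hom[OF assms(1)] arrow_csec_conj[OF assms(3,4)]) auto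

lemma conj_map_mult:
 assumes N: "secs_mod Os N" and c: "has_csec Os k" and g: "g \<in> carrier G" and h: "h \<in> carrier G"
  and E: "E \<in> EA k" and x: "x \<in> elts N (cs E)"
 shows "conj_map G N (g \<otimes> h) (cs E) x = conj_map G N g (cs (cj h E)) (conj_map G N h (cs E) x)"
proof -
 note hE = conj_elem_ab[OF h E]
 note ghE = conj_elem_ab[OF g hE]
 have "conj_map G N g (cs (cj h E)) (conj_map G N h (cs E) x) =
   Fm N (cs (cj g (cj h E))) (cs E) (inv h \<otimes> inv g) x"
  unfolding conj_map_Fm[OF h E] conj_map_Fm[OF g hE]
  by (rule Fm_comp[OF N has_csecD[OF c ghE] has_csecD[OF c hE] has_csecD[OF c E]
    arrow_csec_conj[OF g hE] arrow_csec_conj[OF h E] x])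
 thus ?thesis unfolding conj_map_Fm[OF m_closed[OF g h] E] conj_set_mult[OF g h elem_abD(4)[OF E]]
  unfolding inv_mult_group[OF g h] by (rule sym)
qed

lemma conj_map_central:
 assumes N: "secs_mod Os N" and c: "has_csec Os k" and E: "E \<in> EA k"
  and g: "g \<in> centralizer G E" and x: "x \<in> elts N (cs E)"
 shows "conj_map G N g (cs E) x = x"
proof -
 note EG = elem_abD(4)[OF E]
 have gG: "g \<in> carrier G" using g by (simp add: centralizer_def)
 have gi: "inv g \<in> fst (cs E)"
  using subgroup.m_inv_closed[OF centralizer_subgroup[OF EG] g] by (simp add: csec_def)
 have "conj_map G N g (cs E) x = Fm N (cs E) (cs E) (inv g) x"
  unfolding conj_map_Fm[OF gG E] conj_set_central[OF EG g subset_refl] ..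
 also have "Fm N (cs E) (cs E) (inv g) = Fm N (cs E) (cs E) \<one>"
  using Fm_shift[OF csec_section[OF E] gi one_closed, of N "cs E"] inv_closed[OF gG] r_one[of "inv g"] by metis
 also have "Fm N (cs E) (cs E) \<one> x = x" by (rule Fm_one[OF N has_csecD[OF c E] x])
 finally show ?thesis .
qed

subsection \<open>Equivariant families\<close>

text \<open>Families over all \<open>E\<close>, not only over representatives; equivariance under \<open>G\<close> includes the one under
the normalizer of \<open>E\<close>.\<close>

definition is_cochain :: "nat => ('r, 'a set \<times> 'a set, 'a set, 'm) catmod =>
  ('a set => ('a set list => int) => 'm) => bool"
 where "is_cochain k N c \<longleftrightarrow> (ALL E:EA k. additive_on (St k E) (Fob N (cs E)) (c E)) &
  (ALL g:carrier G. ALL E:EA k. ALL z:St k E.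
   c (cj g E) (cjc g z) = conj_map G N g (cs E) (c E z))"

lemma is_cochainD:
 assumes "is_cochain k N c"
 shows "E \<in> EA k ==> additive_on (St k E) (Fob N (cs E)) (c E)"
  "g \<in> carrier G ==> E \<in> EA k ==> z \<in> St k E ==>
   c (cj g E) (cjc g z) = conj_map G N g (cs E) (c E z)"
  "E \<in> EA k ==> z \<in> St k E ==> c E z \<in> elts N (cs E)"
 using assms by (auto simp: is_cochain_def additive_on_def)

definition push :: "('a set \<times> 'a set => 'm => 'n) => ('a set => ('a set list => int) => 'm) =>
  'a set => ('a set list => int) => 'n"
 where "push etg c = (%E z. etg (cs E) (c E z))"

text \<open>The natural transformation from \<open>Q k\<close> that belongs to a cochain: an element of the Steinberg module of
\<open>E\<close>, seen at a section \<open>X\<close> below \<open>(C(E), E)\<close>, goes to the restriction of its value.\<close>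

definition ev :: "nat => ('r, 'a set \<times> 'a set, 'a set, 'm) catmod => ('a set => ('a set list => int) => 'm) =>
  'a set \<times> 'a set => ('a set \<times> 'a set list => 'r) => 'm"
 where "ev k N c X = Qext k (Fob N X) (%E z. Fm N X (cs E) \<one> (c E z))"

text \<open>The coboundary is composition with the boundary of \<open>Q\<close>. This form makes its formal properties
immediate; \<open>cob_sum\<close> gives the explicit sum.\<close>

definition cob :: "nat => ('r, 'a set \<times> 'a set, 'a set, 'm) catmod => ('a set => ('a set list => int) => 'm) =>
  'a set => ('a set list => int) => 'm"
 where "cob k N c = push (%X x. ev k N c X (bd k X x)) (can (Suc k))"

lemma push_cochain:
 assumes N: "secs_mod Os N" and k: "has_csec Os k" and etg: "catmap (secs_cat Os) R N N' etg" and c: "is_cochain k N c"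
 shows "is_cochain k N' (push etg c)" unfolding is_cochain_def
proof (intro conjI ballI)
 fix E assume E: "E \<in> EA k"
 show "additive_on (St k E) (Fob N' (cs E)) (push etg c E)" unfolding push_def
  using catmapD(1)[OF etg, of "cs E"] has_csecD[OF k E] by (intro additive_on_comp[OF is_cochainD(1)[OF c E]]) simp
next
 fix g E z assume g: "g \<in> carrier G" and E: "E \<in> EA k" and z: "z \<in> St k E"
 show "push etg c (cj g E) (cjc g z) = conj_map G N' g (cs E) (push etg c E z)"
  unfolding push_def is_cochainD(2)[OF c g E z] conj_map_Fm[OF g E]
  by (rule Fm_catmap[OF etg has_csecD[OF k conj_elem_ab[OF g E]] has_csecD[OF k E]
    arrow_csec_conj[OF g E] is_cochainD(3)[OF c E z]])
qed

lemma can_cochain: "is_cochain k (Q k) (can k)" unfolding is_cochain_def Q_Fob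
proof (intro conjI ballI)
 fix E assume E: "E \<in> EA k"
 show "additive_on (St k E) (Qmod k (cs E)) (can k E)" by (rule can_additive[OF csec_els[OF E]])
next
 fix g E z assume g: "g \<in> carrier G" and E: "E \<in> EA k" and z: "z \<in> St k E"
 have "conj_map G (Q k) g (cs E) (can k E z) =
   can k (cj (inv (inv g)) E) (cjc (inv (inv g)) z)" unfolding conj_map_Fm[OF g E] Q_Fm
  by (rule Qmap_hom(2)[OF csec_section[OF conj_elem_ab[OF g E]] csec_section[OF E] arrow_csec_conj[OF g E]
    csec_els[OF E] z])
 thus "can k (cj g E) (cjc g z) = conj_map G (Q k) g (cs E) (can k E z)" unfolding inv_inv[OF g] by simp
qed

context
 fixes Os N k c
 assumes N: "secs_mod Os N" and k: "has_csec Os k" and c: "is_cochain k N c"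
begin

lemma ev_additive:
 assumes X: "X \<in> Os" and E: "E \<in> els k X"
 shows "additive_on (St k E) (Fob N X) (%z. Fm N X (cs E) \<one> (c E z))"
 by (rule additive_on_comp[OF is_cochainD(1)[OF c elsD(1)[OF E]]
   Fm_hom[OF N X has_csecD[OF k elsD(1)[OF E]] arrow_els_csec[OF secs_modD(1)[OF N X] E]]])

lemma ev_hom: "X \<in> Os ==> ev k N c X \<in> module_homs R (Qmod k X) (Fob N X)"
 and ev_can: "X \<in> Os ==> E \<in> els k X ==> z \<in> St k E ==>
  ev k N c X (can k E z) = Fm N X (cs E) \<one> (c E z)"
 unfolding ev_def by (rule Qext_hom[OF secs_modD(2)[OF N] ev_additive]; assumption)+

lemma ev_self:
 assumes E: "E \<in> EA k" and z: "z \<in> St k E"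
 shows "ev k N c (cs E) (can k E z) = c E z" unfolding ev_can[OF has_csecD[OF k E] csec_els[OF E] z]
 by (rule Fm_one[OF N has_csecD[OF k E] is_cochainD(3)[OF c E z]])

lemma ev_catmap: "catmap (secs_cat Os) R (Q k) N (ev k N c)"
proof (rule catmap_secsI)
 show "Os \<subseteq> sections G" using N by (simp add: secs_mod_def)
 fix X assume X: "X \<in> Os"
 show "ev k N c X \<in> module_homs R (Fob (Q k) X) (Fob N X)" unfolding Q_Fob by (rule ev_hom[OF X])
 fix Y g y assume Y: "Y \<in> Os" and g: "arrow X Y g" and y: "y \<in> elts (Q k) Y"
 note Xs = secs_modD(1)[OF N X] and Ys = secs_modD(1)[OF N Y]
 show "ev k N c X (Fm (Q k) X Y g y) = Fm N X Y g (ev k N c Y y)" unfolding Q_Fm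
 proof (rule Qmod_hom_eqI[OF homs_comp[OF Qmap_hom(1)[OF Xs Ys g] ev_hom[OF X]]
    homs_comp[OF ev_hom[OF Y] Fm_hom[OF N X Y g]] secs_modD(2)[OF N X]])
  show "y \<in> carrier (Qmod k Y)" using y by (simp add: Q_Fob)
  fix E z assume E: "E \<in> els k Y" and z: "z \<in> St k E"
  let ?E = "cj (inv g) E"
  note Ek = elsD(1)[OF E] and gG = arrow_carrier[OF g]
  note gi = inv_closed[OF gG] and gE = arrow_els[OF Xs g E]
  note cE = is_cochainD(3)[OF c Ek z]
  have a1: "arrow X (cs ?E) \<one>" by (rule arrow_els_csec[OF Xs gE])
  have a2: "arrow Y (cs E) \<one>" by (rule arrow_els_csec[OF Ys E])
  note o1 = has_csecD[OF k elsD(1)[OF gE]] and o2 = has_csecD[OF k Ek]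
  have "ev k N c X (Qmap k X Y (fst Y #> g) (can k E z)) = Fm N X (cs ?E) \<one> (c ?E (cjc (inv g) z))"
   unfolding Qmap_hom(2)[OF Xs Ys g E z] by (rule ev_can[OF X gE conj_els_steinberg[OF g E z]])
  also have "... = Fm N X (cs ?E) \<one> (Fm N (cs ?E) (cs E) (inv (inv g)) (c E z))"
   unfolding is_cochainD(2)[OF c gi Ek z] conj_map_Fm[OF gi Ek] ..
  also have "... = Fm N X (cs E) (inv (inv g) \<otimes> \<one>) (c E z)"
   by (rule Fm_comp[OF N X o1 o2 a1 arrow_csec_conj[OF gi Ek] cE])
  also have "inv (inv g) \<otimes> \<one> = \<one> \<otimes> g" using gG by simp
  also have "Fm N X (cs E) (\<one> \<otimes> g) (c E z) = Fm N X Y g (Fm N Y (cs E) \<one> (c E z))"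
   by (rule Fm_comp[OF N X Y o2 g a2 cE, symmetric])
  finally show "ev k N c X (Qmap k X Y (fst Y #> g) (can k E z)) = Fm N X Y g (ev k N c Y (can k E z))"
   unfolding ev_can[OF Y E z] .
 qed
qed

lemma ev_push:
 assumes N': "secs_mod Os N'" and etg: "catmap (secs_cat Os) R N N' etg" and X: "X \<in> Os" and x: "x \<in> carrier (Qmod k X)"
 shows "ev k N' (push etg c) X x = etg X (ev k N c X x)"
proof -
 have hom: "ev k N' (push etg c) X \<in> module_homs R (Qmod k X) (Fob N' X)"
  and can: "!!E z. E \<in> els k X ==> z \<in> St k E ==>
   ev k N' (push etg c) X (can k E z) = Fm N' X (cs E) \<one> (push etg c E z)"
 proof -
  have add: "additive_on (St k E) (Fob N' X) (%z. Fm N' X (cs E) \<one> (push etg c E z))" if E: "E \<in> els k X" for E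
   by (rule additive_on_comp[OF is_cochainD(1)[OF push_cochain[OF N k etg c] elsD(1)[OF E]]
     Fm_hom[OF N' X has_csecD[OF k elsD(1)[OF E]] arrow_els_csec[OF secs_modD(1)[OF N' X] E]]])
  show "ev k N' (push etg c) X \<in> module_homs R (Qmod k X) (Fob N' X)"
   unfolding ev_def by (rule Qext_hom(1)[OF secs_modD(2)[OF N' X] add])
  show "ev k N' (push etg c) X (can k E z) = Fm N' X (cs E) \<one> (push etg c E z)"
   if "E \<in> els k X" "z \<in> St k E" for E z
   unfolding ev_def by (rule Qext_hom(2)[OF secs_modD(2)[OF N' X] add that])
 qed
 have etgX: "etg X \<in> module_homs R (Fob N X) (Fob N' X)" using catmapD(1)[OF etg, of X] X by simp
 show ?thesis
 proof (rule Qmod_hom_eqI[OF hom homs_comp[OF ev_hom[OF X] etgX] secs_modD(2)[OF N' X] _ x])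
  fix E z assume E: "E \<in> els k X" and z: "z \<in> St k E"
  show "ev k N' (push etg c) X (can k E z) = etg X (ev k N c X (can k E z))"
   unfolding can[OF E z] ev_can[OF X E z] unfolding push_def
   by (rule Fm_catmap[OF etg X has_csecD[OF k elsD(1)[OF E]] arrow_els_csec[OF secs_modD(1)[OF N X] E]
     is_cochainD(3)[OF c elsD(1)[OF E] z], symmetric])
 qed
qed

lemma cob_catmap: "catmap (secs_cat Os) R (Q (Suc k)) N (%X x. ev k N c X (bd k X x))"
 using N by (intro catmap_comp[OF bd_secs ev_catmap]) (simp add: secs_mod_def)

lemma cob_cochain: "has_csec Os (Suc k) ==> is_cochain (Suc k) N (cob k N c)"
 unfolding cob_def using N by (intro push_cochain[OF Q_secs _ cob_catmap can_cochain]) (simp_all add: secs_mod_def)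

lemma cob_sum:
 assumes k': "has_csec Os (Suc k)" and E: "E \<in> EA (Suc k)" and z: "z \<in> St (Suc k) E"
 shows "cob k N c E z = (\<Oplus>\<^bsub>Fob N (cs E)\<^esub>A\<in>hyps E.
  Fm N (cs E) (cs A) \<one> (c A (truncation (Suc k) A z)))"
proof -
 note EO = has_csecD[OF k' E]
 interpret M: module R "Fob N (cs E)" by (rule secs_modD(2)[OF N EO])
 have "cob k N c E z = (\<Oplus>\<^bsub>Fob N (cs E)\<^esub>A\<in>hyps E. ev k N c (cs E) (can k A (truncation (Suc k) A z)))"
  unfolding cob_def push_def by (rule Qmod_hom_can_sum[OF ev_hom[OF EO] secs_modD(2)[OF N EO] csec_els[OF E] z])
 also have "... = (\<Oplus>\<^bsub>Fob N (cs E)\<^esub>A\<in>hyps E. Fm N (cs E) (cs A) \<one> (c A (truncation (Suc k) A z)))"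
 proof (rule M.finsum_cong'[OF refl])
  have A: "A \<in> els k (cs E)" "truncation (Suc k) A z \<in> St k A" if "A \<in> hyps E" for A
   using els_hyps[OF csec_els[OF E] that] steinberg_truncation[OF E z that] by auto
  show "ev k N c (cs E) (can k A (truncation (Suc k) A z)) =
    Fm N (cs E) (cs A) \<one> (c A (truncation (Suc k) A z))" if "A \<in> hyps E" for A
   by (rule ev_can[OF EO A[OF that]])
  show "(%A. Fm N (cs E) (cs A) \<one> (c A (truncation (Suc k) A z))) \<in> hyps E \<rightarrow> elts N (cs E)"
   using additive_onD(1)[OF ev_additive[OF EO A(1)] A(2)] by blast
 qed
 finally show ?thesis .
qed

end

lemma ev_cong:
 assumes "!!E z. E \<in> EA k ==> z \<in> St k E ==> c E z = c' E z" and x: "x \<in> carrier (Qmod k X)"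
  and M: "module R (Fob N X)" and cl: "!!E z. E \<in> els k X ==> z \<in> St k E ==> Fm N X (cs E) \<one> (c' E z) \<in> elts N X"
 shows "ev k N c X x = ev k N c' X x"
proof -
 interpret M: module R "Fob N X" by (rule M)
 have i: "E \<in> els k X" "si \<in> opp k E" if "x (E, si) ~= \<zero>\<^bsub>R\<^esub>" for E si
 proof -
  have "(E, si) \<in> qindex k X" using x that unfolding Qmod_def R.free_module_carrier by blast
  thus "E \<in> els k X" "si \<in> opp k E" by (simp_all add: qindex_def)
 qed
 have xR: "x i \<in> carrier R" for i using x unfolding Qmod_def R.free_module_carrier by blast
 show ?thesis unfolding ev_def Qext_def lin_ext_def
 proof (rule M.finsum_cong'[OF refl])
  show "(%i. x i \<odot>\<^bsub>Fob N X\<^esub> (case i of (E, si) => Fm N X (cs E) \<one> (c' E (dual k E si)))) \<in>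
    {i. x i ~= \<zero>\<^bsub>R\<^esub>} \<rightarrow> elts N X"
   using xR cl[OF i(1) dual(1)[OF elsD(1)[OF i(1)] i(2)]] by (auto intro!: M.smult_closed)
  fix j assume "j \<in> {i. x i ~= \<zero>\<^bsub>R\<^esub>}"
  moreover obtain E si where j: "j = (E, si)" by (cases j)
  ultimately have "E \<in> els k X" "si \<in> opp k E" using i by auto
  thus "x j \<odot>\<^bsub>Fob N X\<^esub> (case j of (E, si) => Fm N X (cs E) \<one> (c E (dual k E si))) =
    x j \<odot>\<^bsub>Fob N X\<^esub> (case j of (E, si) => Fm N X (cs E) \<one> (c' E (dual k E si)))"
   unfolding j using assms(1)[OF elsD(1) dual(1)[OF elsD(1)]] by simp
 qed
qed

lemma ev_can_id:
 assumes Os: "Os \<subseteq> sections G" and k: "has_csec Os k" and X: "X \<in> Os" and x: "x \<in> carrier (Qmod k X)"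
 shows "ev k (Q k) (can k) X x = x"
proof -
 note S = Q_secs[OF Os, of k]
 note evh = ev_hom[OF S k can_cochain X, unfolded Q_Fob] and evc = ev_can[OF S k can_cochain X]
 have Xs: "X \<in> sections G" using X Os by auto
 have "ev k (Q k) (can k) X x = id x"
 proof (rule Qmod_hom_eqI[OF evh _ Qmod_module _ x])
  show "id \<in> module_homs R (Qmod k X) (Qmod k X)" by (simp add: module_homs_def)
  fix E z assume E: "E \<in> els k X" and z: "z \<in> St k E"
  note Ek = elsD(1)[OF E]
  have "cj (inv \<one>) E = E" "cjc (inv \<one>) z = z"
   using conj_set_one[OF elem_abD(4)[OF Ek]] conj_chain_one[OF z] inv_one by metis+
  thus "ev k (Q k) (can k) X (can k E z) = id (can k E z)"
   unfolding evc[OF E z] Q_Fm Qmap_hom(2)[OF Xs csec_section[OF Ek] arrow_els_csec[OF Xs E] csec_els[OF Ek] z]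
   by (simp only: id_apply)
 qed
 thus ?thesis by simp
qed

lemma ev_cob:
 assumes N: "secs_mod Os N" and k: "has_csec Os k" "has_csec Os (Suc k)" and c: "is_cochain k N c"
  and X: "X \<in> Os" and x: "x \<in> carrier (Qmod (Suc k) X)"
 shows "ev (Suc k) N (cob k N c) X x = ev k N c X (bd k X x)"
proof -
 have Os: "Os \<subseteq> sections G" using N by (simp add: secs_mod_def)
 show ?thesis unfolding cob_def ev_push[OF Q_secs[OF Os] k(2) can_cochain N cob_catmap[OF N k(1) c] X x]
   ev_can_id[OF Os k(2) X x] ..
qed

lemma cob_cob:
 assumes N: "secs_mod Os N" and k: "has_csec Os k" "has_csec Os (Suc k)" "has_csec Os (Suc (Suc k))" and c: "is_cochain k N c"
  and E: "E \<in> EA (Suc (Suc k))" and z: "z \<in> St (Suc (Suc k)) E"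
 shows "cob (Suc k) N (cob k N c) E z = \<zero>\<^bsub>Fob N (cs E)\<^esub>"
proof -
 note EO = has_csecD[OF k(3) E] and cE = can_closed[OF csec_els[OF E], of z]
 have "cob (Suc k) N (cob k N c) E z = ev k N c (cs E) (bd k (cs E) (bd (Suc k) (cs E) (can (Suc (Suc k)) E z)))"
  unfolding cob_def[of "Suc k"] push_def by (rule ev_cob[OF N k(1,2) c EO homs_closed[OF bd_hom cE]])
 also have "... = \<zero>\<^bsub>Fob N (cs E)\<^esub>"
  unfolding bd_bd[OF cE] by (rule homs_zero[OF ev_hom[OF N k(1) c EO] Qmod_module secs_modD(2)[OF N EO]])
 finally show ?thesis .
qed

lemma cob_push:
 assumes N: "secs_mod Os N" and N': "secs_mod Os N'" and k: "has_csec Os k" "has_csec Os (Suc k)"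
  and etg: "catmap (secs_cat Os) R N N' etg" and c: "is_cochain k N c"
  and E: "E \<in> EA (Suc k)" and z: "z \<in> St (Suc k) E"
 shows "cob k N' (push etg c) E z = etg (cs E) (cob k N c E z)"
 unfolding cob_def push_def[of _ "can (Suc k)"]
 by (rule ev_push[OF N k(1) c N' etg has_csecD[OF k(2) E] homs_closed[OF bd_hom can_closed[OF csec_els[OF E]]]])

end

lemma module_homs_int:
 fixes n :: int
 assumes "h \<in> module_homs R M N" "module R M" "module R N" "x \<in> carrier M"
 shows "h ([n] \<cdot>\<^bsub>M\<^esub> x) = [n] \<cdot>\<^bsub>N\<^esub> h x"
proof -
 interpret M: module R M by fact
 interpret N: module R N by fact
 show ?thesis using assms(4) homs_closed[OF assms(1,4)]
  by (simp add: M.int_smult[symmetric] N.int_smult[symmetric] homs_smult[OF assms(1)])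
qed

context p_group_ring
begin

interpretation R: cring R by (rule cring_R)

subsection \<open>Extension from representatives\<close>

definition rep_cochain :: "nat => ('r, 'a set \<times> 'a set, 'a set, 'm) catmod => 'a set =>
  (('a set list => int) => 'm) => bool"
 where "rep_cochain k N E d \<longleftrightarrow> additive_on (St k E) (Fob N (cs E)) d &
  (ALL g:normalizer G E. ALL z:St k E. d (cjc g z) = conj_map G N g (cs E) (d z))"

lemma cochain_rep:
 assumes "is_cochain k N c" "E \<in> EA k"
 shows "rep_cochain k N E (c E)" unfolding rep_cochain_def
proof (intro conjI ballI)
 show "additive_on (St k E) (Fob N (cs E)) (c E)" by (rule is_cochainD(1)[OF assms])
 fix g z assume "g \<in> normalizer G E" and z: "z \<in> St k E"
 hence g: "g \<in> carrier G" "cj g E = E" using normalizer_iff[OF elem_abD(4)[OF assms(2)]] by auto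
 show "c E (cjc g z) = conj_map G N g (cs E) (c E z)"
  using is_cochainD(2)[OF assms(1) g(1) assms(2) z] unfolding g(2) .
qed

context
 fixes \<E> :: "nat => 'a set set" and k :: nat
 assumes reps: "conj_representatives G p k (\<E> k)"
begin

lemma repsD: "E \<in> \<E> k ==> E \<in> EA k" using reps by (auto simp: conj_representatives_def)

lemma reps_ex1: "A \<in> EA k ==> \<exists>!E. E \<in> \<E> k & (EX g:carrier G. A = cj g E)"
 using reps unfolding conj_representatives_def by simp

lemma reps_unique:
 assumes "E \<in> \<E> k" "E' \<in> \<E> k" "g \<in> carrier G" "h \<in> carrier G" "cj g E = cj h E'"
 shows "E' = E" using reps_ex1[OF conj_elem_ab[OF assms(3) repsD[OF assms(1)]]]
proof (rule ex1E)
 fix D assume D: "ALL F. F \<in> \<E> k & (EX h:carrier G. cj g E = cj h F) --> F = D"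
 have "E = D" by (rule D[rule_format]) (use assms(1,3) in simp, rule bexI[of _ g], simp_all)
 moreover have "E' = D" by (rule D[rule_format]) (use assms(2,4,5) in simp, rule bexI[of _ h], simp_all)
 ultimately show ?thesis by simp
qed

lemma reps_cases:
 assumes A: "A \<in> EA k" and z: "z \<in> St k A"
 obtains g E w where "g \<in> carrier G" "E \<in> \<E> k" "A = cj g E" "w \<in> St k E" "z = cjc g w"
proof -
 from ex1_implies_ex[OF reps_ex1[OF A]] obtain g E where gE: "g \<in> carrier G" "E \<in> \<E> k" "A = cj g E"
  by (elim exE conjE bexE)
 note EG = elem_abD(4)[OF repsD[OF gE(2)]]
 have "cjc (inv g) z \<in> St k E" using conj_steinberg[OF inv_closed[OF gE(1)] elem_abD(4)[OF A] z]
  unfolding gE(3) conj_inv_left[OF gE(1) EG] .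
 thus thesis using that[OF gE] conj_chain_inv(2)[OF gE(1) z] by metis
qed

lemma extend_cochain_conj:
 assumes N: "secs_mod Os N" and k: "has_csec Os k" and d: "rep_cochain k N E (d E)" and E: "E \<in> \<E> k"
  and g: "g \<in> carrier G" and w: "w \<in> St k E"
 shows "extend_cochain G \<E> N k d (cj g E) (cjc g w) = conj_map G N g (cs E) (d E w)"
proof -
 note Ek = repsD[OF E]
 note EG = elem_abD(4)[OF Ek]
 let ?P = "%(h, E'). h \<in> carrier G & E' \<in> \<E> k & cj g E = cj h E'"
 obtain h E' where hE: "(SOME x. ?P x) = (h, E')" by (cases "SOME x. ?P x")
 have "?P (SOME x. ?P x)" by (rule someI[of ?P "(g, E)"]) (use g E in simp)
 hence h: "h \<in> carrier G" "E' \<in> \<E> k" "cj g E = cj h E'" unfolding hE by auto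
 have E': "E' = E" by (rule reps_unique[OF E h(2) g h(1,3)])
 define n where "n = inv h \<otimes> g"
 have nG: "n \<in> carrier G" using g h by (simp add: n_def)
 have nE: "cj n E = E"
  unfolding n_def conj_set_mult[OF inv_closed[OF h(1)] g EG] h(3)[unfolded E'] by (rule conj_inv_left[OF h(1) EG])
 hence nN: "n \<in> normalizer G E" using nG normalizer_iff[OF EG] by simp
 have hn: "h \<otimes> n = g" using g h by (simp add: n_def flip: m_assoc)
 have dE: "d E w \<in> elts N (cs E)" using d w by (auto simp: rep_cochain_def additive_on_def)
 have "extend_cochain G \<E> N k d (cj g E) (cjc g w) =
   conj_map G N h (cs E) (d E (cjc (inv h) (cjc g w)))"
  unfolding extend_cochain_def hE[unfolded E'] Let_def by simp
 also have "cjc (inv h) (cjc g w) = cjc n w"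
  unfolding n_def by (rule conj_chain_mult[OF inv_closed[OF h(1)] g, symmetric])
 also have "d E (cjc n w) = conj_map G N n (cs E) (d E w)" using d nN w by (simp add: rep_cochain_def)
 also have "conj_map G N h (cs E) (conj_map G N n (cs E) (d E w)) = conj_map G N (h \<otimes> n) (cs E) (d E w)"
  using conj_map_mult[OF N k h(1) nG Ek dE] unfolding nE by simp
 finally show ?thesis unfolding hn .
qed

lemma extend_cochain_rep:
 assumes N: "secs_mod Os N" and k: "has_csec Os k" and d: "rep_cochain k N E (d E)" and E: "E \<in> \<E> k"
  and w: "w \<in> St k E"
 shows "extend_cochain G \<E> N k d E w = d E w"
proof -
 note Ek = repsD[OF E]
 have one: "\<one> \<in> centralizer G E" using elem_abD(4)[OF Ek] by (auto simp: centralizer_def)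
 have dE: "d E w \<in> elts N (cs E)" using d w by (auto simp: rep_cochain_def additive_on_def)
 show ?thesis using extend_cochain_conj[where d = d and E = E, OF N k d E one_closed w]
  unfolding conj_set_one[OF elem_abD(4)[OF Ek]] conj_chain_one[OF w] conj_map_central[OF N k Ek one dE] .
qed

lemma extend_cochain_is_cochain:
 assumes N: "secs_mod Os N" and k: "has_csec Os k" and d: "!!E. E \<in> \<E> k ==> rep_cochain k N E (d E)"
 shows "is_cochain k N (extend_cochain G \<E> N k d)" unfolding is_cochain_def
proof (intro conjI ballI)
 let ?e = "extend_cochain G \<E> N k d"
 have dE: "d E w \<in> elts N (cs E)" "w' \<in> St k E ==>
   d E (%x. w x + w' x) = d E w \<oplus>\<^bsub>Fob N (cs E)\<^esub> d E w'" if "E \<in> \<E> k" "w \<in> St k E" for E w w'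
  using d[OF that(1)] that(2) by (auto simp: rep_cochain_def additive_on_def)
 fix A assume A: "A \<in> EA k"
 show "additive_on (St k A) (Fob N (cs A)) (?e A)" unfolding additive_on_def
 proof (intro conjI ballI)
  fix z assume z: "z \<in> St k A"
  obtain g E w where g: "g \<in> carrier G" and E: "E \<in> \<E> k" and AE: "A = cj g E"
   and w: "w \<in> St k E" and zw: "z = cjc g w" using reps_cases[OF A z] .
  note hom = conj_map_hom[OF N k g repsD[OF E]]
  show "?e A z \<in> elts N (cs A)"
   unfolding AE zw extend_cochain_conj[where d = d and E = E, OF N k d[OF E] E g w]
   by (rule homs_closed[OF hom dE(1)[OF E w]])
  fix z' assume z': "z' \<in> St k A"
  define w' where "w' = cjc (inv g) z'"
  have w': "w' \<in> St k E" using conj_steinberg[OF inv_closed[OF g] elem_abD(4)[OF A] z']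
   unfolding w'_def AE conj_inv_left[OF g elem_abD(4)[OF repsD[OF E]]] .
  have zw': "z' = cjc g w'" unfolding w'_def by (rule conj_chain_inv(2)[OF g z', symmetric])
  have ww: "(%x. w x + w' x) \<in> St k E" by (rule int_groupD(2)[OF steinberg_group w w'])
  show "?e A (%x. z x + z' x) = ?e A z \<oplus>\<^bsub>Fob N (cs A)\<^esub> ?e A z'"
   unfolding AE zw zw' conj_chain_add[symmetric] extend_cochain_conj[where d = d and E = E, OF N k d[OF E] E g w]
    extend_cochain_conj[where d = d and E = E, OF N k d[OF E] E g w'] extend_cochain_conj[where d = d and E = E, OF N k d[OF E] E g ww] dE(2)[OF E w w']
   by (rule homs_add[OF hom dE(1)[OF E w] dE(1)[OF E w']])
 qed
 fix h z assume h: "h \<in> carrier G" and z: "z \<in> St k A"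
 obtain g E w where g: "g \<in> carrier G" and E: "E \<in> \<E> k" and AE: "A = cj g E"
  and w: "w \<in> St k E" and zw: "z = cjc g w" using reps_cases[OF A z] .
 have "cj h A = cj (h \<otimes> g) E" "cjc h z = cjc (h \<otimes> g) w"
  unfolding AE zw conj_set_mult[OF h g elem_abD(4)[OF repsD[OF E]]] conj_chain_mult[OF h g] by (rule refl)+
 thus "?e (cj h A) (cjc h z) = conj_map G N h (cs A) (?e A z)"
  unfolding AE zw using extend_cochain_conj[where d = d and E = E, OF N k d[OF E] E m_closed[OF h g] w]
   extend_cochain_conj[where d = d and E = E, OF N k d[OF E] E g w] conj_map_mult[OF N k h g repsD[OF E] dE(1)[OF E w]]
  by metis
qed

lemma extend_cochain_eq:
 assumes N: "secs_mod Os N" and k: "has_csec Os k" and c: "is_cochain k N c"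
  and d: "!!E w. E \<in> \<E> k ==> w \<in> St k E ==> d E w = c E w"
  and A: "A \<in> EA k" and z: "z \<in> St k A"
 shows "extend_cochain G \<E> N k d A z = c A z"
proof -
 obtain g E w where g: "g \<in> carrier G" and E: "E \<in> \<E> k" and AE: "A = cj g E"
  and w: "w \<in> St k E" and zw: "z = cjc g w" using reps_cases[OF A z] .
 have "additive_on (St k E) (Fob N (cs E)) (d E)"
  using is_cochainD(1)[OF c repsD[OF E]] d[OF E] int_groupD(2)[OF steinberg_group]
  by (simp add: additive_on_def)
 moreover have "d E (cjc h v) = conj_map G N h (cs E) (d E v)"
  if "h \<in> normalizer G E" "v \<in> St k E" for h v
 proof -
  have h: "h \<in> carrier G" "cj h E = E"
   using that(1) normalizer_iff[OF elem_abD(4)[OF repsD[OF E]]] by auto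
  have "cjc h v \<in> St k E" using conj_steinberg[OF h(1) elem_abD(4)[OF repsD[OF E]] that(2)] h(2) by simp
  thus ?thesis using d[OF E] that(2) cochain_rep[OF c repsD[OF E]] that(1) by (simp add: rep_cochain_def)
 qed
 ultimately have dr: "rep_cochain k N E (d E)" by (simp add: rep_cochain_def)
 show ?thesis
  unfolding AE zw extend_cochain_conj[where d = d and E = E, OF N k dr E g w] is_cochainD(2)[OF c g repsD[OF E] w] d[OF E w] ..
qed

end

subsection \<open>Lifting cochains\<close>

lemma conj_chain_dual:
 assumes E: "E \<in> EA k" and g: "g \<in> normalizer G E" and si: "si \<in> opp k E"
 shows "cjc g (dual k E si) = dual k E (map (cj g) si)"
proof -
 have gG: "g \<in> carrier G" and gE: "cj g E = E" using g normalizer_iff[OF elem_abD(4)[OF E]] by auto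
 have giN: "inv g \<in> normalizer G E"
  by (rule subgroup.m_inv_closed[OF normalizer_imp_subgroup[OF elem_abD(4)[OF E]] g])
 note gsi = opp_conj[OF E g si]
 have gS: "cjc g (dual k E si) \<in> St k E"
  using conj_steinberg[OF gG elem_abD(4)[OF E] dual(1)[OF E si]] gE by simp
 have "cjc g (dual k E si) ta = dual k E (map (cj g) si) ta" if ta: "ta \<in> opp k E" for ta
 proof -
  have car: "ALL H:set ta. H \<subseteq> carrier G" by (rule chain_carrier[OF opp_chain[OF ta]])
  have carsi: "ALL H:set si. H \<subseteq> carrier G" by (rule chain_carrier[OF opp_chain[OF si]])
  have "cjc g (dual k E si) ta = dual k E si (map (cj (inv g)) ta)"
   using car unfolding conj_chain_def by presburger
  also have "... = (if map (cj (inv g)) ta = si then 1 else 0)"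
   by (rule dual(2)[OF E si opp_conj[OF E giN ta]])
  also have "map (cj (inv g)) ta = si \<longleftrightarrow> ta = map (cj g) si"
   using map_conj_set_inv[OF gG car] map_conj_set_inv[OF gG carsi] by metis
  finally show ?thesis using dual(2)[OF E gsi ta] by simp
 qed
 hence "(%x. \<Sum>ta\<in>opp k E. cjc g (dual k E si) ta * dual k E ta x) =
   (%x. \<Sum>ta\<in>opp k E. dual k E (map (cj g) si) ta * dual k E ta x)" by simp
 thus ?thesis using steinberg_expand[OF E gS] steinberg_expand[OF E dual(1)[OF E gsi]] by metis
qed

text \<open>As the normalizer permutes the opposite flags, with stabilizers that act trivially on
\<open>N (C(E), E)\<close>, a choice of lifts at orbit representatives extends equivariantly.\<close>

lemma opp_equivariant_lift:
 assumes N1: "secs_mod Os N1" and N2: "secs_mod Os N2" and k: "has_csec Os k"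
  and f: "catmap (secs_cat Os) R N1 N2 f" and c: "is_cochain k N2 c" and E: "E \<in> EA k"
  and im: "!!z. z \<in> St k E ==> c E z \<in> f (cs E) ` elts N1 (cs E)"
 shows "EX v. (ALL si:opp k E. v si \<in> elts N1 (cs E) & f (cs E) (v si) = c E (dual k E si)) &
  (ALL si:opp k E. ALL g:normalizer G E. v (map (cj g) si) = conj_map G N1 g (cs E) (v si))"
proof -
 let ?N = "normalizer G E" and ?X = "cs E" and ?f = "f (cs E)"
 let ?M = "Fob N1 ?X" and ?a = "%g. map (cj g)" and ?cm = "%g. conj_map G N1 g ?X"
 note EG = elem_abD(4)[OF E]
 have Ns: "subgroup ?N G" by (rule normalizer_imp_subgroup[OF EG])
 have NG: "g \<in> carrier G" "cj g E = E" if "g \<in> ?N" for g using that normalizer_iff[OF EG] by auto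
 have car: "ALL H:set si. H \<subseteq> carrier G" if "si \<in> opp k E" for si
  by (rule chain_carrier[OF opp_chain[OF that]])
 have cm: "?cm g x \<in> carrier ?M" "?f (?cm g x) = conj_map G N2 g ?X (?f x)"
  if g: "g \<in> ?N" and x: "x \<in> carrier ?M" for g x
 proof -
  note o = has_csecD[OF k E] and ar = arrow_csec_conj[OF NG(1)[OF g] E, unfolded NG(2)[OF g]]
  show "?cm g x \<in> carrier ?M"
   using homs_closed[OF conj_map_hom[OF N1 k NG(1)[OF g] E] x] unfolding NG(2)[OF g] .
  show "?f (?cm g x) = conj_map G N2 g ?X (?f x)"
   unfolding conj_map_Fm[OF NG(1)[OF g] E] NG(2)[OF g] by (rule Fm_catmap[OF f o o ar x])
 qed
 have cm_mult: "?cm (g \<otimes> h) x = ?cm g (?cm h x)" if "g \<in> ?N" "h \<in> ?N" "x \<in> carrier ?M" for g h x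
  using conj_map_mult[OF N1 k NG(1)[OF that(1)] NG(1)[OF that(2)] E that(3)] unfolding NG(2)[OF that(2)] .
 have "EX m. m \<in> carrier ?M & ?f m = c E (dual k E si)" if "si \<in> opp k E" for si
  using im[OF dual(1)[OF E that]] by (metis imageE)
 then obtain m where m: "!!si. si \<in> opp k E ==> m si \<in> carrier ?M & ?f (m si) = c E (dual k E si)"
  by metis
 define orb where "orb = (%si. {?a g si | g. g \<in> ?N})"
 define r where "r = (%si. SOME ta. ta \<in> orb si)"
 define v where "v = (%si. ?cm (SOME g. g \<in> ?N & si = ?a g (r si)) (m (r si)))"
 have amult: "?a (g \<otimes> h) si = ?a g (?a h si)" if "g \<in> ?N" "h \<in> ?N" "si \<in> opp k E" for g h si
  by (rule map_conj_set_mult[OF NG(1)[OF that(1)] NG(1)[OF that(2)] car[OF that(3)]])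
 have ainv: "?a (inv g) (?a g si) = si" if "g \<in> ?N" "si \<in> opp k E" for g si
  by (rule map_conj_set_inv(1)[OF NG(1)[OF that(1)] car[OF that(2)]])
 have ginv: "inv g \<in> ?N" if "g \<in> ?N" for g by (rule subgroup.m_inv_closed[OF Ns that])
 have gmul: "g \<otimes> h \<in> ?N" if "g \<in> ?N" "h \<in> ?N" for g h by (rule subgroup.m_closed[OF Ns that])
 have r: "EX g:?N. si = ?a g (r si)" "r si \<in> opp k E" if si: "si \<in> opp k E" for si
 proof -
  have "?a \<one> si \<in> orb si" using subgroup.one_closed[OF Ns] unfolding orb_def by blast
  hence "r si \<in> orb si" unfolding r_def by (rule someI)
  then obtain h where h: "h \<in> ?N" "r si = ?a h si" unfolding orb_def by blast
  show "r si \<in> opp k E" unfolding h(2) by (rule opp_conj[OF E h(1) si])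
  show "EX g:?N. si = ?a g (r si)" using ginv[OF h(1)] ainv[OF h(1) si] unfolding h(2) by metis
 qed
 have r_orb: "r (?a g si) = r si" if g: "g \<in> ?N" and si: "si \<in> opp k E" for g si
 proof -
  have "orb (?a g si) = orb si"
  proof
   show "orb (?a g si) \<subseteq> orb si"
   proof
    fix ta assume "ta \<in> orb (?a g si)"
    then obtain h where h: "h \<in> ?N" "ta = ?a h (?a g si)" unfolding orb_def by blast
    have "ta = ?a (h \<otimes> g) si" unfolding h(2) by (rule amult[OF h(1) g si, symmetric])
    thus "ta \<in> orb si" using gmul[OF h(1) g] unfolding orb_def by blast
   qed
   show "orb si \<subseteq> orb (?a g si)"
   proof
    fix ta assume "ta \<in> orb si"
    then obtain h where h: "h \<in> ?N" "ta = ?a h si" unfolding orb_def by blast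
    have "ta = ?a (h \<otimes> inv g) (?a g si)"
     unfolding h(2) amult[OF h(1) ginv[OF g] opp_conj[OF E g si]] ainv[OF g si] ..
    thus "ta \<in> orb (?a g si)" using gmul[OF h(1) ginv[OF g]] unfolding orb_def by blast
   qed
  qed
  thus ?thesis by (simp add: r_def)
 qed
 have v: "v si = ?cm g (m (r si))" if si: "si \<in> opp k E" and g: "g \<in> ?N" "si = ?a g (r si)" for si g
 proof -
  define h where "h = (SOME g. g \<in> ?N & si = ?a g (r si))"
  have h: "h \<in> ?N" "si = ?a h (r si)"
   using someI[of "%g. g \<in> ?N & si = ?a g (r si)" g] g unfolding h_def by blast+
  note rsi = r(2)[OF si] and gi = ginv[OF g(1)]
  have mr: "m (r si) \<in> carrier ?M" using m[OF rsi] by simp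
  have "?a (inv g \<otimes> h) (r si) = ?a (inv g) (?a g (r si))"
   unfolding amult[OF gi h(1) rsi] using g(2) h(2) by metis
  hence "?a (inv g \<otimes> h) (r si) = r si" using ainv[OF g(1) rsi] by metis
  hence "inv g \<otimes> h \<in> centralizer G E" by (rule opp_free[OF E gmul[OF gi h(1)] rsi])
  hence "?cm (inv g \<otimes> h) (m (r si)) = m (r si)" by (rule conj_map_central[OF N1 k E _ mr])
  hence "?cm g (m (r si)) = ?cm (g \<otimes> (inv g \<otimes> h)) (m (r si))"
   using cm_mult[OF g(1) gmul[OF gi h(1)] mr] by simp
  also have "g \<otimes> (inv g \<otimes> h) = h"
   using NG(1)[OF g(1)] NG(1)[OF h(1)] by (simp flip: m_assoc)
  finally show ?thesis by (simp add: v_def h_def)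
 qed
 show ?thesis
 proof (intro exI[of _ v] conjI ballI)
  fix si assume si: "si \<in> opp k E"
  note rsi = r(2)[OF si]
  obtain g where g: "g \<in> ?N" "si = ?a g (r si)" using r(1)[OF si] by blast
  have mr: "m (r si) \<in> carrier ?M" "?f (m (r si)) = c E (dual k E (r si))" using m[OF rsi] by simp_all
  show "v si \<in> carrier ?M" unfolding v[OF si g] by (rule cm(1)[OF g(1) mr(1)])
  have "?f (v si) = c E (cjc g (dual k E (r si)))" unfolding v[OF si g] cm(2)[OF g(1) mr(1)] mr(2)
   using is_cochainD(2)[OF c NG(1)[OF g(1)] E dual(1)[OF E rsi]] unfolding NG(2)[OF g(1)] by simp
  also have "... = c E (dual k E si)" unfolding conj_chain_dual[OF E g(1) rsi] using g(2) by simp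
  finally show "?f (v si) = c E (dual k E si)" .
  fix h assume h: "h \<in> ?N"
  have "?a h si = ?a (h \<otimes> g) (r (?a h si))"
   unfolding r_orb[OF h si] amult[OF h g(1) rsi] using g(2) by simp
  hence "v (?a h si) = ?cm (h \<otimes> g) (m (r (?a h si)))"
   by (rule v[OF opp_conj[OF E h si] gmul[OF h g(1)]])
  thus "v (?a h si) = ?cm h (v si)" unfolding r_orb[OF h si] v[OF si g] cm_mult[OF h g(1) mr(1)] .
 qed
qed

theorem cochain_lift:
 assumes N1: "secs_mod Os N1" and N2: "secs_mod Os N2" and k: "has_csec Os k"
  and reps: "conj_representatives G p k (\<E> k)"
  and f: "catmap (secs_cat Os) R N1 N2 f" and c: "is_cochain k N2 c"
  and im: "!!E z. E \<in> EA k ==> z \<in> St k E ==>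
   c E z \<in> f (cs E) ` elts N1 (cs E)"
 shows "EX c'. is_cochain k N1 c' & (ALL E:EA k. ALL z:St k E. f (cs E) (c' E z) = c E z)"
proof -
 have "EX d. rep_cochain k N1 E d & (ALL z:St k E. f (cs E) (d z) = c E z)" if EE: "E \<in> \<E> k" for E
 proof -
  have E: "E \<in> EA k" by (rule repsD[of k \<E>, OF reps EE])
  note EG = elem_abD(4)[OF E] and EO = has_csecD[OF k E]
  let ?X = "cs E"
  let ?M = "Fob N1 ?X"
  interpret M: module R ?M by (rule secs_modD(2)[OF N1 EO])
  have fX: "f ?X \<in> module_homs R ?M (Fob N2 ?X)" using catmapD(1)[OF f, of ?X] EO by simp
  note N2m = secs_modD(2)[OF N2 EO]
  have N2g: "abelian_group (Fob N2 ?X)" using N2m module.axioms(2) by blast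
  obtain v where v: "!!si. si \<in> opp k E ==> v si \<in> carrier ?M" "!!si. si \<in> opp k E ==> f ?X (v si) = c E (dual k E si)"
   "!!si g. si \<in> opp k E ==> g \<in> normalizer G E ==> v (map (cj g) si) = conj_map G N1 g ?X (v si)"
   using opp_equivariant_lift[OF N1 N2 k f c E im[OF E]] by blast
  define d where "d = (%z :: 'a set list => int. \<Oplus>\<^bsub>?M\<^esub>si\<in>opp k E. [z si] \<cdot>\<^bsub>?M\<^esub> v si)"
  have "additive_on (St k E) ?M d" unfolding d_def
  proof (rule additive_on_finsum[OF M.abelian_group_axioms])
   fix si assume "si \<in> opp k E"
   thus "additive_on (St k E) ?M (%z. [z si] \<cdot>\<^bsub>?M\<^esub> v si)"
    using v(1) by (simp add: additive_on_def M.add.int_pow_mult)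
  qed
  moreover have "d (cjc g z) = conj_map G N1 g ?X (d z)"
   if g: "g \<in> normalizer G E" and z: "z \<in> St k E" for g z
  proof -
   have gG: "g \<in> carrier G" "cj g E = E" using g normalizer_iff[OF EG] by auto
   have giN: "inv g \<in> normalizer G E" by (rule subgroup.m_inv_closed[OF normalizer_imp_subgroup[OF EG] g])
   have car: "ALL H:set si. H \<subseteq> carrier G" if "si \<in> opp k E" for si
    by (rule chain_carrier[OF opp_chain[OF that]])
   have hom: "conj_map G N1 g ?X \<in> module_homs R ?M ?M"
    using conj_map_hom[OF N1 k gG(1) E] unfolding gG(2) .
   have img: "map (cj g) ` opp k E = opp k E"
   proof
    show "map (cj g) ` opp k E \<subseteq> opp k E" using opp_conj[OF E g] by blast
    show "opp k E \<subseteq> map (cj g) ` opp k E"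
    proof
     fix si assume si: "si \<in> opp k E"
     show "si \<in> map (cj g) ` opp k E"
      using opp_conj[OF E giN si] map_conj_set_inv(2)[OF gG(1) car[OF si]] by (metis image_eqI)
    qed
   qed
   have inj: "inj_on (map (cj g)) (opp k E)"
    by (rule inj_on_inverseI[where g = "map (cj (inv g))"]) (rule map_conj_set_inv(1)[OF gG(1) car])
   have "d (cjc g z) = (\<Oplus>\<^bsub>?M\<^esub>si\<in>map (cj g) ` opp k E. [cjc g z si] \<cdot>\<^bsub>?M\<^esub> v si)"
    unfolding d_def img ..
   also have "... = (\<Oplus>\<^bsub>?M\<^esub>si\<in>opp k E. [cjc g z (map (cj g) si)] \<cdot>\<^bsub>?M\<^esub> v (map (cj g) si))"
    using v(1) by (intro M.finsum_reindex inj) (auto simp: img intro!: M.add.int_pow_closed opp_conj[OF E g])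
   also have "... = (\<Oplus>\<^bsub>?M\<^esub>si\<in>opp k E. conj_map G N1 g ?X ([z si] \<cdot>\<^bsub>?M\<^esub> v si))"
   proof (rule M.finsum_cong'[OF refl])
    show "(%si. conj_map G N1 g ?X ([z si] \<cdot>\<^bsub>?M\<^esub> v si)) \<in> opp k E \<rightarrow> carrier ?M"
     using v(1) by (intro funcsetI homs_closed[OF hom] M.add.int_pow_closed) auto
    fix si assume si: "si \<in> opp k E"
    show "[cjc g z (map (cj g) si)] \<cdot>\<^bsub>?M\<^esub> v (map (cj g) si) =
      conj_map G N1 g ?X ([z si] \<cdot>\<^bsub>?M\<^esub> v si)"
     unfolding conj_chain_apply[OF gG(1) car[OF si]] v(3)[OF si g]
      module_homs_int[OF hom M.module_axioms M.module_axioms v(1)[OF si]] ..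
   qed
   also have "... = conj_map G N1 g ?X (d z)" unfolding d_def using v(1)
    by (intro homs_finsum[OF hom M.module_axioms M.module_axioms, symmetric])
     (auto intro!: M.add.int_pow_closed)
   finally show ?thesis .
  qed
  moreover have "f ?X (d z) = c E z" if z: "z \<in> St k E" for z
  proof -
   interpret N2: module R "Fob N2 ?X" by (rule N2m)
   have "f ?X (d z) = (\<Oplus>\<^bsub>Fob N2 ?X\<^esub>si\<in>opp k E. f ?X ([z si] \<cdot>\<^bsub>?M\<^esub> v si))"
    unfolding d_def using v(1)
    by (intro homs_finsum[OF fX M.module_axioms N2m]) (auto intro!: M.add.int_pow_closed)
   also have "... = (\<Oplus>\<^bsub>Fob N2 ?X\<^esub>si\<in>opp k E. [z si] \<cdot>\<^bsub>Fob N2 ?X\<^esub> c E (dual k E si))"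
   proof (rule N2.finsum_cong'[OF refl])
    show "(%si. [z si] \<cdot>\<^bsub>Fob N2 ?X\<^esub> c E (dual k E si)) \<in> opp k E \<rightarrow> carrier (Fob N2 ?X)"
     using is_cochainD(3)[OF c E dual(1)[OF E]] by (auto intro!: N2.add.int_pow_closed)
    fix si assume si: "si \<in> opp k E"
    show "f ?X ([z si] \<cdot>\<^bsub>?M\<^esub> v si) = [z si] \<cdot>\<^bsub>Fob N2 ?X\<^esub> c E (dual k E si)"
     unfolding module_homs_int[OF fX M.module_axioms N2m v(1)[OF si]] v(2)[OF si] ..
   qed
   also have "... = c E z" by (rule additive_on_expand[OF E N2g is_cochainD(1)[OF c E] z, symmetric])
   finally show ?thesis .
  qed
  ultimately show ?thesis unfolding rep_cochain_def by blast
 qed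
 hence "EX d. ALL E:\<E> k. rep_cochain k N1 E (d E) & (ALL z:St k E. f (cs E) (d E z) = c E z)"
  by (intro bchoice ballI)
 then obtain d where dd: "ALL E:\<E> k. rep_cochain k N1 E (d E) & (ALL z:St k E. f (cs E) (d E z) = c E z)" ..
 have d: "!!E. E \<in> \<E> k ==> rep_cochain k N1 E (d E)"
  "!!E z. E \<in> \<E> k ==> z \<in> St k E ==> f (cs E) (d E z) = c E z" using dd by simp_all
 let ?c = "extend_cochain G \<E> N1 k d"
 have c': "is_cochain k N1 ?c" by (rule extend_cochain_is_cochain[where d = d and \<E> = \<E>, OF reps N1 k d(1)])
 have "f (cs A) (?c A z) = c A z" if A: "A \<in> EA k" and z: "z \<in> St k A" for A z
 proof -
  obtain g E w where g: "g \<in> carrier G" and E: "E \<in> \<E> k" and AE: "A = cj g E"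
   and w: "w \<in> St k E" and zw: "z = cjc g w" using reps_cases[where \<E> = \<E>, OF reps A z] .
  have Ek: "E \<in> EA k" by (rule repsD[of k \<E>, OF reps E])
  have dE: "d E w \<in> elts N1 (cs E)" using d(1)[OF E] w by (auto simp: rep_cochain_def additive_on_def)
  have "f (cs A) (?c A z) = conj_map G N2 g (cs E) (f (cs E) (d E w))"
   unfolding AE zw extend_cochain_conj[where d = d and E = E and \<E> = \<E>, OF reps N1 k d(1)[OF E] E g w] conj_map_Fm[OF g Ek]
   by (rule Fm_catmap[OF f has_csecD[OF k conj_elem_ab[OF g Ek]] has_csecD[OF k Ek] arrow_csec_conj[OF g Ek] dE])
  also have "... = c A z" unfolding d(2)[OF E w] AE zw by (rule is_cochainD(2)[OF c g Ek w, symmetric])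
  finally show ?thesis .
 qed
 thus ?thesis using c' by blast
qed

end

lemma (in abelian_group) minus_eq_zero_iff:
 "x \<in> carrier G ==> y \<in> carrier G ==> x \<ominus> y = \<zero> \<longleftrightarrow> x = y"
 by (metis a_minus_def add.inv_closed add.inv_equality minus_minus r_neg)

lemma (in abelian_group) minus_zero_right: "x \<in> carrier G ==> x \<ominus> \<zero> = x"
 by (simp add: a_minus_def)

lemma (in abelian_group) minus_minus_zeroD:
 assumes "x \<in> carrier G" "y \<in> carrier G" "z \<in> carrier G" "(x \<ominus> y) \<ominus> z = \<zero>"
 shows "y = x \<ominus> z"
proof -
 have "x \<ominus> y = z" using assms minus_eq_zero_iff[of "x \<ominus> y" z] by simp
 thus ?thesis using assms(1-3) by (auto simp: a_minus_def minus_add r_neg2)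
qed

lemma (in abelian_group) minus_minus_zeroD':
 assumes "x \<in> carrier G" "y \<in> carrier G" "z \<in> carrier G" "(x \<ominus> y) \<ominus> z = \<zero>"
 shows "x = y \<oplus> z"
proof -
 have "x \<ominus> y = z" using assms minus_eq_zero_iff[of "x \<ominus> y" z] by simp
 thus ?thesis using assms(1-3) a_comm[of x "\<ominus> y"] by (auto simp: a_minus_def r_neg2)
qed

section \<open>Submodules, products and quotients of modules\<close>

lemma (in module) submodule_linI:
 assumes "H \<subseteq> carrier M" "\<zero>\<^bsub>M\<^esub> \<in> H"
  and lin: "!!r x y. r \<in> carrier R ==> x \<in> H ==> y \<in> H ==> r \<odot>\<^bsub>M\<^esub> x \<oplus>\<^bsub>M\<^esub> y \<in> H"
 shows "submodule H R M"
proof (rule submoduleI[OF assms(1,2)])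
 have sm: "r \<odot>\<^bsub>M\<^esub> x \<in> H" if "r \<in> carrier R" "x \<in> H" for r x
  using lin[OF that assms(2)] that assms(1) by auto
 show "r \<odot>\<^bsub>M\<^esub> x \<in> H" if "r \<in> carrier R" "x \<in> H" for r x by (rule sm[OF that])
 show "x \<oplus>\<^bsub>M\<^esub> y \<in> H" if "x \<in> H" "y \<in> H" for x y
  using lin[OF R.one_closed that] that assms(1) by auto
 show "\<ominus>\<^bsub>M\<^esub> x \<in> H" if "x \<in> H" for x
 proof -
  have "\<ominus>\<^bsub>M\<^esub> x = (\<ominus>\<^bsub>R\<^esub> \<one>\<^bsub>R\<^esub>) \<odot>\<^bsub>M\<^esub> x"
   using smult_l_minus[OF R.one_closed, of x] that assms(1) by auto
  thus ?thesis using sm[of "\<ominus>\<^bsub>R\<^esub> \<one>\<^bsub>R\<^esub>" x] that by simp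
 qed
qed

lemma module_homs_linI:
 assumes M: "module R M" and N: "module R N" and cl: "!!x. x \<in> carrier M ==> h x \<in> carrier N"
  and lin: "!!r x y. r \<in> carrier R ==> x \<in> carrier M ==> y \<in> carrier M ==>
   h (r \<odot>\<^bsub>M\<^esub> x \<oplus>\<^bsub>M\<^esub> y) = r \<odot>\<^bsub>N\<^esub> h x \<oplus>\<^bsub>N\<^esub> h y"
 shows "h \<in> module_homs R M N"
proof -
 interpret M: module R M by (rule M)
 interpret N: module R N by (rule N)
 have add: "h (x \<oplus>\<^bsub>M\<^esub> y) = h x \<oplus>\<^bsub>N\<^esub> h y" if "x \<in> carrier M" "y \<in> carrier M" for x y
  using lin[OF M.R.one_closed that] that cl by simp
 have zero: "h \<zero>\<^bsub>M\<^esub> = \<zero>\<^bsub>N\<^esub>"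
  using add[of "\<zero>\<^bsub>M\<^esub>" "\<zero>\<^bsub>M\<^esub>"] cl[of "\<zero>\<^bsub>M\<^esub>"] N.add.l_cancel_one[of "h \<zero>\<^bsub>M\<^esub>" "h \<zero>\<^bsub>M\<^esub>"] by simp
 show ?thesis
 proof (rule module_homsI[OF cl add])
  fix r x assume "r \<in> carrier R" "x \<in> carrier M"
  thus "h (r \<odot>\<^bsub>M\<^esub> x) = r \<odot>\<^bsub>N\<^esub> h x" using lin[of r x "\<zero>\<^bsub>M\<^esub>"] zero cl by simp
 qed
qed

lemma prod_module_module:
 assumes R: "cring R" and M: "!!i. i \<in> I ==> module R (M i)"
 shows "module R (prod_module I M)"
proof (rule moduleI[OF R])
 note ax = module.axioms(2)[OF M, THEN abelian_group.axioms(1)]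
 show "abelian_group (prod_module I M)"
 proof (rule abelian_groupI)
  fix x assume x: "x \<in> carrier (prod_module I M)"
  have "(\<lambda>i\<in>I. \<ominus>\<^bsub>M i\<^esub> x i) \<in> carrier (prod_module I M)"
   using x abelian_group.a_inv_closed[OF module.axioms(2)[OF M]] by (auto simp: prod_module_def PiE_iff)
  moreover have "(\<lambda>i\<in>I. \<ominus>\<^bsub>M i\<^esub> x i) \<oplus>\<^bsub>prod_module I M\<^esub> x = \<zero>\<^bsub>prod_module I M\<^esub>"
   using x abelian_group.l_neg[OF module.axioms(2)[OF M]] by (auto simp: prod_module_def PiE_iff intro!: restrict_ext)
  ultimately show "EX y:carrier (prod_module I M). y \<oplus>\<^bsub>prod_module I M\<^esub> x = \<zero>\<^bsub>prod_module I M\<^esub>" by blast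
  show "\<zero>\<^bsub>prod_module I M\<^esub> \<oplus>\<^bsub>prod_module I M\<^esub> x = x"
   using x abelian_monoid.l_zero[OF ax] by (auto simp: prod_module_def PiE_iff extensional_def fun_eq_iff)
  fix y assume y: "y \<in> carrier (prod_module I M)"
  show "x \<oplus>\<^bsub>prod_module I M\<^esub> y \<in> carrier (prod_module I M)"
   using x y abelian_monoid.a_closed[OF ax] by (auto simp: prod_module_def PiE_iff)
  show "x \<oplus>\<^bsub>prod_module I M\<^esub> y = y \<oplus>\<^bsub>prod_module I M\<^esub> x"
   using x y abelian_monoid.a_comm[OF ax] by (auto simp: prod_module_def PiE_iff intro!: restrict_ext)
  fix z assume z: "z \<in> carrier (prod_module I M)"
  show "x \<oplus>\<^bsub>prod_module I M\<^esub> y \<oplus>\<^bsub>prod_module I M\<^esub> z = x \<oplus>\<^bsub>prod_module I M\<^esub> (y \<oplus>\<^bsub>prod_module I M\<^esub> z)"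
   using x y z abelian_monoid.a_assoc[OF ax] by (auto simp: prod_module_def PiE_iff intro!: restrict_ext)
 next
  show "\<zero>\<^bsub>prod_module I M\<^esub> \<in> carrier (prod_module I M)"
   using abelian_monoid.zero_closed[OF ax] by (auto simp: prod_module_def PiE_iff)
 qed
next
 fix r x assume *: "r \<in> carrier R" "x \<in> carrier (prod_module I M)"
 show "r \<odot>\<^bsub>prod_module I M\<^esub> x \<in> carrier (prod_module I M)"
  using * module.smult_closed[OF M] by (auto simp: prod_module_def PiE_iff)
 fix y assume "y \<in> carrier (prod_module I M)"
 thus "r \<odot>\<^bsub>prod_module I M\<^esub> (x \<oplus>\<^bsub>prod_module I M\<^esub> y) =
   r \<odot>\<^bsub>prod_module I M\<^esub> x \<oplus>\<^bsub>prod_module I M\<^esub> r \<odot>\<^bsub>prod_module I M\<^esub> y"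
  using * module.smult_r_distr[OF M] by (auto simp: prod_module_def PiE_iff intro!: restrict_ext)
next
 fix r s x assume *: "r \<in> carrier R" "s \<in> carrier R" "x \<in> carrier (prod_module I M)"
 show "(r \<oplus>\<^bsub>R\<^esub> s) \<odot>\<^bsub>prod_module I M\<^esub> x = r \<odot>\<^bsub>prod_module I M\<^esub> x \<oplus>\<^bsub>prod_module I M\<^esub> s \<odot>\<^bsub>prod_module I M\<^esub> x"
  using * module.smult_l_distr[OF M] by (auto simp: prod_module_def PiE_iff intro!: restrict_ext)
 show "r \<otimes>\<^bsub>R\<^esub> s \<odot>\<^bsub>prod_module I M\<^esub> x = r \<odot>\<^bsub>prod_module I M\<^esub> (s \<odot>\<^bsub>prod_module I M\<^esub> x)"
  using * module.smult_assoc1[OF M] by (auto simp: prod_module_def PiE_iff intro!: restrict_ext)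
next
 fix x assume "x \<in> carrier (prod_module I M)"
 thus "\<one>\<^bsub>R\<^esub> \<odot>\<^bsub>prod_module I M\<^esub> x = x"
  using module.smult_one[OF M] by (auto simp: prod_module_def PiE_iff extensional_def fun_eq_iff)
qed

lemma restricted_module:
 assumes M: "module R M" and "H \<subseteq> carrier M" "\<zero>\<^bsub>M\<^esub> \<in> H"
  and "!!r x y. r \<in> carrier R ==> x \<in> H ==> y \<in> H ==> r \<odot>\<^bsub>M\<^esub> x \<oplus>\<^bsub>M\<^esub> y \<in> H"
 shows "module R (M\<lparr>carrier := H\<rparr>)"
 by (rule submodule.submodule_is_module[OF module.submodule_linI[OF M assms(2-4)] M])

lemma prod_module_lin:
 "r \<odot>\<^bsub>prod_module I M\<^esub> x \<oplus>\<^bsub>prod_module I M\<^esub> y = (\<lambda>i\<in>I. r \<odot>\<^bsub>M i\<^esub> x i \<oplus>\<^bsub>M i\<^esub> y i)"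
 by (auto simp: prod_module_def PiE_iff)

lemma kernel_module_module:
 assumes M: "module R M" and N: "module R N" and h: "h \<in> module_homs R M N"
 shows "module R (kernel_module M N h)" unfolding kernel_module_def
proof (rule restricted_module[OF M])
 interpret M: module R M by (rule M)
 interpret N: module R N by (rule N)
 show "\<zero>\<^bsub>M\<^esub> \<in> {x \<in> carrier M. h x = \<zero>\<^bsub>N\<^esub>}" using homs_zero[OF h M N] by simp
 fix r x y assume "r \<in> carrier R" "x \<in> {x \<in> carrier M. h x = \<zero>\<^bsub>N\<^esub>}" "y \<in> {x \<in> carrier M. h x = \<zero>\<^bsub>N\<^esub>}"
 thus "r \<odot>\<^bsub>M\<^esub> x \<oplus>\<^bsub>M\<^esub> y \<in> {x \<in> carrier M. h x = \<zero>\<^bsub>N\<^esub>}"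
  by (simp add: homs_add[OF h] homs_smult[OF h])
qed auto

lemma image_submodule:
 assumes L: "module R L" and M: "module R M" and f: "f \<in> module_homs R L M"
 shows "submodule (f ` carrier L) R M"
proof (rule module.submodule_linI[OF M])
 interpret L: module R L by (rule L)
 show "f ` carrier L \<subseteq> carrier M" using homs_closed[OF f] by auto
 show "\<zero>\<^bsub>M\<^esub> \<in> f ` carrier L" using homs_zero[OF f L M] L.zero_closed by (metis image_eqI)
 fix r x y assume r: "r \<in> carrier R" and "x \<in> f ` carrier L" "y \<in> f ` carrier L"
 then obtain u v where uv: "u \<in> carrier L" "v \<in> carrier L" "x = f u" "y = f v" by blast
 have "r \<odot>\<^bsub>M\<^esub> x \<oplus>\<^bsub>M\<^esub> y = f (r \<odot>\<^bsub>L\<^esub> u \<oplus>\<^bsub>L\<^esub> v)"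
  using r uv by (simp add: homs_add[OF f] homs_smult[OF f])
 thus "r \<odot>\<^bsub>M\<^esub> x \<oplus>\<^bsub>M\<^esub> y \<in> f ` carrier L" using r uv by auto
qed

lemma image_submodule_kernel:
 assumes L: "module R L" and M: "module R M" and N: "module R N" and f: "f \<in> module_homs R L M"
  and h: "h \<in> module_homs R M N" and hf: "!!x. x \<in> carrier L ==> h (f x) = \<zero>\<^bsub>N\<^esub>"
 shows "submodule (f ` carrier L) R (kernel_module M N h)" using hf homs_closed[OF f] f
 by (intro image_submodule L kernel_module_module[OF M N h])
  (auto simp: module_homs_def kernel_module_def)

lemma zero_submodule: "module R M ==> submodule {\<zero>\<^bsub>M\<^esub>} R M"
 by (rule module.submodule_linI)
  (auto simp: module.smult_r_null abelian_monoid.l_zero abelian_monoid.zero_closed module.axioms abelian_group.axioms(1))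

context
 fixes R :: "('r, 's) ring_scheme" and M :: "('r, 'm) module" and B :: "'m set"
 assumes M: "module R M" and B: "submodule B R M"
begin

interpretation M: module R M by (rule M)

lemma B_subset: "B \<subseteq> carrier M" and B_zero: "\<zero>\<^bsub>M\<^esub> \<in> B" and B_group: "subgroup B (add_monoid M)"
 using M.submoduleE(1)[OF B] submodule.axioms(1)[OF B] subgroup.one_closed[of B "add_monoid M"] by auto

lemma B_abelian: "abelian_subgroup B M"
 using abelian_subgroupI3[OF additive_subgroupI[OF B_group] M.abelian_group_axioms] .

lemma quot_carrier: "carrier (quot_module M B) = {B +>\<^bsub>M\<^esub> x | x. x \<in> carrier M}"
 by (auto simp: quot_module_def A_RCOSETS_def')

lemma quot_zero: "\<zero>\<^bsub>quot_module M B\<^esub> = B +>\<^bsub>M\<^esub> \<zero>\<^bsub>M\<^esub>"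
 using M.a_coset_join2[OF M.zero_closed B_group B_zero] by (simp add: quot_module_def)

lemma coset_eq_iff:
 assumes "x \<in> carrier M" "y \<in> carrier M"
 shows "B +>\<^bsub>M\<^esub> x = B +>\<^bsub>M\<^esub> y \<longleftrightarrow> x \<ominus>\<^bsub>M\<^esub> y \<in> B"
proof
 assume "B +>\<^bsub>M\<^esub> x = B +>\<^bsub>M\<^esub> y"
 moreover have "x \<in> B +>\<^bsub>M\<^esub> x" unfolding a_r_coset_def' using B_zero assms(1) by force
 ultimately obtain b where b: "b \<in> B" "x = b \<oplus>\<^bsub>M\<^esub> y" unfolding a_r_coset_def' by auto
 hence "x \<ominus>\<^bsub>M\<^esub> y = b" using assms B_subset by (auto simp: a_minus_def M.a_assoc M.r_neg)
 thus "x \<ominus>\<^bsub>M\<^esub> y \<in> B" using b by simp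
next
 assume b: "x \<ominus>\<^bsub>M\<^esub> y \<in> B"
 have "x = (x \<ominus>\<^bsub>M\<^esub> y) \<oplus>\<^bsub>M\<^esub> y" using assms by (simp add: a_minus_def M.a_assoc M.l_neg)
 hence "x \<in> B +>\<^bsub>M\<^esub> y" unfolding a_r_coset_def' using b by blast
 thus "B +>\<^bsub>M\<^esub> x = B +>\<^bsub>M\<^esub> y" using M.a_repr_independence[OF _ assms(2) B_group] by simp
qed

lemma quot_add:
 "x \<in> carrier M ==> y \<in> carrier M ==>
  (B +>\<^bsub>M\<^esub> x) \<oplus>\<^bsub>quot_module M B\<^esub> (B +>\<^bsub>M\<^esub> y) = B +>\<^bsub>M\<^esub> (x \<oplus>\<^bsub>M\<^esub> y)"
 using abelian_subgroup.a_rcos_sum[OF B_abelian] by (simp add: quot_module_def)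

lemma quot_smult:
 assumes r: "r \<in> carrier R" and x: "x \<in> carrier M"
 shows "r \<odot>\<^bsub>quot_module M B\<^esub> (B +>\<^bsub>M\<^esub> x) = B +>\<^bsub>M\<^esub> (r \<odot>\<^bsub>M\<^esub> x)"
proof -
 have "B +>\<^bsub>M\<^esub> (r \<odot>\<^bsub>M\<^esub> (b \<oplus>\<^bsub>M\<^esub> x)) = B +>\<^bsub>M\<^esub> (r \<odot>\<^bsub>M\<^esub> x)" if "b \<in> B" for b
 proof -
  have b: "b \<in> carrier M" "r \<odot>\<^bsub>M\<^esub> b \<in> B"
   using that B_subset M.submoduleE(4)[OF B r that] by auto
  have "r \<odot>\<^bsub>M\<^esub> (b \<oplus>\<^bsub>M\<^esub> x) \<ominus>\<^bsub>M\<^esub> r \<odot>\<^bsub>M\<^esub> x = r \<odot>\<^bsub>M\<^esub> b"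
   using r x b(1) by (simp add: M.smult_r_distr a_minus_def M.a_assoc M.r_neg)
  thus ?thesis using coset_eq_iff[of "r \<odot>\<^bsub>M\<^esub> (b \<oplus>\<^bsub>M\<^esub> x)" "r \<odot>\<^bsub>M\<^esub> x"] r x b by simp
 qed
 moreover have "EX b. b \<in> B" using B_zero by blast
 ultimately show ?thesis by (auto simp: quot_module_def a_r_coset_def'[of M B x])
qed

end

text \<open>Isomorphisms of cohomology groups all arise from a map on cocycles that hits every class and detects
coboundaries.\<close>

theorem quot_isomorphism:
 assumes M: "module R M" and B: "submodule B R M" and N: "module R N" and B': "submodule B' R N"
  and h: "h \<in> module_homs R M N"
  and reflects: "!!x. x \<in> carrier M ==> h x \<in> B' \<longleftrightarrow> x \<in> B"
  and surj: "!!y. y \<in> carrier N ==> EX x:carrier M. y \<ominus>\<^bsub>N\<^esub> h x \<in> B'"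
 shows "module_isomorphic R (quot_module M B) (quot_module N B')"
proof -
 interpret M: module R M by (rule M)
 interpret N: module R N by (rule N)
 note cM = quot_carrier[OF M B] and cN = quot_carrier[OF N B']
 let ?q = "%x. B +>\<^bsub>M\<^esub> x" and ?q' = "%y. B' +>\<^bsub>N\<^esub> y"
 define \<Phi> where "\<Phi> X = ?q' (h (SOME x. x \<in> carrier M & X = ?q x))" for X
 note hc = homs_closed[OF h]
 have diff: "?q x = ?q y \<longleftrightarrow> ?q' (h x) = ?q' (h y)" if xy: "x \<in> carrier M" "y \<in> carrier M" for x y
  unfolding coset_eq_iff[OF M B xy] coset_eq_iff[OF N B' hc[OF xy(1)] hc[OF xy(2)]]
   homs_minus[OF h M N xy, symmetric] reflects[OF M.minus_closed[OF xy]] ..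
 have \<Phi>: "\<Phi> (?q x) = ?q' (h x)" if x: "x \<in> carrier M" for x
 proof -
  let ?y = "SOME y. y \<in> carrier M & ?q x = ?q y"
  have "?y \<in> carrier M & ?q x = ?q ?y" by (rule someI[of _ x]) (use x in simp)
  thus ?thesis unfolding \<Phi>_def using diff[OF x, of ?y] by simp
 qed
 have "\<Phi> \<in> module_homs R (quot_module M B) (quot_module N B')"
 proof (rule module_homsI)
  fix X assume "X \<in> carrier (quot_module M B)"
  then obtain x where x: "x \<in> carrier M" "X = ?q x" unfolding cM by blast
  show "\<Phi> X \<in> carrier (quot_module N B')" unfolding x(2) \<Phi>[OF x(1)] cN using hc[OF x(1)] by blast
  show "\<Phi> (r \<odot>\<^bsub>quot_module M B\<^esub> X) = r \<odot>\<^bsub>quot_module N B'\<^esub> \<Phi> X" if r: "r \<in> carrier R" for r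
   unfolding x(2) quot_smult[OF M B r x(1)] \<Phi>[OF x(1)] \<Phi>[OF M.smult_closed[OF r x(1)]]
    quot_smult[OF N B' r hc[OF x(1)]] homs_smult[OF h r x(1)] ..
  fix Y assume "Y \<in> carrier (quot_module M B)"
  then obtain y where y: "y \<in> carrier M" "Y = ?q y" unfolding cM by blast
  show "\<Phi> (X \<oplus>\<^bsub>quot_module M B\<^esub> Y) = \<Phi> X \<oplus>\<^bsub>quot_module N B'\<^esub> \<Phi> Y"
   unfolding x(2) y(2) quot_add[OF M B x(1) y(1)] \<Phi>[OF x(1)] \<Phi>[OF y(1)] \<Phi>[OF M.a_closed[OF x(1) y(1)]]
    quot_add[OF N B' hc[OF x(1)] hc[OF y(1)]] homs_add[OF h x(1) y(1)] ..
 qed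
 moreover have "bij_betw \<Phi> (carrier (quot_module M B)) (carrier (quot_module N B'))"
 proof (rule bij_betw_imageI)
  show "inj_on \<Phi> (carrier (quot_module M B))"
  proof (rule inj_onI)
   fix X Y assume "X \<in> carrier (quot_module M B)" "Y \<in> carrier (quot_module M B)" and e: "\<Phi> X = \<Phi> Y"
   then obtain x y where x: "x \<in> carrier M" "X = ?q x" and y: "y \<in> carrier M" "Y = ?q y" unfolding cM by blast
   show "X = Y" using e unfolding x(2) y(2) \<Phi>[OF x(1)] \<Phi>[OF y(1)] diff[OF x(1) y(1)] .
  qed
  show "\<Phi> ` carrier (quot_module M B) = carrier (quot_module N B')"
  proof (intro equalityI subsetI)
   fix Y assume "Y \<in> \<Phi> ` carrier (quot_module M B)"
   thus "Y \<in> carrier (quot_module N B')" using calculation by (auto intro: homs_closed)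
  next
   fix Y assume "Y \<in> carrier (quot_module N B')"
   then obtain y where y: "y \<in> carrier N" "Y = ?q' y" unfolding cN by blast
   obtain x where x: "x \<in> carrier M" "y \<ominus>\<^bsub>N\<^esub> h x \<in> B'" using surj[OF y(1)] by blast
   have "Y = \<Phi> (?q x)" unfolding y(2) \<Phi>[OF x(1)] using coset_eq_iff[OF N B' y(1) hc[OF x(1)]] x(2) by simp
   thus "Y \<in> \<Phi> ` carrier (quot_module M B)" using x(1) unfolding cM by blast
  qed
 qed
 ultimately show ?thesis unfolding module_isomorphic_def by blast
qed

lemma module_isomorphic_trans:
 assumes "module_isomorphic R M N" "module_isomorphic R N L"
 shows "module_isomorphic R M L"
proof -
 obtain f where f: "f \<in> module_homs R M N" "bij_betw f (carrier M) (carrier N)"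
  using assms(1) unfolding module_isomorphic_def by (elim bexE)
 obtain g where g: "g \<in> module_homs R N L" "bij_betw g (carrier N) (carrier L)"
  using assms(2) unfolding module_isomorphic_def by (elim bexE)
 show ?thesis unfolding module_isomorphic_def
  by (rule bexI[OF _ homs_comp[OF f(1) g(1)]]) (use bij_betw_trans[OF f(2) g(2)] in \<open>simp add: comp_def\<close>)
qed

lemma module_isomorphic_quot_zero:
 assumes M: "module R M" and N: "module R N" and h: "h \<in> module_homs R M N"
  and b: "bij_betw h (carrier M) (carrier N)"
 shows "module_isomorphic R M (quot_module N {\<zero>\<^bsub>N\<^esub>})"
proof -
 interpret N: module R N by (rule N)
 note Z = zero_submodule[OF N]
 let ?q = "%y. {\<zero>\<^bsub>N\<^esub>} +>\<^bsub>N\<^esub> y"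
 have q: "?q y = {y}" if "y \<in> carrier N" for y using that by (simp add: a_r_coset_def')
 note hc = homs_closed[OF h]
 have "(%x. ?q (h x)) \<in> module_homs R M (quot_module N {\<zero>\<^bsub>N\<^esub>})"
  using hc by (intro module_homsI)
   (auto simp: quot_carrier[OF N Z] quot_add[OF N Z] quot_smult[OF N Z] homs_add[OF h] homs_smult[OF h])
 moreover have "bij_betw (%x. ?q (h x)) (carrier M) (carrier (quot_module N {\<zero>\<^bsub>N\<^esub>}))"
 proof (rule bij_betw_imageI)
  show "inj_on (%x. ?q (h x)) (carrier M)" using b hc by (auto simp: bij_betw_def inj_on_def q)
  show "(%x. ?q (h x)) ` carrier M = carrier (quot_module N {\<zero>\<^bsub>N\<^esub>})"
   unfolding quot_carrier[OF N Z] bij_betw_imp_surj_on[OF b, symmetric] by auto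
 qed
 ultimately show ?thesis unfolding module_isomorphic_def by blast
qed

lemma quot_zero_transfer:
 assumes M: "module R M" and B: "submodule B R M"
  and iso: "module_isomorphic R (quot_module M B) (quot_module N B')" and N: "carrier N = {x}"
 shows "zero_module (quot_module M B)"
proof -
 obtain h where b: "bij_betw h (carrier (quot_module M B)) (carrier (quot_module N B'))"
  using iso unfolding module_isomorphic_def by (elim bexE)
 have z: "\<zero>\<^bsub>quot_module M B\<^esub> \<in> carrier (quot_module M B)"
  unfolding quot_zero[OF M B] quot_carrier[OF M B]
  using abelian_monoid.zero_closed[OF abelian_group.axioms(1)[OF module.axioms(2)[OF M]]] by blast
 have c: "carrier (quot_module N B') = {B' +>\<^bsub>N\<^esub> x}"
  by (simp add: quot_module_def A_RCOSETS_def' N)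
 have all: "y = \<zero>\<^bsub>quot_module M B\<^esub>" if y: "y \<in> carrier (quot_module M B)" for y
 proof (rule inj_onD[OF bij_betw_imp_inj_on[OF b] _ y z])
  have "h w = B' +>\<^bsub>N\<^esub> x" if "w \<in> carrier (quot_module M B)" for w
   using bij_betw_apply[OF b that] c by simp
  thus "h y = h \<zero>\<^bsub>quot_module M B\<^esub>" using y z by simp
 qed
 show ?thesis unfolding zero_module_def
 proof (intro equalityI subsetI)
  fix y assume "y \<in> carrier (quot_module M B)"
  thus "y \<in> {\<zero>\<^bsub>quot_module M B\<^esub>}" using all by (simp only: singleton_iff)
 next
  fix y assume "y \<in> {\<zero>\<^bsub>quot_module M B\<^esub>}"
  thus "y \<in> carrier (quot_module M B)" using z by (simp only: singleton_iff)
 qed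
qed

section \<open>Modules of natural transformations\<close>

lemma kernel_module_ops:
 "x \<oplus>\<^bsub>kernel_module M N h\<^esub> y = x \<oplus>\<^bsub>M\<^esub> y" "r \<odot>\<^bsub>kernel_module M N h\<^esub> x = r \<odot>\<^bsub>M\<^esub> x"
 by (simp_all add: kernel_module_def)

lemma catmap_lin:
 assumes f: "catmap C R M N f" and g: "catmap C R M N g" and M: "is_catmod C R M" and N: "is_catmod C R N"
  and r: "r \<in> carrier R"
 shows "catmap C R M N (%X x. r \<odot>\<^bsub>Fob N X\<^esub> f X x \<oplus>\<^bsub>Fob N X\<^esub> g X x)"
 unfolding catmap_def
proof (intro conjI ballI)
 fix X assume X: "X \<in> Ob C"
 interpret NX: module R "Fob N X" by (rule is_catmodD(1)[OF N X])
 show "(%x. r \<odot>\<^bsub>Fob N X\<^esub> f X x \<oplus>\<^bsub>Fob N X\<^esub> g X x) \<in> module_homs R (Fob M X) (Fob N X)"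
  by (rule homs_sum[OF homs_comp[OF catmapD(1)[OF f X] module_homs_scale[OF NX.module_axioms NX.zero_closed r]]
    catmapD(1)[OF g X] is_catmodD(1)[OF M X] NX.module_axioms])
next
 fix X Y a y assume *: "X \<in> Ob C" "Y \<in> Ob C" "a \<in> Hom C X Y" "y \<in> elts M Y"
 interpret NY: module R "Fob N Y" by (rule is_catmodD(1)[OF N *(2)])
 note hom = is_catmodD(2)[OF N *(1-3)] and fy = catmapD(3)[OF f *(2,4)] and gy = catmapD(3)[OF g *(2,4)]
 show "r \<odot>\<^bsub>Fob N X\<^esub> f X (Fmap M X Y a y) \<oplus>\<^bsub>Fob N X\<^esub> g X (Fmap M X Y a y) =
   Fmap N X Y a (r \<odot>\<^bsub>Fob N Y\<^esub> f Y y \<oplus>\<^bsub>Fob N Y\<^esub> g Y y)"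
  unfolding catmapD(2)[OF f *] catmapD(2)[OF g *] homs_add[OF hom NY.smult_closed[OF r fy] gy]
   homs_smult[OF hom r fy] ..
qed

lemma catmap_zero:
 assumes M: "is_catmod C R M" and N: "is_catmod C R N"
 shows "catmap C R M N (%X x. \<zero>\<^bsub>Fob N X\<^esub>)" unfolding catmap_def
proof (intro conjI ballI)
 fix X assume X: "X \<in> Ob C"
 interpret NX: module R "Fob N X" by (rule is_catmodD(1)[OF N X])
 show "(%x. \<zero>\<^bsub>Fob N X\<^esub>) \<in> module_homs R (Fob M X) (Fob N X)" by (simp add: module_homs_def)
 fix Y a assume Y: "Y \<in> Ob C" and a: "a \<in> Hom C X Y"
 show "\<zero>\<^bsub>Fob N X\<^esub> = Fmap N X Y a \<zero>\<^bsub>Fob N Y\<^esub>"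
  by (rule homs_zero[OF is_catmodD(2)[OF N X Y a] is_catmodD(1)[OF N Y] NX.module_axioms, symmetric])
qed

abbreviation nat_restrict ::
  "('o, 'a) small_category => ('r, 'o, 'a, 'm) catmod => ('o => 'm => 'n) => 'o => 'm => 'n"
 where "nat_restrict C M etg \<equiv> \<lambda>X\<in>Ob C. \<lambda>x\<in>elts M X. etg X x"

lemma nat_restrict_cong:
 "(!!X x. X \<in> Ob C ==> x \<in> elts M X ==> etg X x = etg' X x) ==> nat_restrict C M etg = nat_restrict C M etg'"
 by (intro restrict_ext)

lemma nat_restrict_eq_iff:
 "nat_restrict C M etg = nat_restrict C M etg' \<longleftrightarrow> (ALL X:Ob C. ALL x:elts M X. etg X x = etg' X x)"
 (is "?l = ?r \<longleftrightarrow> _")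
proof
 assume eq: "?l = ?r"
 show "ALL X:Ob C. ALL x:elts M X. etg X x = etg' X x"
 proof (intro ballI)
  fix X x assume "X \<in> Ob C" "x \<in> elts M X"
  thus "etg X x = etg' X x" using fun_cong[OF fun_cong[OF eq, of X], of x] by simp
 qed
qed (rule nat_restrict_cong, simp)

lemma nat_restrict_id:
 assumes "etg \<in> nat_homs C R M N"
 shows "nat_restrict C M etg = etg"
proof -
 have "nat_restrict C M etg = (\<lambda>X\<in>Ob C. etg X)"
  using assms by (intro restrict_ext) (auto simp: nat_homs_def PiE_iff extensional_restrict)
 also have "... = etg" using assms by (auto simp: nat_homs_def PiE_iff extensional_restrict)
 finally show ?thesis .
qed

lemma nat_hom_carrier: "carrier (nat_hom_module C R M N) = nat_homs C R M N"
 by (simp add: nat_hom_module_def)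

lemma nat_hom_module_lin:
 "r \<odot>\<^bsub>nat_hom_module C R M N\<^esub> etg \<oplus>\<^bsub>nat_hom_module C R M N\<^esub> etg' =
  nat_restrict C M (%X x. r \<odot>\<^bsub>Fob N X\<^esub> etg X x \<oplus>\<^bsub>Fob N X\<^esub> etg' X x)"
 by (simp add: nat_hom_module_def prod_module_def cong: restrict_cong)

lemma nat_hom_module_add:
 "etg \<oplus>\<^bsub>nat_hom_module C R M N\<^esub> etg' = nat_restrict C M (%X x. etg X x \<oplus>\<^bsub>Fob N X\<^esub> etg' X x)"
 by (simp add: nat_hom_module_def prod_module_def cong: restrict_cong)

lemma nat_hom_module_zero: "\<zero>\<^bsub>nat_hom_module C R M N\<^esub> = nat_restrict C M (%X x. \<zero>\<^bsub>Fob N X\<^esub>)"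
 by (simp add: nat_hom_module_def prod_module_def cong: restrict_cong)

lemma nat_hom_module_module:
 assumes R: "cring R" and M: "is_catmod C R M" and N: "is_catmod C R N"
 shows "module R (nat_hom_module C R M N)"
proof -
 let ?P = "prod_module (Ob C) (%X. prod_module (elts M X) (%_. Fob N X))"
 have P: "module R ?P" by (intro prod_module_module[OF R]) (rule is_catmodD(1)[OF N])
 show ?thesis unfolding nat_hom_module_def
 proof (rule restricted_module[OF P])
  show "nat_homs C R M N \<subseteq> carrier ?P"
   by (auto simp: nat_homs_def prod_module_def PiE_def module_homs_def)
  show "\<zero>\<^bsub>?P\<^esub> \<in> nat_homs C R M N"
   using catmap_restrict[OF catmap_zero[OF M N] M] by (simp add: prod_module_def)
  fix r etg etg' assume r: "r \<in> carrier R" and etg: "etg \<in> nat_homs C R M N" "etg' \<in> nat_homs C R M N"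
  have "r \<odot>\<^bsub>?P\<^esub> etg \<oplus>\<^bsub>?P\<^esub> etg' = nat_restrict C M (%X x. r \<odot>\<^bsub>Fob N X\<^esub> etg X x \<oplus>\<^bsub>Fob N X\<^esub> etg' X x)"
   by (simp add: prod_module_def cong: restrict_cong)
  thus "r \<odot>\<^bsub>?P\<^esub> etg \<oplus>\<^bsub>?P\<^esub> etg' \<in> nat_homs C R M N"
   using catmap_restrict[OF catmap_lin[OF nat_homs_catmap[OF etg(1)] nat_homs_catmap[OF etg(2)] M N r] M] by simp
 qed
qed

lemma precomp_nat_homs:
 assumes M: "is_catmod C R M" and \<theta>: "catmap C R M K \<theta>" and etg: "catmap C R K N etg"
 shows "precomp C M \<theta> etg \<in> nat_homs C R M N"
 unfolding precomp_def by (rule catmap_restrict[OF catmap_comp[OF \<theta> etg] M])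

lemma precomp_hom:
 assumes R: "cring R" and M: "is_catmod C R M" and K: "is_catmod C R K" and N: "is_catmod C R N" and \<theta>: "catmap C R M K \<theta>"
 shows "precomp C M \<theta> \<in> module_homs R (nat_hom_module C R K N) (nat_hom_module C R M N)"
proof (rule module_homs_linI[OF nat_hom_module_module[OF R K N] nat_hom_module_module[OF R M N]])
 show "precomp C M \<theta> etg \<in> carrier (nat_hom_module C R M N)" if "etg \<in> carrier (nat_hom_module C R K N)" for etg
  using precomp_nat_homs[OF M \<theta> nat_homs_catmap] that by (simp add: nat_hom_carrier)
 fix r etg etg'
 show "precomp C M \<theta> (r \<odot>\<^bsub>nat_hom_module C R K N\<^esub> etg \<oplus>\<^bsub>nat_hom_module C R K N\<^esub> etg') =
   r \<odot>\<^bsub>nat_hom_module C R M N\<^esub> precomp C M \<theta> etg \<oplus>\<^bsub>nat_hom_module C R M N\<^esub> precomp C M \<theta> etg'"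
  unfolding nat_hom_module_lin precomp_def by (rule nat_restrict_cong) (simp add: catmapD(3)[OF \<theta>])
qed

section \<open>Resolutions\<close>

text \<open>Projectivity of \<open>P\<close> with respect to one pair of carrier types, so that it can be assumed for several pairs.\<close>

definition lifts ::
  "('o, 'a) small_category => ('r, 's) ring_scheme => ('r, 'o, 'a, 'p) catmod =>
  ('r, 'o, 'a, 'm) catmod => ('r, 'o, 'a, 'n) catmod => bool"
 where "lifts C R P M N \<longleftrightarrow> (ALL f g. catmap C R M N f --> catmap C R P N g -->
  (ALL X:Ob C. ALL x:elts P X. g X x \<in> f X ` elts M X) -->
  (EX h. catmap C R P M h & (ALL X:Ob C. ALL x:elts P X. f X (h X x) = g X x)))"

lemma liftsD:
 assumes "lifts C R P M N" "catmap C R M N f" "catmap C R P N g"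
  and "!!X x. X \<in> Ob C ==> x \<in> elts P X ==> g X x \<in> f X ` elts M X"
 shows "EX h. catmap C R P M h & (ALL X:Ob C. ALL x:elts P X. f X (h X x) = g X x)"
 using assms unfolding lifts_def by simp

lemma catmap_zero_closed:
 "catmap C R M N h ==> is_catmod C R M ==> is_catmod C R N ==> X \<in> Ob C ==> h X \<zero>\<^bsub>Fob M X\<^esub> = \<zero>\<^bsub>Fob N X\<^esub>"
 by (rule homs_zero[OF catmapD(1) is_catmodD(1) is_catmodD(1)])

lemma catmap_minus:
 "catmap C R M N h ==> is_catmod C R M ==> is_catmod C R N ==> X \<in> Ob C ==>
  x \<in> elts M X ==> y \<in> elts M X ==> h X (x \<ominus>\<^bsub>Fob M X\<^esub> y) = h X x \<ominus>\<^bsub>Fob N X\<^esub> h X y"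
 by (rule homs_minus[OF catmapD(1) is_catmodD(1) is_catmodD(1)])

lemma catmod_group: "is_catmod C R M ==> X \<in> Ob C ==> abelian_group (Fob M X)"
 by (rule module.axioms(2)[OF is_catmodD(1)])

text \<open>The augmentation may go to any target \<open>K\<close>; below, both resolutions are augmented to \<open>Q 0\<close>.\<close>

locale resolution =
 fixes C :: "('o, 'a) small_category" and R :: "('r, 's) ring_scheme"
  and A :: "nat => ('r, 'o, 'a, 'p) catmod" and d :: "nat => 'o => 'p => 'p"
  and e :: "'o => 'p => 'k" and K :: "('r, 'o, 'a, 'k) catmod"
 assumes catmod: "is_catmod C R (A n)" and target: "is_catmod C R K"
  and d: "catmap C R (A (Suc n)) (A n) (d n)" and e: "catmap C R (A 0) K e"
  and e_surj: "X \<in> Ob C ==> y \<in> elts K X ==> y \<in> e X ` elts (A 0) X"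
  and e_exact: "X \<in> Ob C ==> x \<in> elts (A 0) X ==>
   e X x = \<zero>\<^bsub>Fob K X\<^esub> \<longleftrightarrow> x \<in> d 0 X ` elts (A (Suc 0)) X"
  and d_exact: "X \<in> Ob C ==> x \<in> elts (A (Suc n)) X ==>
   d n X x = \<zero>\<^bsub>Fob (A n) X\<^esub> \<longleftrightarrow> x \<in> d (Suc n) X ` carrier (Fob (A (Suc (Suc n))) X)"
begin

lemmas d_closed = catmapD(3)[OF d]

lemma dd: "X \<in> Ob C ==> x \<in> carrier (Fob (A (Suc (Suc n))) X) ==> d n X (d (Suc n) X x) = \<zero>\<^bsub>Fob (A n) X\<^esub>"
 by (subst d_exact) (simp_all add: d_closed)

lemma ed: "X \<in> Ob C ==> x \<in> elts (A (Suc 0)) X ==> e X (d 0 X x) = \<zero>\<^bsub>Fob K X\<^esub>"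
 by (subst e_exact) (simp_all add: d_closed)

text \<open>The predicate carried through the recursion says that the next map can be lifted.\<close>

lemma chain_map_exists:
 assumes B: "resolution C R B dB eB K"
  and lifts0: "lifts C R (A 0) (B 0) K" and lifts: "!!n. lifts C R (A (Suc n)) (B (Suc n)) (B n)"
 shows "EX f. ALL n. catmap C R (A n) (B n) (f n) &
  (ALL X:Ob C. ALL x:elts (A (Suc n)) X. dB n X (f (Suc n) X x) = f n X (d n X x)) &
  (ALL X:Ob C. ALL x:elts (A 0) X. eB X (f 0 X x) = e X x)"
proof -
 interpret B: resolution C R B dB eB K by (rule B)
 let ?P = "%n ph. catmap C R (A n) (B n) ph &
  (ALL X:Ob C. ALL x:elts (A (Suc n)) X. ph X (d n X x) \<in> dB n X ` elts (B (Suc n)) X) &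
  (n = 0 --> (ALL X:Ob C. ALL x:elts (A 0) X. eB X (ph X x) = e X x))"
 let ?D = "%n ph ps. ALL X:Ob C. ALL x:elts (A (Suc n)) X. dB n X (ps X x) = ph X (d n X x)"
 have "EX f. ALL n. ?P n (f n) & ?D n (f n) (f (Suc n))"
 proof (rule dependent_nat_choice)
  have "EX h. catmap C R (A 0) (B 0) h & (ALL X:Ob C. ALL x:elts (A 0) X. eB X (h X x) = e X x)"
   by (rule liftsD[OF lifts0 B.e e]) (rule B.e_surj, assumption, rule catmapD(3)[OF e])
  then obtain h where h: "catmap C R (A 0) (B 0) h" "ALL X:Ob C. ALL x:elts (A 0) X. eB X (h X x) = e X x"
   by (elim exE conjE)
  have "h X (d 0 X x) \<in> dB 0 X ` elts (B (Suc 0)) X" if "X \<in> Ob C" "x \<in> elts (A (Suc 0)) X" for X x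
   using B.e_exact[OF that(1) catmapD(3)[OF h(1) that(1) d_closed[OF that]]]
    bspec[OF bspec[OF h(2) that(1)] d_closed[OF that]] ed[OF that] by simp
  hence *: "?P 0 h" using h by simp
  show "EX ph. ?P 0 ph" by (rule exI[of _ h]) (rule *)
 next
  fix ph n assume P: "?P n ph"
  note ph = conjunct1[OF P] and im = bspec[OF bspec[OF conjunct1[OF conjunct2[OF P]]]]
  have "EX h. catmap C R (A (Suc n)) (B (Suc n)) h & ?D n ph h"
   by (rule liftsD[OF lifts B.d catmap_comp[OF d ph]]) (rule im)
  then obtain h where h: "catmap C R (A (Suc n)) (B (Suc n)) h" "?D n ph h" by (elim exE conjE)
  have "h X (d (Suc n) X x) \<in> dB (Suc n) X ` carrier (Fob (B (Suc (Suc n))) X)"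
   if "X \<in> Ob C" "x \<in> carrier (Fob (A (Suc (Suc n))) X)" for X x
   using B.d_exact[OF that(1) catmapD(3)[OF h(1) that(1) d_closed[OF that]]]
    bspec[OF bspec[OF h(2) that(1)] d_closed[OF that]] dd[OF that]
    catmap_zero_closed[OF ph catmod B.catmod that(1)] by simp
  hence *: "?P (Suc n) h & ?D n ph h" using h by simp
  show "EX ps. ?P (Suc n) ps & ?D n ph ps" by (rule exI[of _ h]) (rule *)
 qed
 then obtain f where f: "ALL n. ?P n (f n) & ?D n (f n) (f (Suc n))" ..
 note P = conjunct1[OF spec[OF f]] and D = conjunct2[OF spec[OF f]]
 show ?thesis by (rule exI[of _ f], rule allI)
   (rule conjI[OF conjunct1[OF P] conjI[OF D mp[OF conjunct2[OF conjunct2[OF P]] refl]]])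
qed

lemma homotopy_exists:
 assumes lifts: "!!n. lifts C R (A n) (A (Suc n)) (A n)"
  and t: "!!n. catmap C R (A n) (A n) (t n)"
  and dt: "!!n X x. X \<in> Ob C ==> x \<in> elts (A (Suc n)) X ==> d n X (t (Suc n) X x) = t n X (d n X x)"
  and et: "!!X x. X \<in> Ob C ==> x \<in> elts (A 0) X ==> e X (t 0 X x) = e X x"
 shows "EX s. (ALL n. catmap C R (A n) (A (Suc n)) (s n)) &
  (ALL n. ALL X:Ob C. ALL x:elts (A (Suc n)) X.
   d (Suc n) X (s (Suc n) X x) = (t (Suc n) X x \<ominus>\<^bsub>Fob (A (Suc n)) X\<^esub> x) \<ominus>\<^bsub>Fob (A (Suc n)) X\<^esub> s n X (d n X x))"
proof -
 let ?P = "%n s. catmap C R (A n) (A (Suc n)) s &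
  (ALL X:Ob C. ALL x:elts (A (Suc n)) X.
   d n X (s X (d n X x)) = t n X (d n X x) \<ominus>\<^bsub>Fob (A n) X\<^esub> d n X x)"
 let ?D = "%n s s'. ALL X:Ob C. ALL x:elts (A (Suc n)) X.
  d (Suc n) X (s' X x) = (t (Suc n) X x \<ominus>\<^bsub>Fob (A (Suc n)) X\<^esub> x) \<ominus>\<^bsub>Fob (A (Suc n)) X\<^esub> s X (d n X x)"
 have id: "catmap C R (A n) (A n) (%X x. x)" for n by (simp add: catmap_def module_homs_def)
 note tid = catmap_diff[OF t id catmod catmod] and tc = catmapD(3)[OF t]
 have self: "x \<ominus>\<^bsub>Fob M X\<^esub> x = \<zero>\<^bsub>Fob M X\<^esub>" if "is_catmod C R M" "X \<in> Ob C" "x \<in> elts M X" for M X x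
  using abelian_group.minus_eq_zero_iff[OF catmod_group[OF that(1,2)] that(3,3)] by simp
 have "EX s. ALL n. ?P n (s n) & ?D n (s n) (s (Suc n))"
 proof (rule dependent_nat_choice)
  have "EX h. catmap C R (A 0) (A (Suc 0)) h &
    (ALL X:Ob C. ALL x:elts (A 0) X. d 0 X (h X x) = t 0 X x \<ominus>\<^bsub>Fob (A 0) X\<^esub> x)"
  proof (rule liftsD[OF lifts d tid])
   fix X x assume X: "X \<in> Ob C" and x: "x \<in> elts (A 0) X"
   show "t 0 X x \<ominus>\<^bsub>Fob (A 0) X\<^esub> x \<in> d 0 X ` elts (A (Suc 0)) X"
    using catmap_minus[OF e catmod target X tc[OF X x] x] self[OF target X catmapD(3)[OF e X x]]
     e_exact[OF X catmapD(3)[OF tid X x]] by (simp add: et[OF X x])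
  qed
  then obtain h where h: "catmap C R (A 0) (A (Suc 0)) h"
   "ALL X:Ob C. ALL x:elts (A 0) X. d 0 X (h X x) = t 0 X x \<ominus>\<^bsub>Fob (A 0) X\<^esub> x" by (elim exE conjE)
  have *: "?P 0 h" using h d_closed by simp
  show "EX s. ?P 0 s" by (rule exI[of _ h]) (rule *)
 next
  fix s n assume P: "?P n s"
  note s = conjunct1[OF P] and ds = bspec[OF bspec[OF conjunct2[OF P]]]
  note sd = catmap_comp[OF d s] and tn = catmapD(3)[OF tid]
  have "EX h. catmap C R (A (Suc n)) (A (Suc (Suc n))) h & ?D n s h"
  proof (rule liftsD[OF lifts d catmap_diff[OF tid sd catmod catmod]])
   fix X x assume X: "X \<in> Ob C" and x: "x \<in> elts (A (Suc n)) X"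
   let ?t = "t (Suc n) X x \<ominus>\<^bsub>Fob (A (Suc n)) X\<^esub> x"
   have "d n X ?t = t n X (d n X x) \<ominus>\<^bsub>Fob (A n) X\<^esub> d n X x"
    unfolding catmap_minus[OF d catmod catmod X tc[OF X x] x] dt[OF X x] ..
   hence "d n X (?t \<ominus>\<^bsub>Fob (A (Suc n)) X\<^esub> s X (d n X x)) = \<zero>\<^bsub>Fob (A n) X\<^esub>"
    unfolding catmap_minus[OF d catmod catmod X tn[OF X x] catmapD(3)[OF sd X x]] ds[OF X x]
    using self[OF catmod X tn[OF X d_closed[OF X x]]] by simp
   thus "?t \<ominus>\<^bsub>Fob (A (Suc n)) X\<^esub> s X (d n X x) \<in> d (Suc n) X ` carrier (Fob (A (Suc (Suc n))) X)"
    using d_exact[OF X catmapD(3)[OF catmap_diff[OF tid sd catmod catmod] X x]] by simp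
  qed
  then obtain h where h: "catmap C R (A (Suc n)) (A (Suc (Suc n))) h" "?D n s h" by (elim exE conjE)
  have "d (Suc n) X (h X (d (Suc n) X x)) = t (Suc n) X (d (Suc n) X x) \<ominus>\<^bsub>Fob (A (Suc n)) X\<^esub> d (Suc n) X x"
   if X: "X \<in> Ob C" and x: "x \<in> carrier (Fob (A (Suc (Suc n))) X)" for X x
   unfolding bspec[OF bspec[OF h(2) X] d_closed[OF X x]] dd[OF X x] catmap_zero_closed[OF s catmod catmod X]
   by (rule abelian_group.minus_zero_right[OF catmod_group[OF catmod X] tn[OF X d_closed[OF X x]]])
  hence *: "?P (Suc n) h & ?D n s h" using h by simp
  show "EX s'. ?P (Suc n) s' & ?D n s s'" by (rule exI[of _ h]) (rule *)
 qed
 then obtain s where s: "ALL n. ?P n (s n) & ?D n (s n) (s (Suc n))" ..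
 show ?thesis
  by (rule exI[of _ s], intro conjI allI conjunct1[OF conjunct1[OF spec[OF s]]] conjunct2[OF spec[OF s]])
qed

end

subsection \<open>Independence of Ext from the resolution\<close>

abbreviation "ext_cochains C R A F n \<equiv> nat_hom_module C R (A n) F"
abbreviation "ext_coboundary C A d n \<equiv> precomp C (A (Suc n)) (d n)"
abbreviation "ext_cocycles C R A d F n \<equiv>
 kernel_module (ext_cochains C R A F n) (ext_cochains C R A F (Suc n)) (ext_coboundary C A d n)"
abbreviation "ext_coboundaries C R A d F n \<equiv> ext_coboundary C A d n ` carrier (ext_cochains C R A F n)"

lemma Ext_Suc: "Ext C R A d F (Suc n) = quot_module (ext_cocycles C R A d F (Suc n)) (ext_coboundaries C R A d F n)"
 by (simp add: Ext_def cohomology_def)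

context resolution
begin

context
 fixes F :: "('r, 'o, 'a, 'm) catmod"
 assumes R: "cring R" and F: "is_catmod C R F"
begin

lemma ext_cochains_module: "module R (ext_cochains C R A F n)"
 by (rule nat_hom_module_module[OF R catmod F])

lemma ext_coboundary_hom: "ext_coboundary C A d n \<in> module_homs R (ext_cochains C R A F n) (ext_cochains C R A F (Suc n))"
 by (rule precomp_hom[OF R catmod catmod F d])

lemma ext_cocycles_module: "module R (ext_cocycles C R A d F n)"
 by (rule kernel_module_module[OF ext_cochains_module ext_cochains_module ext_coboundary_hom])

lemma ext_cocycles_iff:
 "etg \<in> carrier (ext_cocycles C R A d F n) \<longleftrightarrow> etg \<in> nat_homs C R (A n) F &
  (ALL X:Ob C. ALL x:elts (A (Suc n)) X. etg X (d n X x) = \<zero>\<^bsub>Fob F X\<^esub>)"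
proof -
 have "ext_coboundary C A d n etg = \<zero>\<^bsub>ext_cochains C R A F (Suc n)\<^esub> \<longleftrightarrow>
   (ALL X:Ob C. ALL x:elts (A (Suc n)) X. etg X (d n X x) = \<zero>\<^bsub>Fob F X\<^esub>)"
  unfolding precomp_def nat_hom_module_zero nat_restrict_eq_iff ..
 thus ?thesis by (simp add: kernel_module_def nat_hom_carrier)
qed

lemma ext_coboundaries_submodule: "submodule (ext_coboundaries C R A d F n) R (ext_cocycles C R A d F (Suc n))"
proof (rule image_submodule_kernel[OF ext_cochains_module ext_cochains_module ext_cochains_module ext_coboundary_hom ext_coboundary_hom])
 fix etg assume "etg \<in> carrier (ext_cochains C R A F n)"
 hence etg: "catmap C R (A n) F etg" by (simp add: nat_hom_carrier nat_homs_catmap)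
 show "ext_coboundary C A d (Suc n) (ext_coboundary C A d n etg) = \<zero>\<^bsub>ext_cochains C R A F (Suc (Suc n))\<^esub>"
  unfolding precomp_def nat_hom_module_zero
  by (rule nat_restrict_cong) (simp add: d_closed dd catmap_zero_closed[OF etg catmod F])
qed

lemma ext_coboundariesI:
 assumes "etg \<in> nat_homs C R (A (Suc n)) F" "catmap C R (A n) F ze"
  and "!!X x. X \<in> Ob C ==> x \<in> elts (A (Suc n)) X ==> etg X x = ze X (d n X x)"
 shows "etg \<in> ext_coboundaries C R A d F n"
proof (rule image_eqI[of _ _ "nat_restrict C (A n) ze"])
 have "etg = nat_restrict C (A (Suc n)) etg" by (rule nat_restrict_id[OF assms(1), symmetric])
 also have "... = ext_coboundary C A d n (nat_restrict C (A n) ze)"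
  unfolding precomp_def by (rule nat_restrict_cong) (simp add: assms(3) d_closed)
 finally show "etg = ext_coboundary C A d n (nat_restrict C (A n) ze)" .
qed (simp add: nat_hom_carrier catmap_restrict[OF assms(2) catmod])

lemma pull_back_hom:
 assumes B: "resolution C R B dB eB K" and f: "!!n. catmap C R (A n) (B n) (f n)"
  and df: "!!n X x. X \<in> Ob C ==> x \<in> elts (A (Suc n)) X ==> dB n X (f (Suc n) X x) = f n X (d n X x)"
 shows "precomp C (A n) (f n) \<in> module_homs R (ext_cocycles C R B dB F n) (ext_cocycles C R A d F n)"
proof -
 interpret B: resolution C R B dB eB K by (rule B)
 note hom = precomp_hom[OF R catmod B.catmod F f]
 have "precomp C (A n) (f n) etg \<in> carrier (ext_cocycles C R A d F n)" if "etg \<in> carrier (ext_cocycles C R B dB F n)" for etg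
 proof -
  have etg: "etg \<in> nat_homs C R (B n) F" and z: "!!X x. X \<in> Ob C ==> x \<in> elts (B (Suc n)) X ==> etg X (dB n X x) = \<zero>\<^bsub>Fob F X\<^esub>"
   using that unfolding B.ext_cocycles_iff[OF R F] by simp_all
  show ?thesis unfolding ext_cocycles_iff using precomp_nat_homs[OF catmod f nat_homs_catmap[OF etg]]
   by (simp add: precomp_def d_closed df[symmetric] z catmapD(3)[OF f])
 qed
 thus ?thesis
  using hom by (intro module_homsI) (simp_all add: kernel_module_def homs_add[OF hom] homs_smult[OF hom])
qed

text \<open>The usual argument with chain maps \<open>f\<close>, \<open>g\<close> and homotopies from \<open>gf\<close> and \<open>fg\<close> to the identity, written
out on cocycles: the first homotopy gives surjectivity on classes, the second one injectivity.\<close>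

theorem Ext_independent:
 assumes B: "resolution C R B dB eB K"
  and AB: "lifts C R (A 0) (B 0) K" "!!n. lifts C R (A (Suc n)) (B (Suc n)) (B n)"
  and BA: "lifts C R (B 0) (A 0) K" "!!n. lifts C R (B (Suc n)) (A (Suc n)) (A n)"
  and AA: "!!n. lifts C R (A n) (A (Suc n)) (A n)" and BB: "!!n. lifts C R (B n) (B (Suc n)) (B n)"
 shows "module_isomorphic R (Ext C R B dB F (Suc n)) (Ext C R A d F (Suc n))"
proof -
 interpret B: resolution C R B dB eB K by (rule B)
 obtain f where F0: "ALL n. catmap C R (A n) (B n) (f n) &
  (ALL X:Ob C. ALL x:elts (A (Suc n)) X. dB n X (f (Suc n) X x) = f n X (d n X x)) &
  (ALL X:Ob C. ALL x:elts (A 0) X. eB X (f 0 X x) = e X x)" using chain_map_exists[OF B AB] ..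
 obtain g where G0: "ALL n. catmap C R (B n) (A n) (g n) &
  (ALL X:Ob C. ALL x:elts (B (Suc n)) X. d n X (g (Suc n) X x) = g n X (dB n X x)) &
  (ALL X:Ob C. ALL x:elts (B 0) X. e X (g 0 X x) = eB X x)"
  using B.chain_map_exists[OF resolution_axioms BA] ..
 have f: "catmap C R (A n) (B n) (f n)" and df: "X \<in> Ob C ==> x \<in> elts (A (Suc n)) X ==> dB n X (f (Suc n) X x) = f n X (d n X x)"
  and ef: "X \<in> Ob C ==> y \<in> elts (A 0) X ==> eB X (f 0 X y) = e X y" for n X x y
  using F0 by simp_all
 have g: "catmap C R (B n) (A n) (g n)" and dg: "X \<in> Ob C ==> x \<in> elts (B (Suc n)) X ==> d n X (g (Suc n) X x) = g n X (dB n X x)"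
  and eg: "X \<in> Ob C ==> y \<in> elts (B 0) X ==> e X (g 0 X y) = eB X y" for n X x y
  using G0 by simp_all
 note fc = catmapD(3)[OF f] and gc = catmapD(3)[OF g]
 have "EX s. (ALL n. catmap C R (A n) (A (Suc n)) (s n)) &
  (ALL n. ALL X:Ob C. ALL x:elts (A (Suc n)) X. d (Suc n) X (s (Suc n) X x) =
   (g (Suc n) X (f (Suc n) X x) \<ominus>\<^bsub>Fob (A (Suc n)) X\<^esub> x) \<ominus>\<^bsub>Fob (A (Suc n)) X\<^esub> s n X (d n X x))"
  by (rule homotopy_exists[OF AA catmap_comp[OF f g]]) (simp_all add: dg df eg ef fc)
 then obtain s where S: "(ALL n. catmap C R (A n) (A (Suc n)) (s n)) &
  (ALL n. ALL X:Ob C. ALL x:elts (A (Suc n)) X. d (Suc n) X (s (Suc n) X x) =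
   (g (Suc n) X (f (Suc n) X x) \<ominus>\<^bsub>Fob (A (Suc n)) X\<^esub> x) \<ominus>\<^bsub>Fob (A (Suc n)) X\<^esub> s n X (d n X x))" ..
 note s = spec[OF conjunct1[OF S]] and ds = bspec[OF bspec[OF spec[OF conjunct2[OF S]]]]
 have "EX h. (ALL n. catmap C R (B n) (B (Suc n)) (h n)) &
  (ALL n. ALL X:Ob C. ALL x:elts (B (Suc n)) X. dB (Suc n) X (h (Suc n) X x) =
   (f (Suc n) X (g (Suc n) X x) \<ominus>\<^bsub>Fob (B (Suc n)) X\<^esub> x) \<ominus>\<^bsub>Fob (B (Suc n)) X\<^esub> h n X (dB n X x))"
  by (rule B.homotopy_exists[OF BB catmap_comp[OF g f]]) (simp_all add: dg df eg ef gc)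
 then obtain h where H: "(ALL n. catmap C R (B n) (B (Suc n)) (h n)) &
  (ALL n. ALL X:Ob C. ALL x:elts (B (Suc n)) X. dB (Suc n) X (h (Suc n) X x) =
   (f (Suc n) X (g (Suc n) X x) \<ominus>\<^bsub>Fob (B (Suc n)) X\<^esub> x) \<ominus>\<^bsub>Fob (B (Suc n)) X\<^esub> h n X (dB n X x))" ..
 note h = spec[OF conjunct1[OF H]] and dh = bspec[OF bspec[OF spec[OF conjunct2[OF H]]]]
 let ?\<Phi> = "precomp C (A (Suc n)) (f (Suc n))"
 let ?ZA = "ext_cocycles C R A d F (Suc n)" and ?ZB = "ext_cocycles C R B dB F (Suc n)"
 note hom = pull_back_hom[OF B f df, of "Suc n"]
 show ?thesis unfolding Ext_Suc
 proof (rule quot_isomorphism[OF B.ext_cocycles_module[OF R F] B.ext_coboundaries_submodule[OF R F]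
    ext_cocycles_module ext_coboundaries_submodule hom])
  fix etg assume etgZ: "etg \<in> carrier ?ZB"
  hence etg: "etg \<in> nat_homs C R (B (Suc n)) F"
   and z: "!!X x. X \<in> Ob C ==> x \<in> carrier (Fob (B (Suc (Suc n))) X) ==> etg X (dB (Suc n) X x) = \<zero>\<^bsub>Fob F X\<^esub>"
   unfolding B.ext_cocycles_iff[OF R F] by simp_all
  note etgm = nat_homs_catmap[OF etg]
  show "?\<Phi> etg \<in> ext_coboundaries C R A d F n \<longleftrightarrow> etg \<in> ext_coboundaries C R B dB F n"
  proof
   assume "?\<Phi> etg \<in> ext_coboundaries C R A d F n"
   then obtain ze where ze: "ze \<in> nat_homs C R (A n) F" "?\<Phi> etg = ext_coboundary C A d n ze"
    unfolding nat_hom_carrier by (elim imageE)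
   have eq: "etg X (f (Suc n) X x) = ze X (d n X x)" if "X \<in> Ob C" "x \<in> elts (A (Suc n)) X" for X x
    using ze(2) that unfolding precomp_def nat_restrict_eq_iff by simp
   note zeg = catmap_comp[OF g nat_homs_catmap[OF ze(1)]] and etgh = catmap_comp[OF h etgm]
   show "etg \<in> ext_coboundaries C R B dB F n"
   proof (rule B.ext_coboundariesI[OF R F etg catmap_diff[OF zeg etgh B.catmod F]])
    fix X x assume X: "X \<in> Ob C" and x: "x \<in> elts (B (Suc n)) X"
    note m = catmap_minus[OF etgm B.catmod F X] and etgc = catmapD(3)[OF etgm X]
    note fgx = fc[OF X gc[OF X x]] and hx = catmapD(3)[OF h X B.d_closed[OF X x]]
    have "(etg X (f (Suc n) X (g (Suc n) X x)) \<ominus>\<^bsub>Fob F X\<^esub> etg X x) \<ominus>\<^bsub>Fob F X\<^esub> etg X (h n X (dB n X x)) = \<zero>\<^bsub>Fob F X\<^esub>"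
     unfolding m[OF fgx x, symmetric] m[OF abelian_group.minus_closed[OF catmod_group[OF B.catmod X] fgx x] hx, symmetric]
      dh[OF X x, symmetric] by (rule z[OF X catmapD(3)[OF h X x]])
    from abelian_group.minus_minus_zeroD[OF catmod_group[OF F X] etgc[OF fgx] etgc[OF x] etgc[OF hx] this]
    show "etg X x = ze X (g n X (dB n X x)) \<ominus>\<^bsub>Fob F X\<^esub> etg X (h n X (dB n X x))"
     unfolding eq[OF X gc[OF X x]] dg[OF X x] .
   qed
  next
   assume "etg \<in> ext_coboundaries C R B dB F n"
   then obtain ze where ze: "ze \<in> nat_homs C R (B n) F" "etg = ext_coboundary C B dB n ze"
    unfolding nat_hom_carrier by (elim imageE)
   show "?\<Phi> etg \<in> ext_coboundaries C R A d F n"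
   proof (rule ext_coboundariesI[OF _ catmap_comp[OF f nat_homs_catmap[OF ze(1)]]])
    show "?\<Phi> etg \<in> nat_homs C R (A (Suc n)) F" by (rule precomp_nat_homs[OF catmod f etgm])
   qed (simp add: ze(2) precomp_def fc df)
  qed
 next
  fix etg assume etgZ: "etg \<in> carrier ?ZA"
  hence etg: "etg \<in> nat_homs C R (A (Suc n)) F"
   and z: "!!X x. X \<in> Ob C ==> x \<in> carrier (Fob (A (Suc (Suc n))) X) ==> etg X (d (Suc n) X x) = \<zero>\<^bsub>Fob F X\<^esub>"
   unfolding ext_cocycles_iff by simp_all
  note etgm = nat_homs_catmap[OF etg]
  let ?c = "precomp C (B (Suc n)) (g (Suc n)) etg" and ?w = "ext_coboundary C A d n (nat_restrict C (A n) (%X x. etg X (s n X x)))"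
  interpret Z: module R ?ZA by (rule ext_cocycles_module)
  note sub = ext_coboundaries_submodule[of n] and etgs = catmap_comp[OF s etgm]
  have w: "?w \<in> ext_coboundaries C R A d F n"
   using catmap_restrict[OF etgs catmod] by (simp add: nat_hom_carrier)
  have wZ: "?w \<in> carrier ?ZA" using Z.submoduleE(1)[OF sub] w by (rule subsetD)
  have "?\<Phi> ?c = nat_restrict C (A (Suc n)) (%X x. etg X x \<oplus>\<^bsub>Fob F X\<^esub> ?w X x)"
   unfolding precomp_def
  proof (rule nat_restrict_cong)
   fix X x assume X: "X \<in> Ob C" and x: "x \<in> elts (A (Suc n)) X"
   note m = catmap_minus[OF etgm catmod F X] and etgc = catmapD(3)[OF etgm X]
   note gfx = gc[OF X fc[OF X x]] and sx = catmapD(3)[OF s X d_closed[OF X x]]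
   have "(etg X (g (Suc n) X (f (Suc n) X x)) \<ominus>\<^bsub>Fob F X\<^esub> etg X x) \<ominus>\<^bsub>Fob F X\<^esub> etg X (s n X (d n X x)) = \<zero>\<^bsub>Fob F X\<^esub>"
    unfolding m[OF gfx x, symmetric] m[OF abelian_group.minus_closed[OF catmod_group[OF catmod X] gfx x] sx, symmetric]
     ds[OF X x, symmetric] by (rule z[OF X catmapD(3)[OF s X x]])
   from abelian_group.minus_minus_zeroD'[OF catmod_group[OF F X] etgc[OF gfx] etgc[OF x] etgc[OF sx] this]
   show "nat_restrict C (B (Suc n)) (%X x. etg X (g (Suc n) X x)) X (f (Suc n) X x) =
     etg X x \<oplus>\<^bsub>Fob F X\<^esub> nat_restrict C (A (Suc n)) (%X x. nat_restrict C (A n) (%X x. etg X (s n X x)) X (d n X x)) X x"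
    using X x fc[OF X x] d_closed[OF X x] by simp
  qed
  also have "... = etg \<oplus>\<^bsub>?ZA\<^esub> ?w" unfolding kernel_module_ops nat_hom_module_add ..
  finally have "etg \<ominus>\<^bsub>?ZA\<^esub> ?\<Phi> ?c = \<ominus>\<^bsub>?ZA\<^esub> ?w"
   using etgZ wZ by (simp only: Z.minus_add a_minus_def Z.r_neg2 Z.a_inv_closed)
  moreover have "?c \<in> carrier ?ZB"
   by (rule homs_closed[OF B.pull_back_hom[OF R F resolution_axioms g dg] etgZ])
  ultimately show "EX c:carrier ?ZB. etg \<ominus>\<^bsub>?ZA\<^esub> ?\<Phi> c \<in> ext_coboundaries C R A d F n"
   using Z.submoduleE(3)[OF sub w] by (intro bexI[of _ ?c]) simp_all
 qed
qed

end

end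

section \<open>Two resolutions of the constant functor\<close>

context p_group_ring
begin

interpretation R: cring R by (rule cring_R)

lemma ev_cong':
 assumes N: "secs_mod Os N" and k: "has_csec Os k" and c: "is_cochain k N c"
  and eq: "!!E z. E \<in> EA k ==> z \<in> St k E ==> c' E z = c E z"
  and X: "X \<in> Os" and x: "x \<in> carrier (Qmod k X)"
 shows "ev k N c' X x = ev k N c X x"
 by (rule ev_cong[OF eq x secs_modD(2)[OF N X] additive_onD(1)[OF ev_additive[OF N k c X]]])

lemma ev_zero:
 assumes N: "secs_mod Os N" and k: "has_csec Os k"
  and zero: "!!E z. E \<in> EA k ==> z \<in> St k E ==> c E z = \<zero>\<^bsub>Fob N (cs E)\<^esub>"
  and X: "X \<in> Os" and x: "x \<in> carrier (Qmod k X)"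
 shows "ev k N c X x = \<zero>\<^bsub>Fob N X\<^esub>"
proof -
 interpret M: module R "Fob N X" by (rule secs_modD(2)[OF N X])
 have z0: "Fm N X (cs E) \<one> (c E z) = \<zero>\<^bsub>Fob N X\<^esub>" if E: "E \<in> els k X" and z: "z \<in> St k E" for E z
  unfolding zero[OF elsD(1)[OF E] z]
  by (rule homs_zero[OF Fm_hom[OF N X has_csecD[OF k elsD(1)[OF E]] arrow_els_csec[OF secs_modD(1)[OF N X] E]]
    secs_modD(2)[OF N has_csecD[OF k elsD(1)[OF E]]] secs_modD(2)[OF N X]])
 have add: "additive_on (St k E) (Fob N X) (%z. Fm N X (cs E) \<one> (c E z))" if E: "E \<in> els k X" for E
  using z0[OF E] int_groupD(2)[OF steinberg_group] by (simp add: additive_on_def)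
 show ?thesis
 proof (rule Qmod_hom_eqI[of _ k X "Fob N X" "%x. \<zero>\<^bsub>Fob N X\<^esub>", OF _ _ M.module_axioms _ x])
  show "ev k N c X \<in> module_homs R (Qmod k X) (Fob N X)"
   unfolding ev_def by (rule Qext_hom(1)[OF M.module_axioms add])
  show "(%x. \<zero>\<^bsub>Fob N X\<^esub>) \<in> module_homs R (Qmod k X) (Fob N X)"
   by (simp add: module_homs_def)
  fix E z assume E: "E \<in> els k X" and z: "z \<in> St k E"
  have "ev k N c X (can k E z) = Fm N X (cs E) \<one> (c E z)"
   unfolding ev_def by (rule Qext_hom(2)[OF M.module_axioms add E z])
  thus "ev k N c X (can k E z) = \<zero>\<^bsub>Fob N X\<^esub>" unfolding z0[OF E z] .
 qed
qed

lemma cob_cong: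
 assumes N: "secs_mod Os N" and k: "has_csec Os k" "has_csec Os (Suc k)" and c: "is_cochain k N c"
  and eq: "!!E z. E \<in> EA k ==> z \<in> St k E ==> c' E z = c E z"
  and E: "E \<in> EA (Suc k)"
 shows "cob k N c' E z = cob k N c E z" unfolding cob_def push_def
 by (rule ev_cong'[OF N k(1) c eq has_csecD[OF k(2) E] homs_closed[OF bd_hom can_closed[OF csec_els[OF E]]]])

lemma cob_can:
 assumes "Os \<subseteq> sections G" "has_csec Os k" "has_csec Os (Suc k)" "E \<in> EA (Suc k)"
 shows "cob k (Q k) (can k) E z = bd k (cs E) (can (Suc k) E z)" unfolding cob_def push_def
 by (rule ev_can_id[OF assms(1,2) has_csecD[OF assms(3,4)] homs_closed[OF bd_hom can_closed[OF csec_els[OF assms(4)]]]])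

abbreviation star :: "('a set \<times> 'a set) set"
 where "star \<equiv> Ob (sec_cat_star G)"

lemma star_sections: "star \<subseteq> sections G" by (auto simp: star_section)

lemma star_cat: "secs_cat star = sec_cat_star G" by (simp add: sec_cat_star_def)

lemma small_cat_star: "small_cat (sec_cat_star G)"
 using small_cat_restrict[OF small_cat_sec_cat, of star] star_sections unfolding star_cat
 by (simp add: sec_cat_def)

lemma star_catmap: "catmap (sec_cat_star G) R M N etg ==> catmap (secs_cat star) R M N etg"
 by (simp add: star_cat)

lemmas has_star = has_csec_star

lemma Q_star: "secs_mod star (Q k)" by (rule Q_secs[OF star_sections])

lemma Q_star_catmod: "is_catmod (sec_cat_star G) R (Q k)"
 using Q_star[of k] by (simp add: secs_mod_def star_cat)

lemma bd_star: "catmap (sec_cat_star G) R (Q (Suc k)) (Q k) (bd k)"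
 using bd_secs[OF star_sections, of k] by (simp add: star_cat)

lemma Q_resolution: "resolution (sec_cat_star G) R (%n. Q (Suc n)) (%n. bd (Suc n)) (bd 0) (Q 0)"
proof
 show "catmap (sec_cat_star G) R (Q (Suc 0)) (Q 0) (bd 0)" by (rule bd_star)
 fix X assume X: "X \<in> star"
 show "y \<in> bd 0 X ` elts (Q (Suc 0)) X" if y: "y \<in> elts (Q 0) X" for y
 proof -
  obtain z where "z \<in> carrier (Qmod 1 X)" "bd 0 X z = y" using Q_exact_0[OF X y[unfolded Q_Fob]] by (elim bexE)
  thus ?thesis unfolding Q_Fob by (intro image_eqI[of _ _ z]) simp_all
 qed
 have ex: "bd n X x = \<zero>\<^bsub>Fob (Q n) X\<^esub> \<longleftrightarrow> x \<in> bd (Suc n) X ` carrier (Fob (Q (Suc (Suc n))) X)"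
  if x: "x \<in> elts (Q (Suc n)) X" for n x
 proof
  assume "bd n X x = \<zero>\<^bsub>Fob (Q n) X\<^esub>"
  then obtain z where "z \<in> carrier (Qmod (Suc (Suc n)) X)" "bd (Suc n) X z = x"
   unfolding Q_Fob by (rule Q_exact_Suc[OF X x[unfolded Q_Fob], THEN bexE])
  thus "x \<in> bd (Suc n) X ` carrier (Fob (Q (Suc (Suc n))) X)" unfolding Q_Fob by (intro image_eqI[of _ _ z]) simp_all
 next
  assume "x \<in> bd (Suc n) X ` carrier (Fob (Q (Suc (Suc n))) X)"
  then obtain z where "z \<in> carrier (Qmod (Suc (Suc n)) X)" "x = bd (Suc n) X z" unfolding Q_Fob by (elim imageE)
  thus "bd n X x = \<zero>\<^bsub>Fob (Q n) X\<^esub>" unfolding Q_Fob by (simp add: bd_bd)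
 qed
 show "bd 0 X x = \<zero>\<^bsub>Fob (Q 0) X\<^esub> \<longleftrightarrow> x \<in> bd (Suc 0) X ` carrier (Fob (Q (Suc (Suc 0))) X)"
  if "x \<in> elts (Q (Suc 0)) X" for x by (rule ex[OF that])
 show "bd (Suc n) X x = \<zero>\<^bsub>Fob (Q (Suc n)) X\<^esub> \<longleftrightarrow> x \<in> bd (Suc (Suc n)) X ` carrier (Fob (Q (Suc (Suc (Suc n)))) X)"
  if "x \<in> carrier (Fob (Q (Suc (Suc n))) X)" for n x by (rule ex[OF that])
qed (rule Q_star_catmod bd_star)+

text \<open>Lifting a natural transformation from \<open>Q k\<close> is lifting the corresponding cochain.\<close>

lemma Q_lifts:
 assumes reps: "conj_representatives G p (Suc k) (\<E> (Suc k))" and M: "secs_mod star M" and N: "secs_mod star N"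
 shows "lifts (sec_cat_star G) R (Q (Suc k)) M N" unfolding lifts_def
proof (intro allI impI)
 fix f g assume f: "catmap (sec_cat_star G) R M N f" and g: "catmap (sec_cat_star G) R (Q (Suc k)) N g"
  and im: "ALL X:star. ALL x:elts (Q (Suc k)) X. g X x \<in> f X ` elts M X"
 note fs = star_catmap[OF f] and gs = star_catmap[OF g]
 note c = push_cochain[OF Q_star has_star gs can_cochain]
 have "EX c'. is_cochain (Suc k) M c' &
   (ALL E:EA (Suc k). ALL z:St (Suc k) E. f (cs E) (c' E z) = push g (can (Suc k)) E z)"
 proof (rule cochain_lift[where \<E> = \<E>, OF M N has_star reps fs c])
  fix E z assume E: "E \<in> EA (Suc k)"
  show "push g (can (Suc k)) E z \<in> f (cs E) ` elts M (cs E)"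
   using im csec_star[OF E] can_closed[OF csec_els[OF E], of z] by (simp add: push_def Q_Fob)
 qed
 then obtain c' where c': "is_cochain (Suc k) M c'"
  and fc: "ALL E:EA (Suc k). ALL z:St (Suc k) E. f (cs E) (c' E z) = push g (can (Suc k)) E z"
  by (elim exE conjE)
 have "f X (ev (Suc k) M c' X x) = g X x" if X: "X \<in> star" and "x \<in> elts (Q (Suc k)) X" for X x
 proof -
  have x: "x \<in> carrier (Qmod (Suc k) X)" using that(2) unfolding Q_Fob .
  have "f X (ev (Suc k) M c' X x) = ev (Suc k) N (push f c') X x"
   by (rule ev_push[OF M has_star c' N fs X x, symmetric])
  also have "... = ev (Suc k) N (push g (can (Suc k))) X x"
   by (rule ev_cong'[OF N has_star c _ X x]) (use fc in \<open>simp add: push_def\<close>)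
  also have "... = g X x"
   unfolding ev_push[OF Q_star has_star can_cochain N gs X x] ev_can_id[OF star_sections has_star X x] ..
  finally show ?thesis .
 qed
 thus "EX h. catmap (sec_cat_star G) R (Q (Suc k)) M h & (ALL X:star. ALL x:elts (Q (Suc k)) X. f X (h X x) = g X x)"
  using ev_catmap[OF M has_star c', unfolded star_cat] by (intro exI[of _ "ev (Suc k) M c'"]) simp
qed

lemma projective_lifts:
 "projective (sec_cat_star G) R P ==> is_catmod (sec_cat_star G) R M ==> is_catmod (sec_cat_star G) R N ==>
  lifts (sec_cat_star G) R P M N"
 unfolding lifts_def by (intro allI impI) (rule projective_lift[OF small_cat_star cring_R]; simp)

end

locale p_group_resolution = p_group_ring G p n_G R
 for G :: "('a, 'b) monoid_scheme" (structure) and p n_G :: nat and R :: "('r, 's) ring_scheme" +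
 fixes P :: "nat => ('r, 'a set \<times> 'a set, 'a set, 'q) catmod"
  and d :: "nat => 'a set \<times> 'a set => 'q => 'q" and \<epsilon> :: "'a set \<times> 'a set => 'q => 'r"
  and \<E> :: "nat => 'a set set"
 assumes res: "projective_resolution (sec_cat_star G) R (const_catmod R) P d \<epsilon>"
  and reps: "!!k. conj_representatives G p k (\<E> k)"
begin

interpretation R: cring R by (rule cring_R)

lemma P_proj: "projective (sec_cat_star G) R (P n)" using res by (simp add: projective_resolution_def)

lemma P_catmod: "is_catmod (sec_cat_star G) R (P n)" using P_proj[of n] by (simp add: projective_def)

lemma P_star: "secs_mod star (P n)" using P_catmod[of n] star_sections by (simp add: secs_mod_def star_cat)

lemma d_catmap: "catmap (sec_cat_star G) R (P (Suc n)) (P n) (d n)"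
 using res by (intro nat_homs_catmap) (simp add: projective_resolution_def)

lemma \<epsilon>_catmap: "catmap (sec_cat_star G) R (P 0) (const_catmod R) \<epsilon>"
 using res by (intro nat_homs_catmap) (simp add: projective_resolution_def)

lemma exact:
 assumes X: "X \<in> star"
 shows "\<epsilon> X ` elts (P 0) X = carrier R"
  "x \<in> elts (P 0) X ==> \<epsilon> X x = \<zero>\<^bsub>R\<^esub> \<longleftrightarrow> x \<in> d 0 X ` elts (P 1) X"
  "x \<in> elts (P (Suc n)) X ==> d n X x = \<zero>\<^bsub>Fob (P n) X\<^esub> \<longleftrightarrow> x \<in> d (Suc n) X ` carrier (Fob (P (Suc (Suc n))) X)"
proof -
 note a = bspec[OF conjunct2[OF conjunct2[OF conjunct2[OF res[unfolded projective_resolution_def]]]] X]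
 note * = conjunct1[OF a] conjunct1[OF conjunct2[OF a]] spec[OF conjunct2[OF conjunct2[OF a]]]
 show "\<epsilon> X ` elts (P 0) X = carrier R" using *(1) by (simp add: const_catmod_def)
 show "x \<in> elts (P 0) X ==> \<epsilon> X x = \<zero>\<^bsub>R\<^esub> \<longleftrightarrow> x \<in> d 0 X ` elts (P 1) X"
  unfolding *(2) by (simp add: const_catmod_def)
 show "x \<in> elts (P (Suc n)) X ==> d n X x = \<zero>\<^bsub>Fob (P n) X\<^esub> \<longleftrightarrow> x \<in> d (Suc n) X ` carrier (Fob (P (Suc (Suc n))) X)"
  unfolding *(3) by simp
qed

text \<open>The augmentation of \<open>P\<close>, transported to \<open>Q 0\<close>, a copy of the constant functor.\<close>

definition aug :: "'a set \<times> 'a set => 'q => 'a set \<times> 'a set list => 'r"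
 where "aug X x = \<epsilon> X x \<odot>\<^bsub>Qmod 0 X\<^esub> unit0"

lemma \<epsilon>_closed: "X \<in> star ==> x \<in> elts (P 0) X ==> \<epsilon> X x \<in> carrier R"
 using exact(1) by blast

lemma aug_catmap: "catmap (sec_cat_star G) R (P 0) (Q 0) aug"
proof (rule catmap_secsI[OF star_sections, unfolded star_cat])
 fix X assume X: "X \<in> star"
 have Xs: "X \<in> sections G" using X star_sections by auto
 interpret M: module R "Qmod 0 X" by (rule Qmod_module)
 let ?K = "const_catmod R :: ('r, 'a set \<times> 'a set, 'a set, 'r) catmod"
 have \<epsilon>: "\<epsilon> X \<in> module_homs R (Fob (P 0) X) (Fob ?K X)" by (rule catmapD(1)[OF \<epsilon>_catmap X])
 have "(%r. r \<odot>\<^bsub>Qmod 0 X\<^esub> unit0) \<in> module_homs R (Fob ?K X) (Qmod 0 X)"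
  using unit0_closed[OF Xs]
  by (intro module_homsI) (simp_all add: const_catmod_def M.smult_l_distr M.smult_assoc1)
 from homs_comp[OF \<epsilon> this]
 show "aug X \<in> module_homs R (Fob (P 0) X) (Fob (Q 0) X)" unfolding aug_def Q_Fob .
 fix Y g y assume Y: "Y \<in> star" and g: "arrow X Y g" and y: "y \<in> elts (P 0) Y"
 have Ys: "Y \<in> sections G" using Y star_sections by auto
 have "\<epsilon> X (Fm (P 0) X Y g y) = \<epsilon> Y y"
  using Fm_catmap[OF star_catmap[OF \<epsilon>_catmap] X Y g y] by (simp add: Fm_def const_catmod_def)
 moreover have "Qmap 0 X Y (fst Y #> g) (\<epsilon> Y y \<odot>\<^bsub>Qmod 0 Y\<^esub> unit0) = \<epsilon> Y y \<odot>\<^bsub>Qmod 0 X\<^esub> unit0"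
  using homs_smult[OF Qmap_hom(1)[OF Xs Ys g] \<epsilon>_closed[OF Y y] unit0_closed[OF Ys]] Qmap_unit0[OF Xs Ys g] by simp
 ultimately show "aug X (Fm (P 0) X Y g y) = Fm (Q 0) X Y g (aug Y y)" unfolding aug_def Q_Fm by simp
qed

lemma aug_zero_iff: "X \<in> star ==> x \<in> elts (P 0) X ==> aug X x = \<zero>\<^bsub>Qmod 0 X\<^esub> \<longleftrightarrow> x \<in> d 0 X ` elts (P 1) X"
proof -
 assume X: "X \<in> star" and x: "x \<in> elts (P 0) X"
 interpret M: module R "Qmod 0 X" by (rule Qmod_module)
 have "unit0 \<in> carrier (Qmod 0 X)" using unit0_closed X star_sections by blast
 hence "aug X x = \<zero>\<^bsub>Qmod 0 X\<^esub> \<longleftrightarrow> \<epsilon> X x = \<zero>\<^bsub>R\<^esub>"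
  using unit0_scale_inj[OF \<epsilon>_closed[OF X x], of X] by (auto simp: aug_def)
 thus ?thesis using exact(2)[OF X x] by simp
qed

lemma aug_surj: "X \<in> star ==> x \<in> carrier (Qmod 0 X) ==> x \<in> aug X ` elts (P 0) X"
proof -
 assume X: "X \<in> star" and x: "x \<in> carrier (Qmod 0 X)"
 have Xs: "X \<in> sections G" using X star_sections by auto
 obtain y where y: "y \<in> elts (P 0) X" "x ({\<one>}, []) = \<epsilon> X y"
  using exact(1)[OF X] Qmod_0_scale(2)[OF Xs x] by auto
 have "x = aug X y" unfolding aug_def y(2)[symmetric] by (rule Qmod_0_scale(1)[OF Xs x])
 thus ?thesis using y(1) by blast
qed

lemma P_resolution: "resolution (sec_cat_star G) R P d aug (Q 0)"
proof
 show "y \<in> aug X ` elts (P 0) X" if "X \<in> star" "y \<in> elts (Q 0) X" for X y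
  by (rule aug_surj[OF that(1) that(2)[unfolded Q_Fob]])
 show "aug X x = \<zero>\<^bsub>Fob (Q 0) X\<^esub> \<longleftrightarrow> x \<in> d 0 X ` elts (P (Suc 0)) X" if "X \<in> star" "x \<in> elts (P 0) X" for X x
  unfolding Q_Fob using aug_zero_iff[OF that] by simp
 show "d n X x = \<zero>\<^bsub>Fob (P n) X\<^esub> \<longleftrightarrow> x \<in> d (Suc n) X ` carrier (Fob (P (Suc (Suc n))) X)"
  if "X \<in> star" "x \<in> elts (P (Suc n)) X" for X x n by (rule exact(3)[OF that])
qed (rule P_catmod Q_star_catmod d_catmap aug_catmap)+

theorem Ext_Q:
 assumes F: "is_catmod (sec_cat_star G) R F"
 shows "module_isomorphic R (Ext (sec_cat_star G) R P d F (Suc n))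
  (Ext (sec_cat_star G) R (%n. Q (Suc n)) (%n. bd (Suc n)) F (Suc n))"
 by (rule resolution.Ext_independent[OF Q_resolution cring_R F P_resolution])
  (rule projective_lifts P_proj P_catmod Q_star_catmod P_star Q_star Q_lifts[where \<E> = \<E>, OF reps])+

end

section \<open>The Steinberg complex\<close>

context p_group_ring
begin

interpretation R: cring R by (rule cring_R)

lemma cochain_lin:
 assumes N: "secs_mod Os N" and k: "has_csec Os k" and c: "is_cochain k N c" and c': "is_cochain k N c'"
  and r: "r \<in> carrier R"
 shows "is_cochain k N (%E z. r \<odot>\<^bsub>Fob N (cs E)\<^esub> c E z \<oplus>\<^bsub>Fob N (cs E)\<^esub> c' E z)"
 unfolding is_cochain_def
proof (intro conjI ballI)
 fix E assume E: "E \<in> EA k"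
 interpret M: module R "Fob N (cs E)" by (rule secs_modD(2)[OF N has_csecD[OF k E]])
 note cE = is_cochainD(3)[OF c E] and cE' = is_cochainD(3)[OF c' E]
 show "additive_on (St k E) (Fob N (cs E))
   (%z. r \<odot>\<^bsub>Fob N (cs E)\<^esub> c E z \<oplus>\<^bsub>Fob N (cs E)\<^esub> c' E z)"
  unfolding additive_on_def
 proof (intro conjI ballI)
  fix z assume z: "z \<in> St k E"
  show "r \<odot>\<^bsub>Fob N (cs E)\<^esub> c E z \<oplus>\<^bsub>Fob N (cs E)\<^esub> c' E z \<in> elts N (cs E)"
   using cE[OF z] cE'[OF z] r by simp
  fix w assume w: "w \<in> St k E"
  show "r \<odot>\<^bsub>Fob N (cs E)\<^esub> c E (%x. z x + w x) \<oplus>\<^bsub>Fob N (cs E)\<^esub> c' E (%x. z x + w x) =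
    (r \<odot>\<^bsub>Fob N (cs E)\<^esub> c E z \<oplus>\<^bsub>Fob N (cs E)\<^esub> c' E z) \<oplus>\<^bsub>Fob N (cs E)\<^esub>
    (r \<odot>\<^bsub>Fob N (cs E)\<^esub> c E w \<oplus>\<^bsub>Fob N (cs E)\<^esub> c' E w)"
   using additive_onD(2)[OF is_cochainD(1)[OF c E] z w] additive_onD(2)[OF is_cochainD(1)[OF c' E] z w]
    cE[OF z] cE'[OF z] cE[OF w] cE'[OF w] r by (simp add: M.smult_r_distr M.a_ac)
 qed
next
 fix g E z assume g: "g \<in> carrier G" and E: "E \<in> EA k" and z: "z \<in> St k E"
 interpret M: module R "Fob N (cs E)" by (rule secs_modD(2)[OF N has_csecD[OF k E]])
 note hom = conj_map_hom[OF N k g E] and cz = is_cochainD(3)[OF c E z] is_cochainD(3)[OF c' E z]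
 show "r \<odot>\<^bsub>Fob N (cs (cj g E))\<^esub> c (cj g E) (cjc g z)
    \<oplus>\<^bsub>Fob N (cs (cj g E))\<^esub> c' (cj g E) (cjc g z) =
   conj_map G N g (cs E) (r \<odot>\<^bsub>Fob N (cs E)\<^esub> c E z \<oplus>\<^bsub>Fob N (cs E)\<^esub> c' E z)"
  unfolding is_cochainD(2)[OF c g E z] is_cochainD(2)[OF c' g E z]
   homs_add[OF hom M.smult_closed[OF r cz(1)] cz(2)] homs_smult[OF hom r cz(1)] ..
qed

lemma ev_lin:
 assumes N: "secs_mod Os N" and k: "has_csec Os k" and c: "is_cochain k N c" and c': "is_cochain k N c'"
  and r: "r \<in> carrier R" and X: "X \<in> Os" and x: "x \<in> carrier (Qmod k X)"
 shows "ev k N (%E z. r \<odot>\<^bsub>Fob N (cs E)\<^esub> c E z \<oplus>\<^bsub>Fob N (cs E)\<^esub> c' E z) X x =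
  r \<odot>\<^bsub>Fob N X\<^esub> ev k N c X x \<oplus>\<^bsub>Fob N X\<^esub> ev k N c' X x"
proof -
 note NX = secs_modD(2)[OF N X]
 interpret M: module R "Fob N X" by (rule NX)
 note e = ev_hom[OF N k c X] ev_hom[OF N k c' X]
 show ?thesis
 proof (rule Qmod_hom_eqI[OF ev_hom[OF N k cochain_lin[OF N k c c' r] X]
    homs_sum[OF homs_comp[OF e(1) module_homs_scale[OF NX M.zero_closed r]] e(2) Qmod_module NX] NX _ x])
  fix E z assume E: "E \<in> els k X" and z: "z \<in> St k E"
  note Ek = elsD(1)[OF E]
  interpret ME: module R "Fob N (cs E)" by (rule secs_modD(2)[OF N has_csecD[OF k Ek]])
  note hom = Fm_hom[OF N X has_csecD[OF k Ek] arrow_els_csec[OF secs_modD(1)[OF N X] E]]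
   and cz = is_cochainD(3)[OF c Ek z] is_cochainD(3)[OF c' Ek z]
  show "ev k N (%E z. r \<odot>\<^bsub>Fob N (cs E)\<^esub> c E z \<oplus>\<^bsub>Fob N (cs E)\<^esub> c' E z) X (can k E z) =
    r \<odot>\<^bsub>Fob N X\<^esub> ev k N c X (can k E z) \<oplus>\<^bsub>Fob N X\<^esub> ev k N c' X (can k E z)"
   unfolding ev_can[OF N k cochain_lin[OF N k c c' r] X E z] ev_can[OF N k c X E z] ev_can[OF N k c' X E z]
    homs_add[OF hom ME.smult_closed[OF r cz(1)] cz(2)] homs_smult[OF hom r cz(1)] ..
 qed
qed

lemma cob_lin:
 assumes N: "secs_mod Os N" and k: "has_csec Os k" "has_csec Os (Suc k)" and c: "is_cochain k N c" and c': "is_cochain k N c'"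
  and r: "r \<in> carrier R" and E: "E \<in> EA (Suc k)"
 shows "cob k N (%E z. r \<odot>\<^bsub>Fob N (cs E)\<^esub> c E z \<oplus>\<^bsub>Fob N (cs E)\<^esub> c' E z) E z =
  r \<odot>\<^bsub>Fob N (cs E)\<^esub> cob k N c E z \<oplus>\<^bsub>Fob N (cs E)\<^esub> cob k N c' E z"
 unfolding cob_def push_def
 by (rule ev_lin[OF N k(1) c c' r has_csecD[OF k(2) E] homs_closed[OF bd_hom can_closed[OF csec_els[OF E]]]])

lemma zero_cochain:
 assumes N: "secs_mod Os N" and k: "has_csec Os k"
 shows "is_cochain k N (%E z. \<zero>\<^bsub>Fob N (cs E)\<^esub>)" unfolding is_cochain_def
proof (intro conjI ballI)
 fix E assume E: "E \<in> EA k"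
 interpret M: module R "Fob N (cs E)" by (rule secs_modD(2)[OF N has_csecD[OF k E]])
 show "additive_on (St k E) (Fob N (cs E)) (%z. \<zero>\<^bsub>Fob N (cs E)\<^esub>)"
  by (simp add: additive_on_def)
 fix g assume g: "g \<in> carrier G"
 show "\<zero>\<^bsub>Fob N (cs (cj g E))\<^esub> = conj_map G N g (cs E) \<zero>\<^bsub>Fob N (cs E)\<^esub>"
  by (rule homs_zero[OF conj_map_hom[OF N k g E] M.module_axioms
    secs_modD(2)[OF N has_csecD[OF k conj_elem_ab[OF g E]]], symmetric])
qed

end

locale p_group_catmod = p_group_ring G p n_G R
 for G :: "('a, 'b) monoid_scheme" (structure) and p n_G :: nat and R :: "('r, 's) ring_scheme" +
 fixes F :: "('r, 'a set \<times> 'a set, 'a set, 'm) catmod" and \<E> :: "nat => 'a set set"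
 assumes F_catmod: "is_catmod (sec_cat G) R F"
  and reps: "!!k. conj_representatives G p k (\<E> k)"
begin

interpretation R: cring R by (rule cring_R)

abbreviation "SC k \<equiv> steinberg_cochains G \<E> F k"
abbreviation "\<delta> k \<equiv> steinberg_coboundary G p \<E> F k"
abbreviation "ext k c \<equiv> extend_cochain G \<E> F k c"

text \<open>Restriction of a cochain to the representatives, extended by the default value as the product module
requires. It is inverse to extension by equivariance.\<close>

definition rs :: "nat => ('a set => ('a set list => int) => 'm) => 'a set => ('a set list => int) => 'm"
 where "rs k c = (\<lambda>E\<in>\<E> k. \<lambda>z\<in>St k E. c E z)"

lemma F_secs: "secs_mod (sections G) F" using F_catmod by (simp add: secs_mod_def sec_cat_def)

lemma F_star: "secs_mod star F"
 using is_catmod_restrict[OF F_catmod, of star] star_sections by (simp add: secs_mod_def sec_cat_def)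

lemmas has_sec = has_sections

lemma \<E>_elem_ab: "E \<in> \<E> k ==> E \<in> EA k" by (rule repsD[OF reps])

lemma F_csec_module: "E \<in> EA k ==> module R (Fob F (cs E))"
 by (rule secs_modD(2)[OF F_secs csec_section])

lemma steinberg_hom_carrier:
 "f \<in> carrier (steinberg_hom G F k E) \<longleftrightarrow> f \<in> extensional (St k E) & rep_cochain k F E f"
 by (auto simp: steinberg_hom_def rep_cochain_def additive_on_def PiE_iff)

lemma steinberg_hom_module:
 assumes E: "E \<in> EA k"
 shows "module R (steinberg_hom G F k E)"
proof -
 let ?N = "Fob F (cs E)" and ?S = "St k E"
 let ?P = "prod_module ?S (%_. ?N)"
 interpret M: module R ?N by (rule F_csec_module[OF E])
 have P: "module R ?P" by (rule prod_module_module[OF cring_R M.module_axioms])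
 have C: "steinberg_hom G F k E = ?P\<lparr>carrier := carrier (steinberg_hom G F k E)\<rparr>"
  by (simp add: steinberg_hom_def)
 have hom: "conj_map G F g (cs E) \<in> module_homs R ?N ?N" and conj: "z \<in> ?S ==> cjc g z \<in> ?S"
  if "g \<in> normalizer G E" for g z
 proof -
  have g: "g \<in> carrier G" "cj g E = E" using that normalizer_iff[OF elem_abD(4)[OF E]] by auto
  show "conj_map G F g (cs E) \<in> module_homs R ?N ?N" using conj_map_hom[OF F_secs has_sec g(1) E] unfolding g(2) .
  show "z \<in> ?S ==> cjc g z \<in> ?S"
   using conj_steinberg[OF g(1) elem_abD(4)[OF E], of z k] unfolding g(2) .
 qed
 note add = int_groupD(2)[OF steinberg_group]
 show ?thesis
 proof (subst C, rule restricted_module[OF P])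
  show "carrier (steinberg_hom G F k E) \<subseteq> carrier ?P"
   by (auto simp: steinberg_hom_def prod_module_def)
  show "\<zero>\<^bsub>?P\<^esub> \<in> carrier (steinberg_hom G F k E)"
   unfolding steinberg_hom_carrier rep_cochain_def additive_on_def
   using conj add homs_zero[OF hom M.module_axioms M.module_axioms] by (simp add: prod_module_def)
  fix r x y assume r: "r \<in> carrier R" and "x \<in> carrier (steinberg_hom G F k E)" "y \<in> carrier (steinberg_hom G F k E)"
  hence x: "rep_cochain k F E x" and y: "rep_cochain k F E y" unfolding steinberg_hom_carrier by simp_all
  have v: "x z \<in> carrier ?N" "y z \<in> carrier ?N" if "z \<in> ?S" for z
   using x y that unfolding rep_cochain_def additive_on_def by auto
  have xa: "x (%si. z si + w si) = x z \<oplus>\<^bsub>?N\<^esub> x w" "y (%si. z si + w si) = y z \<oplus>\<^bsub>?N\<^esub> y w" if "z \<in> ?S" "w \<in> ?S" for z w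
   using x y that unfolding rep_cochain_def additive_on_def by auto
  have xc: "x (cjc g z) = conj_map G F g (cs E) (x z)" "y (cjc g z) = conj_map G F g (cs E) (y z)"
   if "g \<in> normalizer G E" "z \<in> ?S" for g z using x y that unfolding rep_cochain_def by auto
  show "r \<odot>\<^bsub>?P\<^esub> x \<oplus>\<^bsub>?P\<^esub> y \<in> carrier (steinberg_hom G F k E)"
   unfolding prod_module_lin steinberg_hom_carrier rep_cochain_def additive_on_def using r v xa xc conj add
   by (simp add: M.smult_r_distr M.a_ac homs_add[OF hom] homs_smult[OF hom] homs_closed[OF hom])
 qed
qed

lemma SC_module: "module R (SC k)"
 unfolding steinberg_cochains_def by (rule prod_module_module[OF cring_R steinberg_hom_module[OF \<E>_elem_ab]])

lemma SC_carrier: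
 "c \<in> carrier (SC k) \<longleftrightarrow> c \<in> extensional (\<E> k) &
  (ALL E:\<E> k. c E \<in> extensional (St k E) & rep_cochain k F E (c E))"
 by (auto simp: steinberg_cochains_def prod_module_def PiE_iff steinberg_hom_carrier)

lemma SC_lin:
 "r \<odot>\<^bsub>SC k\<^esub> c \<oplus>\<^bsub>SC k\<^esub> c' = rs k (%E z. r \<odot>\<^bsub>Fob F (cs E)\<^esub> c E z \<oplus>\<^bsub>Fob F (cs E)\<^esub> c' E z)"
 by (simp add: steinberg_cochains_def prod_module_def steinberg_hom_def rs_def cong: restrict_cong)

lemma SC_lin_rs:
 "r \<odot>\<^bsub>SC k\<^esub> rs k c \<oplus>\<^bsub>SC k\<^esub> rs k c' = rs k (%E z. r \<odot>\<^bsub>Fob F (cs E)\<^esub> c E z \<oplus>\<^bsub>Fob F (cs E)\<^esub> c' E z)"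
 unfolding SC_lin by (simp add: rs_def cong: restrict_cong)

lemma SC_zero: "\<zero>\<^bsub>SC k\<^esub> = rs k (%E z. \<zero>\<^bsub>Fob F (cs E)\<^esub>)"
 by (simp add: steinberg_cochains_def prod_module_def steinberg_hom_def rs_def cong: restrict_cong)

lemma ext_cochain: "c \<in> carrier (SC k) ==> is_cochain k F (ext k c)"
 by (rule extend_cochain_is_cochain[where d = c and \<E> = \<E>, OF reps F_secs has_sec]) (simp add: SC_carrier)

lemma rs_closed: "is_cochain k F c ==> rs k c \<in> carrier (SC k)"
proof -
 assume c: "is_cochain k F c"
 have "rep_cochain k F E (\<lambda>z\<in>St k E. c E z)" if E: "E \<in> \<E> k" for E
 proof -
  have "cjc g z \<in> St k E" if "g \<in> normalizer G E" "z \<in> St k E" for g z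
  proof -
   have g: "g \<in> carrier G" "cj g E = E" using that normalizer_iff[OF elem_abD(4)[OF \<E>_elem_ab[OF E]]] by auto
   show ?thesis using conj_steinberg[OF g(1) elem_abD(4)[OF \<E>_elem_ab[OF E]] that(2)] unfolding g(2) .
  qed
  thus ?thesis using cochain_rep[OF c \<E>_elem_ab[OF E]] int_groupD(2)[OF steinberg_group]
   by (simp add: rep_cochain_def additive_on_def)
 qed
 thus ?thesis by (simp add: SC_carrier rs_def)
qed

lemma ext_rs:
 assumes "is_cochain k F c" "A \<in> EA k" "z \<in> St k A"
 shows "ext k (rs k c) A z = c A z"
 by (rule extend_cochain_eq[where \<E> = \<E>, OF reps F_secs has_sec assms(1) _ assms(2,3)]) (simp add: rs_def)

lemma rs_cong: "(!!E z. E \<in> EA k ==> z \<in> St k E ==> c E z = c' E z) ==> rs k c = rs k c'"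
 unfolding rs_def by (intro restrict_ext) (simp add: \<E>_elem_ab)

lemma rs_ext: "c \<in> carrier (SC k) ==> rs k (ext k c) = c"
proof -
 assume c: "c \<in> carrier (SC k)"
 have "rs k (ext k c) = (\<lambda>E\<in>\<E> k. \<lambda>z\<in>St k E. c E z)" unfolding rs_def
  by (intro restrict_ext, rule extend_cochain_rep[where d = c and \<E> = \<E>, OF reps F_secs has_sec])
   (use c in \<open>simp_all add: SC_carrier\<close>)
 also have "... = (\<lambda>E\<in>\<E> k. c E)"
  using c by (intro restrict_ext) (simp add: SC_carrier extensional_restrict)
 also have "... = c" using c by (simp add: SC_carrier extensional_restrict)
 finally show ?thesis .
qed

lemma rs_eqD:
 assumes "rs k c = rs k c'" "is_cochain k F c" "is_cochain k F c'" "E \<in> EA k" "z \<in> St k E"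
 shows "c E z = c' E z" using ext_rs[OF assms(2,4,5)] ext_rs[OF assms(3,4,5)] assms(1) by simp

lemma coboundary_ext:
 assumes c: "c \<in> carrier (SC k)"
 shows "\<delta> k c = rs (Suc k) (cob k F (ext k c))" unfolding steinberg_coboundary_def rs_def Defres_Fm
 by (intro restrict_ext, rule cob_sum[OF F_secs has_sec ext_cochain[OF c] has_sec \<E>_elem_ab, symmetric])

lemma coboundary_rs:
 assumes c: "is_cochain k F c"
 shows "\<delta> k (rs k c) = rs (Suc k) (cob k F c)" unfolding coboundary_ext[OF rs_closed[OF c]]
 by (rule rs_cong, rule cob_cong[OF F_secs has_sec has_sec c ext_rs[OF c]])

lemma ext_lin:
 assumes c: "c \<in> carrier (SC k)" and c': "c' \<in> carrier (SC k)" and r: "r \<in> carrier R"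
  and E: "E \<in> EA k" and z: "z \<in> St k E"
 shows "ext k (r \<odot>\<^bsub>SC k\<^esub> c \<oplus>\<^bsub>SC k\<^esub> c') E z =
  r \<odot>\<^bsub>Fob F (cs E)\<^esub> ext k c E z \<oplus>\<^bsub>Fob F (cs E)\<^esub> ext k c' E z"
proof -
 have "r \<odot>\<^bsub>SC k\<^esub> c \<oplus>\<^bsub>SC k\<^esub> c' = r \<odot>\<^bsub>SC k\<^esub> rs k (ext k c) \<oplus>\<^bsub>SC k\<^esub> rs k (ext k c')"
  unfolding rs_ext[OF c] rs_ext[OF c'] ..
 also have "... = rs k (%E z. r \<odot>\<^bsub>Fob F (cs E)\<^esub> ext k c E z \<oplus>\<^bsub>Fob F (cs E)\<^esub> ext k c' E z)"
  by (rule SC_lin_rs)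
 finally show ?thesis
  by (simp only: ext_rs[OF cochain_lin[OF F_secs has_sec ext_cochain[OF c] ext_cochain[OF c'] r] E z])
qed

lemma coboundary_hom: "\<delta> k \<in> module_homs R (SC k) (SC (Suc k))"
proof (rule module_homs_linI[OF SC_module SC_module])
 show "\<delta> k c \<in> carrier (SC (Suc k))" if "c \<in> carrier (SC k)" for c
  unfolding coboundary_ext[OF that] by (rule rs_closed[OF cob_cochain[OF F_secs has_sec ext_cochain[OF that] has_sec]])
 fix r c c' assume r: "r \<in> carrier R" and c: "c \<in> carrier (SC k)" and c': "c' \<in> carrier (SC k)"
 interpret M: module R "SC k" by (rule SC_module)
 note e = ext_cochain[OF c] ext_cochain[OF c']
 have "\<delta> k (r \<odot>\<^bsub>SC k\<^esub> c \<oplus>\<^bsub>SC k\<^esub> c') = rs (Suc k) (cob k F (ext k (r \<odot>\<^bsub>SC k\<^esub> c \<oplus>\<^bsub>SC k\<^esub> c')))"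
  by (rule coboundary_ext) (use r c c' in simp)
 also have "... = rs (Suc k) (%E z. r \<odot>\<^bsub>Fob F (cs E)\<^esub> cob k F (ext k c) E z \<oplus>\<^bsub>Fob F (cs E)\<^esub> cob k F (ext k c') E z)"
 proof (rule rs_cong)
  fix E z assume E: "E \<in> EA (Suc k)"
  have "cob k F (ext k (r \<odot>\<^bsub>SC k\<^esub> c \<oplus>\<^bsub>SC k\<^esub> c')) E z =
    cob k F (%E z. r \<odot>\<^bsub>Fob F (cs E)\<^esub> ext k c E z \<oplus>\<^bsub>Fob F (cs E)\<^esub> ext k c' E z) E z"
   by (rule cob_cong[OF F_secs has_sec has_sec cochain_lin[OF F_secs has_sec e r] ext_lin[OF c c' r] E])
  also note cob_lin[OF F_secs has_sec has_sec e r E]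
  finally show "cob k F (ext k (r \<odot>\<^bsub>SC k\<^esub> c \<oplus>\<^bsub>SC k\<^esub> c')) E z =
    r \<odot>\<^bsub>Fob F (cs E)\<^esub> cob k F (ext k c) E z \<oplus>\<^bsub>Fob F (cs E)\<^esub> cob k F (ext k c') E z" .
 qed
 also have "... = r \<odot>\<^bsub>SC (Suc k)\<^esub> \<delta> k c \<oplus>\<^bsub>SC (Suc k)\<^esub> \<delta> k c'"
  unfolding coboundary_ext[OF c] coboundary_ext[OF c'] SC_lin_rs ..
 finally show "\<delta> k (r \<odot>\<^bsub>SC k\<^esub> c \<oplus>\<^bsub>SC k\<^esub> c') = r \<odot>\<^bsub>SC (Suc k)\<^esub> \<delta> k c \<oplus>\<^bsub>SC (Suc k)\<^esub> \<delta> k c'" .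
qed

lemma coboundary_zero_iff:
 assumes c: "is_cochain k F c"
 shows "\<delta> k (rs k c) = \<zero>\<^bsub>SC (Suc k)\<^esub> \<longleftrightarrow>
  (ALL E:EA (Suc k). ALL z:St (Suc k) E. cob k F c E z = \<zero>\<^bsub>Fob F (cs E)\<^esub>)"
proof
 assume "\<delta> k (rs k c) = \<zero>\<^bsub>SC (Suc k)\<^esub>"
 hence "rs (Suc k) (cob k F c) = rs (Suc k) (%E z. \<zero>\<^bsub>Fob F (cs E)\<^esub>)"
  unfolding coboundary_rs[OF c] SC_zero .
 from rs_eqD[OF this cob_cochain[OF F_secs has_sec c has_sec] zero_cochain[OF F_secs has_sec]]
 show "ALL E:EA (Suc k). ALL z:St (Suc k) E. cob k F c E z = \<zero>\<^bsub>Fob F (cs E)\<^esub>" by simp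
next
 assume *: "ALL E:EA (Suc k). ALL z:St (Suc k) E. cob k F c E z = \<zero>\<^bsub>Fob F (cs E)\<^esub>"
 show "\<delta> k (rs k c) = \<zero>\<^bsub>SC (Suc k)\<^esub>"
  unfolding coboundary_rs[OF c] SC_zero by (rule rs_cong) (use * in simp)
qed

lemma coboundary_coboundary: "c \<in> carrier (SC k) ==> \<delta> (Suc k) (\<delta> k c) = \<zero>\<^bsub>SC (Suc (Suc k))\<^esub>"
 unfolding coboundary_ext using ext_cochain[of c k]
 by (simp add: coboundary_zero_iff[OF cob_cochain[OF F_secs has_sec _ has_sec]] cob_cob[OF F_secs has_sec has_sec has_sec])

theorem Steinberg_complex: "cochain_complex R (steinberg_cochains G \<E> F) (steinberg_coboundary G p \<E> F)"
 unfolding cochain_complex_def using SC_module coboundary_hom coboundary_coboundary by blast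

abbreviation cocycles :: "nat => ('r, 'a set => ('a set list => int) => 'm) module"
 where "cocycles k \<equiv> kernel_module (SC k) (SC (Suc k)) (\<delta> k)"

lemma cocycles_module: "module R (cocycles k)"
 by (rule kernel_module_module[OF SC_module SC_module coboundary_hom])

lemma coboundaries_submodule: "submodule (\<delta> k ` carrier (SC k)) R (cocycles (Suc k))"
 by (rule image_submodule_kernel[OF SC_module SC_module SC_module coboundary_hom coboundary_hom[of "Suc k"]])
  (rule coboundary_coboundary)

end

section \<open>Degrees -1 and 0\<close>

context p_group_ring
begin

interpretation R: cring R by (rule cring_R)

text \<open>The transformation from \<open>Q 0\<close> with value \<open>m X\<close> at the generator \<open>unit0\<close>.\<close>

definition const_map :: "('r, 'a set \<times> 'a set, 'a set, 'm) catmod => ('a set \<times> 'a set => 'm) =>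
  'a set \<times> 'a set => ('a set \<times> 'a set list => 'r) => 'm"
 where "const_map N m X q = q ({\<one>}, []) \<odot>\<^bsub>Fob N X\<^esub> m X"

definition compatible :: "('a set \<times> 'a set) set => ('r, 'a set \<times> 'a set, 'a set, 'm) catmod =>
  ('a set \<times> 'a set => 'm) => bool"
 where "compatible Os N m \<longleftrightarrow> (ALL X:Os. m X \<in> elts N X) &
  (ALL X:Os. ALL Y:Os. ALL g. arrow X Y g --> Fm N X Y g (m Y) = m X)"

lemma compatibleD:
 assumes "compatible Os N m"
 shows "X \<in> Os ==> m X \<in> elts N X"
  "X \<in> Os ==> Y \<in> Os ==> arrow X Y g ==> Fm N X Y g (m Y) = m X"
 using assms by (auto simp: compatible_def)

lemma unit0_value: "unit0 ({\<one>}, []) = \<one>\<^bsub>R\<^esub>" by (simp add: unit0_def unit_vec_def)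

lemma const_map_unit0:
 assumes "secs_mod Os N" "compatible Os N m" "X \<in> Os"
 shows "const_map N m X unit0 = m X" unfolding const_map_def unit0_value
 by (rule module.smult_one[OF secs_modD(2)[OF assms(1,3)] compatibleD(1)[OF assms(2,3)]])

lemma Qmod_0_hom:
 assumes "X \<in> sections G" "h \<in> module_homs R (Qmod 0 X) M" "q \<in> carrier (Qmod 0 X)"
 shows "h q = q ({\<one>}, []) \<odot>\<^bsub>M\<^esub> h unit0"
 using homs_smult[OF assms(2) Qmod_0_scale(2)[OF assms(1,3)] unit0_closed[OF assms(1)]]
  Qmod_0_scale(1)[OF assms(1,3)] by simp

lemma const_map_catmap:
 assumes N: "secs_mod Os N" and m: "compatible Os N m"
 shows "catmap (secs_cat Os) R (Q 0) N (const_map N m)"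
proof (rule catmap_secsI)
 show "Os \<subseteq> sections G" using N by (simp add: secs_mod_def)
 fix X assume X: "X \<in> Os"
 note Xs = secs_modD(1)[OF N X]
 interpret M: module R "Fob N X" by (rule secs_modD(2)[OF N X])
 note mX = compatibleD(1)[OF m X]
 show "const_map N m X \<in> module_homs R (Fob (Q 0) X) (Fob N X)" unfolding Q_Fob
 proof (rule module_homsI)
  fix q assume q: "q \<in> carrier (Qmod 0 X)"
  note qR = Qmod_0_scale(2)[OF Xs q]
  show "const_map N m X q \<in> elts N X" using qR mX by (simp add: const_map_def)
  show "const_map N m X (r \<odot>\<^bsub>Qmod 0 X\<^esub> q) = r \<odot>\<^bsub>Fob N X\<^esub> const_map N m X q" if "r \<in> carrier R" for r
   using qR mX that by (simp add: const_map_def Qmod_def R.free_module_simps M.smult_assoc1)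
  fix q' assume "q' \<in> carrier (Qmod 0 X)"
  thus "const_map N m X (q \<oplus>\<^bsub>Qmod 0 X\<^esub> q') = const_map N m X q \<oplus>\<^bsub>Fob N X\<^esub> const_map N m X q'"
   using qR mX Qmod_0_scale(2)[OF Xs] by (simp add: const_map_def Qmod_def R.free_module_simps M.smult_l_distr)
 qed
 fix Y g q assume Y: "Y \<in> Os" and g: "arrow X Y g" and q: "q \<in> elts (Q 0) Y"
 note Ys = secs_modD(1)[OF N Y]
 note q' = q[unfolded Q_Fob]
 note qR = Qmod_0_scale(2)[OF Ys q']
 have "Qmap 0 X Y (fst Y #> g) q = q ({\<one>}, []) \<odot>\<^bsub>Qmod 0 X\<^esub> unit0"
  using Qmod_0_hom[OF Ys Qmap_hom(1)[OF Xs Ys g] q'] unfolding Qmap_unit0[OF Xs Ys g] .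
 hence "Qmap 0 X Y (fst Y #> g) q ({\<one>}, []) = q ({\<one>}, [])"
  using qR by (simp add: Qmod_def R.free_module_simps unit0_value)
 thus "const_map N m X (Fm (Q 0) X Y g q) = Fm N X Y g (const_map N m Y q)"
  unfolding const_map_def Q_Fm homs_smult[OF Fm_hom[OF N X Y g] qR compatibleD(1)[OF m Y]]
   compatibleD(2)[OF m X Y g] by simp
qed

definition const0 :: "('r, 'a set \<times> 'a set, 'a set, 'm) catmod => ('a set \<times> 'a set => 'm) =>
  'a set => ('a set list => int) => 'm"
 where "const0 N m = push (const_map N m) (can 0)"

definition const1 :: "('r, 'a set \<times> 'a set, 'a set, 'm) catmod => ('a set \<times> 'a set => 'm) =>
  'a set => ('a set list => int) => 'm"
 where "const1 N m = push (const_map N m) (push (bd 0) (can (Suc 0)))"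

lemma aug_cochain: "is_cochain (Suc 0) (Q 0) (push (bd 0) (can (Suc 0)))"
 by (rule push_cochain[OF Q_star has_star star_catmap[OF bd_star[of 0]] can_cochain])

lemma const0_cochain:
 assumes "secs_mod (sections G) N" "compatible (sections G) N m"
 shows "is_cochain 0 N (const0 N m)"
 unfolding const0_def by (rule push_cochain[OF Q_secs has_sections const_map_catmap[OF assms] can_cochain]) simp

lemma const1_cochain:
 assumes "secs_mod star N" "compatible star N m"
 shows "is_cochain (Suc 0) N (const1 N m)"
 unfolding const1_def by (rule push_cochain[OF Q_star has_star const_map_catmap[OF assms] aug_cochain])

lemma cob_const0:
 assumes N: "secs_mod (sections G) N" and m: "compatible (sections G) N m"
  and E: "E \<in> EA (Suc 0)" and z: "z \<in> St (Suc 0) E"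
 shows "cob 0 N (const0 N m) E z = const1 N m E z" unfolding const0_def const1_def
  cob_push[OF Q_secs[OF subset_refl] N has_sections has_sections const_map_catmap[OF N m] can_cochain E z]
  cob_can[OF subset_refl has_sections has_sections E] by (simp add: push_def)

lemma ev_const1:
 assumes N: "secs_mod star N" and m: "compatible star N m" and X: "X \<in> star" and q: "q \<in> carrier (Qmod (Suc 0) X)"
 shows "ev (Suc 0) N (const1 N m) X q = const_map N m X (bd 0 X q)"
 unfolding const1_def ev_push[OF Q_star has_star aug_cochain N const_map_catmap[OF N m] X q]
  ev_push[OF Q_star has_star can_cochain Q_star star_catmap[OF bd_star] X q] ev_can_id[OF star_sections has_star X q] ..

lemma cob_const1:
 assumes N: "secs_mod star N" and m: "compatible star N m"
  and E: "E \<in> EA (Suc (Suc 0))" and z: "z \<in> St (Suc (Suc 0)) E"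
 shows "cob (Suc 0) N (const1 N m) E z = \<zero>\<^bsub>Fob N (cs E)\<^esub>"
proof -
 note X = csec_star[OF E] and cE = can_closed[OF csec_els[OF E], of z]
 have "cob (Suc 0) N (const1 N m) E z = const_map N m (cs E) (bd 0 (cs E) (bd (Suc 0) (cs E) (can (Suc (Suc 0)) E z)))"
  unfolding cob_def push_def by (rule ev_const1[OF N m X homs_closed[OF bd_hom cE]])
 also have "... = \<zero>\<^bsub>Fob N (cs E)\<^esub>" unfolding bd_bd[OF cE]
  by (rule homs_zero[OF _ Qmod_module secs_modD(2)[OF N X]])
   (use catmapD(1)[OF const_map_catmap[OF N m]] X in \<open>simp add: Q_Fob\<close>)
 finally show ?thesis .
qed

lemma unit0_boundary:
 assumes "X \<in> star"
 obtains q where "q \<in> carrier (Qmod (Suc 0) X)" "bd 0 X q = unit0"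
proof -
 have "unit0 \<in> carrier (Qmod 0 X)" by (rule unit0_closed) (use assms star_sections in auto)
 from Q_exact_0[OF assms this] show thesis by (elim bexE) (rule that, simp_all)
qed

text \<open>Since \<open>Q 1 \<rightarrow> Q 0\<close> is onto, the generator of \<open>Q 0\<close> can be lifted and evaluated.\<close>

lemma const1_inject:
 assumes N: "secs_mod star N" and m: "compatible star N m" and m': "compatible star N m'"
  and eq: "!!E z. E \<in> EA (Suc 0) ==> z \<in> St (Suc 0) E ==> const1 N m E z = const1 N m' E z"
  and X: "X \<in> star"
 shows "m X = m' X"
proof -
 obtain q where q: "q \<in> carrier (Qmod (Suc 0) X)" "bd 0 X q = unit0" by (rule unit0_boundary[OF X])
 have "ev (Suc 0) N (const1 N m) X q = ev (Suc 0) N (const1 N m') X q"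
  by (rule ev_cong'[OF N has_star const1_cochain[OF N m'] eq X q(1)])
 thus ?thesis unfolding ev_const1[OF N m X q(1)] ev_const1[OF N m' X q(1)] q(2)
   const_map_unit0[OF N m X] const_map_unit0[OF N m' X] .
qed

text \<open>A cocycle vanishes on the boundaries, hence on the kernel of \<open>Q 1 \<rightarrow> Q 0\<close>, and factors through \<open>Q 0\<close>.\<close>

lemma const1_surject:
 assumes N: "secs_mod star N" and c: "is_cochain (Suc 0) N c"
  and zero: "!!E z. E \<in> EA (Suc (Suc 0)) ==> z \<in> St (Suc (Suc 0)) E ==>
   cob (Suc 0) N c E z = \<zero>\<^bsub>Fob N (cs E)\<^esub>"
 shows "EX m. compatible star N m & (ALL E:EA (Suc 0). ALL z:St (Suc 0) E. c E z = const1 N m E z)"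
proof -
 have ex: "EX q. q \<in> carrier (Qmod (Suc 0) X) & bd 0 X q = unit0" if "X \<in> star" for X
  using unit0_boundary[OF that] by blast
 define q where "q X = (SOME q. q \<in> carrier (Qmod (Suc 0) X) & bd 0 X q = unit0)" for X
 have q: "q X \<in> carrier (Qmod (Suc 0) X)" "bd 0 X (q X) = unit0" if "X \<in> star" for X
  using someI_ex[OF ex[OF that]] unfolding q_def by simp_all
 let ?ev = "ev (Suc 0) N c"
 define m where "m X = ?ev X (q X)" for X
 have ev: "?ev X x = const_map N m X (bd 0 X x)" if X: "X \<in> star" and x: "x \<in> carrier (Qmod (Suc 0) X)" for X x
 proof -
  interpret M: module R "Fob N X" by (rule secs_modD(2)[OF N X])
  interpret Q1: module R "Qmod (Suc 0) X" by (rule Qmod_module)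
  interpret Q0: module R "Qmod 0 X" by (rule Qmod_module)
  have Xs: "X \<in> sections G" using X star_sections by auto
  note hom = ev_hom[OF N has_star c X]
  note bx = homs_closed[OF bd_hom x]
  let ?r = "bd 0 X x ({\<one>}, [])"
  note r = Qmod_0_scale(2)[OF Xs bx]
  note rq = Q1.smult_closed[OF r q(1)[OF X]]
  have bz: "bd 0 X (x \<ominus>\<^bsub>Qmod (Suc 0) X\<^esub> ?r \<odot>\<^bsub>Qmod (Suc 0) X\<^esub> q X) = \<zero>\<^bsub>Qmod 0 X\<^esub>"
   unfolding homs_minus[OF bd_hom Qmod_module Qmod_module x rq] homs_smult[OF bd_hom r q(1)[OF X]] q(2)[OF X]
    Qmod_0_scale(1)[OF Xs bx, symmetric] using Q0.minus_eq_zero_iff[OF bx bx] by simp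
  obtain y where y: "y \<in> carrier (Qmod (Suc (Suc 0)) X)"
   "bd (Suc 0) X y = x \<ominus>\<^bsub>Qmod (Suc 0) X\<^esub> ?r \<odot>\<^bsub>Qmod (Suc 0) X\<^esub> q X"
   using Q_exact_Suc[OF X Q1.minus_closed[OF x rq] bz] by (elim bexE)
  have "?ev X x \<ominus>\<^bsub>Fob N X\<^esub> ?ev X (?r \<odot>\<^bsub>Qmod (Suc 0) X\<^esub> q X) = ?ev X (bd (Suc 0) X y)"
   unfolding y(2) homs_minus[OF hom Qmod_module M.module_axioms x rq] ..
  also have "... = \<zero>\<^bsub>Fob N X\<^esub>"
   unfolding ev_cob[OF N has_star has_star c X y(1), symmetric] by (rule ev_zero[OF N has_star zero X y(1)])
  finally have "?ev X x = ?ev X (?r \<odot>\<^bsub>Qmod (Suc 0) X\<^esub> q X)"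
   using M.minus_eq_zero_iff[OF homs_closed[OF hom x] homs_closed[OF hom rq]] by simp
  thus ?thesis unfolding const_map_def m_def homs_smult[OF hom r q(1)[OF X]] .
 qed
 have m: "compatible star N m" unfolding compatible_def
 proof (intro conjI ballI allI impI)
  fix X assume X: "X \<in> star"
  show mX: "m X \<in> elts N X" unfolding m_def by (rule homs_closed[OF ev_hom[OF N has_star c X] q(1)[OF X]])
  fix Y g assume Y: "Y \<in> star" and g: "arrow X Y g"
  have Xs: "X \<in> sections G" and Ys: "Y \<in> sections G" using X Y star_sections by auto
  note qg = homs_closed[OF Qmap_hom(1)[OF Xs Ys g] q(1)[OF Y]]
  have "Fm N X Y g (m Y) = ?ev X (Fm (Q (Suc 0)) X Y g (q Y))"
   unfolding m_def by (rule Fm_catmap[OF ev_catmap[OF N has_star c] X Y g, symmetric]) (use q(1)[OF Y] in \<open>simp add: Q_Fob\<close>)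
  also have "... = const_map N m X (bd 0 X (Qmap (Suc 0) X Y (fst Y #> g) (q Y)))"
   unfolding Q_Fm by (rule ev[OF X qg])
  also have "bd 0 X (Qmap (Suc 0) X Y (fst Y #> g) (q Y)) = Qmap 0 X Y (fst Y #> g) (bd 0 Y (q Y))"
   using Fm_catmap[OF bd_secs[OF star_sections] X Y g, of "q Y" 0] q(1)[OF Y] by (simp add: Q_Fob Q_Fm)
  also have "... = unit0" unfolding q(2)[OF Y] by (rule Qmap_unit0[OF Xs Ys g])
  also have "const_map N m X unit0 = m X"
   unfolding const_map_def unit0_value by (rule module.smult_one[OF secs_modD(2)[OF N X] mX])
  finally show "Fm N X Y g (m Y) = m X" .
 qed
 have "c E z = const1 N m E z" if E: "E \<in> EA (Suc 0)" and z: "z \<in> St (Suc 0) E" for E z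
  using ev[OF csec_star[OF E] can_closed[OF csec_els[OF E], of z]] unfolding ev_self[OF N has_star c E z]
  by (simp add: const1_def push_def)
 thus ?thesis using m by blast
qed

lemma csec_trivial: "cs {\<one>} = (carrier G, {\<one>})" by (auto simp: csec_def centralizer_def)

abbreviation top_section :: "'a set \<times> 'a set"
 where "top_section \<equiv> (carrier G, {\<one>})"

lemma top_section: "top_section \<in> sections G"
 using csec_section[OF trivial_elem_ab] unfolding csec_trivial .

lemma arrow_top: "X \<in> sections G ==> arrow X top_section \<one>"
 using arrow_els_csec[of X "{\<one>}" 0] els_0[of X] unfolding csec_trivial by simp

definition restr :: "('r, 'a set \<times> 'a set, 'a set, 'm) catmod => 'm => 'a set \<times> 'a set => 'm"
 where "restr N x X = Fm N X top_section \<one> x"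

lemma restr_hom:
 assumes "secs_mod (sections G) N" "X \<in> sections G"
 shows "(%x. restr N x X) \<in> module_homs R (Fob N top_section) (Fob N X)"
 using Fm_hom[OF assms top_section arrow_top[OF assms(2)]] by (simp add: restr_def)

lemma restr_compatible:
 assumes N: "secs_mod (sections G) N" and x: "x \<in> elts N top_section"
 shows "compatible (sections G) N (restr N x)" unfolding compatible_def
proof (intro conjI ballI allI impI)
 fix X assume X: "X \<in> sections G"
 show "restr N x X \<in> elts N X" by (rule homs_closed[OF restr_hom[OF N X] x])
 fix Y g assume Y: "Y \<in> sections G" and g: "arrow X Y g"
 note gG = arrow_carrier[OF g]
 have "Fm N X Y g (restr N x Y) = Fm N X top_section (\<one> \<otimes> g) x"
  unfolding restr_def by (rule Fm_comp[OF N X Y top_section g arrow_top[OF Y] x])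
 also have "Fm N X top_section (\<one> \<otimes> g) = Fm N X top_section \<one>"
  using Fm_shift[OF top_section, of g \<one> N X] gG by simp
 finally show "Fm N X Y g (restr N x Y) = restr N x X" unfolding restr_def .
qed

lemma const0_surject:
 assumes N: "secs_mod (sections G) N" and c: "is_cochain 0 N c"
 shows "EX x:elts N top_section. ALL E:EA 0. ALL z:St 0 E. c E z = const0 N (restr N x) E z"
proof (intro bexI[of _ "ev 0 N c top_section unit0"] ballI)
 let ?x = "ev 0 N c top_section unit0"
 note u = unit0_closed[OF top_section]
 show "?x \<in> elts N top_section" by (rule homs_closed[OF ev_hom[OF N has_sections c top_section] u])
 fix E z assume E: "E \<in> EA 0" and z: "z \<in> St 0 E"
 note X = csec_section[OF E]
 have "restr N ?x (cs E) = ev 0 N c (cs E) (Fm (Q 0) (cs E) top_section \<one> unit0)" unfolding restr_def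
  by (rule Fm_catmap[OF ev_catmap[OF N has_sections c] X top_section arrow_top[OF X], symmetric])
   (use u in \<open>simp add: Q_Fob\<close>)
 also have "Fm (Q 0) (cs E) top_section \<one> unit0 = unit0"
  unfolding Q_Fm by (rule Qmap_unit0[OF X top_section arrow_top[OF X]])
 finally have r: "restr N ?x (cs E) = ev 0 N c (cs E) unit0" .
 have "c E z = ev 0 N c (cs E) (can 0 E z)" by (rule ev_self[OF N has_sections c E z, symmetric])
 also have "... = can 0 E z ({\<one>}, []) \<odot>\<^bsub>Fob N (cs E)\<^esub> ev 0 N c (cs E) unit0"
  by (rule Qmod_0_hom[OF X ev_hom[OF N has_sections c X] can_closed[OF csec_els[OF E]]])
 finally show "c E z = const0 N (restr N ?x) E z" unfolding const0_def push_def const_map_def r .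
qed

lemma const0_unit:
 assumes N: "secs_mod (sections G) N" and x: "x \<in> elts N top_section"
 shows "const0 N (restr N x) {\<one>} (dual 0 {\<one>} []) = x"
 unfolding const0_def push_def unit0_can[symmetric] csec_trivial
  const_map_unit0[OF N restr_compatible[OF N x] top_section]
 unfolding restr_def by (rule Fm_one[OF N top_section x])

lemma const_map_lin:
 assumes N: "secs_mod Os N" and X: "X \<in> Os" and q: "q \<in> carrier (Qmod 0 X)" and r: "r \<in> carrier R"
  and m: "m X \<in> elts N X" "m' X \<in> elts N X"
  and n: "n X = r \<odot>\<^bsub>Fob N X\<^esub> m X \<oplus>\<^bsub>Fob N X\<^esub> m' X"
 shows "const_map N n X q = r \<odot>\<^bsub>Fob N X\<^esub> const_map N m X q \<oplus>\<^bsub>Fob N X\<^esub> const_map N m' X q"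
proof -
 interpret M: module R "Fob N X" by (rule secs_modD(2)[OF N X])
 note qR = Qmod_0_scale(2)[OF secs_modD(1)[OF N X] q]
 have "q ({\<one>}, []) \<odot>\<^bsub>Fob N X\<^esub> (r \<odot>\<^bsub>Fob N X\<^esub> m X) = r \<odot>\<^bsub>Fob N X\<^esub> (q ({\<one>}, []) \<odot>\<^bsub>Fob N X\<^esub> m X)"
  using qR r m(1) by (simp add: R.m_comm flip: M.smult_assoc1)
 thus ?thesis using qR r m by (simp add: const_map_def n M.smult_r_distr)
qed

end

section \<open>Cohomology of the section category and of the Steinberg complex\<close>

context p_group_catmod
begin

interpretation R: cring R by (rule cring_R)

abbreviation "sec_lim \<equiv> limit_module (sec_cat_star G) F"

lemma Lim_carrier: "f \<in> carrier sec_lim \<longleftrightarrow> f \<in> extensional star & compatible star F f"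
proof -
 have "(ALL a:Hom (sec_cat_star G) X Y. Fmap F X Y a (f Y) = f X) \<longleftrightarrow> (ALL g. arrow X Y g --> Fm F X Y g (f Y) = f X)" for X Y
 proof -
  have "a \<in> Hom (sec_cat_star G) X Y \<longleftrightarrow> (EX g. arrow X Y g & a = fst Y #> g)" for a
   using Hom_iff[of a X Y] by (simp add: sec_cat_star_def)
  thus ?thesis by (auto simp: Fm_def)
 qed
 thus ?thesis by (auto simp: limit_module_def PiE_iff compatible_def)
qed

lemma Lim_lin: "r \<odot>\<^bsub>sec_lim\<^esub> f \<oplus>\<^bsub>sec_lim\<^esub> f' = (\<lambda>X\<in>star. r \<odot>\<^bsub>Fob F X\<^esub> f X \<oplus>\<^bsub>Fob F X\<^esub> f' X)"
 by (simp add: limit_module_def prod_module_def cong: restrict_cong)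

lemma Lim_zero: "\<zero>\<^bsub>sec_lim\<^esub> = (\<lambda>X\<in>star. \<zero>\<^bsub>Fob F X\<^esub>)"
 by (simp add: limit_module_def prod_module_def)

lemma F_star_module: "X \<in> star ==> module R (Fob F X)" by (rule secs_modD(2)[OF F_star])

lemma compatible_zero: "compatible star F (%X. \<zero>\<^bsub>Fob F X\<^esub>)" unfolding compatible_def
proof (intro conjI ballI allI impI)
 fix X assume X: "X \<in> star"
 interpret M: module R "Fob F X" by (rule F_star_module[OF X])
 show "\<zero>\<^bsub>Fob F X\<^esub> \<in> elts F X" by simp
 fix Y g assume Y: "Y \<in> star" and g: "arrow X Y g"
 show "Fm F X Y g \<zero>\<^bsub>Fob F Y\<^esub> = \<zero>\<^bsub>Fob F X\<^esub>"
  by (rule homs_zero[OF Fm_hom[OF F_star X Y g] F_star_module[OF Y] M.module_axioms])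
qed

lemma compatible_restrict: "compatible star F f ==> compatible star F (\<lambda>X\<in>star. f X)"
 by (simp add: compatible_def)

lemma compatible_lin:
 assumes f: "compatible star F f" and f': "compatible star F f'" and r: "r \<in> carrier R"
 shows "compatible star F (%X. r \<odot>\<^bsub>Fob F X\<^esub> f X \<oplus>\<^bsub>Fob F X\<^esub> f' X)"
 unfolding compatible_def
proof (intro conjI ballI allI impI)
 fix X assume X: "X \<in> star"
 interpret M: module R "Fob F X" by (rule F_star_module[OF X])
 show "r \<odot>\<^bsub>Fob F X\<^esub> f X \<oplus>\<^bsub>Fob F X\<^esub> f' X \<in> elts F X"
  using r compatibleD(1)[OF f X] compatibleD(1)[OF f' X] by simp
 fix Y g assume Y: "Y \<in> star" and g: "arrow X Y g"
 interpret MY: module R "Fob F Y" by (rule F_star_module[OF Y])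
 note hom = Fm_hom[OF F_star X Y g] and v = compatibleD(1)[OF f Y] compatibleD(1)[OF f' Y]
 show "Fm F X Y g (r \<odot>\<^bsub>Fob F Y\<^esub> f Y \<oplus>\<^bsub>Fob F Y\<^esub> f' Y) = r \<odot>\<^bsub>Fob F X\<^esub> f X \<oplus>\<^bsub>Fob F X\<^esub> f' X"
  unfolding homs_add[OF hom MY.smult_closed[OF r v(1)] v(2)] homs_smult[OF hom r v(1)]
   compatibleD(2)[OF f X Y g] compatibleD(2)[OF f' X Y g] ..
qed

lemma Lim_module: "module R sec_lim"
proof -
 let ?P = "prod_module star (Fob F)"
 have C: "sec_lim = ?P\<lparr>carrier := carrier sec_lim\<rparr>" by (simp add: limit_module_def)
 show ?thesis
 proof (subst C, rule restricted_module)
  show "module R ?P" by (rule prod_module_module[OF cring_R F_star_module])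
  show "carrier sec_lim \<subseteq> carrier ?P" by (auto simp: limit_module_def prod_module_def)
  show "\<zero>\<^bsub>?P\<^esub> \<in> carrier sec_lim"
   unfolding Lim_carrier using compatible_restrict[OF compatible_zero] by (simp add: prod_module_def)
  fix r x y assume "r \<in> carrier R" "x \<in> carrier sec_lim" "y \<in> carrier sec_lim"
  thus "r \<odot>\<^bsub>?P\<^esub> x \<oplus>\<^bsub>?P\<^esub> y \<in> carrier sec_lim"
   unfolding prod_module_lin Lim_carrier by (auto intro: compatible_restrict[OF compatible_lin])
 qed
qed

abbreviation "F_top \<equiv> Fob F top_section"

lemma F_top_module: "module R F_top" by (rule secs_modD(2)[OF F_secs top_section])

lemma restr_compatible_star: "x \<in> carrier F_top ==> compatible star F (restr F x)"
 using restr_compatible[OF F_secs] star_sections unfolding compatible_def by blast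

lemma to_limit_restr: "to_limit G F x = (\<lambda>X\<in>star. restr F x X)"
 by (simp add: to_limit_def Defres_Fm restr_def)

lemma restr_lin:
 assumes "r \<in> carrier R" "x \<in> carrier F_top" "y \<in> carrier F_top" "X \<in> sections G"
 shows "restr F (r \<odot>\<^bsub>F_top\<^esub> x \<oplus>\<^bsub>F_top\<^esub> y) X = r \<odot>\<^bsub>Fob F X\<^esub> restr F x X \<oplus>\<^bsub>Fob F X\<^esub> restr F y X"
proof -
 interpret M: module R F_top by (rule F_top_module)
 note hom = restr_hom[OF F_secs assms(4)]
 show ?thesis
  unfolding homs_add[OF hom M.smult_closed[OF assms(1,2)] assms(3)] homs_smult[OF hom assms(1,2)] ..
qed

lemma to_limit_hom: "to_limit G F \<in> module_homs R F_top sec_lim"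
proof (rule module_homs_linI[OF F_top_module Lim_module])
 show "to_limit G F x \<in> carrier sec_lim" if "x \<in> carrier F_top" for x
  unfolding Lim_carrier to_limit_restr using compatible_restrict[OF restr_compatible_star[OF that]] by simp
 fix r x y assume "r \<in> carrier R" "x \<in> carrier F_top" "y \<in> carrier F_top"
 thus "to_limit G F (r \<odot>\<^bsub>F_top\<^esub> x \<oplus>\<^bsub>F_top\<^esub> y) = r \<odot>\<^bsub>sec_lim\<^esub> to_limit G F x \<oplus>\<^bsub>sec_lim\<^esub> to_limit G F y"
  unfolding Lim_lin to_limit_restr
  by (intro restrict_ext) (use star_sections in \<open>auto simp: restr_lin\<close>)
qed

lemma cocycles_trivial:
 assumes "\<E> k = {}"
 shows "carrier (cocycles k) = {\<zero>\<^bsub>SC k\<^esub>}"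
proof -
 interpret M: module R "SC k" by (rule SC_module)
 have "c = c'" if "c \<in> carrier (SC k)" "c' \<in> carrier (SC k)" for c c'
  using that by (simp add: SC_carrier assms)
 moreover have "\<delta> k \<zero>\<^bsub>SC k\<^esub> = \<zero>\<^bsub>SC (Suc k)\<^esub>"
  by (rule homs_zero[OF coboundary_hom SC_module SC_module])
 ultimately show ?thesis using M.zero_closed unfolding kernel_module_def by auto
qed

subsection \<open>Degree -1\<close>

lemma const0_hom: "(%x. rs 0 (const0 F (restr F x))) \<in> module_homs R F_top (SC 0)"
proof (rule module_homs_linI[OF F_top_module SC_module])
 show "rs 0 (const0 F (restr F x)) \<in> carrier (SC 0)" if "x \<in> carrier F_top" for x
  by (rule rs_closed[OF const0_cochain[OF F_secs restr_compatible[OF F_secs that]]])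
 fix r x y assume r: "r \<in> carrier R" and x: "x \<in> carrier F_top" and y: "y \<in> carrier F_top"
 show "rs 0 (const0 F (restr F (r \<odot>\<^bsub>F_top\<^esub> x \<oplus>\<^bsub>F_top\<^esub> y))) =
   r \<odot>\<^bsub>SC 0\<^esub> rs 0 (const0 F (restr F x)) \<oplus>\<^bsub>SC 0\<^esub> rs 0 (const0 F (restr F y))"
  unfolding SC_lin_rs
 proof (rule rs_cong)
  fix E z assume E: "E \<in> EA 0"
  note X = csec_section[OF E]
  show "const0 F (restr F (r \<odot>\<^bsub>F_top\<^esub> x \<oplus>\<^bsub>F_top\<^esub> y)) E z =
    r \<odot>\<^bsub>Fob F (cs E)\<^esub> const0 F (restr F x) E z \<oplus>\<^bsub>Fob F (cs E)\<^esub> const0 F (restr F y) E z"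
   unfolding const0_def push_def
   by (rule const_map_lin[where m = "restr F x" and m' = "restr F y", OF F_secs X can_closed[OF csec_els[OF E]] r
     compatibleD(1)[OF restr_compatible[OF F_secs x] X] compatibleD(1)[OF restr_compatible[OF F_secs y] X]])
    (rule restr_lin[OF r x y X])
 qed
qed

lemma kernel_const0:
 assumes x: "x \<in> carrier F_top"
 shows "\<delta> 0 (rs 0 (const0 F (restr F x))) = \<zero>\<^bsub>SC (Suc 0)\<^esub> \<longleftrightarrow> to_limit G F x = \<zero>\<^bsub>sec_lim\<^esub>"
proof -
 let ?m = "restr F x"
 note m = restr_compatible[OF F_secs x] and ms = restr_compatible_star[OF x]
 have z1: "const1 F (%X. \<zero>\<^bsub>Fob F X\<^esub>) E z = \<zero>\<^bsub>Fob F (cs E)\<^esub>" if E: "E \<in> EA (Suc 0)" for E z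
  unfolding const1_def push_def const_map_def
  by (rule module.smult_r_null[OF F_csec_module[OF E] Qmod_0_scale(2)[OF csec_section[OF E]
    homs_closed[OF bd_hom can_closed[OF csec_els[OF E]]]]])
 have "\<delta> 0 (rs 0 (const0 F ?m)) = \<zero>\<^bsub>SC (Suc 0)\<^esub> \<longleftrightarrow>
   (ALL E:EA (Suc 0). ALL z:St (Suc 0) E. const1 F ?m E z = \<zero>\<^bsub>Fob F (cs E)\<^esub>)"
  unfolding coboundary_zero_iff[OF const0_cochain[OF F_secs m]] using cob_const0[OF F_secs m] by simp
 also have "... \<longleftrightarrow> (ALL X:star. ?m X = \<zero>\<^bsub>Fob F X\<^esub>)"
 proof
  assume *: "ALL E:EA (Suc 0). ALL z:St (Suc 0) E. const1 F ?m E z = \<zero>\<^bsub>Fob F (cs E)\<^esub>"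
  show "ALL X:star. ?m X = \<zero>\<^bsub>Fob F X\<^esub>"
  proof
   fix X assume X: "X \<in> star"
   show "?m X = \<zero>\<^bsub>Fob F X\<^esub>"
    by (rule const1_inject[OF F_star ms compatible_zero _ X]) (use * z1 in simp)
  qed
 next
  assume *: "ALL X:star. ?m X = \<zero>\<^bsub>Fob F X\<^esub>"
  show "ALL E:EA (Suc 0). ALL z:St (Suc 0) E. const1 F ?m E z = \<zero>\<^bsub>Fob F (cs E)\<^esub>"
  proof (intro ballI)
   fix E z assume E: "E \<in> EA (Suc 0)"
   have "const1 F ?m E z = const1 F (%X. \<zero>\<^bsub>Fob F X\<^esub>) E z"
    unfolding const1_def push_def const_map_def bspec[OF * csec_star[OF E]] ..
   thus "const1 F ?m E z = \<zero>\<^bsub>Fob F (cs E)\<^esub>" unfolding z1[OF E] .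
  qed
 qed
 also have "... \<longleftrightarrow> to_limit G F x = \<zero>\<^bsub>sec_lim\<^esub>"
  unfolding to_limit_restr Lim_zero by (auto simp: fun_eq_iff restrict_def)
 finally show ?thesis .
qed

text \<open>A transformation from \<open>Q 0\<close> on all sections is determined by its value at \<open>(G, 1)\<close>, as every section
restricts to it; this identifies \<open>F(G)\<close> with the cochains in degree -1.\<close>

theorem degree_m1:
 "module_isomorphic R (reduced_cohomology_m1 G F) (steinberg_cohomology G p \<E> F (- 1))"
proof -
 let ?K = "kernel_module F_top sec_lim (to_limit G F)" and ?h = "%x. rs 0 (const0 F (restr F x))"
 have K: "module R ?K" by (rule kernel_module_module[OF F_top_module Lim_module to_limit_hom])
 have carK: "x \<in> carrier ?K \<longleftrightarrow> x \<in> carrier F_top & to_limit G F x = \<zero>\<^bsub>sec_lim\<^esub>" for x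
  by (simp add: kernel_module_def)
 have carC: "c \<in> carrier (cocycles 0) \<longleftrightarrow> c \<in> carrier (SC 0) & \<delta> 0 c = \<zero>\<^bsub>SC (Suc 0)\<^esub>" for c
  by (simp add: kernel_module_def)
 note hc = homs_closed[OF const0_hom]
 have hom: "?h \<in> module_homs R ?K (cocycles 0)" by (rule module_homsI)
   (simp_all add: carK carC kernel_const0 hc, simp_all add: kernel_module_def homs_add[OF const0_hom] homs_smult[OF const0_hom])
 have "bij_betw ?h (carrier ?K) (carrier (cocycles 0))"
 proof (rule bij_betw_imageI)
  show "inj_on ?h (carrier ?K)"
  proof (rule inj_onI)
   fix x y assume "x \<in> carrier ?K" "y \<in> carrier ?K" and eq: "?h x = ?h y"
   hence x: "x \<in> carrier F_top" and y: "y \<in> carrier F_top" by (simp_all add: carK)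
   have d: "dual 0 {\<one>} [] \<in> St 0 {\<one>}" using dual(1)[OF trivial_elem_ab] by (simp add: opp_0)
   have "const0 F (restr F x) {\<one>} (dual 0 {\<one>} []) = const0 F (restr F y) {\<one>} (dual 0 {\<one>} [])"
    by (rule rs_eqD[OF eq const0_cochain[OF F_secs restr_compatible[OF F_secs x]]
      const0_cochain[OF F_secs restr_compatible[OF F_secs y]] trivial_elem_ab d])
   thus "x = y" unfolding const0_unit[OF F_secs x] const0_unit[OF F_secs y] .
  qed
  show "?h ` carrier ?K = carrier (cocycles 0)"
  proof (intro equalityI subsetI)
   fix c assume "c \<in> ?h ` carrier ?K"
   thus "c \<in> carrier (cocycles 0)" using homs_closed[OF hom] by auto
  next
   fix c assume "c \<in> carrier (cocycles 0)"
   hence c: "c \<in> carrier (SC 0)" "\<delta> 0 c = \<zero>\<^bsub>SC (Suc 0)\<^esub>" by (simp_all add: carC)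
   obtain x where x: "x \<in> carrier F_top"
    and ex: "ALL E:EA 0. ALL z:St 0 E. ext 0 c E z = const0 F (restr F x) E z"
    using const0_surject[OF F_secs ext_cochain[OF c(1)]] by (elim bexE)
   have "rs 0 (ext 0 c) = ?h x" by (rule rs_cong) (use ex in simp)
   hence "c = ?h x" unfolding rs_ext[OF c(1)] .
   moreover have "x \<in> carrier ?K" using x c(2) kernel_const0[OF x] calculation by (simp add: carK)
   ultimately show "c \<in> ?h ` carrier ?K" by (rule image_eqI)
  qed
 qed
 from module_isomorphic_quot_zero[OF K cocycles_module hom this] show ?thesis
  by (simp add: reduced_cohomology_m1_def steinberg_cohomology_def cohomology_def kernel_module_def)
qed

subsection \<open>Degree 0\<close>

lemma const1_hom: "(%f. rs (Suc 0) (const1 F f)) \<in> module_homs R sec_lim (cocycles (Suc 0))"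
proof (rule module_homs_linI[OF Lim_module cocycles_module])
 show "rs (Suc 0) (const1 F f) \<in> carrier (cocycles (Suc 0))" if "f \<in> carrier sec_lim" for f
 proof -
  have f: "compatible star F f" using that by (simp add: Lim_carrier)
  note c = const1_cochain[OF F_star f]
  show ?thesis
   using rs_closed[OF c] coboundary_zero_iff[OF c] cob_const1[OF F_star f] by (simp add: kernel_module_def)
 qed
 fix r f f' assume r: "r \<in> carrier R" and "f \<in> carrier sec_lim" "f' \<in> carrier sec_lim"
 hence f: "compatible star F f" and f': "compatible star F f'" by (simp_all add: Lim_carrier)
 have "rs (Suc 0) (const1 F (r \<odot>\<^bsub>sec_lim\<^esub> f \<oplus>\<^bsub>sec_lim\<^esub> f')) =
   r \<odot>\<^bsub>SC (Suc 0)\<^esub> rs (Suc 0) (const1 F f) \<oplus>\<^bsub>SC (Suc 0)\<^esub> rs (Suc 0) (const1 F f')"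
  unfolding SC_lin_rs
 proof (rule rs_cong)
  fix E z assume E: "E \<in> EA (Suc 0)"
  note X = csec_star[OF E]
  show "const1 F (r \<odot>\<^bsub>sec_lim\<^esub> f \<oplus>\<^bsub>sec_lim\<^esub> f') E z =
    r \<odot>\<^bsub>Fob F (cs E)\<^esub> const1 F f E z \<oplus>\<^bsub>Fob F (cs E)\<^esub> const1 F f' E z"
   unfolding const1_def push_def
   by (rule const_map_lin[where m = f and m' = f', OF F_star X homs_closed[OF bd_hom can_closed[OF csec_els[OF E]]] r
     compatibleD(1)[OF f X] compatibleD(1)[OF f' X]])
    (use X in \<open>simp add: Lim_lin\<close>)
 qed
 thus "rs (Suc 0) (const1 F (r \<odot>\<^bsub>sec_lim\<^esub> f \<oplus>\<^bsub>sec_lim\<^esub> f')) =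
   r \<odot>\<^bsub>cocycles (Suc 0)\<^esub> rs (Suc 0) (const1 F f) \<oplus>\<^bsub>cocycles (Suc 0)\<^esub> rs (Suc 0) (const1 F f')"
  by (simp add: kernel_module_def)
qed

text \<open>The elements of the limit are the transformations from \<open>Q 0\<close> to \<open>F\<close> on the sections with nontrivial
second member, and these are the 1-cocycles in the indexing by rank.\<close>

theorem degree_0:
 "module_isomorphic R (reduced_cohomology_0 G F) (steinberg_cohomology G p \<E> F 0)"
proof -
 let ?h = "%f. rs (Suc 0) (const1 F f)" and ?B' = "\<delta> 0 ` carrier (SC 0)"
 interpret C: module R "cocycles (Suc 0)" by (rule cocycles_module)
 have "module_isomorphic R (quot_module sec_lim (to_limit G F ` carrier F_top)) (quot_module (cocycles (Suc 0)) ?B')"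
 proof (rule quot_isomorphism[OF Lim_module image_submodule[OF F_top_module Lim_module to_limit_hom]
    cocycles_module coboundaries_submodule const1_hom])
  fix f assume "f \<in> carrier sec_lim"
  hence f: "compatible star F f" "f \<in> extensional star" by (simp_all add: Lim_carrier)
  have key: "?h f = \<delta> 0 (rs 0 (const0 F (restr F x))) \<longleftrightarrow> f = to_limit G F x" if x: "x \<in> carrier F_top" for x
  proof -
   note m = restr_compatible[OF F_secs x] and ms = restr_compatible_star[OF x]
   have "\<delta> 0 (rs 0 (const0 F (restr F x))) = ?h (restr F x)"
    unfolding coboundary_rs[OF const0_cochain[OF F_secs m]] by (rule rs_cong) (rule cob_const0[OF F_secs m])
   moreover have "?h f = ?h (restr F x) \<longleftrightarrow> f = to_limit G F x"
   proof
    assume eq: "?h f = ?h (restr F x)"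
    have "f X = restr F x X" if X: "X \<in> star" for X
     by (rule const1_inject[OF F_star f(1) ms rs_eqD[OF eq const1_cochain[OF F_star f(1)] const1_cochain[OF F_star ms]] X])
    thus "f = to_limit G F x" unfolding to_limit_restr by (intro extensionalityI[OF f(2)]) auto
   next
    assume "f = to_limit G F x"
    thus "?h f = ?h (restr F x)"
     unfolding to_limit_restr by (intro rs_cong) (simp add: const1_def push_def const_map_def csec_star)
   qed
   ultimately show ?thesis by simp
  qed
  show "?h f \<in> ?B' \<longleftrightarrow> f \<in> to_limit G F ` carrier F_top"
  proof
   assume "?h f \<in> ?B'"
   then obtain c where c: "c \<in> carrier (SC 0)" "?h f = \<delta> 0 c" by (elim imageE)
   obtain x where x: "x \<in> carrier F_top"
    and ex: "ALL E:EA 0. ALL z:St 0 E. ext 0 c E z = const0 F (restr F x) E z"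
    using const0_surject[OF F_secs ext_cochain[OF c(1)]] by (elim bexE)
   have "rs 0 (ext 0 c) = rs 0 (const0 F (restr F x))" by (rule rs_cong) (use ex in simp)
   hence "c = rs 0 (const0 F (restr F x))" unfolding rs_ext[OF c(1)] .
   hence "f = to_limit G F x" using c(2) key[OF x] by simp
   thus "f \<in> to_limit G F ` carrier F_top" using x by (rule image_eqI)
  next
   assume "f \<in> to_limit G F ` carrier F_top"
   then obtain x where x: "x \<in> carrier F_top" "f = to_limit G F x" by (elim imageE)
   hence "?h f = \<delta> 0 (rs 0 (const0 F (restr F x)))" using key by simp
   thus "?h f \<in> ?B'" using homs_closed[OF const0_hom x(1)] by (rule image_eqI)
  qed
 next
  fix c assume cc: "c \<in> carrier (cocycles (Suc 0))"
  hence c: "c \<in> carrier (SC (Suc 0))" "\<delta> (Suc 0) (rs (Suc 0) (ext (Suc 0) c)) = \<zero>\<^bsub>SC (Suc (Suc 0))\<^esub>"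
   using rs_ext[of c "Suc 0"] by (simp_all add: kernel_module_def)
  note z = bspec[OF bspec[OF c(2)[unfolded coboundary_zero_iff[OF ext_cochain[OF c(1)]]]]]
  have "EX m. compatible star F m &
    (ALL E:EA (Suc 0). ALL z:St (Suc 0) E. ext (Suc 0) c E z = const1 F m E z)"
   by (rule const1_surject[OF F_star ext_cochain[OF c(1)]]) (rule z)
  then obtain m where m: "compatible star F m"
   and em: "ALL E:EA (Suc 0). ALL z:St (Suc 0) E. ext (Suc 0) c E z = const1 F m E z" by (elim exE conjE)
  let ?f = "\<lambda>X\<in>star. m X"
  have "rs (Suc 0) (ext (Suc 0) c) = ?h ?f"
   by (rule rs_cong) (use em in \<open>simp add: const1_def push_def const_map_def csec_star\<close>)
  hence "c = ?h ?f" unfolding rs_ext[OF c(1)] .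
  moreover have "?f \<in> carrier sec_lim" using compatible_restrict[OF m] by (simp add: Lim_carrier)
  moreover have "c \<ominus>\<^bsub>cocycles (Suc 0)\<^esub> c \<in> ?B'"
   using C.minus_eq_zero_iff[OF cc cc] B_zero[OF cocycles_module coboundaries_submodule] by simp
  ultimately show "EX f:carrier sec_lim. c \<ominus>\<^bsub>cocycles (Suc 0)\<^esub> ?h f \<in> ?B'" by (intro bexI[of _ ?f]) simp_all
 qed
 thus ?thesis by (simp add: reduced_cohomology_0_def steinberg_cohomology_def cohomology_def)
qed

subsection \<open>Positive degrees\<close>

lemma F_star_catmod: "is_catmod (sec_cat_star G) R F" using F_star by (simp add: secs_mod_def star_cat)

abbreviation "QZ \<equiv> ext_cocycles (sec_cat_star G) R (%n. Q (Suc n)) (%n. bd (Suc n)) F"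
abbreviation "QB \<equiv> ext_coboundaries (sec_cat_star G) R (%n. Q (Suc n)) (%n. bd (Suc n)) F"

lemma nat_hom_cochain: "catmap (sec_cat_star G) R (Q (Suc k)) F etg ==> is_cochain (Suc k) F (push etg (can (Suc k)))"
 by (rule push_cochain[OF Q_star has_star star_catmap can_cochain])

lemma cochain_nat_hom: "is_cochain (Suc k) F c ==> catmap (sec_cat_star G) R (Q (Suc k)) F (ev (Suc k) F c)"
 using ev_catmap[OF F_star has_star] by (simp add: star_cat)

lemma ev_nat_hom:
 assumes "catmap (sec_cat_star G) R (Q (Suc k)) F etg" "X \<in> star" "x \<in> carrier (Qmod (Suc k) X)"
 shows "ev (Suc k) F (push etg (can (Suc k))) X x = etg X x"
 unfolding ev_push[OF Q_star has_star can_cochain F_star star_catmap[OF assms(1)] assms(2,3)]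
  ev_can_id[OF star_sections has_star assms(2,3)] ..

lemma cob_nat_hom:
 assumes etg: "catmap (sec_cat_star G) R (Q (Suc k)) F etg"
  and E: "E \<in> EA (Suc (Suc k))" and z: "z \<in> St (Suc (Suc k)) E"
 shows "cob (Suc k) F (push etg (can (Suc k))) E z = etg (cs E) (bd (Suc k) (cs E) (can (Suc (Suc k)) E z))"
 unfolding cob_push[OF Q_star F_star has_star has_star star_catmap[OF etg] can_cochain E z]
  cob_can[OF star_sections has_star has_star E] ..

text \<open>Evaluation at the canonical elements turns natural transformations from \<open>Q k\<close> into cochains, with inverse
\<open>ev\<close>, and the coboundaries agree by construction.\<close>

theorem Ext_Q_Steinberg:
 "module_isomorphic R (Ext (sec_cat_star G) R (%n. Q (Suc n)) (%n. bd (Suc n)) F (Suc n))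
  (quot_module (cocycles (Suc (Suc n))) (\<delta> (Suc n) ` carrier (SC (Suc n))))"
proof -
 interpret Q: resolution "sec_cat_star G" R "%n. Q (Suc n)" "%n. bd (Suc n)" "bd 0" "Q 0" by (rule Q_resolution)
 let ?C = "sec_cat_star G" and ?k = "Suc (Suc n)" and ?B = "\<delta> (Suc n) ` carrier (SC (Suc n))"
 let ?h = "%etg. rs ?k (push etg (can ?k))"
 note ZI = Q.ext_cocycles_iff[OF cring_R F_star_catmod, unfolded Q_Fob]
 interpret C: module R "cocycles ?k" by (rule cocycles_module)
 note modZ = Q.ext_cocycles_module[OF cring_R F_star_catmod, of "Suc n"]
 have canC: "can j E z \<in> carrier (Qmod j (cs E))" if "E \<in> EA j" for j E z
  by (rule can_closed[OF csec_els[OF that]])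
 have hom: "?h \<in> module_homs R (QZ (Suc n)) (cocycles ?k)"
 proof (rule module_homs_linI[OF modZ cocycles_module])
  fix etg assume "etg \<in> carrier (QZ (Suc n))"
  hence etg: "catmap ?C R (Q ?k) F etg" and z: "!!X x. X \<in> star ==> x \<in> carrier (Qmod (Suc ?k) X) ==> etg X (bd ?k X x) = \<zero>\<^bsub>Fob F X\<^esub>"
   unfolding ZI by (simp_all add: nat_homs_catmap)
  show "?h etg \<in> carrier (cocycles ?k)"
   using rs_closed[OF nat_hom_cochain[OF etg]] coboundary_zero_iff[OF nat_hom_cochain[OF etg]]
   by (simp add: kernel_module_def cob_nat_hom[OF etg] z csec_star canC)
 next
  fix r etg etg'
  have "?h (r \<odot>\<^bsub>QZ (Suc n)\<^esub> etg \<oplus>\<^bsub>QZ (Suc n)\<^esub> etg') = r \<odot>\<^bsub>SC ?k\<^esub> ?h etg \<oplus>\<^bsub>SC ?k\<^esub> ?h etg'"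
   unfolding kernel_module_ops nat_hom_module_lin SC_lin_rs
   by (rule rs_cong) (simp add: push_def csec_star canC Q_Fob)
  thus "?h (r \<odot>\<^bsub>QZ (Suc n)\<^esub> etg \<oplus>\<^bsub>QZ (Suc n)\<^esub> etg') = r \<odot>\<^bsub>cocycles ?k\<^esub> ?h etg \<oplus>\<^bsub>cocycles ?k\<^esub> ?h etg'"
   unfolding kernel_module_ops .
 qed
 show ?thesis unfolding Ext_Suc
 proof (rule quot_isomorphism[OF modZ Q.ext_coboundaries_submodule[OF cring_R F_star_catmod] cocycles_module coboundaries_submodule hom])
  fix etg assume "etg \<in> carrier (QZ (Suc n))"
  hence etg: "etg \<in> nat_homs ?C R (Q ?k) F" unfolding ZI by simp
  note etgm = nat_homs_catmap[OF etg]
  show "?h etg \<in> ?B \<longleftrightarrow> etg \<in> QB n"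
  proof
   assume "?h etg \<in> ?B"
   then obtain c where c: "c \<in> carrier (SC (Suc n))" "?h etg = \<delta> (Suc n) c" by (elim imageE)
   note e = ext_cochain[OF c(1)]
   note ec = cob_cochain[OF F_secs has_sec e has_sec]
   show "etg \<in> QB n"
   proof (rule Q.ext_coboundariesI[OF cring_R F_star_catmod etg cochain_nat_hom[OF e]])
    fix X x assume X: "X \<in> star" and "x \<in> elts (Q ?k) X"
    hence x: "x \<in> carrier (Qmod ?k X)" by (simp add: Q_Fob)
    have "etg X x = ev ?k F (push etg (can ?k)) X x" by (rule ev_nat_hom[OF etgm X x, symmetric])
    also have "... = ev ?k F (cob (Suc n) F (ext (Suc n) c)) X x"
     by (rule ev_cong'[OF F_star has_star ec rs_eqD[OF c(2)[unfolded coboundary_ext[OF c(1)]] nat_hom_cochain[OF etgm] ec] X x])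
    also have "... = ev (Suc n) F (ext (Suc n) c) X (bd (Suc n) X x)"
     by (rule ev_cob[OF F_star has_star has_star e X x])
    finally show "etg X x = ev (Suc n) F (ext (Suc n) c) X (bd (Suc n) X x)" .
   qed
  next
   assume "etg \<in> QB n"
   then obtain ze where ze: "ze \<in> nat_homs ?C R (Q (Suc n)) F" "etg = ext_coboundary ?C (%n. Q (Suc n)) (%n. bd (Suc n)) n ze"
    unfolding nat_hom_carrier by (elim imageE)
   note zm = nat_homs_catmap[OF ze(1)]
   have "?h etg = \<delta> (Suc n) (rs (Suc n) (push ze (can (Suc n))))"
    unfolding coboundary_rs[OF nat_hom_cochain[OF zm]]
    by (rule rs_cong, subst cob_nat_hom[OF zm], assumption+) (simp add: ze(2) precomp_def push_def csec_star canC Q_Fob)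
   thus "?h etg \<in> ?B" using rs_closed[OF nat_hom_cochain[OF zm]] by (rule image_eqI)
  qed
 next
  fix c assume cc: "c \<in> carrier (cocycles ?k)"
  hence c: "c \<in> carrier (SC ?k)" by (simp add: kernel_module_def)
  note e = ext_cochain[OF c] and em = cochain_nat_hom[OF ext_cochain[OF c]]
  have "\<delta> ?k (rs ?k (ext ?k c)) = \<zero>\<^bsub>SC (Suc ?k)\<^esub>" unfolding rs_ext[OF c] using cc by (simp add: kernel_module_def)
  note z = bspec[OF bspec[OF this[unfolded coboundary_zero_iff[OF e]]]]
  let ?etg = "nat_restrict ?C (Q ?k) (ev ?k F (ext ?k c))"
  have "ev ?k F (ext ?k c) X (bd ?k X x) = \<zero>\<^bsub>Fob F X\<^esub>" if X: "X \<in> star" and x: "x \<in> carrier (Qmod (Suc ?k) X)" for X x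
   unfolding ev_cob[OF F_star has_star has_star e X x, symmetric] by (rule ev_zero[OF F_star has_star z X x])
  hence etg: "?etg \<in> carrier (QZ (Suc n))"
   unfolding ZI using catmap_restrict[OF em Q_star_catmod] homs_closed[OF bd_hom] by (simp add: Q_Fob)
  have "?h ?etg = rs ?k (ext ?k c)"
   by (rule rs_cong) (simp add: push_def csec_star canC Q_Fob ev_self[OF F_star has_star e])
  hence "?h ?etg = c" unfolding rs_ext[OF c] .
  moreover have "c \<ominus>\<^bsub>cocycles ?k\<^esub> c \<in> ?B"
   using C.minus_eq_zero_iff[OF cc cc] B_zero[OF cocycles_module coboundaries_submodule] by simp
  ultimately show "EX etg:carrier (QZ (Suc n)). c \<ominus>\<^bsub>cocycles ?k\<^esub> ?h etg \<in> ?B"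
   using etg by (intro bexI[of _ ?etg]) simp_all
 qed
qed

context
 fixes P :: "nat => ('r, 'a set \<times> 'a set, 'a set, 'q) catmod"
  and d :: "nat => 'a set \<times> 'a set => 'q => 'q" and \<epsilon> :: "'a set \<times> 'a set => 'q => 'r"
 assumes res: "projective_resolution (sec_cat_star G) R (const_catmod R) P d \<epsilon>"
begin

interpretation p_group_resolution G p n_G R P d \<epsilon> \<E> by unfold_locales (rule res, rule reps)

lemma Ext_quot:
 "module_isomorphic R (Ext (sec_cat_star G) R P d F (Suc n))
  (quot_module (cocycles (Suc (Suc n))) (\<delta> (Suc n) ` carrier (SC (Suc n))))"
 by (rule module_isomorphic_trans[OF Ext_Q[OF F_star_catmod] Ext_Q_Steinberg])

theorem Ext_Steinberg:
 "module_isomorphic R (Ext (sec_cat_star G) R P d F (Suc n)) (steinberg_cohomology G p \<E> F (int (Suc n)))"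
 using Ext_quot[of n] by (simp add: steinberg_cohomology_def cohomology_def nat_add_distrib)

lemma Ext_zero:
 assumes "\<E> (Suc (Suc n)) = {}"
 shows "zero_module (Ext (sec_cat_star G) R P d F (Suc n))"
proof -
 interpret P: resolution "sec_cat_star G" R P d aug "Q 0" by (rule P_resolution)
 show ?thesis using quot_zero_transfer[OF P.ext_cocycles_module[OF cring_R F_star_catmod]
    P.ext_coboundaries_submodule[OF cring_R F_star_catmod] Ext_quot[unfolded Ext_Suc] cocycles_trivial[OF assms]]
  unfolding Ext_Suc .
qed

end

lemma reduced_cohomology_0_zero:
 assumes "\<E> (Suc 0) = {}"
 shows "zero_module (reduced_cohomology_0 G F)"
proof -
 have "module_isomorphic R (quot_module sec_lim (to_limit G F ` carrier F_top))
   (quot_module (cocycles (Suc 0)) (\<delta> 0 ` carrier (SC 0)))"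
  using degree_0 by (simp add: reduced_cohomology_0_def steinberg_cohomology_def cohomology_def)
 from quot_zero_transfer[OF Lim_module image_submodule[OF F_top_module Lim_module to_limit_hom] this cocycles_trivial[OF assms]]
 show ?thesis by (simp add: reduced_cohomology_0_def)
qed

text \<open>The maximum that defines the rank ranges over a bounded set, by the order of \<open>G\<close>.\<close>

lemma no_reps_above_rank:
 assumes "rk G p < k"
 shows "\<E> k = {}"
proof (rule ccontr)
 assume "\<E> k ~= {}"
 hence k: "EA k ~= {}" using \<E>_elem_ab by blast
 have "s \<le> n_G" if "EA s ~= {}" for s
 proof -
  obtain E where E: "E \<in> EA s" using \<open>EA s ~= {}\<close> by blast
  have "finite (carrier G)" using order_G p_gt_1 by (intro card_ge_0_finite) (simp add: order_def)
  hence "p ^ s \<le> p ^ n_G" using card_mono[OF _ elem_abD(4)[OF E]] elem_abD(3)[OF E] order_G by (simp add: order_def)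
  thus ?thesis using p_gt_1 power_increasing_iff by blast
 qed
 hence "{s. EA s ~= {}} \<subseteq> {..n_G}" by (intro subsetI) (simp only: mem_Collect_eq atMost_iff)
 hence "finite {s. EA s ~= {}}" by (rule finite_subset) simp
 hence "k \<le> rk G p" unfolding rk_def by (rule Max_ge) (use k in simp)
 thus False using assms by simp
qed

end

section \<open>The Steinberg complex computes reduced cohomology\<close>

theorem proposition5p4:
  fixes G :: "('g, 'x) monoid_scheme" and R :: "('r, 's) ring_scheme" and p a :: nat
    and F :: "('r, 'g set \<times> 'g set, 'g set, 'm) catmod"
    and \<E> :: "nat \<Rightarrow> 'g set set"
    and P :: "nat \<Rightarrow> ('r, 'g set \<times> 'g set, 'g set, 'q) catmod"
    and d :: "nat \<Rightarrow> 'g set \<times> 'g set \<Rightarrow> 'q \<Rightarrow> 'q"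
    and \<epsilon> :: "'g set \<times> 'g set \<Rightarrow> 'q \<Rightarrow> 'r"
  assumes "Factorial_Ring.prime p"
    and "group G" and "order G = p ^ a"
    and "cring R" and "p_local p R"
    and "is_catmod (sec_cat G) R F"
    and "\<And>k. conj_representatives G p k (\<E> k)"
    and "projective_resolution (sec_cat_star G) R (const_catmod R) P d \<epsilon>"
  shows "cochain_complex R (steinberg_cochains G \<E> F) (steinberg_coboundary G p \<E> F) \<and>
    module_isomorphic R (reduced_cohomology_m1 G F) (steinberg_cohomology G p \<E> F (- 1)) \<and>
    module_isomorphic R (reduced_cohomology_0 G F) (steinberg_cohomology G p \<E> F 0) \<and>
    (\<forall>i\<ge>1. module_isomorphic R (Ext (sec_cat_star G) R P d F i)
              (steinberg_cohomology G p \<E> F (int i))) \<and>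
    (0 \<ge> rk G p \<longrightarrow> zero_module (reduced_cohomology_0 G F)) \<and>
    (\<forall>i\<ge>1. i \<ge> rk G p \<longrightarrow> zero_module (Ext (sec_cat_star G) R P d F i))"
proof -
  interpret p_group_catmod G p a R F \<E>
    using assms(1-4,6,7)
    by (simp add: p_group_catmod_def p_group_catmod_axioms_def p_group_ring_def p_group_ring_axioms_def
        finite_p_group_def finite_p_group_axioms_def)
  have "module_isomorphic R (Ext (sec_cat_star G) R P d F i) (steinberg_cohomology G p \<E> F (int i))" if "i \<ge> 1" for i
    using Ext_Steinberg[OF assms(8), of "i - 1"] that by simp
  moreover have "zero_module (Ext (sec_cat_star G) R P d F i)" if "i \<ge> 1" "i \<ge> rk G p" for i
  proof -
    have "\<E> (Suc (Suc (i - 1))) = {}" by (rule no_reps_above_rank) (use that in simp)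
    from Ext_zero[OF assms(8) this] show ?thesis using that by simp
  qed
  moreover have "zero_module (reduced_cohomology_0 G F)" if "0 \<ge> rk G p"
    by (rule reduced_cohomology_0_zero, rule no_reps_above_rank) (use that in simp)
  ultimately show ?thesis using Steinberg_complex degree_m1 degree_0 by simp
qed

end
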